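(* Let $E$ be a complex Fréchet space. Then the canonical map $$I_0\colon\mathfrak{L}\mathcal{G}_{[0,\infty]}(E)/\mathfrak{L}\mathcal{G}_{\{\infty\}}(E)\to\mathcal{LO}_{[0,\infty]}(E)/\mathcal{LO}_{\{\infty\}}(E),\quad[F]\mapsto[F],$$ is a linear isomorphism and $I_0\circ\mathfrak{L}_{\mathcal{B}}=\mathcal{L}^{\mathcal{B}}$ on $\mathcal{B}([0,\infty[,E)$.
   Context: $\mathbb{N}=\{1,2,\dots\}$, $\overline{\mathbb{R}}:=\mathbb{R}\cup\{\pm\infty\}$, $\overline{\mathbb{C}}:=\overline{\mathbb{R}}+i\mathbb{R}$. $E$ carries a directed system of seminorms $(p_\alpha)_{\alpha\in\mathfrak{A}}$ generating its topology. $\mathcal{O}(\Omega,E)$: $E$-valued holomorphic functions on open $\Omega\subset\mathbb{C}$; $\mathcal{B}([0,\infty[,E):=\mathcal{O}(\mathbb{C}\setminus[0,\infty[,E)/\mathcal{O}(\mathbb{C},E)$. For $c>0$ put $U_{1/c}(\emptyset):=\emptyset$, $U_{1/c}([0,\infty]):=\{z\mid d(z,[0,\infty[)<c\}$ ($d$ Euclidean distance) and $U_{1/c}(\{\infty\}):=\,]1/c,\infty[\,+\,i\,]-c,c[$; for $n\in\mathbb{N}$ and $K\in\{\emptyset,[0,\infty],\{\infty\}\}$, $S_n(K):=(\mathbb{C}\setminus\overline{U_n(K)})\cap\{|\operatorname{Im}z|<n\}$ ($U_n(K)$ is $U_{1/c}(K)$ with $c=1/n$). $\gamma_K$ denotes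 the boundary of $U_{1/c}(K)$ with clockwise orientation. Function values on $\mathbb{C}\setminus K$ are meant when writing $\overline{\mathbb{C}}\setminus K$. The transform $\mathcal{L}^{\mathcal{B}}=\mathcal{L}^{\mathcal{B}}_{[0,\infty[}$: $\mathcal{O}^{exp}(\overline{\mathbb{C}}\setminus K,E)$ is the space of all $f\in\mathcal{O}(\mathbb{C}\setminus K,E)$ with $\sup_{S_n(K)}p_\alpha(f(z))e^{-\frac1n|\operatorname{Re}z|}<\infty$ for all $n,\alpha$. $\mathcal{LO}_{[0,\infty]}(E)$ is the space of all $f\in\mathcal{O}(\{\operatorname{Re}z>0\},E)$ with $\sup_{\operatorname{Re}z\ge\frac1k}p_\alpha(f(z))e^{-\frac1k|z|}<\infty$ for all $k\in\mathbb{N}$, $\alpha\in\mathfrak{A}$; $\mathcal{LO}_{\{\infty\}}(E)$ is the space of all $f\in\mathcal{O}(\{\operatorname{Re}z>0\},E)$ with $\sup_{\operatorname{Re}z\ge\frac1k}p_\alpha(f(z))e^{-\frac1k|z|+k|\operatorname{Re}z|}<\infty$ for all $k,\alpha$. For $E$ Fréchet, the canonical map $\mathcal{R}_{[0,\infty[}\colon\mathcal{O}^{exp}(\overline{\mathbb{C}}\setminus[0,\infty],E)/\mathcal{O}^{exp}(\overline{\mathbb{C}}\setminus\{\infty\},E)\to\mathcal{B}([0,\infty[,E)$, $[F]\mapsto[F]$, is a linear isomorphism; for $G\in\mathcal{O}^{exp}(\overline{\mathbb{C}}\setminus[0,\infty],E)$ put $\mathcal{L}(G)(\zeta):=\int_{\gamma_{[0,\infty]}}G(z)e^{-z\zeta}dz$,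 $\operatorname{Re}\zeta>0$ ($c>0$ small enough depending on $\zeta$; independent of $c$), which lies in $\mathcal{LO}_{[0,\infty]}(E)$. Then $\mathcal{L}^{\mathcal{B}}(f):=[\mathcal{L}(G)]\in\mathcal{LO}_{[0,\infty]}(E)/\mathcal{LO}_{\{\infty\}}(E)$ for any $G$ representing $\mathcal{R}_{[0,\infty[}^{-1}(f)$; this is a well-defined linear isomorphism. Langenbruch's transform $\mathfrak{L}_{\mathcal{B}}$: $\mathcal{H}_{-\infty}(\overline{\mathbb{C}}\setminus K,E)$ is the space of all $f\in\mathcal{O}(\mathbb{C}\setminus K,E)$ with $\sup_{S_n(K)}p_\alpha(f(z))e^{n|\operatorname{Re}z|}<\infty$ for all $n,\alpha$. $\mathfrak{L}\mathcal{G}_{[0,\infty]}(E)$ is the space of all $f\in\mathcal{O}(\mathbb{C},E)$ with $\sup_{\operatorname{Re}z\ge-k}p_\alpha(f(z))e^{-\frac1k|z|}<\infty$ for all $k,\alpha$; $\mathfrak{L}\mathcal{G}_{\{\infty\}}(E)$ is the space of all $f\in\mathcal{O}(\mathbb{C},E)$ with $\sup_{\operatorname{Re}z\ge-k}p_\alpha(f(z))e^{k|\operatorname{Re}z|-\frac1k|z|}<\infty$ for all $k,\alpha$. For $g\in\mathcal{H}_{-\infty}(\overline{\mathbb{C}}\setminus[0,\infty],E)$ put $\mathfrak{L}(g)(z):=\int_{\gamma_{[0,\infty]}}g(\zeta)e^{-z\zeta}d\zeta$, $z\in\mathbb{C}$. The canonical map $R_+\colon\mathcal{H}_{-\infty}(\overline{\mathbb{C}}\setminus[0,\infty],E)/\mathcal{H}_{-\infty}(\overline{\mathbb{C}}\setminus\{\infty\},E)\to\mathcal{B}([0,\infty[,E)$,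 $[F]\mapsto[F]$, is a linear isomorphism, and $\mathfrak{L}_{\mathcal{B}}(f):=[\mathfrak{L}(g)]\in\mathfrak{L}\mathcal{G}_{[0,\infty]}(E)/\mathfrak{L}\mathcal{G}_{\{\infty\}}(E)$, $g$ any representative of $R_+^{-1}(f)$, is a well-defined linear isomorphism on $\mathcal{B}([0,\infty[,E)$ (Langenbruch). *)

theory Defs
  imports "HOL-Analysis.Analysis" "HOL-Library.Function_Algebras" "HOL-Library.Set_Algebras"
begin

section \<open>Complex Frechet spaces\<close>

text \<open>The space \<open>E\<close> is a type \<open>'e\<close> with a scalar multiplication \<open>sc\<close> and a family of seminorms
  \<open>p\<close> indexed by the elements of a type \<open>'a\<close>.\<close>

definition seminorm :: "(complex \<Rightarrow> 'e::ab_group_add \<Rightarrow> 'e) \<Rightarrow> ('e \<Rightarrow> real) \<Rightarrow> bool" where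
  "seminorm sc q \<longleftrightarrow> (\<forall>x y. q (x + y) \<le> q x + q y) \<and> (\<forall>a x. q (sc a x) = cmod a * q x)"

definition directed_seminorms :: "('a \<Rightarrow> 'e \<Rightarrow> real) \<Rightarrow> bool" where
  "directed_seminorms p \<longleftrightarrow>
     (\<forall>\<alpha> \<beta>. \<exists>\<gamma>. \<exists>C>0. \<forall>x. p \<alpha> x \<le> C * p \<gamma> x \<and> p \<beta> x \<le> C * p \<gamma> x)"

definition seminorm_topology :: "('a \<Rightarrow> 'e::ab_group_add \<Rightarrow> real) \<Rightarrow> 'e topology" where
  "seminorm_topology p = topology_generated_by {{y. p \<alpha> (y - x) < r} | \<alpha> x r. 0 < r}"

definition frechet_space ::
  "(complex \<Rightarrow> 'e::ab_group_add \<Rightarrow> 'e) \<Rightarrow> ('a \<Rightarrow> 'e \<Rightarrow> real) \<Rightarrow> bool" where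
  "frechet_space sc p \<longleftrightarrow>
     vector_space sc \<and> (\<forall>\<alpha>. seminorm sc (p \<alpha>)) \<and> directed_seminorms p \<and>
     (\<exists>d. Metric_space UNIV d \<and> (\<forall>x y z. d (x + z) (y + z) = d x y) \<and>
          Metric_space.mcomplete UNIV d \<and>
          Metric_space.mtopology UNIV d = seminorm_topology p)"

section \<open>Spaces of holomorphic functions\<close>

text \<open>A function on \<open>\<Omega>\<close> is represented by the total function that vanishes outside \<open>\<Omega>\<close>, so that
  equality of functions on \<open>\<Omega>\<close> is equality in HOL and the vector space operations are those of
  the function type. Accordingly, \<open>restr \<Omega>\<close> is the restriction of functions to \<open>\<Omega>\<close>.\<close>

definition restr :: "complex set \<Rightarrow> (complex \<Rightarrow> 'e::zero) \<Rightarrow> complex \<Rightarrow> 'e" where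
  "restr \<Omega> f = (\<lambda>z. if z \<in> \<Omega> then f z else 0)"

definition holo ::
  "(complex \<Rightarrow> 'e::ab_group_add \<Rightarrow> 'e) \<Rightarrow> ('a \<Rightarrow> 'e \<Rightarrow> real) \<Rightarrow> complex set \<Rightarrow> (complex \<Rightarrow> 'e) set" where
  "holo sc p \<Omega> = {f. restr \<Omega> f = f \<and>
     (\<forall>z\<in>\<Omega>. \<exists>d. limitin (seminorm_topology p) (\<lambda>w. sc (inverse (w - z)) (f w - f z)) d (at z))}"

text \<open>Functions in \<open>holo sc p \<Omega>\<close> such that \<open>p\<^sub>\<alpha>(f(z)) exp(w\<^sub>n(z))\<close> is bounded on \<open>S\<^sub>n\<close> for all \<open>\<alpha>\<close>
  and \<open>n \<ge> 1\<close>.\<close>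

definition weighted_holo ::
  "(complex \<Rightarrow> 'e::ab_group_add \<Rightarrow> 'e) \<Rightarrow> ('a \<Rightarrow> 'e \<Rightarrow> real) \<Rightarrow> complex set \<Rightarrow>
   (nat \<Rightarrow> complex set) \<Rightarrow> (nat \<Rightarrow> complex \<Rightarrow> real) \<Rightarrow> (complex \<Rightarrow> 'e) set" where
  "weighted_holo sc p \<Omega> S w =
     {f \<in> holo sc p \<Omega>. \<forall>n\<ge>1. \<forall>\<alpha>. bdd_above ((\<lambda>z. p \<alpha> (f z) * exp (w n z)) ` S n)}"

abbreviation right_half_plane :: "complex set" where
  "right_half_plane \<equiv> {z. 0 < Re z}"

text \<open>The sets \<open>K \<in> {\<emptyset>, [0,\<infinity>], {\<infinity>}}\<close> are the subsets \<open>{}\<close>, \<open>{0..\<infinity>}\<close>, \<open>{\<infinity>}\<close> of \<open>ereal\<close>.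
  Only these three are meant below. \<open>finite_part K\<close> is \<open>K \<inter> \<complex>\<close>, and \<open>nbhd c K\<close> is the set
  written \<open>U\<^sub>1\<^sub>/\<^sub>c(K)\<close> (so \<open>U\<^sub>n(K)\<close> is \<open>nbhd (1/n) K\<close>).\<close>

definition finite_part :: "ereal set \<Rightarrow> complex set" where
  "finite_part K = complex_of_real ` {x. ereal x \<in> K}"

definition nbhd :: "real \<Rightarrow> ereal set \<Rightarrow> complex set" where
  "nbhd c K = (if K = {\<infinity>} then {z. 1 / c < Re z \<and> \<bar>Im z\<bar> < c}
               else {z. \<exists>x\<in>finite_part K. dist z x < c})"

definition strip_minus :: "ereal set \<Rightarrow> nat \<Rightarrow> complex set" where
  "strip_minus K n = {z. z \<notin> closure (nbhd (1 / real n) K) \<and> \<bar>Im z\<bar> < real n}"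

text \<open>\<open>O\<^sup>e\<^sup>x\<^sup>p(K)\<close> and \<open>H\<^sub>-\<^sub>\<infinity>(K)\<close> as spaces of functions on \<open>\<complex> \ K\<close>.\<close>

definition O_exp ::
  "(complex \<Rightarrow> 'e::ab_group_add \<Rightarrow> 'e) \<Rightarrow> ('a \<Rightarrow> 'e \<Rightarrow> real) \<Rightarrow> ereal set \<Rightarrow> (complex \<Rightarrow> 'e) set" where
  "O_exp sc p K = weighted_holo sc p (- finite_part K) (strip_minus K)
     (\<lambda>n z. - (1 / real n) * \<bar>Re z\<bar>)"

definition H_minus_inf ::
  "(complex \<Rightarrow> 'e::ab_group_add \<Rightarrow> 'e) \<Rightarrow> ('a \<Rightarrow> 'e \<Rightarrow> real) \<Rightarrow> ereal set \<Rightarrow> (complex \<Rightarrow> 'e) set" where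
  "H_minus_inf sc p K = weighted_holo sc p (- finite_part K) (strip_minus K)
     (\<lambda>n z. real n * \<bar>Re z\<bar>)"

definition LO_zero_inf ::
  "(complex \<Rightarrow> 'e::ab_group_add \<Rightarrow> 'e) \<Rightarrow> ('a \<Rightarrow> 'e \<Rightarrow> real) \<Rightarrow> (complex \<Rightarrow> 'e) set" where
  "LO_zero_inf sc p = weighted_holo sc p right_half_plane (\<lambda>k. {z. 1 / real k \<le> Re z})
     (\<lambda>k z. - (1 / real k) * cmod z)"

definition LO_inf ::
  "(complex \<Rightarrow> 'e::ab_group_add \<Rightarrow> 'e) \<Rightarrow> ('a \<Rightarrow> 'e \<Rightarrow> real) \<Rightarrow> (complex \<Rightarrow> 'e) set" where
  "LO_inf sc p = weighted_holo sc p right_half_plane (\<lambda>k. {z. 1 / real k \<le> Re z})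
     (\<lambda>k z. - (1 / real k) * cmod z + real k * \<bar>Re z\<bar>)"

definition LG_zero_inf ::
  "(complex \<Rightarrow> 'e::ab_group_add \<Rightarrow> 'e) \<Rightarrow> ('a \<Rightarrow> 'e \<Rightarrow> real) \<Rightarrow> (complex \<Rightarrow> 'e) set" where
  "LG_zero_inf sc p = weighted_holo sc p UNIV (\<lambda>k. {z. - real k \<le> Re z})
     (\<lambda>k z. - (1 / real k) * cmod z)"

definition LG_inf ::
  "(complex \<Rightarrow> 'e::ab_group_add \<Rightarrow> 'e) \<Rightarrow> ('a \<Rightarrow> 'e \<Rightarrow> real) \<Rightarrow> (complex \<Rightarrow> 'e) set" where
  "LG_inf sc p = weighted_holo sc p UNIV (\<lambda>k. {z. - real k \<le> Re z})
     (\<lambda>k z. real k * \<bar>Re z\<bar> - (1 / real k) * cmod z)"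

section \<open>Quotient spaces\<close>

text \<open>The class of \<open>F\<close> modulo a subspace \<open>N\<close> is the coset \<open>F +o N\<close>.\<close>

definition quot :: "'v::ab_group_add set \<Rightarrow> 'v set \<Rightarrow> 'v set set" where
  "quot V N = (\<lambda>F. F +o N) ` V"

text \<open>Scalar multiplication \<open>a \<cdot> (F + N) = a F + N\<close>. Adding \<open>N\<close> is needed only for \<open>a = 0\<close>.
  Addition of cosets is addition of sets.\<close>

definition quot_scale ::
  "(complex \<Rightarrow> 'e::ab_group_add \<Rightarrow> 'e) \<Rightarrow> (complex \<Rightarrow> 'e) set \<Rightarrow> complex \<Rightarrow>
   (complex \<Rightarrow> 'e) set \<Rightarrow> (complex \<Rightarrow> 'e) set" where
  "quot_scale sc N a X = (\<lambda>F z. sc a (F z)) ` X + N"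

definition quot_linear_iso ::
  "(complex \<Rightarrow> 'e::ab_group_add \<Rightarrow> 'e) \<Rightarrow> (complex \<Rightarrow> 'e) set \<Rightarrow> (complex \<Rightarrow> 'e) set \<Rightarrow>
   (complex \<Rightarrow> 'e) set \<Rightarrow> (complex \<Rightarrow> 'e) set \<Rightarrow>
   ((complex \<Rightarrow> 'e) set \<Rightarrow> (complex \<Rightarrow> 'e) set) \<Rightarrow> bool" where
  "quot_linear_iso sc V N W M T \<longleftrightarrow>
     bij_betw T (quot V N) (quot W M) \<and>
     (\<forall>X\<in>quot V N. \<forall>Y\<in>quot V N. T (X + Y) = T X + T Y) \<and>
     (\<forall>a. \<forall>X\<in>quot V N. T (quot_scale sc N a X) = quot_scale sc M a (T X))"

text \<open>The map \<open>[F] \<mapsto> [h F]\<close> into classes modulo \<open>M\<close>; it is meaningful when \<open>h F +o M\<close> does not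
  depend on the representative \<open>F\<close>, since otherwise \<open>the_elem\<close> is applied to a non-singleton.\<close>

definition quot_map :: "('v \<Rightarrow> 'w::ab_group_add) \<Rightarrow> 'w set \<Rightarrow> 'v set \<Rightarrow> 'w set" where
  "quot_map h M X = the_elem ((\<lambda>F. h F +o M) ` X)"

section \<open>Laplace integrals\<close>

text \<open>The boundary of the \<open>c\<close>-neighbourhood of \<open>[0,\<infinity>[\<close>, with clockwise orientation:
  in along \<open>Im z = -c\<close> from \<open>+\<infinity>\<close>, along the left half circle through \<open>-c\<close>,
  and out along \<open>Im z = c\<close>.\<close>

definition gamma_path :: "real \<Rightarrow> real \<Rightarrow> complex" where
  "gamma_path c t =
     (if t \<le> -1 then Complex (- 1 - t) (- c)
      else if t < 1 then complex_of_real c * cis (pi - pi / 2 * t)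
      else Complex (t - 1) c)"

definition continuous_functional ::
  "(complex \<Rightarrow> 'e::ab_group_add \<Rightarrow> 'e) \<Rightarrow> ('a \<Rightarrow> 'e \<Rightarrow> real) \<Rightarrow> ('e \<Rightarrow> complex) \<Rightarrow> bool" where
  "continuous_functional sc p \<phi> \<longleftrightarrow>
     Vector_Spaces.linear sc (*) \<phi> \<and> continuous_map (seminorm_topology p) euclidean \<phi>"

text \<open>The \<open>E\<close>-valued path integral is the Pettis integral. The two kinks of the path, where
  \<open>vector_derivative\<close> is unspecified, form a null set.\<close>

definition has_gamma_integral ::
  "(complex \<Rightarrow> 'e::ab_group_add \<Rightarrow> 'e) \<Rightarrow> ('a \<Rightarrow> 'e \<Rightarrow> real) \<Rightarrow> real \<Rightarrow> (complex \<Rightarrow> 'e) \<Rightarrow> 'e \<Rightarrow> bool" where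
  "has_gamma_integral sc p c f e \<longleftrightarrow>
     (\<forall>\<phi>. continuous_functional sc p \<phi> \<longrightarrow>
        has_bochner_integral lborel
          (\<lambda>t. \<phi> (f (gamma_path c t)) * vector_derivative (gamma_path c) (at t)) (\<phi> e))"

text \<open>The common value of the integrals for all sufficiently small \<open>c > 0\<close>, as a function of
  \<open>\<zeta> \<in> \<Omega>\<close>. Both transforms below use it; they differ in \<open>\<Omega>\<close> and the admitted \<open>G\<close>.\<close>

definition laplace ::
  "(complex \<Rightarrow> 'e::ab_group_add \<Rightarrow> 'e) \<Rightarrow> ('a \<Rightarrow> 'e \<Rightarrow> real) \<Rightarrow> complex set \<Rightarrow> (complex \<Rightarrow> 'e) \<Rightarrow>
   complex \<Rightarrow> 'e" where
  "laplace sc p \<Omega> G = restr \<Omega> (\<lambda>\<zeta>. THE e.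
     \<forall>\<^sub>F c in at_right 0. has_gamma_integral sc p c (\<lambda>z. sc (exp (- z * \<zeta>)) (G z)) e)"

section \<open>Hyperfunctions and the two transforms\<close>

abbreviation slit_plane :: "complex set" where
  "slit_plane \<equiv> - finite_part {0..\<infinity>}"

definition entire_on_slit ::
  "(complex \<Rightarrow> 'e::ab_group_add \<Rightarrow> 'e) \<Rightarrow> ('a \<Rightarrow> 'e \<Rightarrow> real) \<Rightarrow> (complex \<Rightarrow> 'e) set" where
  "entire_on_slit sc p = restr slit_plane ` holo sc p UNIV"

definition hyperfunctions ::
  "(complex \<Rightarrow> 'e::ab_group_add \<Rightarrow> 'e) \<Rightarrow> ('a \<Rightarrow> 'e \<Rightarrow> real) \<Rightarrow> (complex \<Rightarrow> 'e) set set" where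
  "hyperfunctions sc p = quot (holo sc p slit_plane) (entire_on_slit sc p)"

definition R_inverse ::
  "(complex \<Rightarrow> 'e::ab_group_add \<Rightarrow> 'e) \<Rightarrow> ('a \<Rightarrow> 'e \<Rightarrow> real) \<Rightarrow> (complex \<Rightarrow> 'e) set \<Rightarrow> (complex \<Rightarrow> 'e) set" where
  "R_inverse sc p =
     inv_into (quot (O_exp sc p {0..\<infinity>}) (restr slit_plane ` O_exp sc p {\<infinity>}))
       (quot_map id (entire_on_slit sc p))"

definition laplace_hyper ::
  "(complex \<Rightarrow> 'e::ab_group_add \<Rightarrow> 'e) \<Rightarrow> ('a \<Rightarrow> 'e \<Rightarrow> real) \<Rightarrow> (complex \<Rightarrow> 'e) set \<Rightarrow> (complex \<Rightarrow> 'e) set" where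
  "laplace_hyper sc p f = quot_map (laplace sc p right_half_plane) (LO_inf sc p) (R_inverse sc p f)"

definition R_plus_inverse ::
  "(complex \<Rightarrow> 'e::ab_group_add \<Rightarrow> 'e) \<Rightarrow> ('a \<Rightarrow> 'e \<Rightarrow> real) \<Rightarrow> (complex \<Rightarrow> 'e) set \<Rightarrow> (complex \<Rightarrow> 'e) set" where
  "R_plus_inverse sc p =
     inv_into (quot (H_minus_inf sc p {0..\<infinity>}) (restr slit_plane ` H_minus_inf sc p {\<infinity>}))
       (quot_map id (entire_on_slit sc p))"

definition langenbruch_hyper ::
  "(complex \<Rightarrow> 'e::ab_group_add \<Rightarrow> 'e) \<Rightarrow> ('a \<Rightarrow> 'e \<Rightarrow> real) \<Rightarrow> (complex \<Rightarrow> 'e) set \<Rightarrow> (complex \<Rightarrow> 'e) set" where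
  "langenbruch_hyper sc p f = quot_map (laplace sc p UNIV) (LG_inf sc p) (R_plus_inverse sc p f)"

definition I_zero ::
  "(complex \<Rightarrow> 'e::ab_group_add \<Rightarrow> 'e) \<Rightarrow> ('a \<Rightarrow> 'e \<Rightarrow> real) \<Rightarrow> (complex \<Rightarrow> 'e) set \<Rightarrow> (complex \<Rightarrow> 'e) set" where
  "I_zero sc p = quot_map (restr right_half_plane) (LO_inf sc p)"

end

theory Submission
  imports Defs "HOL-Complex_Analysis.Complex_Analysis"
begin

text \<open>Every \<open>f\<close> holomorphic off the half-line splits as \<open>f = g + h\<close> with \<open>h\<close> entire and \<open>g\<close> in
  \<open>H\<^sub>-\<^sub>\<infinity>\<close>. After multiplication by a Gaussian, \<open>g\<close> only needs to be bounded on the strips; then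
  \<open>g\<close> comes from the Cauchy integral of \<open>f\<close> over a contour that narrows towards the half-line, each
  piece of whose kernel is approximated by an entire function of \<open>z\<close>, because its poles can be pushed
  to infinity along the half-line as in Runge's theorem.

  Hence a hyperfunction has a single representative \<open>g\<close> for both transforms, and these are given by
  the same integral, so that \<open>I\<^sub>0\<close> carries one to the other. Injectivity of \<open>I\<^sub>0\<close> follows by comparing
  the growth conditions. For surjectivity, the Borel transform \<open>f\<close> of \<open>F\<close> inverts the Laplace
  transform; if \<open>f = g + h\<close> as above, then \<open>F\<close> minus the Laplace transform of \<open>g\<close> is the Laplace
  transform of the entire \<open>h\<close> for \<open>Re \<zeta> > 1\<close>, where moving the contour to the right shows that it
  decays like \<open>LO\<^sub>\<infinity>\<close>. Vector-valued estimates are reduced to scalar ones by functionals bounded by a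
  seminorm (Hahn-Banach).\<close>

section \<open>Seminorms and duality\<close>

text \<open>The entire part \<open>h\<close> must serve all seminorms at once, although Runge
  approximations are chosen by size. Metrizability gives a cofinal sequence of seminorms, and a
  diagonal choice of tolerances then fixes kernels \<open>E j\<close> that depend on
  \<open>f\<close> only through its size on the pieces of the contour. The same kernels act on every
  scalar function \<open>\<phi> \<circ> f\<close>, with estimates uniform over the polar of a
  seminorm; this uniformity lets completeness turn scalar limits into a vector.

  All strips are treated with one contour. It has to come arbitrarily close to the half-line near
  infinity, so that every strip, whatever its distance from the half-line, lies outside the contour
  up to a bounded set.

  A function in \<open>LO_zero_inf\<close> is controlled only at a positive distance from the
  imaginary axis, so the Borel integrals start at \<open>s = 1\<close>. This costs a factor
  \<open>exp (Re z)\<close> and confines the inversion to \<open>Re \<zeta> > 1\<close>. That is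
  enough: for bounded \<open>Re \<zeta>\<close> the decay that defines \<open>LO_inf\<close> already
  follows from the growth bound of \<open>LO_zero_inf\<close>.\<close>

locale frechet =
  fixes sc :: "complex \<Rightarrow> 'e::ab_group_add \<Rightarrow> 'e" and p :: "'a \<Rightarrow> 'e \<Rightarrow> real"
  assumes frechet: "frechet_space sc p"
begin

sublocale vector_space sc
  using frechet by (simp add: frechet_space_def)

lemma p_add: "p a (x + y) \<le> p a x + p a y"
  and p_scale: "p a (sc c x) = cmod c * p a x"
  using frechet by (auto simp: frechet_space_def seminorm_def)

lemma p_zero [simp]: "p a 0 = 0"
  using p_scale[of a 0 0] by simp

lemma p_minus [simp]: "p a (- x) = p a x"
  using p_scale[of a "-1" x] by simp

lemma p_nonneg [simp]: "0 \<le> p a x"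
  using p_add[of a x "- x"] by simp

lemma p_diff: "p a (x - y) \<le> p a x + p a y"
  using p_add[of a x "- y"] by simp

lemma p_diff_comm: "p a (x - y) = p a (y - x)"
  using p_minus[of a "x - y"] by simp

lemma p_triangle: "p a (x - z) \<le> p a (x - y) + p a (y - z)"
  using p_add[of a "x - y" "y - z"] by simp

lemma p_rev_triangle: "\<bar>p a x - p a y\<bar> \<le> p a (x - y)"
  using p_add[of a "x - y" y] p_add[of a "y - x" x] by (simp add: p_diff_comm[of a y x])

lemma p_directed: "\<exists>c. \<exists>C>0. \<forall>x. p a x \<le> C * p c x \<and> p b x \<le> C * p c x"
  using frechet by (simp add: frechet_space_def directed_seminorms_def)

section \<open>Topology, metric and completeness in terms of the seminorms\<close>

lemma topspace_seminorm [simp]: "topspace (seminorm_topology p) = UNIV"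
proof -
  have "x \<in> \<Union> {{y. p \<alpha> (y - x) < r} | \<alpha> x r. 0 < r}" for x
  proof (rule UnionI)
    \<comment> \<open>\<open>undefined\<close> stands for an arbitrary index; every unit ball about
      \<open>x\<close> contains \<open>x\<close>.\<close>
    show "{y. p undefined (y - x) < 1} \<in> {{y. p \<alpha> (y - x) < r} | \<alpha> x r. 0 < r}"
      unfolding mem_Collect_eq by (intro exI conjI) (rule refl, rule zero_less_one)
  qed simp
  then show ?thesis unfolding seminorm_topology_def topology_generated_by_topspace by blast
qed

text \<open>Finite intersections are the only step that mixes two seminorms; directedness dominates
  both by one, at the price of a factor \<open>C\<close> in the radius. An off-centre basic set is
  handled by the triangle inequality.\<close>

lemma openin_seminorm_ball:
  assumes "openin (seminorm_topology p) U" "x \<in> U"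
  shows "\<exists>a r. 0 < r \<and> (\<forall>y. p a (y - x) < r \<longrightarrow> y \<in> U)"
proof -
  have "generate_topology_on {{y. p \<alpha> (y - x) < r} | \<alpha> x r. 0 < r} U"
    using assms(1) by (simp add: seminorm_topology_def openin_topology_generated_by_iff)
  then have "x \<in> U \<Longrightarrow> \<exists>a r. 0 < r \<and> (\<forall>y. p a (y - x) < r \<longrightarrow> y \<in> U)"
  proof (induction rule: generate_topology_on.induct)
    case (Int V W)
    then obtain a r b s where *: "0 < r" "\<forall>y. p a (y - x) < r \<longrightarrow> y \<in> V"
      "0 < s" "\<forall>y. p b (y - x) < s \<longrightarrow> y \<in> W" by auto
    obtain c C where C: "C > 0" "\<forall>x. p a x \<le> C * p c x \<and> p b x \<le> C * p c x"
      using p_directed by blast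
    have "y \<in> V \<inter> W" if "p c (y - x) < min r s / C" for y
    proof -
      have "C * p c (y - x) < min r s" using that C(1) by (simp add: field_simps)
      then show ?thesis using C(2) *
        by (metis IntI min_less_iff_conj order_le_less_trans)
    qed
    moreover have "min r s / C > 0" using * C by simp
    ultimately show ?case by blast
  next
    case (UN K)
    then show ?case by (meson Union_iff)
  next
    case (Basis S)
    then obtain a z r where S: "S = {y. p a (y - z) < r}" "0 < r" by blast
    have "p a (y - z) < r" if "p a (y - x) < r - p a (x - z)" for y
      using that p_triangle[of a y z x] by simp
    then show ?case using S Basis by (intro exI[of _ a] exI[of _ "r - p a (x - z)"]) auto
  qed auto
  then show ?thesis using assms(2) by blast
qed

lemma openin_seminorm_ballI: "0 < r \<Longrightarrow> openin (seminorm_topology p) {y. p a (y - x) < r}"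
  unfolding seminorm_topology_def openin_topology_generated_by_iff
  by (rule generate_topology_on.Basis) blast

text \<open>Seminorm balls form neighbourhood bases, so convergence, and with it the derivative in
  \<open>holo\<close>, can be tested seminorm by seminorm.\<close>

lemma limitin_seminorm_iff:
  "limitin (seminorm_topology p) f l F \<longleftrightarrow> (\<forall>a. ((\<lambda>x. p a (f x - l)) \<longlongrightarrow> 0) F)"
proof
  assume *: "limitin (seminorm_topology p) f l F"
  show "\<forall>a. ((\<lambda>x. p a (f x - l)) \<longlongrightarrow> 0) F"
  proof
    fix a
    have "eventually (\<lambda>x. p a (f x - l) < r) F" if "0 < r" for r
      using * openin_seminorm_ballI[OF that, of a l] that unfolding limitin_def by auto
    then show "((\<lambda>x. p a (f x - l)) \<longlongrightarrow> 0) F"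
      by (auto simp: tendsto_iff dist_real_def)
  qed
next
  assume *: "\<forall>a. ((\<lambda>x. p a (f x - l)) \<longlongrightarrow> 0) F"
  show "limitin (seminorm_topology p) f l F"
    unfolding limitin_def
  proof (intro conjI allI impI)
    fix U assume "openin (seminorm_topology p) U \<and> l \<in> U"
    then have o: "openin (seminorm_topology p) U" "l \<in> U" by blast+
    then obtain a r where ar: "0 < r" "\<And>y. p a (y - l) < r \<Longrightarrow> y \<in> U"
      using openin_seminorm_ball[OF o] by blast
    have "eventually (\<lambda>x. p a (f x - l) < r) F"
      by (rule order_tendstoD(2)[OF spec[OF *, of a] ar(1)])
    then show "eventually (\<lambda>x. f x \<in> U) F" by eventually_elim (rule ar(2))
  qed simp
qed

lemma metric_exists:
  obtains d where "Metric_space UNIV d" "\<And>x y z. d (x + z) (y + z) = d x y"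
    "Metric_space.mcomplete UNIV d" "Metric_space.mtopology UNIV d = seminorm_topology p"
  using frechet by (auto simp: frechet_space_def)

text \<open>The metric separates points: a metric ball about 0 that misses \<open>x\<close> contains
  a seminorm ball, and a vector on which all seminorms vanish lies in every seminorm ball.\<close>

lemma seminorms_separate:
  assumes "\<And>a. p a x = 0"
  shows "x = 0"
proof -
  obtain d where d: "Metric_space UNIV d" "Metric_space.mtopology UNIV d = seminorm_topology p"
    using metric_exists by metis
  interpret Metric_space UNIV d by fact
  show ?thesis
  proof (rule ccontr)
    assume "x \<noteq> 0"
    then have "0 < d 0 x" by (simp add: mdist_pos_less)
    then have o: "openin (seminorm_topology p) (mball 0 (d 0 x))" "0 \<in> mball 0 (d 0 x)"
      using openin_mball[of 0 "d 0 x"] d(2) by simp_all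
    then obtain a r where "0 < r" "\<And>y. p a (y - 0) < r \<Longrightarrow> y \<in> mball 0 (d 0 x)"
      using openin_seminorm_ball[OF o] by blast
    with assms[of a] have "x \<in> mball 0 (d 0 x)" by (simp del: in_mball)
    then show False by simp
  qed
qed

text \<open>Translation invariance makes the metric distance of \<open>x m\<close> and
  \<open>x n\<close> that of \<open>x m - x n\<close> from 0, and each metric ball about 0 contains
  a seminorm ball. So Cauchy in every seminorm implies Cauchy in the metric.\<close>

lemma seminorm_complete:
  assumes "\<And>a e. 0 < e \<Longrightarrow> \<exists>N. \<forall>m\<ge>N. \<forall>n\<ge>N. p a (x m - x n) \<le> e"
  obtains l where "\<And>a. (\<lambda>n. p a (x n - l)) \<longlonglongrightarrow> 0"
proof -
  obtain d where d: "Metric_space UNIV d" "\<And>x y z. d (x + z) (y + z) = d x y"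
    "Metric_space.mcomplete UNIV d" "Metric_space.mtopology UNIV d = seminorm_topology p"
    using metric_exists by metis
  interpret Metric_space UNIV d by fact
  have "MCauchy x"
    unfolding MCauchy_def
  proof (intro conjI allI impI)
    fix e :: real assume "0 < e"
    then have o: "openin (seminorm_topology p) (mball 0 e)" "0 \<in> mball 0 e"
      using openin_mball[of 0 e] d(4) by simp_all
    then obtain a r where ar: "0 < r" "\<And>y. p a (y - 0) < r \<Longrightarrow> y \<in> mball 0 e"
      using openin_seminorm_ball[OF o] by blast
    obtain N where N: "\<forall>m\<ge>N. \<forall>n\<ge>N. p a (x m - x n) \<le> r/2" using assms[of "r/2" a] ar by auto
    have "d (x n) (x m) < e" if "n \<ge> N" "m \<ge> N" for n m
    proof -
      have "x m - x n \<in> mball 0 e" using N that ar by fastforce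
      then show ?thesis using d(2)[of 0 "x n" "x m - x n"] by simp
    qed
    then show "\<exists>N. \<forall>n n'. N \<le> n \<longrightarrow> N \<le> n' \<longrightarrow> d (x n) (x n') < e" by blast
  qed simp
  then obtain l where "limitin mtopology x l sequentially"
    using d(3) unfolding mcomplete_def by blast
  then show ?thesis using that unfolding d(4) limitin_seminorm_iff by blast
qed

text \<open>The metric balls of radius \<open>1 / (n + 1)\<close> about 0 form a countable base of
  neighbourhoods and yield the \<open>\<beta> n\<close>. A seminorm whose unit ball contains the
  neighbourhood \<open>p (\<beta> n) y < r n\<close> is bounded by a multiple of
  \<open>p (\<beta> n)\<close>. The diagonal choice of tolerances in
  \<open>bounded_splitting\<close> rests on this sequence.\<close>

lemma countable_cofinal:
  obtains \<beta> :: "nat \<Rightarrow> 'a" where "\<And>a. \<exists>i. \<exists>C>0. \<forall>x. p a x \<le> C * p (\<beta> i) x"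
proof -
  obtain d where d: "Metric_space UNIV d" "Metric_space.mtopology UNIV d = seminorm_topology p"
    using metric_exists by metis
  interpret Metric_space UNIV d by fact
  have "\<exists>a r. 0 < r \<and> (\<forall>y. p a (y - 0) < r \<longrightarrow> y \<in> mball 0 (inverse (Suc n)))" for n
  proof -
    have "openin mtopology (mball 0 (inverse (Suc n)))" by (rule openin_mball)
    then have o: "openin (seminorm_topology p) (mball 0 (inverse (Suc n)))"
      "0 \<in> mball 0 (inverse (Suc n))" by (simp_all add: d(2) del: of_nat_Suc)
    then show ?thesis using openin_seminorm_ball[OF o] by blast
  qed
  then obtain \<beta> r where \<beta>: "\<And>n. 0 < r n" "\<And>n y. p (\<beta> n) (y - 0) < r n \<Longrightarrow> y \<in> mball 0 (inverse (Suc n))"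
    by metis
  have "\<exists>i. \<exists>C>0. \<forall>x. p a x \<le> C * p (\<beta> i) x" for a
  proof -
    have "openin mtopology {y. p a (y - 0) < 1}" unfolding d(2) by (rule openin_seminorm_ballI) simp
    then have "\<forall>x\<in>{y. p a (y - 0) < 1}. \<exists>r>0. mball x r \<subseteq> {y. p a (y - 0) < 1}"
      unfolding openin_mtopology by blast
    moreover have "0 \<in> {y. p a (y - 0) < 1}" by simp
    ultimately obtain e where e: "e > 0" "mball 0 e \<subseteq> {y. p a (y - 0) < 1}" by blast
    obtain n where n: "inverse (Suc n) < e" using reals_Archimedean[OF e(1)] by blast
    have *: "p a y < 1" if "p (\<beta> n) y < r n" for y
    proof -
      have "y \<in> mball 0 (inverse (Suc n))" using that \<beta> by simp
      then have "y \<in> mball 0 e" using n by auto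
      then show ?thesis using e by auto
    qed
    \<comment> \<open>Homogeneity: \<open>x\<close> is scaled to \<open>p (\<beta> n)\<close>-size
      \<open>r n / 2\<close>, just inside the ball. If \<open>p (\<beta> n) x = 0\<close>, every
      multiple of \<open>x\<close> lies in the ball, which forces \<open>p a x = 0\<close>.\<close>
    have "p a x \<le> (2 / r n) * p (\<beta> n) x" for x
    proof (cases "p (\<beta> n) x = 0")
      case True
      have "p a x \<le> e" if "e > 0" for e
      proof -
        have "p a (sc (of_real (1/e)) x) < 1" using True \<beta>(1)[of n] by (intro *) (simp add: p_scale)
        then show ?thesis using that by (simp add: p_scale norm_divide field_simps)
      qed
      then have "p a x \<le> 0" by (meson dense_ge)
      then show ?thesis using True by simp
    next
      case False
      then have pos: "p (\<beta> n) x > 0" by (simp add: less_le)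
      let ?c = "r n / (2 * p (\<beta> n) x)"
      have c: "?c > 0" using pos \<beta>(1)[of n] by simp
      have "p a (sc (of_real ?c) x) < 1"
        using pos \<beta>(1)[of n] by (intro *) (simp add: p_scale norm_divide norm_mult)
      then have "?c * p a x < 1" using c \<beta>(1)[of n] by (simp add: p_scale norm_divide norm_mult)
      then show ?thesis using pos \<beta>(1)[of n] by (simp add: field_simps)
    qed
    then show ?thesis using \<beta>(1)[of n] by (intro exI[of _ n] exI[of _ "2 / r n"]) auto
  qed
  then show ?thesis using that by blast
qed

text \<open>Zorn's lemma is applied to graphs of real-linear functionals dominated by \<open>p a\<close>.\<close>

lemma Hahn_Banach_real:
  obtains u :: "'e \<Rightarrow> real" where "\<And>x y. u (x + y) = u x + u y"
    "\<And>t x. u (sc (of_real t) x) = t * u x" "\<And>x. u x \<le> p a x" "u x0 = p a x0"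
proof -
  define good where "good = {G. (\<forall>x s y t. (x, s) \<in> G \<and> (y, t) \<in> G \<longrightarrow> (x + y, s + t) \<in> G) \<and>
    (\<forall>c x s. (x, s) \<in> G \<longrightarrow> (sc (of_real c) x, c * s) \<in> G) \<and>
    (\<forall>x s. (x, s) \<in> G \<longrightarrow> s \<le> p a x) \<and> (x0, p a x0) \<in> G}"
  \<comment> \<open>The norming line: on the multiples of \<open>x0\<close> the functional is fixed
    by its value \<open>p a x0\<close> at \<open>x0\<close>, and membership of this pair is built
    into \<open>good\<close>.\<close>
  define G0 where "G0 = range (\<lambda>t. (sc (of_real t) x0, t * p a x0))"
  have G0: "G0 \<in> good"
  proof -
    have 1: "(x + y, s + t) \<in> G0" if xs: "(x, s) \<in> G0" and yt: "(y, t) \<in> G0" for x s y t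
    proof -
      from xs obtain u where "x = sc (of_real u) x0" "s = u * p a x0" by (auto simp: G0_def)
      moreover from yt obtain v where "y = sc (of_real v) x0" "t = v * p a x0" by (auto simp: G0_def)
      ultimately have "(x + y, s + t) = (\<lambda>t. (sc (of_real t) x0, t * p a x0)) (u + v)"
        by (simp add: scale_left_distrib algebra_simps)
      then show ?thesis unfolding G0_def by blast
    qed
    have 2: "(sc (of_real c) x, c * s) \<in> G0" if xs: "(x, s) \<in> G0" for c x s
    proof -
      from xs obtain u where "x = sc (of_real u) x0" "s = u * p a x0" by (auto simp: G0_def)
      then have "(sc (of_real c) x, c * s) = (\<lambda>t. (sc (of_real t) x0, t * p a x0)) (c * u)"
        by (simp add: mult.assoc)
      then show ?thesis unfolding G0_def by blast
    qed
    have 3: "s \<le> p a x" if xs: "(x, s) \<in> G0" for x s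
      using that by (auto simp: G0_def p_scale intro!: mult_right_mono)
    have 4: "(x0, p a x0) \<in> G0" unfolding G0_def by (rule image_eqI[of _ _ 1]) auto
    show ?thesis using 1 2 3 4 unfolding good_def by blast
  qed
  have "\<exists>M\<in>good. \<forall>X\<in>good. M \<subseteq> X \<longrightarrow> X = M"
  proof (rule subset_Zorn)
    fix \<C> assume C: "subset.chain good \<C>"
    show "\<exists>U\<in>good. \<forall>X\<in>\<C>. X \<subseteq> U"
    proof (cases "\<C> = {}")
      case True
      then show ?thesis using G0 by blast
    next
      case False
      have sub: "\<And>X. X \<in> \<C> \<Longrightarrow> X \<in> good" using C unfolding subset.chain_def by blast
      have tot: "X \<subseteq> Y \<or> Y \<subseteq> X" if "X \<in> \<C>" "Y \<in> \<C>" for X Y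
        using C that unfolding subset_chain_def by blast
      have "\<Union>\<C> \<in> good"
        unfolding good_def
      proof (intro CollectI conjI allI impI)
        fix x s y t assume "(x, s) \<in> \<Union>\<C> \<and> (y, t) \<in> \<Union>\<C>"
        then obtain X Y where XY: "X \<in> \<C>" "Y \<in> \<C>" "(x,s) \<in> X" "(y,t) \<in> Y" by blast
        then obtain Z where Z: "Z \<in> \<C>" "(x,s) \<in> Z" "(y,t) \<in> Z" using tot[OF XY(1,2)] by blast
        then show "(x + y, s + t) \<in> \<Union>\<C>" using sub[OF Z(1)] unfolding good_def by blast
      next
        fix c x s assume "(x, s) \<in> \<Union>\<C>"
        then obtain Z where Z: "Z \<in> \<C>" "(x,s) \<in> Z" by blast
        then show "(sc (of_real c) x, c * s) \<in> \<Union>\<C>" using sub[OF Z(1)] unfolding good_def by blast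
      next
        fix x s assume "(x, s) \<in> \<Union>\<C>"
        then obtain Z where Z: "Z \<in> \<C>" "(x,s) \<in> Z" by blast
        then show "s \<le> p a x" using sub[OF Z(1)] unfolding good_def by blast
      next
        obtain Z where Z: "Z \<in> \<C>" using False by blast
        then show "(x0, p a x0) \<in> \<Union>\<C>" using sub[OF Z(1)] unfolding good_def by blast
      qed
      then show ?thesis by blast
    qed
  qed
  then obtain M where M: "M \<in> good" "\<And>X. X \<in> good \<Longrightarrow> M \<subseteq> X \<Longrightarrow> X = M" by blast
  have Madd: "(x + y, s + t) \<in> M" if "(x, s) \<in> M" "(y, t) \<in> M" for x y s t
    using M(1) that unfolding good_def by blast
  have Msc: "(sc (of_real c) x, c * s) \<in> M" if "(x, s) \<in> M" for c x s
    using M(1) that unfolding good_def by blast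
  have Mle: "s \<le> p a x" if "(x, s) \<in> M" for x s
    using M(1) that unfolding good_def by blast
  have M0: "(x0, p a x0) \<in> M" using M(1) unfolding good_def by blast
  have Mdiff: "(x - y, s - t) \<in> M" if "(x, s) \<in> M" "(y, t) \<in> M" for x y s t
    using Madd[OF that(1) Msc[OF that(2), of "-1"]] by simp
  have zero: "s = 0" if "(0, s) \<in> M" for s
  proof -
    have "s \<le> p a 0" "- s \<le> p a 0" using Mle[OF that] Mle[OF Msc[OF that, of "-1"]] by auto
    then show ?thesis by simp
  qed
  have uniq: "s = t" if "(x, s) \<in> M" "(x, t) \<in> M" for x s t
    using zero[of "s - t"] Mdiff[OF that] by simp
  have total: "\<exists>s. (y, s) \<in> M" for y
  proof (rule ccontr)
    assume ny: "\<nexists>s. (y, s) \<in> M"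
    \<comment> \<open>Any value between the two sides can be assigned to \<open>y\<close>;
      subadditivity at \<open>x + x' = (x - y) + (x' + y)\<close> shows that no lower bound exceeds
      an upper one. The supremum \<open>c\<close> of the lower bounds is taken.\<close>
    have key: "s - p a (x - y) \<le> p a (x' + y) - s'" if "(x, s) \<in> M" "(x', s') \<in> M" for x s x' s'
    proof -
      have "s + s' \<le> p a (x + x')" using Mle[OF Madd[OF that]] .
      also have "\<dots> \<le> p a (x - y) + p a (x' + y)" using p_add[of a "x - y" "x' + y"] by simp
      finally show ?thesis by simp
    qed
    define c where "c = (SUP z\<in>M. snd z - p a (fst z - y))"
    have bdd: "bdd_above ((\<lambda>z. snd z - p a (fst z - y)) ` M)"
      using key[OF _ M0] by (intro bdd_aboveI[of _ "p a (x0 + y) - p a x0"]) auto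
    have c1: "s - p a (x - y) \<le> c" if "(x, s) \<in> M" for x s
      unfolding c_def using cSUP_upper[OF that bdd] by simp
    have c2: "c \<le> p a (x + y) - s" if "(x, s) \<in> M" for x s
      unfolding c_def using key[OF _ that] M0 by (intro cSUP_least) auto
    \<comment> \<open>Dividing by \<open>\<bar>t\<bar>\<close> reduces negative \<open>t\<close> to
      \<open>c1\<close> and positive \<open>t\<close> to \<open>c2\<close>.\<close>
    have c3: "s + t * c \<le> p a (x + sc (of_real t) y)" if "(x, s) \<in> M" for x s t
    proof (cases t "0::real" rule: linorder_cases)
      case less
      have eq: "sc (of_real (inverse (-t))) x - y = sc (of_real (inverse (-t))) (x + sc (of_real t) y)"
        using less by (simp add: scale_right_distrib)
      have "inverse (-t) * s - p a (sc (of_real (inverse (-t))) x - y) \<le> c" using c1[OF Msc[OF that]] .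
      then have "inverse (-t) * s - inverse (-t) * p a (x + sc (of_real t) y) \<le> c"
        unfolding eq p_scale using less by (simp add: norm_inverse)
      then have "inverse (-t) * (s - p a (x + sc (of_real t) y)) \<le> c" by (simp add: algebra_simps)
      then show ?thesis using less by (simp add: field_simps)
    next
      case equal
      then show ?thesis using Mle[OF that] by simp
    next
      case greater
      have eq: "sc (of_real (inverse t)) x + y = sc (of_real (inverse t)) (x + sc (of_real t) y)"
        using greater by (simp add: scale_right_distrib)
      have "c \<le> p a (sc (of_real (inverse t)) x + y) - inverse t * s" using c2[OF Msc[OF that]] .
      then have "c \<le> inverse t * p a (x + sc (of_real t) y) - inverse t * s"
        unfolding eq p_scale using greater by (simp add: norm_inverse)
      then have "c \<le> inverse t * (p a (x + sc (of_real t) y) - s)" by (simp add: algebra_simps)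
      then show ?thesis using greater by (simp add: field_simps)
    qed
    define M' where "M' = {(x + sc (of_real t) y, s + t * c) | x s t. (x, s) \<in> M}"
    have M'I: "(z, r) \<in> M'" if "(x, s) \<in> M" "z = x + sc (of_real t) y" "r = s + t * c" for z r x s t
      using that unfolding M'_def by blast
    have sub: "M \<subseteq> M'"
    proof
      fix z assume "z \<in> M"
      then show "z \<in> M'" by (cases z) (auto intro: M'I[of _ _ _ 0])
    qed
    have "M' \<in> good"
      unfolding good_def
    proof (intro CollectI conjI allI impI)
      fix x s z t assume "(x, s) \<in> M' \<and> (z, t) \<in> M'"
      then obtain x1 s1 t1 x2 s2 t2 where "(x1, s1) \<in> M" "x = x1 + sc (of_real t1) y" "s = s1 + t1 * c"
        "(x2, s2) \<in> M" "z = x2 + sc (of_real t2) y" "t = s2 + t2 * c" unfolding M'_def by blast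
      then show "(x + z, s + t) \<in> M'"
        by (intro M'I[OF Madd, of x1 s1 x2 s2 _ "t1 + t2"]) (auto simp: scale_left_distrib algebra_simps)
    next
      fix b x s assume "(x, s) \<in> M'"
      then obtain x1 s1 t1 where "(x1, s1) \<in> M" "x = x1 + sc (of_real t1) y" "s = s1 + t1 * c"
        unfolding M'_def by blast
      then show "(sc (of_real b) x, b * s) \<in> M'"
        by (intro M'I[OF Msc, of x1 s1 _ b "b * t1"]) (auto simp: scale_right_distrib algebra_simps)
    next
      fix x s assume "(x, s) \<in> M'"
      then show "s \<le> p a x" using c3 unfolding M'_def by blast
    next
      show "(x0, p a x0) \<in> M'" using sub M0 by blast
    qed
    then have "M' = M" using M(2) sub by blast
    have "(0, 0) \<in> M" using Msc[OF M0, of 0] by simp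
    then have "(y, c) \<in> M'" by (intro M'I[of 0 0 _ 1]) auto
    then show False using ny \<open>M' = M\<close> by blast
  qed
  define u where "u x = (THE s. (x, s) \<in> M)" for x
  have uM: "(x, u x) \<in> M" for x
    unfolding u_def using total[of x] uniq by (metis (mono_tags, lifting) theI)
  show ?thesis
  proof (rule that[of u])
    show "u (x + y) = u x + u y" for x y using uniq[OF uM Madd[OF uM uM]] .
    show "u (sc (of_real t) x) = t * u x" for t x using uniq[OF uM Msc[OF uM]] .
    show "u x \<le> p a x" for x using Mle[OF uM] .
    show "u x0 = p a x0" using uniq[OF uM M0] .
  qed
qed

section \<open>Polars of seminorms and the continuous dual\<close>

definition polar :: "'a \<Rightarrow> ('e \<Rightarrow> complex) set" where
  "polar a = {\<phi>. Vector_Spaces.linear sc (*) \<phi> \<and> (\<forall>x. cmod (\<phi> x) \<le> p a x)}"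

abbreviation dual :: "('e \<Rightarrow> complex) \<Rightarrow> bool" where
  "dual \<equiv> continuous_functional sc p"

text \<open>A real functional \<open>u\<close> that norms \<open>x0\<close> is completed to the
  complex-linear functional with real part \<open>u\<close>. The bound passes from \<open>u\<close>
  to \<open>\<phi>\<close> by rotating \<open>x\<close> with a unimodular \<open>c\<close> for which
  \<open>c * \<phi> x\<close> is real and nonnegative.\<close>

lemma Hahn_Banach:
  obtains \<phi> where "\<phi> \<in> polar a" "cmod (\<phi> x0) = p a x0"
proof -
  obtain u where u: "\<And>x y. u (x + y) = u x + u y" "\<And>t x. u (sc (of_real t) x) = t * u x"
     "\<And>x. u x \<le> p a x" "u x0 = p a x0" using Hahn_Banach_real by metis
  define \<phi> where "\<phi> x = Complex (u x) (- u (sc \<i> x))" for x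
  have sc_eq: "sc c x = sc (of_real (Re c)) x + sc (of_real (Im c)) (sc \<i> x)" for c x
  proof -
    have "c = of_real (Re c) + of_real (Im c) * \<i>" by (simp add: complex_eq_iff)
    then have "sc c x = sc (of_real (Re c) + of_real (Im c) * \<i>) x" by (rule arg_cong)
    then show ?thesis by (simp only: scale_left_distrib scale_scale)
  qed
  have lin: "\<phi> (x + y) = \<phi> x + \<phi> y" for x y
    by (simp add: \<phi>_def u(1) scale_right_distrib complex_eq_iff)
  have hom: "\<phi> (sc c x) = c * \<phi> x" for c x
  proof -
    have 1: "u (sc c x) = Re c * u x + Im c * u (sc \<i> x)" for c
      by (subst sc_eq) (simp only: u(1,2))
    have 2: "u (sc \<i> (sc c x)) = Re c * u (sc \<i> x) - Im c * u x"
      unfolding scale_scale 1[of "\<i> * c"] by simp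
    show ?thesis using 1[of c] 2 by (simp add: \<phi>_def complex_eq_iff del: scale_scale)
  qed
  have bound: "cmod (\<phi> x) \<le> p a x" for x
  proof (cases "\<phi> x = 0")
    case False
    define c where "c = cnj (\<phi> x) / cmod (\<phi> x)"
    have nc: "cmod c = 1" using False by (simp add: c_def norm_divide)
    have "c * \<phi> x = of_real (cmod (\<phi> x))"
      using False complex_norm_square[of "\<phi> x"]
      by (simp add: c_def power2_eq_square mult.commute field_simps)
    then have "cmod (\<phi> x) = Re (\<phi> (sc c x))" by (simp add: hom)
    also have "\<dots> = u (sc c x)" by (simp add: \<phi>_def)
    also have "\<dots> \<le> p a (sc c x)" by (rule u)
    finally show ?thesis by (simp add: p_scale nc)
  qed simp
  have "Vector_Spaces.linear sc (*) \<phi>"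
    unfolding Vector_Spaces.linear_def module_hom_def module_hom_axioms_def
    using lin hom vector_space_axioms module_axioms
    by (auto simp: module_def vector_space_def algebra_simps)
  then have "\<phi> \<in> polar a" using bound by (simp add: polar_def)
  moreover have "cmod (\<phi> x0) = p a x0"
  proof (rule antisym[OF bound])
    show "p a x0 \<le> cmod (\<phi> x0)" using abs_Re_le_cmod[of "\<phi> x0"] u(4) by (simp add: \<phi>_def)
  qed
  ultimately show ?thesis using that by blast
qed

text \<open>\<open>polar a\<close> is the polar of the unit ball of \<open>p a\<close>, and by
  Hahn-Banach \<open>p a x\<close> is attained on it. Nearly every vector-valued estimate below is a
  scalar estimate with a bound that is uniform over \<open>polar a\<close>.\<close>

lemma seminorm_le_polar:
  assumes "\<And>\<phi>. \<phi> \<in> polar a \<Longrightarrow> cmod (\<phi> x) \<le> B"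
  shows "p a x \<le> B"
  using Hahn_Banach[of a x] assms by metis

lemma polar_le: "\<phi> \<in> polar a \<Longrightarrow> cmod (\<phi> x) \<le> p a x"
  by (simp add: polar_def)

lemma linear_functional:
  assumes "Vector_Spaces.linear sc (*) \<phi>"
  shows "\<phi> (x + y) = \<phi> x + \<phi> y" "\<phi> (x - y) = \<phi> x - \<phi> y" "\<phi> 0 = 0" "\<phi> (- x) = - \<phi> x"
    "\<phi> (sc c x) = c * \<phi> x" "\<phi> (sum f A) = (\<Sum>i\<in>A. \<phi> (f i))"
proof -
  interpret l: Vector_Spaces.linear sc "(*)" \<phi> by fact
  show "\<phi> (x + y) = \<phi> x + \<phi> y" "\<phi> (x - y) = \<phi> x - \<phi> y" "\<phi> 0 = 0" "\<phi> (- x) = - \<phi> x"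
    "\<phi> (sc c x) = c * \<phi> x" "\<phi> (sum f A) = (\<Sum>i\<in>A. \<phi> (f i))"
    using l.add l.diff l.zero l.neg l.scale l.sum by auto
qed

text \<open>Continuity at 0 bounds \<open>\<phi>\<close> on some seminorm ball, and homogeneity
  turns this into a global bound; the factor 2 keeps the scaled vector strictly inside the
  ball.\<close>

lemma dual_bounded:
  assumes "dual \<phi>"
  obtains a C where "C > 0" "\<And>x. cmod (\<phi> x) \<le> C * p a x"
proof -
  have lin: "Vector_Spaces.linear sc (*) \<phi>" and cont: "continuous_map (seminorm_topology p) euclidean \<phi>"
    using assms by (auto simp: continuous_functional_def)
  have o: "openin (seminorm_topology p) {x. \<phi> x \<in> ball 0 1}"
    using cont open_ball[of "0::complex" 1] unfolding continuous_map_def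
    by (simp only: open_openin[symmetric] topspace_seminorm UNIV_I simp_thms)
  have "0 \<in> {x. \<phi> x \<in> ball 0 1}" using linear_functional(3)[OF lin] by simp
  then obtain a r where ar: "0 < r" "\<And>y. p a (y - 0) < r \<Longrightarrow> y \<in> {x. \<phi> x \<in> ball 0 1}"
    using openin_seminorm_ball[OF o] by blast
  have *: "cmod (\<phi> x) < 1" if "p a x < r" for x using ar(2)[of x] that by simp
  have "cmod (\<phi> x) \<le> (2 / r) * p a x" for x
  proof (cases "p a x = 0")
    case True
    have "cmod (\<phi> x) \<le> e" if "e > 0" for e
    proof -
      have "cmod (\<phi> (sc (of_real (1/e)) x)) < 1" using True ar(1) by (intro *) (simp add: p_scale)
      then show ?thesis using that by (simp add: linear_functional[OF lin] norm_mult norm_divide field_simps)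
    qed
    then have "cmod (\<phi> x) \<le> 0" by (meson dense_ge)
    then show ?thesis using True by simp
  next
    case False
    then have pos: "p a x > 0" by (simp add: less_le)
    let ?c = "r / (2 * p a x)"
    have c: "?c > 0" using pos ar by simp
    have "cmod (\<phi> (sc (of_real ?c) x)) < 1"
      using pos ar(1) by (intro *) (simp add: p_scale norm_divide norm_mult)
    then have "?c * cmod (\<phi> x) < 1" using c ar(1) by (simp add: linear_functional[OF lin] norm_divide norm_mult)
    then show ?thesis using pos ar(1) by (simp add: field_simps)
  qed
  then show ?thesis using that[of "2 / r" a] ar by simp
qed

lemma dualI:
  assumes lin: "Vector_Spaces.linear sc (*) \<phi>" and le: "\<And>x. cmod (\<phi> x) \<le> C * p a x"
  shows "dual \<phi>"
  unfolding continuous_functional_def continuous_map_def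
proof (intro conjI allI impI lin)
  fix U :: "complex set" assume U: "openin euclidean U"
  have "\<exists>T. openin (seminorm_topology p) T \<and> x \<in> T \<and> T \<subseteq> {x. \<phi> x \<in> U}" if "\<phi> x \<in> U" for x
  proof -
    obtain e where e: "e > 0" "ball (\<phi> x) e \<subseteq> U" using U \<open>\<phi> x \<in> U\<close> by (metis open_openin openE)
    let ?r = "e / (\<bar>C\<bar> + 1)"
    have r: "?r > 0" using e by simp
    have "\<phi> y \<in> U" if "p a (y - x) < ?r" for y
    proof -
      have "cmod (\<phi> y - \<phi> x) \<le> C * p a (y - x)" using le[of "y - x"] by (simp add: linear_functional[OF lin])
      also have "\<dots> \<le> (\<bar>C\<bar> + 1) * p a (y - x)" by (intro mult_right_mono) auto
      also have "\<dots> < e" using that by (simp add: field_simps)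
      finally show ?thesis using e by (auto simp: dist_norm norm_minus_commute)
    qed
    then show ?thesis using openin_seminorm_ballI[OF r, of a x] r
      by (intro exI[of _ "{y. p a (y - x) < ?r}"]) auto
  qed
  then show "openin (seminorm_topology p) {x \<in> topspace (seminorm_topology p). \<phi> x \<in> U}"
    by (subst openin_subopen) auto
qed auto

lemma polar_dual: "\<phi> \<in> polar a \<Longrightarrow> dual \<phi>"
  by (rule dualI[of _ 1 a]) (auto simp: polar_def)

lemma dual_linear:
  assumes "dual \<phi>"
  shows "\<phi> (x + y) = \<phi> x + \<phi> y" "\<phi> (x - y) = \<phi> x - \<phi> y" "\<phi> 0 = 0" "\<phi> (- x) = - \<phi> x"
    "\<phi> (sc c x) = c * \<phi> x" "\<phi> (sum f A) = (\<Sum>i\<in>A. \<phi> (f i))"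
  using linear_functional[of \<phi>] assms by (auto simp: continuous_functional_def)

text \<open>By Hahn-Banach every \<open>p a (x - y)\<close> is attained by a functional, so a
  difference killed by the dual has all seminorms zero.\<close>

lemma dual_eqI:
  assumes "\<And>\<phi>. dual \<phi> \<Longrightarrow> \<phi> x = \<phi> y"
  shows "x = y"
proof -
  have "p a (x - y) \<le> 0" for a
    by (rule seminorm_le_polar) (use assms polar_dual dual_linear(2) in \<open>metis norm_zero order_refl
      right_minus_eq\<close>)
  then have "x - y = 0" by (intro seminorms_separate) (simp add: antisym)
  then show ?thesis by simp
qed

lemma dual_tendsto:
  assumes "dual \<phi>" "\<And>a. ((\<lambda>n. p a (x n - l)) \<longlongrightarrow> 0) F"
  shows "((\<lambda>n. \<phi> (x n)) \<longlongrightarrow> \<phi> l) F"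
proof -
  obtain a C where C: "\<And>x. cmod (\<phi> x) \<le> C * p a x" using dual_bounded[OF assms(1)] by metis
  have "((\<lambda>n. C * p a (x n - l)) \<longlongrightarrow> 0) F" using tendsto_mult_left_zero[OF assms(2)] by (simp add: mult.commute)
  then have "((\<lambda>n. \<phi> (x n - l)) \<longlongrightarrow> 0) F"
    by (rule Lim_null_comparison[rotated]) (simp add: C)
  then show ?thesis using Lim_null dual_linear(2)[OF assms(1)] by force
qed

text \<open>Uniformity over each polar upgrades scalar Cauchy estimates to Cauchy estimates in the
  seminorms. This is the device that produces vectors: difference quotients, Riemann sums, truncated
  Laplace and Borel integrals and the approximants of the entire part all obtain their limits
  here.\<close>

lemma weak_complete:
  assumes "\<And>a e. 0 < e \<Longrightarrow> \<exists>N. \<forall>m\<ge>N. \<forall>n\<ge>N. \<forall>\<phi>\<in>polar a. cmod (\<phi> (x m) - \<phi> (x n)) \<le> e"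
  obtains l where "\<And>\<phi>. dual \<phi> \<Longrightarrow> (\<lambda>n. \<phi> (x n)) \<longlonglongrightarrow> \<phi> l" "\<And>a. (\<lambda>n. p a (x n - l)) \<longlonglongrightarrow> 0"
proof -
  have "\<exists>N. \<forall>m\<ge>N. \<forall>n\<ge>N. p a (x m - x n) \<le> e" if "0 < e" for a e
    using assms[OF that, of a] by (metis dual_linear(2) polar_dual seminorm_le_polar)
  then obtain l where "\<And>a. (\<lambda>n. p a (x n - l)) \<longlonglongrightarrow> 0" using seminorm_complete by blast
  then show ?thesis using that dual_tendsto by blast
qed

end

section \<open>Vector-valued holomorphic functions and line integrals\<close>

text \<open>Taylor's formula of order 1. On the half ball the Cauchy estimate on discs of radius
  \<open>r / 4\<close> bounds the second derivative by
  \<open>2 * B / (r / 4)^2 = 32 * B / r^2\<close>. The constant depends on \<open>u\<close> only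
  through \<open>B\<close>, which makes the estimate uniform over a polar.\<close>

lemma quotient_remainder_bound:
  fixes u :: "complex \<Rightarrow> complex"
  assumes hol: "u holomorphic_on ball z r" and "0 < r" and B: "\<And>w. w \<in> ball z r \<Longrightarrow> cmod (u w) \<le> B"
    and w: "w \<in> ball z (r / 2)" "w \<noteq> z"
  shows "cmod ((u w - u z) / (w - z) - deriv u z) \<le> 32 * B / r\<^sup>2 * cmod (w - z)"
proof -
  have d2: "cmod ((deriv ^^ 2) u x) \<le> 32 * B / r\<^sup>2" if "x \<in> ball z (r/2)" for x
  proof -
    have sub: "cball x (r/4) \<subseteq> ball z r"
      using that \<open>0 < r\<close> by (intro cball_subset_ball_iff[THEN iffD2]) (auto simp: dist_commute)
    have "cmod ((deriv ^^ 2) u x) \<le> fact 2 * B / (r/4)^2"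
    proof (rule Cauchy_inequality)
      show "u holomorphic_on ball x (r/4)"
        by (rule holomorphic_on_subset[OF hol]) (use sub ball_subset_cball in blast)
      show "continuous_on (cball x (r/4)) u"
        by (rule continuous_on_subset[OF holomorphic_on_imp_continuous_on[OF hol] sub])
      show "cmod (u y) \<le> B" if "cmod (x - y) = r/4" for y
        by (rule B) (use sub that in \<open>auto simp: dist_norm subset_iff\<close>)
    qed (use \<open>0 < r\<close> in auto)
    then show ?thesis by (simp add: power_divide)
  qed
  have "cmod ((deriv ^^ 0) u w - (\<Sum>i\<le>1. (deriv ^^ i) u z * (w - z) ^ i / fact i))
     \<le> 32 * B / r\<^sup>2 * cmod (w - z) ^ Suc 1 / fact 1"
  proof (rule complex_Taylor[of "ball z (r/2)"])
    fix i x assume x: "x \<in> ball z (r/2)"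
    have "(deriv ^^ i) u holomorphic_on ball z r" by (rule holomorphic_higher_deriv[OF hol]) simp
    moreover have "x \<in> ball z r" using x \<open>0 < r\<close> by auto
    ultimately have "((deriv ^^ i) u has_field_derivative deriv ((deriv ^^ i) u) x) (at x)"
      by (rule holomorphic_derivI[OF _ open_ball])
    then show "((deriv ^^ i) u has_field_derivative (deriv ^^ Suc i) u x) (at x within ball z (r/2))"
      unfolding funpow.simps o_apply by (rule has_field_derivative_at_within)
  next
    show "cmod ((deriv ^^ Suc 1) u x) \<le> 32 * B / r\<^sup>2" if "x \<in> ball z (r/2)" for x
      using d2[OF that] by (simp only: Suc_1)
    show "convex (ball z (r/2))" "w \<in> ball z (r/2)" "z \<in> ball z (r/2)"
      using w \<open>0 < r\<close> by auto
  qed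
  then have "cmod (u w - u z - deriv u z * (w - z)) \<le> 32 * B / r\<^sup>2 * cmod (w - z) ^ 2"
    by (simp add: numeral_2_eq_2 algebra_simps)
  moreover have "u w - u z - deriv u z * (w - z) = ((u w - u z) / (w - z) - deriv u z) * (w - z)"
    using w by (simp add: field_simps)
  ultimately have "cmod ((u w - u z) / (w - z) - deriv u z) * cmod (w - z)
    \<le> (32 * B / r\<^sup>2 * cmod (w - z)) * cmod (w - z)"
    by (simp only: norm_mult power2_eq_square mult.assoc)
  then show ?thesis using w by (metis mult_le_cancel_right norm_ge_zero norm_le_zero_iff not_le right_minus_eq)
qed

text \<open>The error depends on \<open>u\<close> only through its modulus of continuity at scale
  \<open>1 / n\<close>, so it is uniform over all functionals of a polar. The induction runs over
  the initial segments up to \<open>k / n\<close>.\<close>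

lemma Riemann_sum_bound:
  fixes u :: "real \<Rightarrow> complex"
  assumes cont: "continuous_on {0..1} u" and "0 < n"
    and e: "\<And>s t. s \<in> {0..1} \<Longrightarrow> t \<in> {0..1} \<Longrightarrow> \<bar>s - t\<bar> \<le> 1 / real n \<Longrightarrow> cmod (u s - u t) \<le> e"
  shows "cmod (integral {0..1} u - (\<Sum>i<n. u (real i / real n) / of_nat n)) \<le> e"
proof -
  have "k \<le> n \<Longrightarrow> cmod (integral {0..real k / real n} u - (\<Sum>i<k. u (real i / real n) / of_nat n))
      \<le> e * (real k / real n)" for k
  proof (induction k)
    case (Suc k)
    let ?a = "real k / real n" and ?b = "real (Suc k) / real n"
    have ab: "0 \<le> ?a" "?a \<le> ?b" "?b \<le> 1" "?b - ?a = 1 / real n"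
      using Suc.prems \<open>0 < n\<close> by (auto simp: field_simps)
    have int: "u integrable_on {c..d}" if "0 \<le> c" "d \<le> 1" for c d
      by (rule integrable_continuous_interval) (rule continuous_on_subset[OF cont], use that in auto)
    have split: "integral {0..?b} u = integral {0..?a} u + integral {?a..?b} u"
      by (subst Henstock_Kurzweil_Integration.integral_combine) (use ab int in auto)
    have "integral {?a..?b} u - u ?a / of_nat n = integral {?a..?b} (\<lambda>t. u t - u ?a)"
    proof -
      have "integral {?a..?b} (\<lambda>t. u t - u ?a) = integral {?a..?b} u - integral {?a..?b} (\<lambda>t. u ?a)"
        by (rule integral_diff) (use ab int in auto)
      moreover have "integral {?a..?b} (\<lambda>t. u ?a) = u ?a / of_nat n"
        using ab by (simp add: scaleR_conv_of_real divide_inverse mult.commute)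
      ultimately show ?thesis by simp
    qed
    also have "cmod \<dots> \<le> e * (?b - ?a)"
    proof (rule integral_bound)
      show "continuous_on {?a..?b} (\<lambda>t. u t - u ?a)"
        by (intro continuous_intros continuous_on_subset[OF cont]) (use ab in auto)
      show "cmod (u t - u ?a) \<le> e" if "t \<in> {?a..?b}" for t
        by (rule e) (use that ab(3,4) order_trans[OF ab(1), of t] in \<open>auto simp: ab(1)\<close>)
    qed (use ab in auto)
    finally have "cmod (integral {?a..?b} u - u ?a / of_nat n) \<le> e * (1 / real n)" unfolding ab(4) .
    moreover have "cmod (integral {0..?a} u - (\<Sum>i<k. u (real i / real n) / of_nat n)) \<le> e * ?a"
      using Suc by simp
    ultimately have "cmod ((integral {0..?a} u - (\<Sum>i<k. u (real i / real n) / of_nat n)) +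
        (integral {?a..?b} u - u ?a / of_nat n)) \<le> e * ?a + e * (1 / real n)"
      by (intro norm_triangle_mono)
    also have "e * ?a + e * (1 / real n) = e * ?b" using \<open>0 < n\<close> by (simp add: field_simps)
    finally show ?case unfolding split by (simp add: algebra_simps)
  qed simp
  from this[of n] show ?thesis using \<open>0 < n\<close> by simp
qed

lemma continuous_on_linepath_comp:
  assumes "continuous_on (closed_segment a b) g"
  shows "continuous_on {0..1} (\<lambda>t. g (linepath a b t))"
  by (rule continuous_on_compose2[OF assms]) (auto intro!: continuous_intros simp: linepath_in_path)

lemma contour_integral_linepath_eq:
  "contour_integral (linepath a b) F = integral {0..1} (\<lambda>t. F (linepath a b t)) * (b - a)"
  by (simp add: contour_integral_integral)

section \<open>Continuity and weak holomorphy of \<open>E\<close>-valued functions\<close>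

context frechet
begin

definition econt :: "complex set \<Rightarrow> (complex \<Rightarrow> 'e) \<Rightarrow> bool" where
  "econt S Q \<longleftrightarrow> (\<forall>a. \<forall>w\<in>S. ((\<lambda>v. p a (Q v - Q w)) \<longlongrightarrow> 0) (at w within S))"

lemma econt_subset: "econt S Q \<Longrightarrow> T \<subseteq> S \<Longrightarrow> econt T Q"
  unfolding econt_def by (meson subsetD tendsto_within_subset)

lemma econt_seminorm_continuous:
  assumes "econt S Q"
  shows "continuous_on S (\<lambda>w. p a (Q w))"
  unfolding continuous_on_def
proof
  fix w assume "w \<in> S"
  then have "((\<lambda>v. p a (Q v - Q w)) \<longlongrightarrow> 0) (at w within S)" using assms by (auto simp: econt_def)
  then have "((\<lambda>v. p a (Q v) - p a (Q w)) \<longlongrightarrow> 0) (at w within S)"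
    by (rule Lim_null_comparison[rotated]) (simp add: p_rev_triangle)
  then show "((\<lambda>v. p a (Q v)) \<longlongrightarrow> p a (Q w)) (at w within S)" by (simp add: Lim_null[symmetric])
qed

lemma econt_dual_continuous:
  assumes "econt S Q" "dual \<phi>"
  shows "continuous_on S (\<lambda>w. \<phi> (Q w))"
  unfolding continuous_on_def
proof
  fix w assume "w \<in> S"
  then show "((\<lambda>v. \<phi> (Q v)) \<longlongrightarrow> \<phi> (Q w)) (at w within S)"
    using assms(1) by (intro dual_tendsto[OF assms(2)]) (auto simp: econt_def)
qed

lemma econt_bounded:
  assumes "econt S Q" "compact S"
  obtains B where "B \<ge> 0" "\<And>w. w \<in> S \<Longrightarrow> p a (Q w) \<le> B"
proof -
  have "bounded ((\<lambda>w. p a (Q w)) ` S)"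
    using assms by (intro compact_imp_bounded compact_continuous_image econt_seminorm_continuous)
  then obtain B where "\<forall>x\<in>(\<lambda>w. p a (Q w)) ` S. norm x \<le> B" unfolding bounded_iff by blast
  then show ?thesis using that[of "max B 0"] by force
qed

lemma econt_scale:
  assumes K: "continuous_on S K" and Q: "econt S Q"
  shows "econt S (\<lambda>w. sc (K w) (Q w))"
  unfolding econt_def
proof (intro allI ballI)
  fix a w assume w: "w \<in> S"
  have 1: "((\<lambda>v. cmod (K v) * p a (Q v - Q w) + cmod (K v - K w) * p a (Q w)) \<longlongrightarrow>
     cmod (K w) * 0 + cmod (K w - K w) * p a (Q w)) (at w within S)"
    using w K Q by (intro tendsto_intros) (auto simp: continuous_on_def econt_def)
  have "p a (sc (K v) (Q v) - sc (K w) (Q w)) \<le> cmod (K v) * p a (Q v - Q w) + cmod (K v - K w) * p a (Q w)" for v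
  proof -
    have "sc (K v) (Q v) - sc (K w) (Q w) = sc (K v) (Q v - Q w) + sc (K v - K w) (Q w)"
      by (simp add: scale_right_diff_distrib scale_left_diff_distrib)
    then show ?thesis
      using p_add[of a "sc (K v) (Q v - Q w)" "sc (K v - K w) (Q w)"] by (simp add: p_scale)
  qed
  then show "((\<lambda>v. p a (sc (K v) (Q v) - sc (K w) (Q w))) \<longlongrightarrow> 0) (at w within S)"
    using 1 by (intro Lim_null_comparison[OF _ 1[simplified]]) auto
qed

lemma holo_limit:
  assumes "f \<in> holo sc p \<Omega>" "z \<in> \<Omega>"
  obtains d where "\<And>a. ((\<lambda>w. p a (sc (inverse (w - z)) (f w - f z) - d)) \<longlongrightarrow> 0) (at z)"
  using assms by (auto simp: holo_def limitin_seminorm_iff)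

text \<open>\<open>f w - f z\<close> is \<open>w - z\<close> times a difference quotient, and the
  quotient stays bounded near \<open>z\<close> in every seminorm.\<close>

lemma holo_econt:
  assumes f: "f \<in> holo sc p \<Omega>"
  shows "econt \<Omega> f"
  unfolding econt_def
proof (intro allI ballI)
  fix a z assume "z \<in> \<Omega>"
  then obtain d where d: "\<And>a. ((\<lambda>w. p a (sc (inverse (w - z)) (f w - f z) - d)) \<longlongrightarrow> 0) (at z)"
    using holo_limit[OF f] by metis
  have 1: "((\<lambda>w. cmod (w - z) * (p a (sc (inverse (w - z)) (f w - f z) - d) + p a d)) \<longlongrightarrow>
     cmod (z - z) * (0 + p a d)) (at z)"
    by (intro tendsto_intros d)
  have "((\<lambda>w. p a (f w - f z)) \<longlongrightarrow> 0) (at z)"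
  proof (rule Lim_null_comparison)
    show "eventually (\<lambda>w. norm (p a (f w - f z)) \<le>
       cmod (w - z) * (p a (sc (inverse (w - z)) (f w - f z) - d) + p a d)) (at z)"
      unfolding eventually_at_filter
    proof (intro always_eventually allI impI)
      fix w assume "w \<noteq> z"
      then have "p a (f w - f z) = cmod (w - z) * p a (sc (inverse (w - z)) (f w - f z))"
        by (simp add: p_scale norm_inverse)
      also have "\<dots> \<le> cmod (w - z) * (p a (sc (inverse (w - z)) (f w - f z) - d) + p a d)"
        using p_add[of a "sc (inverse (w - z)) (f w - f z) - d" d] by (intro mult_left_mono) auto
      finally show "norm (p a (f w - f z)) \<le>
         cmod (w - z) * (p a (sc (inverse (w - z)) (f w - f z) - d) + p a d)" by simp
    qed
  qed (use 1 in simp)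
  then show "((\<lambda>w. p a (f w - f z)) \<longlongrightarrow> 0) (at z within \<Omega>)"
    by (rule tendsto_within_subset) simp
qed

lemma holo_dual_holomorphic:
  assumes f: "f \<in> holo sc p \<Omega>" and \<phi>: "dual \<phi>"
  shows "(\<lambda>z. \<phi> (f z)) holomorphic_on \<Omega>"
  unfolding holomorphic_on_def
proof
  fix z assume "z \<in> \<Omega>"
  then obtain d where d: "\<And>a. ((\<lambda>w. p a (sc (inverse (w - z)) (f w - f z) - d)) \<longlongrightarrow> 0) (at z)"
    using holo_limit[OF f] by metis
  have "((\<lambda>w. \<phi> (sc (inverse (w - z)) (f w - f z))) \<longlongrightarrow> \<phi> d) (at z)"
    by (rule dual_tendsto[OF \<phi> d])
  then have "((\<lambda>z. \<phi> (f z)) has_field_derivative \<phi> d) (at z)"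
    by (simp add: has_field_derivative_iff dual_linear[OF \<phi>] divide_inverse mult.commute)
  then show "(\<lambda>z. \<phi> (f z)) field_differentiable at z within \<Omega>"
    using field_differentiable_at_within field_differentiable_def by blast
qed

text \<open>Local boundedness makes the error of the scalar difference quotients linear in
  \<open>w - z\<close>, uniformly over the polar of each seminorm. The quotients are then Cauchy in
  every seminorm, so completeness supplies a vector-valued derivative.\<close>

lemma holoI_weak:
  assumes restr: "restr \<Omega> f = f" and "open \<Omega>"
    and hol: "\<And>\<phi>. dual \<phi> \<Longrightarrow> (\<lambda>z. \<phi> (f z)) holomorphic_on \<Omega>"
    and bdd: "\<And>a z. z \<in> \<Omega> \<Longrightarrow> \<exists>r>0. \<exists>B. \<forall>w\<in>ball z r. w \<in> \<Omega> \<longrightarrow> p a (f w) \<le> B"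
  shows "f \<in> holo sc p \<Omega>"
  unfolding holo_def
proof (intro CollectI conjI ballI restr)
  fix z assume z: "z \<in> \<Omega>"
  let ?q = "\<lambda>w. sc (inverse (w - z)) (f w - f z)"
  have est: "\<exists>r>0. \<exists>M\<ge>0. \<forall>w\<in>ball z r - {z}. \<forall>\<phi>\<in>polar a.
      cmod (\<phi> (?q w) - deriv (\<lambda>z. \<phi> (f z)) z) \<le> M * cmod (w - z)" for a
  proof -
    obtain r B where rB: "r > 0" "\<And>w. w \<in> ball z r \<Longrightarrow> w \<in> \<Omega> \<Longrightarrow> p a (f w) \<le> B"
      using bdd[OF z, of a] by blast
    obtain s where s: "s > 0" "ball z s \<subseteq> \<Omega>" using \<open>open \<Omega>\<close> z openE by blast
    let ?r = "min r s"
    have r0: "?r > 0" using rB s by simp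
    have B: "p a (f w) \<le> B" if "w \<in> ball z ?r" for w using rB s that by (auto simp: subset_iff)
    have "cmod (\<phi> (?q w) - deriv (\<lambda>z. \<phi> (f z)) z) \<le> 32 * B / ?r\<^sup>2 * cmod (w - z)"
      if w: "w \<in> ball z (?r/2) - {z}" and \<phi>: "\<phi> \<in> polar a" for w \<phi>
    proof -
      have "cmod ((\<phi> (f w) - \<phi> (f z)) / (w - z) - deriv (\<lambda>z. \<phi> (f z)) z) \<le> 32 * B / ?r\<^sup>2 * cmod (w - z)"
      proof (rule quotient_remainder_bound[OF _ r0])
        show "(\<lambda>z. \<phi> (f z)) holomorphic_on ball z ?r"
          by (rule holomorphic_on_subset[OF hol[OF polar_dual[OF \<phi>]]]) (use s in auto)
        show "cmod (\<phi> (f w)) \<le> B" if "w \<in> ball z ?r" for w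
          using polar_le[OF \<phi>, of "f w"] B[OF that] by simp
      qed (use w in auto)
      then show ?thesis
        by (simp add: dual_linear[OF polar_dual[OF \<phi>]] divide_inverse mult.commute)
    qed
    moreover have "0 \<le> B" using B[of z] r0 p_nonneg[of a "f z"] by (metis centre_in_ball order_trans)
    ultimately show ?thesis using r0 by (intro exI[of _ "?r/2"] conjI exI[of _ "32 * B / ?r\<^sup>2"]) auto
  qed
  \<comment> \<open>A particular sequence tending to \<open>z\<close>; it yields a candidate
    \<open>l\<close> for the derivative by sequential completeness.\<close>
  define wn where "wn n = z + of_real (inverse (Suc n))" for n
  have wn: "wn n \<noteq> z" "cmod (wn n - z) = inverse (Suc n)" for n
    by (auto simp: wn_def norm_inverse simp del: of_nat_Suc)
  have small: "\<exists>N. \<forall>n\<ge>N. M * inverse (Suc n) \<le> e \<and> inverse (Suc n) < r" if "e > 0" "r > 0" for M e r :: real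
  proof -
    have "(\<lambda>n. M * inverse (Suc n)) \<longlonglongrightarrow> M * 0" by (intro tendsto_intros LIMSEQ_inverse_real_of_nat)
    then have "eventually (\<lambda>n. M * inverse (Suc n) < e) sequentially"
      using order_tendstoD(2)[of _ 0 sequentially e] that by simp
    moreover have "eventually (\<lambda>n. inverse (real (Suc n)) < r) sequentially"
      using order_tendstoD(2)[OF LIMSEQ_inverse_real_of_nat] that by blast
    ultimately have "eventually (\<lambda>n. M * inverse (Suc n) \<le> e \<and> inverse (Suc n) < r) sequentially"
      by eventually_elim auto
    then show ?thesis by (simp add: eventually_sequentially)
  qed
  obtain l where l: "\<And>\<phi>. dual \<phi> \<Longrightarrow> (\<lambda>n. \<phi> (?q (wn n))) \<longlonglongrightarrow> \<phi> l"
  proof (rule weak_complete[of "\<lambda>n. ?q (wn n)"])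
    fix a and e :: real assume "0 < e"
    obtain r M where rM: "r > 0" "M \<ge> 0" "\<And>w \<phi>. w \<in> ball z r - {z} \<Longrightarrow> \<phi> \<in> polar a \<Longrightarrow>
      cmod (\<phi> (?q w) - deriv (\<lambda>z. \<phi> (f z)) z) \<le> M * cmod (w - z)" using est[of a] by blast
    obtain N where N: "\<And>n. n \<ge> N \<Longrightarrow> M * inverse (Suc n) \<le> e/2 \<and> inverse (Suc n) < r"
      using small[of "e/2" r M] \<open>0 < e\<close> rM by auto
    have "cmod (\<phi> (?q (wn n)) - deriv (\<lambda>z. \<phi> (f z)) z) \<le> e/2" if "n \<ge> N" "\<phi> \<in> polar a" for n \<phi>
      using rM(3)[of "wn n" \<phi>] N[OF that(1)] wn[of n] that by (simp add: dist_norm norm_minus_commute)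
    then have "cmod (\<phi> (?q (wn m)) - \<phi> (?q (wn n))) \<le> e" if "m \<ge> N" "n \<ge> N" "\<phi> \<in> polar a" for m n \<phi>
      using that by (smt (verit) norm_triangle_ineq4 diff_diff_eq2 diff_add_cancel field_sum_of_halves
        norm_minus_commute norm_diff_triangle_ineq norm_triangle_sub norm_diff_triangle_le)
    then show "\<exists>N. \<forall>m\<ge>N. \<forall>n\<ge>N. \<forall>\<phi>\<in>polar a. cmod (\<phi> (?q (wn m)) - \<phi> (?q (wn n))) \<le> e" by blast
  qed blast
  have "((\<lambda>w. p a (?q w - l)) \<longlongrightarrow> 0) (at z)" for a
  proof -
    obtain r M where rM: "r > 0" "M \<ge> 0" "\<And>w \<phi>. w \<in> ball z r - {z} \<Longrightarrow> \<phi> \<in> polar a \<Longrightarrow>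
      cmod (\<phi> (?q w) - deriv (\<lambda>z. \<phi> (f z)) z) \<le> M * cmod (w - z)" using est[of a] by blast
    have ld: "\<phi> l = deriv (\<lambda>z. \<phi> (f z)) z" if "\<phi> \<in> polar a" for \<phi>
    proof -
      have "(\<lambda>n. \<phi> (?q (wn n)) - deriv (\<lambda>z. \<phi> (f z)) z) \<longlonglongrightarrow> 0"
      proof (rule Lim_null_comparison)
        obtain N where N: "\<And>n. n \<ge> N \<Longrightarrow> M * inverse (Suc n) \<le> 1 \<and> inverse (Suc n) < r"
          using small[of 1 r M] rM by auto
        show "eventually (\<lambda>n. cmod (\<phi> (?q (wn n)) - deriv (\<lambda>z. \<phi> (f z)) z) \<le> M * inverse (Suc n)) sequentially"
          using rM(3)[of "wn _" \<phi>] N wn that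
          by (intro eventually_sequentiallyI[of N]) (simp add: dist_norm norm_minus_commute)
        show "(\<lambda>n. M * inverse (Suc n)) \<longlonglongrightarrow> 0"
          using tendsto_mult_left[OF LIMSEQ_inverse_real_of_nat, of M] by simp
      qed
      then have "(\<lambda>n. \<phi> (?q (wn n))) \<longlonglongrightarrow> deriv (\<lambda>z. \<phi> (f z)) z" by (simp add: Lim_null[symmetric])
      then show ?thesis using l[OF polar_dual[OF that]] LIMSEQ_unique by blast
    qed
    \<comment> \<open>As \<open>\<phi> l\<close> is the scalar derivative for every
      \<open>\<phi>\<close> in the polar, the estimate holds for all \<open>w\<close> near
      \<open>z\<close> and not only along \<open>wn\<close>.\<close>
    have 1: "p a (?q w - l) \<le> M * cmod (w - z)" if "w \<in> ball z r - {z}" for w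
      using rM(3)[OF that] ld by (intro seminorm_le_polar) (simp add: dual_linear(2)[OF polar_dual])
    have 2: "((\<lambda>w. M * cmod (w - z)) \<longlongrightarrow> M * cmod (z - z)) (at z)" by (intro tendsto_intros)
    show ?thesis
    proof (rule Lim_null_comparison)
      show "eventually (\<lambda>w. norm (p a (?q w - l)) \<le> M * cmod (w - z)) (at z)"
        unfolding eventually_at using 1 rM(1) by (auto simp: dist_commute)
    qed (use 2 in simp)
  qed
  then show "\<exists>d. limitin (seminorm_topology p) ?q d (at z)" by (auto simp: limitin_seminorm_iff)
qed

section \<open>Line integrals with values in \<open>E\<close>\<close>

definition lineint :: "complex \<Rightarrow> complex \<Rightarrow> (complex \<Rightarrow> 'e) \<Rightarrow> 'e" where
  "lineint a b Q = (SOME e. \<forall>\<phi>. dual \<phi> \<longrightarrow> \<phi> e = contour_integral (linepath a b) (\<lambda>w. \<phi> (Q w)))"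

text \<open>Equidistant Riemann sums converge at a rate that is uniform over functionals bounded by
  \<open>C * p a\<close>, because the rate comes from the uniform continuity of \<open>Q\<close> in
  \<open>p a\<close>.\<close>

lemma lineint_exists:
  assumes Q: "econt (closed_segment u v) Q"
  shows "\<exists>e. \<forall>\<phi>. dual \<phi> \<longrightarrow> \<phi> e = contour_integral (linepath u v) (\<lambda>w. \<phi> (Q w))"
proof -
  define x where "x n = (\<Sum>i<Suc n. sc (of_real (inverse (Suc n))) (Q (linepath u v (real i / real (Suc
    n)))))" for n
  have R: "\<phi> (x n) = (\<Sum>i<Suc n. \<phi> (Q (linepath u v (real i / real (Suc n)))) / of_nat (Suc n))" if "dual \<phi>"
    for \<phi> n
    unfolding x_def by (simp add: dual_linear[OF that] divide_inverse mult.commute del: of_nat_Suc)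
  have est: "\<exists>N. \<forall>n\<ge>N. \<forall>\<phi>. dual \<phi> \<and> (\<forall>x. cmod (\<phi> x) \<le> C * p a x) \<longrightarrow>
     cmod (integral {0..1} (\<lambda>t. \<phi> (Q (linepath u v t))) - \<phi> (x n)) \<le> e" if "e > 0" "C > 0" for a e C
  proof -
    \<comment> \<open>\<open>P (s, t)\<close> measures the oscillation of \<open>Q\<close>. It is
      continuous on the unit square and zero on the diagonal, so comparing \<open>(s, t)\<close>
      with \<open>(t, t)\<close> gives a modulus of continuity of \<open>Q\<close> in
      \<open>p a\<close>.\<close>
    define P where "P z = p a (Q (linepath u v (fst z)) - Q (linepath u v (snd z)))" for z :: "real \<times> real"
    have cP: "continuous_on ({0..1} \<times> {0..1}) P"
      unfolding continuous_on_def
    proof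
      fix z :: "real \<times> real" assume z: "z \<in> {0..1} \<times> {0..1}"
      let ?F = "at z within {0..1} \<times> {0..1}"
      have lim: "((\<lambda>y. p a (Q (linepath u v (h y)) - Q (linepath u v (h z)))) \<longlongrightarrow> 0) ?F"
        if h: "continuous_on ({0..1} \<times> {0..1}) h" "h ` ({0..1} \<times> {0..1}) \<subseteq> {0..1}" for h :: "real \<times> real \<Rightarrow> real"
      proof -
        have "continuous_on (closed_segment u v) (\<lambda>w. p a (Q w - Q (linepath u v (h z))))"
        proof -
          have "econt (closed_segment u v) (\<lambda>w. Q w - Q (linepath u v (h z)))"
            using Q unfolding econt_def by simp
          then show ?thesis by (rule econt_seminorm_continuous)
        qed
        then have "continuous_on ({0..1} \<times> {0..1}) (\<lambda>y. p a (Q (linepath u v (h y)) - Q (linepath u v (h z))))"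
          by (rule continuous_on_compose2)
            (use h in \<open>auto simp: linepath_def intro!: continuous_intros linepath_in_path[unfolded linepath_def]\<close>)
        then show ?thesis using z unfolding continuous_on_def by force
      qed
      have "((\<lambda>y. P y - P z) \<longlongrightarrow> 0) ?F"
      proof (rule Lim_null_comparison)
        show "eventually (\<lambda>y. norm (P y - P z) \<le> p a (Q (linepath u v (fst y)) - Q (linepath u v (fst z)))
            + p a (Q (linepath u v (snd y)) - Q (linepath u v (snd z)))) ?F"
        proof (intro always_eventually allI)
          fix y
          let ?A = "\<lambda>t. Q (linepath u v t)"
          have "\<bar>P y - P z\<bar> \<le> p a ((?A (fst y) - ?A (snd y)) - (?A (fst z) - ?A (snd z)))"
            unfolding P_def by (rule p_rev_triangle)
          also have "(?A (fst y) - ?A (snd y)) - (?A (fst z) - ?A (snd z)) =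
             (?A (fst y) - ?A (fst z)) - (?A (snd y) - ?A (snd z))" by simp
          also have "p a \<dots> \<le> p a (?A (fst y) - ?A (fst z)) + p a (?A (snd y) - ?A (snd z))" by (rule p_diff)
          finally show "norm (P y - P z) \<le> p a (?A (fst y) - ?A (fst z)) + p a (?A (snd y) - ?A (snd z))" by simp
        qed
        show "((\<lambda>y. p a (Q (linepath u v (fst y)) - Q (linepath u v (fst z))) +
           p a (Q (linepath u v (snd y)) - Q (linepath u v (snd z)))) \<longlongrightarrow> 0) ?F"
          using tendsto_add[OF lim[of fst] lim[of snd]] by (force intro: continuous_intros)
      qed
      then show "(P \<longlongrightarrow> P z) ?F" by (simp add: Lim_null[symmetric])
    qed
    have "uniformly_continuous_on ({0..1} \<times> {0..1}) P"
      by (intro compact_uniformly_continuous cP compact_Times) auto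
    then obtain d where d: "d > 0" "\<And>y z. y \<in> {0..1} \<times> {0..1} \<Longrightarrow> z \<in> {0..1} \<times> {0..1} \<Longrightarrow> dist z y < d
      \<Longrightarrow> dist (P z) (P y) < e / C"
      unfolding uniformly_continuous_on_def using \<open>e > 0\<close> \<open>C > 0\<close> by (metis divide_pos_pos)
    obtain N where N: "inverse (real (Suc N)) < d" using reals_Archimedean d(1) by blast
    have "cmod (integral {0..1} (\<lambda>t. \<phi> (Q (linepath u v t))) - \<phi> (x n)) \<le> e"
      if "n \<ge> N" and \<phi>: "dual \<phi>" "\<And>x. cmod (\<phi> x) \<le> C * p a x" for n \<phi>
      unfolding R[OF \<phi>(1)]
    proof (rule Riemann_sum_bound)
      show "continuous_on {0..1} (\<lambda>t. \<phi> (Q (linepath u v t)))"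
        by (rule continuous_on_linepath_comp) (rule econt_dual_continuous[OF Q \<phi>(1)])
      fix s t :: real assume st: "s \<in> {0..1}" "t \<in> {0..1}" "\<bar>s - t\<bar> \<le> 1 / real (Suc n)"
      have "1 / real (Suc n) \<le> inverse (real (Suc N))" using \<open>n \<ge> N\<close> by (simp add: divide_simps)
      then have "dist (s, t) (t, t) < d" using st(3) N by (simp add: dist_Pair_Pair dist_real_def)
      then have "dist (P (s, t)) (P (t, t)) < e / C" using d(2)[of "(t,t)" "(s,t)"] st by auto
      then have "p a (Q (linepath u v s) - Q (linepath u v t)) < e / C" by (simp add: P_def)
      then have "C * p a (Q (linepath u v s) - Q (linepath u v t)) < e" using \<open>C > 0\<close> by (simp add: field_simps)
      then show "cmod (\<phi> (Q (linepath u v s)) - \<phi> (Q (linepath u v t))) \<le> e"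
        using \<phi>(2)[of "Q (linepath u v s) - Q (linepath u v t)"] by (simp add: dual_linear[OF \<phi>(1)])
    qed simp
    then show ?thesis by blast
  qed
  obtain l where l: "\<And>\<phi>. dual \<phi> \<Longrightarrow> (\<lambda>n. \<phi> (x n)) \<longlonglongrightarrow> \<phi> l"
  proof (rule weak_complete[of x])
    fix a and e :: real assume "0 < e"
    then obtain N where "\<forall>n\<ge>N. \<forall>\<phi>. dual \<phi> \<and> (\<forall>x. cmod (\<phi> x) \<le> 1 * p a x) \<longrightarrow>
      cmod (integral {0..1} (\<lambda>t. \<phi> (Q (linepath u v t))) - \<phi> (x n)) \<le> e/2"
      using est[of "e/2" 1 a] by auto
    then have N: "\<And>n \<phi>. n \<ge> N \<Longrightarrow> \<phi> \<in> polar a \<Longrightarrow>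
      cmod (integral {0..1} (\<lambda>t. \<phi> (Q (linepath u v t))) - \<phi> (x n)) \<le> e/2"
      by (simp add: polar_dual polar_le)
    have "cmod (\<phi> (x m) - \<phi> (x n)) \<le> e" if "m \<ge> N" "n \<ge> N" "\<phi> \<in> polar a" for m n \<phi>
    proof -
      let ?I = "integral {0..1} (\<lambda>t. \<phi> (Q (linepath u v t)))"
      have "cmod ((?I - \<phi> (x n)) - (?I - \<phi> (x m))) \<le> e/2 + e/2"
        using N[OF that(1,3)] N[OF that(2,3)] norm_triangle_ineq4[of "?I - \<phi> (x n)" "?I - \<phi> (x m)"] by linarith
      then show ?thesis by simp
    qed
    then show "\<exists>N. \<forall>m\<ge>N. \<forall>n\<ge>N. \<forall>\<phi>\<in>polar a. cmod (\<phi> (x m) - \<phi> (x n)) \<le> e" by blast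
  qed blast
  \<comment> \<open>The sums \<open>x n\<close> approximate the integral over the parameter
    interval; the speed \<open>v - u\<close> of the segment is supplied here.\<close>
  have "\<phi> (sc (v - u) l) = contour_integral (linepath u v) (\<lambda>w. \<phi> (Q w))" if \<phi>: "dual \<phi>" for \<phi>
  proof -
    obtain a C where C: "C > 0" "\<And>x. cmod (\<phi> x) \<le> C * p a x" using dual_bounded[OF \<phi>] by metis
    have "(\<lambda>n. \<phi> (x n)) \<longlonglongrightarrow> integral {0..1} (\<lambda>t. \<phi> (Q (linepath u v t)))"
      unfolding LIMSEQ_iff
    proof (intro allI impI)
      fix e :: real assume "e > 0"
      then obtain N where "\<And>n. n \<ge> N \<Longrightarrow> cmod (integral {0..1} (\<lambda>t. \<phi> (Q (linepath u v t))) - \<phi> (x n)) \<le> e/2"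
        using est[of "e/2" C a] C \<phi> by auto
      then show "\<exists>N. \<forall>n\<ge>N. cmod (\<phi> (x n) - integral {0..1} (\<lambda>t. \<phi> (Q (linepath u v t)))) < e"
        using \<open>e > 0\<close> by (intro exI[of _ N]) (force simp: norm_minus_commute)
    qed
    then have "\<phi> l = integral {0..1} (\<lambda>t. \<phi> (Q (linepath u v t)))" using l[OF \<phi>] LIMSEQ_unique by blast
    then show ?thesis by (simp add: dual_linear[OF \<phi>] contour_integral_linepath_eq mult.commute)
  qed
  then show ?thesis by blast
qed

lemma dual_lineint:
  assumes "econt (closed_segment u v) Q" "dual \<phi>"
  shows "\<phi> (lineint u v Q) = contour_integral (linepath u v) (\<lambda>w. \<phi> (Q w))"
  using someI_ex[OF lineint_exists[OF assms(1)]] assms(2) unfolding lineint_def by blast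

end

section \<open>Pushing poles to infinity\<close>

text \<open>Expansion of \<open>1 / (z - w)\<close> in powers of
  \<open>q = (w - b) / (z - b)\<close>, where \<open>\<bar>q\<bar> \<le> 1/2\<close>; the remainder
  is exactly \<open>q^K / (z - w)\<close>, and \<open>\<bar>z - w\<bar> \<ge> r / 2\<close>.\<close>

lemma geometric_pole:
  fixes w z b :: complex
  assumes "0 < r" "cmod (w - b) \<le> r / 2" "r \<le> cmod (z - b)"
  shows "cmod (1 / (z - w) - (\<Sum>k<K. (w - b) ^ k / (z - b) ^ Suc k)) \<le> 2 / r * (1/2) ^ K"
proof -
  define q where "q = (w - b) / (z - b)"
  have zb: "z \<noteq> b" using assms by auto
  have q: "cmod q \<le> 1/2"
  proof -
    have "cmod (w - b) \<le> 1/2 * cmod (z - b)" using assms by simp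
    then show ?thesis using zb by (simp add: q_def norm_divide divide_simps)
  qed
  then have q1: "q \<noteq> 1" by auto
  have zw: "z - w = (z - b) * (1 - q)" using zb by (simp add: q_def field_simps)
  have "(\<Sum>k<K. (w - b) ^ k / (z - b) ^ Suc k) = (1 / (z - b)) * (\<Sum>k<K. q ^ k)"
    by (simp add: q_def sum_distrib_left power_divide)
  also have "\<dots> = (1 / (z - b)) * ((1 - q ^ K) / (1 - q))"
    using sum_gp_strict[of q K] q1 by simp
  finally have sum: "(\<Sum>k<K. (w - b) ^ k / (z - b) ^ Suc k) = (1 - q ^ K) / (z - w)"
    unfolding zw by simp
  have "1 / (z - w) - (\<Sum>k<K. (w - b) ^ k / (z - b) ^ Suc k) = 1 / (z - w) * q ^ K"
    unfolding sum by (simp add: diff_divide_distrib)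
  moreover have "cmod (1 / (z - w)) \<le> 2 / r"
  proof -
    have "r / 2 \<le> cmod (z - w)" using assms norm_triangle_ineq[of "z - w" "w - b"] by simp
    then show ?thesis using assms(1) by (simp add: norm_divide divide_simps)
  qed
  moreover have "cmod (q ^ K) \<le> (1/2) ^ K" unfolding norm_power by (rule power_mono[OF q]) simp
  ultimately show ?thesis using assms(1) by (simp only: norm_mult) (intro mult_mono, auto)
qed

text \<open>Induction along Horner's scheme: \<open>1 / (z - b)\<close> is replaced by a partial sum
  of its geometric series, a polynomial in \<open>1 / (z - b')\<close>. Whole polynomials have to be
  moved, since each step of a chain starts from the result of the previous one.\<close>

lemma push_pole_step:
  fixes P :: "complex poly"
  assumes "0 < r" "cmod (b - b') \<le> r / 2" "0 < e"
  shows "\<exists>P'. \<forall>z. r \<le> cmod (z - b') \<longrightarrow> cmod (poly P (1 / (z - b)) - poly P' (1 / (z - b'))) \<le> e"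
  using \<open>0 < e\<close>
proof (induction P arbitrary: e)
  case 0
  then show ?case by (intro exI[of _ 0]) simp
next
  case (pCons a Q)
  \<comment> \<open>Half of the error budget, divided by the bound \<open>2 / r\<close> of
    \<open>1 / (z - b)\<close>. The other half covers the truncation of the series after
    \<open>K\<close> terms, multiplied by the bound \<open>B\<close> of \<open>Q'\<close>.\<close>
  define e1 where "e1 = e / 2 * (r / 2)"
  have "e1 > 0" using pCons.prems assms by (simp add: e1_def)
  then obtain Q' where Q': "\<And>z. r \<le> cmod (z - b') \<Longrightarrow> cmod (poly Q (1 / (z - b)) - poly Q' (1 / (z - b'))) \<le> e1"
    using pCons.IH by blast
  have "bounded (poly Q' ` cball 0 (1 / r))"
    by (intro compact_imp_bounded compact_continuous_image continuous_intros compact_cball)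
  then obtain B where "B > 0" "\<forall>x\<in>cball 0 (1 / r). cmod (poly Q' x) \<le> B"
    unfolding bounded_pos by auto
  then have B: "\<And>x. cmod x \<le> 1 / r \<Longrightarrow> cmod (poly Q' x) \<le> B" "B > 0" by simp_all
  obtain K where K: "(1/2) ^ K < e / 2 / B / (2 / r)"
    using real_arch_pow_inv[of "e / 2 / B / (2 / r)" "1/2"] pCons.prems B assms by auto
  define X where "X = (\<Sum>k<K. monom ((b - b') ^ k) (Suc k))"
  have X: "poly X (1 / (z - b')) = (\<Sum>k<K. (b - b') ^ k / (z - b') ^ Suc k)" for z
    by (simp add: X_def poly_sum poly_monom power_divide)
  have "cmod (poly (pCons a Q) (1 / (z - b)) - poly ([:a:] + X * Q') (1 / (z - b'))) \<le> e"
    if z: "r \<le> cmod (z - b')" for z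
  proof -
    let ?x = "1 / (z - b)" and ?y = "1 / (z - b')"
    have "poly (pCons a Q) ?x - poly ([:a:] + X * Q') ?y =
       ?x * (poly Q ?x - poly Q' ?y) + (?x - poly X ?y) * poly Q' ?y" by (simp add: algebra_simps)
    also have "cmod \<dots> \<le> 2 / r * e1 + (2 / r * (1/2) ^ K) * B"
    proof (intro norm_triangle_mono; unfold norm_mult; intro mult_mono)
      show "cmod ?x \<le> 2 / r"
        using geometric_pole[OF assms(1,2) z, of 0] by simp
      show "cmod (?x - poly X ?y) \<le> 2 / r * (1/2) ^ K"
        unfolding X using geometric_pole[OF assms(1,2) z] .
      show "cmod (poly Q' ?y) \<le> B"
        by (rule B) (use z assms(1) in \<open>auto simp: norm_divide divide_simps\<close>)
      show "0 \<le> 2 / r * (1 / 2) ^ K" using assms(1) by simp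
    qed (use Q'[OF z] assms(1) in auto)
    also have "2 / r * e1 = e / 2" using assms(1) by (simp add: e1_def)
    also have "(2 / r * (1/2) ^ K) * B \<le> e / 2" using K assms(1) B(2) by (simp add: field_simps)
    finally show ?thesis by simp
  qed
  then show ?case by blast
qed

text \<open>The discs with centres \<open>b m\<close> and radii \<open>\<rho> m\<close> lead to
  infinity. The factor 1/2 in \<open>step\<close> is that of \<open>geometric_pole\<close>: the old
  centre lies in the inner half of the next disc.\<close>

locale pole_chain =
  fixes b :: "nat \<Rightarrow> complex" and \<rho> :: "nat \<Rightarrow> real"
  assumes rho_pos: "0 < \<rho> m"
    and step: "cmod (b m - b (Suc m)) \<le> \<rho> (Suc m) / 2"
    and escape: "\<exists>M. \<forall>m\<ge>M. R + \<rho> m \<le> cmod (b m)"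
begin

text \<open>The pole is moved along the chain with errors \<open>e / 2^(n+1)\<close>, whose sum is
  \<open>e\<close>. Every ball about 0 meets only finitely many discs, so there all but finitely
  many approximants are holomorphic and converge uniformly; hence the limit is entire.\<close>

lemma push_pole_to_infinity:
  fixes P :: "complex poly"
  assumes "0 < e"
  shows "\<exists>t. t holomorphic_on UNIV \<and>
    (\<forall>z. (\<forall>m>j. \<rho> m \<le> cmod (z - b m)) \<longrightarrow> cmod (poly P (1 / (z - b j)) - t z) \<le> e)"
proof -
  have "\<exists>Ps. \<forall>n. (n = 0 \<longrightarrow> Ps n = P) \<and> (\<forall>z. \<rho> (j + Suc n) \<le> cmod (z - b (j + Suc n)) \<longrightarrow>
    cmod (poly (Ps n) (1 / (z - b (j + n))) - poly (Ps (Suc n)) (1 / (z - b (j + Suc n)))) \<le> e / 2 ^ Suc n)"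
  proof (rule dependent_nat_choice)
    fix Q :: "complex poly" and n
    show "\<exists>y. (Suc n = 0 \<longrightarrow> y = P) \<and> (\<forall>z. \<rho> (j + Suc n) \<le> cmod (z - b (j + Suc n)) \<longrightarrow>
      cmod (poly Q (1 / (z - b (j + n))) - poly y (1 / (z - b (j + Suc n)))) \<le> e / 2 ^ Suc n)"
      using push_pole_step[of "\<rho> (j + Suc n)" "b (j + n)" "b (j + Suc n)" "e / 2 ^ Suc n" Q]
        rho_pos step[of "j + n"] assms by auto
  qed auto
  then obtain Ps where Ps: "Ps 0 = P" "\<And>n z. \<rho> (j + Suc n) \<le> cmod (z - b (j + Suc n)) \<Longrightarrow>
    cmod (poly (Ps n) (1 / (z - b (j + n))) - poly (Ps (Suc n)) (1 / (z - b (j + Suc n)))) \<le> e / 2 ^ Suc n"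
    by blast
  define u where "u n z = poly (Ps n) (1 / (z - b (j + n)))" for n z
  \<comment> \<open>The points outside the discs after index \<open>j + i\<close>; there all steps
    from the \<open>i\<close>-th approximant on are controlled.\<close>
  define far where "far i z \<longleftrightarrow> (\<forall>m>j + i. \<rho> m \<le> cmod (z - b m))" for i z
  have tele: "cmod (u i z - u (i + n) z) \<le> e / 2 ^ i - e / 2 ^ (i + n)" if "far i z" for i n z
  proof (induction n)
    case (Suc n)
    have "cmod (u (i + n) z - u (i + Suc n) z) \<le> e / 2 ^ Suc (i + n)"
      using Ps(2)[of "i + n" z] that unfolding far_def u_def by simp
    then have "cmod ((u i z - u (i + n) z) + (u (i + n) z - u (i + Suc n) z))
       \<le> (e / 2 ^ i - e / 2 ^ (i + n)) + e / 2 ^ Suc (i + n)"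
      using Suc by (intro norm_triangle_mono)
    then show ?case by (simp add: field_simps)
  qed simp
  have tele': "cmod (u i z - u n z) \<le> e / 2 ^ i" if "far i z" "n \<ge> i" for i n z
    using tele[OF that(1), of "n - i"] that(2) assms
    by (simp, smt (verit) divide_nonneg_nonneg zero_le_power)
  have pow0: "\<exists>i. e / 2 ^ i < d" if "d > 0" for d
  proof -
    have "0 < d / e" using that assms by simp
    then obtain i where "(1/2) ^ i < d / e" using real_arch_pow_inv[of "d / e" "1/2"] by auto
    then show ?thesis using assms by (auto simp: field_simps intro!: exI[of _ i])
  qed
  have conv: "convergent (\<lambda>n. u n z)" if "far i z" for i z
    unfolding Cauchy_convergent_iff[symmetric]
  proof (rule CauchyI)
    fix d :: real assume "d > 0"
    then obtain k where k: "e / 2 ^ k < d / 2" using pow0[of "d/2"] by auto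
    define N where "N = max i k"
    have fN: "far N z" using that unfolding far_def N_def by auto
    have le: "e / 2 ^ N \<le> e / 2 ^ k" using assms unfolding N_def by (simp add: frac_le)
    have N: "cmod (u N z - u n z) < d / 2" if "n \<ge> N" for n using tele'[OF fN that] le k by linarith
    have "cmod (u m z - u n z) < d" if "m \<ge> N" "n \<ge> N" for m n
      using N[OF that(1)] N[OF that(2)] dist_triangle_half_r[of "u N z" "u m z" d "u n z"]
        by (simp add: dist_norm)
    then show "\<exists>M. \<forall>m\<ge>M. \<forall>n\<ge>M. norm (u m z - u n z) < d" by blast
  qed
  define t where "t z = lim (\<lambda>n. u n z)" for z
  have ut: "cmod (u i z - t z) \<le> e / 2 ^ i" if "far i z" for i z
  proof (rule tendsto_upperbound)
    show "((\<lambda>n. cmod (u i z - u n z)) \<longlongrightarrow> cmod (u i z - t z)) sequentially"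
      unfolding t_def using conv[OF that] by (intro tendsto_intros) (simp add: convergent_LIMSEQ_iff)
    show "eventually (\<lambda>n. cmod (u i z - u n z) \<le> e / 2 ^ i) sequentially"
      using tele'[OF that] by (rule eventually_sequentiallyI)
  qed simp
  have "t holomorphic_on ball 0 R" for R
  proof -
    obtain M where M: "\<And>m. m \<ge> M \<Longrightarrow> R + \<rho> m \<le> cmod (b m)" using escape by blast
    have dist: "\<rho> m \<le> cmod (z - b m)" if "z \<in> ball 0 R" "m \<ge> M" for z m
      using M[OF that(2)] that(1) norm_triangle_ineq2[of "b m" z] by (simp add: norm_minus_commute)
    have far: "far i z" if "z \<in> ball 0 R" "i \<ge> M" for i z
      using dist[OF that(1)] that(2) unfolding far_def by auto
    show ?thesis
    proof (rule holomorphic_uniform_sequence[of _ "\<lambda>n. u (M + n)"])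
      show "u (M + n) holomorphic_on ball 0 R" for n
        unfolding u_def
        by (intro holomorphic_intros) (use dist[of _ "j + (M + n)"] rho_pos[of "j + (M + n)"] in force)
      have "uniform_limit (ball 0 R) (\<lambda>n. u (M + n)) t sequentially"
        unfolding uniform_limit_iff
      proof (intro allI impI)
        fix d :: real assume "d > 0"
        then obtain k where k: "e / 2 ^ k < d" using pow0 by auto
        have "dist (u (M + n) z) (t z) < d" if "z \<in> ball 0 R" "n \<ge> k" for n z
        proof -
          have "dist (u (M + n) z) (t z) \<le> e / 2 ^ (M + n)"
            using ut[OF far[OF that(1)], of "M + n"] by (simp add: dist_norm)
          also have "\<dots> \<le> e / 2 ^ k" using assms that(2) by (simp add: frac_le)
          finally show ?thesis using k by simp
        qed
        then show "\<forall>\<^sub>F n in sequentially. \<forall>z\<in>ball 0 R. dist (u (M + n) z) (t z) < d"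
          by (intro eventually_sequentiallyI[of k]) blast
      qed
      then show "\<exists>d>0. cball x d \<subseteq> ball 0 R \<and> uniform_limit (cball x d) (\<lambda>n. u (M + n)) t sequentially"
        if "x \<in> ball 0 R" for x
        using that open_contains_cball[of "ball 0 R"] open_ball uniform_limit_on_subset by metis
    qed simp
  qed
  then have "t field_differentiable at z" for z
    using holomorphic_on_imp_differentiable_at[of t "ball 0 (cmod z + 1)" z] by simp
  then have "t holomorphic_on UNIV"
    by (simp add: holomorphic_on_def field_differentiable_at_within)
  moreover have "cmod (poly P (1 / (z - b j)) - t z) \<le> e" if "\<forall>m>j. \<rho> m \<le> cmod (z - b m)" for z
    using ut[of 0 z] that by (simp add: far_def u_def Ps(1))
  ultimately show ?thesis by blast
qed

text \<open>The truncated geometric series about \<open>b j\<close> is a polynomial in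
  \<open>w\<close> with coefficients \<open>1 / (z - b j)^(k+1)\<close>; replacing each coefficient
  by an entire function \<open>t k\<close> makes the kernel entire in \<open>z\<close>. The overall
  sign comes from \<open>1 / (w - z) = - (1 / (z - w))\<close>.\<close>

lemma small_Cauchy_kernel:
  assumes "0 < e"
  obtains E E' :: "complex \<Rightarrow> complex \<Rightarrow> complex"
  where "\<And>z w. ((\<lambda>z. E z w) has_field_derivative E' z w) (at z)"
    "continuous_on UNIV (\<lambda>(z, w). E' z w)" "continuous_on UNIV (\<lambda>(z, w). E z w)"
    "\<And>w z. cmod (w - b j) \<le> \<rho> j / 2 \<Longrightarrow> (\<And>m. m \<ge> j \<Longrightarrow> \<rho> m \<le> cmod (z - b m)) \<Longrightarrow>
       cmod (1 / (w - z) - E z w) \<le> e"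
proof -
  have rj: "\<rho> j > 0" by (rule rho_pos)
  obtain K where K: "(1/2) ^ K < e / 2 / (2 / \<rho> j)"
    using real_arch_pow_inv[of "e / 2 / (2 / \<rho> j)" "1/2"] rj assms by auto
  \<comment> \<open>\<open>S\<close> bounds the sum of the weights
    \<open>\<bar>w - b j\<bar>^k\<close>; the summand 1 keeps it positive when
    \<open>K = 0\<close>.\<close>
  define S where "S = (\<Sum>k<K. (\<rho> j / 2) ^ k) + 1"
  have S: "S > 0" unfolding S_def using rj by (intro add_nonneg_pos sum_nonneg) auto
  define e1 where "e1 = e / 2 / S"
  have e1: "e1 > 0" using assms S by (simp add: e1_def)
  have "\<forall>k. \<exists>t. t holomorphic_on UNIV \<and> (\<forall>z. (\<forall>m>j. \<rho> m \<le> cmod (z - b m)) \<longrightarrow>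
     cmod (poly (monom 1 (Suc k)) (1 / (z - b j)) - t z) \<le> e1)"
    using push_pole_to_infinity[OF e1] by blast
  then obtain t where t: "\<And>k. t k holomorphic_on UNIV" "\<And>k z. (\<And>m. m > j \<Longrightarrow> \<rho> m \<le> cmod (z - b m)) \<Longrightarrow>
     cmod (poly (monom 1 (Suc k)) (1 / (z - b j)) - t k z) \<le> e1"
    by metis
  define E where "E z w = - (\<Sum>k<K. (w - b j) ^ k * t k z)" for z w
  define E' where "E' z w = - (\<Sum>k<K. (w - b j) ^ k * deriv (t k) z)" for z w
  show ?thesis
  proof (rule that[of E E'])
    show "((\<lambda>z. E z w) has_field_derivative E' z w) (at z)" for z w
      unfolding E_def E'_def
      by (intro DERIV_minus DERIV_sum DERIV_cmult holomorphic_derivI[OF t(1) open_UNIV UNIV_I])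
    have "continuous_on UNIV (deriv (t k))" for k
      by (intro holomorphic_on_imp_continuous_on holomorphic_deriv t) simp
    then have "continuous_on UNIV (\<lambda>x. deriv (t k) (fst x))" for k
      by (rule continuous_on_compose2) (auto intro: continuous_intros)
    then show "continuous_on UNIV (\<lambda>(z, w). E' z w)"
      unfolding E'_def split_beta by (intro continuous_intros)
    have "continuous_on UNIV (\<lambda>x. t k (fst x))" for k
      by (rule continuous_on_compose2[OF holomorphic_on_imp_continuous_on[OF t(1)]])
        (auto intro: continuous_intros)
    then show "continuous_on UNIV (\<lambda>(z, w). E z w)"
      unfolding E_def split_beta by (intro continuous_intros)
    fix w z assume w: "cmod (w - b j) \<le> \<rho> j / 2" and z: "\<And>m. m \<ge> j \<Longrightarrow> \<rho> m \<le> cmod (z - b m)"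
    let ?s = "\<Sum>k<K. (w - b j) ^ k / (z - b j) ^ Suc k"
    have "1 / (w - z) = - (1 / (z - w))" using minus_divide_right[of 1 "z - w"] by simp
    then have "1 / (w - z) - E z w = - ((1 / (z - w) - ?s) + (?s + E z w))" by algebra
    then have "cmod (1 / (w - z) - E z w) = cmod ((1 / (z - w) - ?s) + (?s + E z w))"
      by (simp only: norm_minus_cancel)
    also have "\<dots> \<le> 2 / \<rho> j * (1/2) ^ K + (\<Sum>k<K. (\<rho> j / 2) ^ k * e1)"
    proof (rule norm_triangle_mono)
      show "cmod (1 / (z - w) - ?s) \<le> 2 / \<rho> j * (1/2) ^ K" by (rule geometric_pole[OF rj w z[OF order_refl]])
      have "?s + E z w = (\<Sum>k<K. (w - b j) ^ k * (poly (monom 1 (Suc k)) (1 / (z - b j)) - t k z))"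
        unfolding E_def by (simp add: sum_subtractf poly_monom power_divide algebra_simps)
      also have "cmod \<dots> \<le> (\<Sum>k<K. (\<rho> j / 2) ^ k * e1)"
      proof (intro sum_norm_le)
        fix k
        have "cmod (w - b j) ^ k \<le> (\<rho> j / 2) ^ k" by (rule power_mono[OF w]) simp
        then show "cmod ((w - b j) ^ k * (poly (monom 1 (Suc k)) (1 / (z - b j)) - t k z)) \<le> (\<rho> j / 2) ^ k * e1"
          using t(2)[of z k] z rj e1 unfolding norm_mult norm_power by (intro mult_mono) auto
      qed
      finally show "cmod (?s + E z w) \<le> (\<Sum>k<K. (\<rho> j / 2) ^ k * e1)" .
    qed
    also have "2 / \<rho> j * (1/2) ^ K \<le> e / 2" using K rj by (simp add: field_simps)
    also have "(\<Sum>k<K. (\<rho> j / 2) ^ k * e1) \<le> S * e1"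
      unfolding S_def sum_distrib_right[symmetric] using e1 by (intro mult_right_mono) auto
    also have "S * e1 = e / 2" using S by (simp add: e1_def)
    finally show "cmod (1 / (w - z) - E z w) \<le> e" by simp
  qed
qed

end

lemma contour_integral_linepath_has_field_derivative:
  fixes F :: "complex \<Rightarrow> complex"
  assumes F: "continuous_on (closed_segment u v) F" and "open \<Omega>" "z \<in> \<Omega>"
    and K: "\<And>z w. z \<in> \<Omega> \<Longrightarrow> w \<in> closed_segment u v \<Longrightarrow> ((\<lambda>z. K z w) has_field_derivative K' z w) (at z)"
    and cK: "\<And>z. z \<in> \<Omega> \<Longrightarrow> continuous_on (closed_segment u v) (K z)"
    and cK': "continuous_on (\<Omega> \<times> closed_segment u v) (\<lambda>(z, w). K' z w)"
  shows "((\<lambda>z. contour_integral (linepath u v) (\<lambda>w. F w * K z w)) has_field_derivative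
     contour_integral (linepath u v) (\<lambda>w. F w * K' z w)) (at z)"
proof -
  obtain r where r: "r > 0" "ball z r \<subseteq> \<Omega>" using assms(2,3) openE by blast
  have lp: "linepath u v t \<in> closed_segment u v" if "t \<in> {0..1}" for t
    using that by (simp add: linepath_in_path)
  have "((\<lambda>z. integral (cbox 0 1) (\<lambda>t. F (linepath u v t) * K z (linepath u v t))) has_field_derivative
     integral (cbox 0 1) (\<lambda>t. F (linepath u v t) * K' z (linepath u v t))) (at z within ball z r)"
  proof (rule leibniz_rule_field_derivative[where U = "ball z r"])
    show "((\<lambda>x. F (linepath u v t) * K x (linepath u v t)) has_field_derivative
        F (linepath u v t) * K' x (linepath u v t)) (at x within ball z r)"
      if "x \<in> ball z r" "t \<in> cbox 0 1" for x t
      by (intro DERIV_cmult has_field_derivative_at_within[OF K]) (use r that lp in auto)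
    show "(\<lambda>t. F (linepath u v t) * K x (linepath u v t)) integrable_on cbox 0 1" if "x \<in> ball z r" for x
      unfolding cbox_interval
      by (intro integrable_continuous_interval continuous_intros continuous_on_linepath_comp F cK)
        (use r that in auto)
    have "continuous_on (ball z r \<times> {0..1}) (\<lambda>x. F (linepath u v (snd x)))"
      by (rule continuous_on_compose2[OF F]) (auto simp: linepath_def intro!: continuous_intros lp[unfolded
        linepath_def])
    moreover have "continuous_on (ball z r \<times> {0..1}) (\<lambda>x. K' (fst x) (linepath u v (snd x)))"
      using continuous_on_compose2[OF cK', of "ball z r \<times> {0..1}" "\<lambda>x. (fst x, linepath u v (snd x))"] r lp
      by (force simp: linepath_def intro!: continuous_intros)
    ultimately show "continuous_on (ball z r \<times> cbox 0 1) (\<lambda>(x, t). F (linepath u v t) * K' x (linepath u v t))"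
      unfolding split_beta cbox_interval by (rule continuous_on_mult)
  qed (use r in auto)
  then have "((\<lambda>z. integral {0..1} (\<lambda>t. F (linepath u v t) * K z (linepath u v t))) has_field_derivative
     integral {0..1} (\<lambda>t. F (linepath u v t) * K' z (linepath u v t))) (at z)"
    using r by (simp add: at_within_open[of z "ball z r"])
  then show ?thesis unfolding contour_integral_linepath_eq by (rule DERIV_cmult_right)
qed

section \<open>Cauchy integrals along a contour narrowing to the half-line\<close>

lemma finite_part_half_line [simp]: "z \<in> finite_part {0..\<infinity>} \<longleftrightarrow> Im z = 0 \<and> 0 \<le> Re z"
  unfolding finite_part_def by (auto simp: image_iff complex_eq_iff intro!: exI[of _ "Re z"])

lemma slit_plane_iff: "z \<in> slit_plane \<longleftrightarrow> Im z \<noteq> 0 \<or> Re z < 0"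
  by auto

lemma half_line_neq_inf [simp]: "{0..\<infinity>} \<noteq> {\<infinity>::ereal}"
proof
  assume eq: "{0..\<infinity>} = {\<infinity>::ereal}"
  have "(0::ereal) \<in> {0..\<infinity>}" by simp
  then show False unfolding eq by simp
qed

lemma finite_part_inf [simp]: "finite_part {\<infinity>} = {}"
  by (simp add: finite_part_def)

lemma open_slit_plane: "open slit_plane"
proof -
  have "slit_plane = {z. Im z \<noteq> 0} \<union> {z. Re z < 0}" by (auto simp: slit_plane_iff)
  moreover have "open {z. Im z \<noteq> 0}" by (intro open_Collect_neq continuous_intros)
  ultimately show ?thesis by (simp add: open_Un open_halfspace_Re_lt)
qed

lemma slit_plane_segment:
  assumes "u < 0" "z \<in> slit_plane"
  shows "closed_segment (of_real u) z \<subseteq> slit_plane"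
proof
  fix x assume "x \<in> closed_segment (of_real u) z"
  then obtain t where t: "0 \<le> t" "t \<le> 1" "x = (1 - t) *\<^sub>R of_real u + t *\<^sub>R z" by (auto simp: in_segment)
  show "x \<in> slit_plane"
  proof (cases "t = 0")
    case True
    then show ?thesis using t assms by (simp add: slit_plane_iff)
  next
    case False
    have "(1 - t) * u + t * Re z < 0" if "Re z < 0"
    proof -
      have "(1 - t) * u \<le> 0" using t assms by (simp add: mult_nonneg_nonpos)
      moreover have "t * Re z < 0" using False t that by (simp add: mult_pos_neg)
      ultimately show ?thesis by simp
    qed
    then show ?thesis using assms False t by (auto simp: slit_plane_iff)
  qed
qed

lemma starlike_slit_plane: "starlike slit_plane"
  unfolding starlike_def using slit_plane_segment[of "-1"]
  by (intro bexI[of _ "of_real (-1)"]) (auto simp: slit_plane_iff)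

text \<open>The slit plane is starlike about -1. Integrals of holomorphic functions along chains in
  it become differences of a primitive, which replaces deformations of contours in the slit
  plane.\<close>

lemma slit_plane_primitive:
  assumes "q holomorphic_on slit_plane"
  obtains P where "\<And>z. z \<in> slit_plane \<Longrightarrow> (P has_field_derivative q z) (at z)"
  using holomorphic_starlike_primitive[of slit_plane q "{}"] assms starlike_slit_plane open_slit_plane
  by (metis Diff_empty finite.emptyI holomorphic_on_imp_continuous_on holomorphic_on_imp_differentiable_at)

section \<open>Integration along chains of oriented segments\<close>

definition eimg :: "(complex \<times> complex) list \<Rightarrow> complex set" where
  "eimg es = (\<Union>(u, v)\<in>set es. closed_segment u v)"

definition elen :: "(complex \<times> complex) list \<Rightarrow> real" where
  "elen es = (\<Sum>(u, v)\<leftarrow>es. cmod (v - u))"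

definition esum :: "(complex \<times> complex) list \<Rightarrow> (complex \<Rightarrow> complex) \<Rightarrow> complex" where
  "esum es f = (\<Sum>(u, v)\<leftarrow>es. contour_integral (linepath u v) f)"

lemma eimg_simps [simp]: "eimg [] = {}" "eimg ((u, v) # es) = closed_segment u v \<union> eimg es"
  by (auto simp: eimg_def)

lemma esum_simps [simp]: "esum [] f = 0"
  "esum ((u, v) # es) f = contour_integral (linepath u v) f + esum es f"
  by (auto simp: esum_def)

lemma elen_simps [simp]: "elen [] = 0" "elen ((u, v) # es) = cmod (v - u) + elen es"
  by (auto simp: elen_def)

lemma compact_eimg: "compact (eimg es)"
  unfolding eimg_def by (auto intro!: compact_UN)

lemma elen_nonneg: "0 \<le> elen es"
  by (induction es) auto

lemma esum_bound:
  assumes "continuous_on (eimg es) f" "0 \<le> B" "\<And>w. w \<in> eimg es \<Longrightarrow> cmod (f w) \<le> B"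
  shows "cmod (esum es f) \<le> B * elen es"
  using assms
proof (induction es)
  case (Cons e es)
  obtain u v where e: "e = (u, v)" by (cases e)
  have c: "continuous_on (closed_segment u v) f" "continuous_on (eimg es) f"
    using Cons.prems(1) by (auto simp: e intro: continuous_on_subset)
  have "cmod (contour_integral (linepath u v) f) \<le> B * cmod (v - u)"
    by (rule contour_integral_bound_linepath)
      (use Cons.prems c in \<open>auto simp: e intro: contour_integrable_continuous_linepath\<close>)
  moreover have "cmod (esum es f) \<le> B * elen es" using Cons c by (auto simp: e)
  ultimately have "cmod (contour_integral (linepath u v) f + esum es f) \<le> B * cmod (v - u) + B * elen es"
    by (rule norm_triangle_mono)
  then show ?case by (simp add: e distrib_left)
qed simp

lemma esum_add:
  assumes "continuous_on (eimg es) f" "continuous_on (eimg es) g"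
  shows "esum es (\<lambda>w. f w + g w) = esum es f + esum es g"
  using assms
proof (induction es)
  case (Cons e es)
  obtain u v where e: "e = (u, v)" by (cases e)
  have c: "continuous_on (closed_segment u v) f" "continuous_on (eimg es) f"
    "continuous_on (closed_segment u v) g" "continuous_on (eimg es) g"
    using Cons.prems by (auto simp: e intro: continuous_on_subset)
  then show ?case using Cons.IH
    by (simp add: e contour_integral_add contour_integrable_continuous_linepath)
qed simp

lemma esum_cmult: "continuous_on (eimg es) f \<Longrightarrow> esum es (\<lambda>w. c * f w) = c * esum es f"
proof (induction es)
  case (Cons e es)
  obtain u v where e: "e = (u, v)" by (cases e)
  have c: "continuous_on (closed_segment u v) f" "continuous_on (eimg es) f"
    using Cons.prems by (auto simp: e intro: continuous_on_subset)
  then show ?case using Cons.IH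
    by (simp add: e distrib_left contour_integral_lmul contour_integrable_continuous_linepath)
qed simp

lemma esum_cong: "(\<And>w. w \<in> eimg es \<Longrightarrow> f w = g w) \<Longrightarrow> esum es f = esum es g"
proof (induction es)
  case (Cons e es)
  obtain u v where e: "e = (u, v)" by (cases e)
  have "contour_integral (linepath u v) f = contour_integral (linepath u v) g"
    by (rule contour_integral_eq) (use Cons.prems e in auto)
  then show ?case using Cons by (simp add: e)
qed simp

lemma esum_diff:
  assumes "continuous_on (eimg es) f" "continuous_on (eimg es) g"
  shows "esum es (\<lambda>w. f w - g w) = esum es f - esum es g"
proof -
  have "continuous_on (eimg es) (\<lambda>w. -1 * g w)" using assms by (intro continuous_intros)
  then have "esum es (\<lambda>w. f w + -1 * g w) = esum es f + -1 * esum es g"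
    using esum_add[OF assms(1)] esum_cmult[OF assms(2), of "-1"] by metis
  then show ?thesis by simp
qed

lemma contour_integral_linepath_primitive:
  assumes "\<And>w. w \<in> closed_segment u v \<Longrightarrow> (P has_field_derivative f w) (at w)"
  shows "contour_integral (linepath u v) f = P v - P u"
proof -
  have "(f has_contour_integral (P (pathfinish (linepath u v)) - P (pathstart (linepath u v)))) (linepath u v)"
    by (rule contour_integral_primitive[of "closed_segment u v"])
      (use assms in \<open>auto intro: has_field_derivative_at_within\<close>)
  then show ?thesis by (simp add: contour_integral_unique)
qed

lemma esum_primitive:
  assumes "\<And>w. w \<in> eimg es \<Longrightarrow> (P has_field_derivative f w) (at w)"
  shows "esum es f = (\<Sum>(u, v)\<leftarrow>es. P v - P u)"
  using assms
proof (induction es)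
  case (Cons e es)
  obtain u v where e: "e = (u, v)" by (cases e)
  show ?case using Cons contour_integral_linepath_primitive[of u v P f] by (simp add: e)
qed simp

lemma esum_has_field_derivative:
  assumes F: "continuous_on (eimg es) F" and "open \<Omega>" "z \<in> \<Omega>"
    and K: "\<And>z w. z \<in> \<Omega> \<Longrightarrow> w \<in> eimg es \<Longrightarrow> ((\<lambda>z. K z w) has_field_derivative K' z w) (at z)"
    and cK: "\<And>z. z \<in> \<Omega> \<Longrightarrow> continuous_on (eimg es) (K z)"
    and cK': "continuous_on (\<Omega> \<times> eimg es) (\<lambda>(z, w). K' z w)"
  shows "((\<lambda>z. esum es (\<lambda>w. F w * K z w)) has_field_derivative esum es (\<lambda>w. F w * K' z w)) (at z)"
  using F K cK cK'
proof (induction es)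
  case (Cons e es)
  obtain u v where e: "e = (u, v)" by (cases e)
  have sub: "closed_segment u v \<subseteq> eimg (e # es)" "eimg es \<subseteq> eimg (e # es)" by (auto simp: e)
  have 1: "((\<lambda>z. contour_integral (linepath u v) (\<lambda>w. F w * K z w)) has_field_derivative
     contour_integral (linepath u v) (\<lambda>w. F w * K' z w)) (at z)"
  proof (rule contour_integral_linepath_has_field_derivative[OF _ assms(2,3)])
    show "continuous_on (\<Omega> \<times> closed_segment u v) (\<lambda>(z, w). K' z w)"
      by (rule continuous_on_subset[OF Cons.prems(4)]) (use sub in auto)
  qed (use Cons.prems sub in \<open>blast intro: continuous_on_subset\<close>)+
  have 2: "((\<lambda>z. esum es (\<lambda>w. F w * K z w)) has_field_derivative esum es (\<lambda>w. F w * K' z w)) (at z)"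
  proof (rule Cons.IH)
    show "continuous_on (\<Omega> \<times> eimg es) (\<lambda>(z, w). K' z w)"
      by (rule continuous_on_subset[OF Cons.prems(4)]) (use sub in auto)
  qed (use Cons.prems sub in \<open>blast intro: continuous_on_subset\<close>)+
  show ?case using DERIV_add[OF 1 2] by (simp add: e)
qed simp

lemma esum_holomorphic:
  assumes "continuous_on (eimg es) F" and "open \<Omega>"
    and "\<And>z w. z \<in> \<Omega> \<Longrightarrow> w \<in> eimg es \<Longrightarrow> ((\<lambda>z. K z w) has_field_derivative K' z w) (at z)"
    and "\<And>z. z \<in> \<Omega> \<Longrightarrow> continuous_on (eimg es) (K z)"
    and "continuous_on (\<Omega> \<times> eimg es) (\<lambda>(z, w). K' z w)"
  shows "(\<lambda>z. esum es (\<lambda>w. F w * K z w)) holomorphic_on \<Omega>"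
  using esum_has_field_derivative[OF assms(1,2) _ assms(3-5)] assms(2)
  by (subst holomorphic_on_open) blast+

lemma Cauchy_kernel_derivative:
  "w \<noteq> z \<Longrightarrow> ((\<lambda>z. 1 / (w - z)) has_field_derivative 1 / (w - z)\<^sup>2) (at z)" for w z :: complex
  by (auto intro!: derivative_eq_intros simp: power2_eq_square field_simps)

lemma esum_Cauchy_holomorphic:
  assumes "continuous_on (eimg es) F" "open \<Omega>" "\<Omega> \<inter> eimg es = {}"
  shows "(\<lambda>z. esum es (\<lambda>w. F w * (1 / (w - z)))) holomorphic_on \<Omega>"
proof (rule esum_holomorphic[OF assms(1,2)])
  show "((\<lambda>z. 1 / (w - z)) has_field_derivative 1 / (w - z)\<^sup>2) (at z)" if "z \<in> \<Omega>" "w \<in> eimg es" for z w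
    using that assms(3) by (intro Cauchy_kernel_derivative) auto
  show "continuous_on (eimg es) (\<lambda>w. 1 / (w - z))" if "z \<in> \<Omega>" for z
    using that assms(3) by (intro continuous_intros) auto
  show "continuous_on (\<Omega> \<times> eimg es) (\<lambda>(z, w). 1 / (w - z)\<^sup>2)"
    unfolding split_beta using assms(3) by (intro continuous_intros) auto
qed

text \<open>\<open>cen m\<close> tends to infinity while its increments, like the heights
  \<open>hgt m\<close>, are at most \<open>1 / sqrt (m + 1)\<close>. So the \<open>m\<close>-th
  piece of the contour lies within \<open>2 / sqrt (m + 1) = rad m / 2\<close> of
  \<open>cen m\<close>, the inner half of a disc of radius \<open>rad m\<close>; the radii tend to
  0, as the strips require. Since \<open>hgt 0 = 0\<close>, the contour starts at the real point
  \<open>vtx 0 = -1\<close>.\<close>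

definition cen :: "nat \<Rightarrow> real" where "cen m = sqrt m - 1"
definition hgt :: "nat \<Rightarrow> real" where "hgt m = sqrt m / (m + 1)"
definition vtx :: "nat \<Rightarrow> complex" where "vtx m = Complex (cen m) (hgt m)"
definition rad :: "nat \<Rightarrow> real" where "rad m = 4 / sqrt (m + 1)"

text \<open>The upper segment runs to the right, its mirror image to the left. The pieces with index
  below \<open>M\<close> together with \<open>outer M\<close> form a closed contour,
  counterclockwise around the part of a square outside a tube about the half-line.\<close>

definition piece :: "nat \<Rightarrow> (complex \<times> complex) list" where
  "piece m = [(vtx m, vtx (Suc m)), (cnj (vtx (Suc m)), cnj (vtx m))]"

definition outer :: "nat \<Rightarrow> (complex \<times> complex) list" where
  "outer M = (let B = cen M in
    [(vtx M, Complex B B), (Complex B B, Complex (-B) B), (Complex (-B) B, Complex (-B) (-B)),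
     (Complex (-B) (-B), Complex B (-B)), (Complex B (-B), cnj (vtx M))])"

text \<open>A piece has \<open>\<bar>Im w\<bar> \<le> 1 / sqrt (m + 1)\<close> and
  \<open>Re w + 2 \<le> 2 * sqrt (m + 1)\<close>, which explains the bound
  \<open>2 / (Re z + 2)\<close>. This bound is convex for \<open>Re z > -2\<close>, so the upper and
  the lower part of the region are convex.\<close>

definition outer_region :: "complex set" where
  "outer_region = {z. Re z < -1} \<union> {z. Re z > -2 \<and> 2 / (Re z + 2) < \<bar>Im z\<bar>}"

section \<open>Position of the contour and of the discs\<close>

lemma sqrt_step: "sqrt (real m + 1) - sqrt m \<le> 1 / sqrt (real m + 1)" "sqrt m \<le> sqrt (real m + 1)"
proof -
  have "(sqrt (real m + 1) - sqrt m) * sqrt (real m + 1) \<le>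
      (sqrt (real m + 1) - sqrt m) * (sqrt (real m + 1) + sqrt m)"
    by (intro mult_left_mono) auto
  also have "\<dots> = 1" by (simp add: algebra_simps)
  finally show "sqrt (real m + 1) - sqrt m \<le> 1 / sqrt (real m + 1)" by (simp add: field_simps)
qed simp

lemma hgt_bounds: "0 \<le> hgt m" "hgt m \<le> 1 / sqrt (real m + 1)" "m > 0 \<Longrightarrow> 0 < hgt m"
proof -
  show "0 \<le> hgt m" "m > 0 \<Longrightarrow> 0 < hgt m" by (auto simp: hgt_def)
  have "sqrt m / (m + 1) \<le> sqrt (real m + 1) / (m + 1)" by (intro divide_right_mono) auto
  also have "\<dots> = sqrt (real m + 1) / (sqrt (real m + 1) * sqrt (real m + 1))" by simp
  also have "\<dots> = 1 / sqrt (real m + 1)" by (simp del: real_sqrt_mult_self)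
  finally show "hgt m \<le> 1 / sqrt (real m + 1)" by (simp add: hgt_def)
qed

lemma rad_bounds: "0 < rad m" "rad m \<le> 4"
  by (auto simp: rad_def field_simps)

lemma cen_mono: "m \<le> n \<Longrightarrow> cen m \<le> cen n"
  by (simp add: cen_def)

lemma cen_ge: "-1 \<le> cen m"
  by (simp add: cen_def)

lemma rad_half_antimono: "1 / sqrt (real m + 1) \<le> rad (Suc m) / 2"
proof -
  have "sqrt (real m + 2) \<le> sqrt (4 * (real m + 1))" by (rule real_sqrt_le_mono) simp
  also have "\<dots> = 2 * sqrt (real m + 1)" unfolding real_sqrt_mult by simp
  finally show ?thesis by (simp add: rad_def field_simps)
qed

lemma pole_chain_cen: "pole_chain (\<lambda>m. of_real (cen m)) rad"
proof
  show "0 < rad m" for m by (rule rad_bounds)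
  show "cmod (complex_of_real (cen m) - complex_of_real (cen (Suc m))) \<le> rad (Suc m) / 2" for m
  proof -
    have "cmod (complex_of_real (cen m) - complex_of_real (cen (Suc m))) = \<bar>cen m - cen (Suc m)\<bar>"
      by (metis norm_of_real of_real_diff)
    also have "\<dots> = sqrt (real m + 1) - sqrt m" using sqrt_step(2)[of m] by (simp add: cen_def add.commute)
    finally show ?thesis using sqrt_step(1)[of m] rad_half_antimono[of m] by simp
  qed
  show "\<exists>M. \<forall>m\<ge>M. R + rad m \<le> cmod (complex_of_real (cen m))" for R
  proof -
    \<comment> \<open>5 is the maximal radius 4 plus the shift 1 in \<open>cen\<close>.\<close>
    obtain M where M: "(\<bar>R\<bar> + 5)\<^sup>2 \<le> real M" using real_arch_simple by blast
    have "R + rad m \<le> cmod (complex_of_real (cen m))" if "m \<ge> M" for m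
    proof -
      have "\<bar>R\<bar> + 5 = sqrt ((\<bar>R\<bar> + 5)\<^sup>2)" by simp
      also have "\<dots> \<le> sqrt m" using M that by (intro real_sqrt_le_mono) linarith
      finally show ?thesis
        using rad_bounds(2)[of m] by (subst norm_of_real) (simp add: cen_def)
    qed
    then show ?thesis by blast
  qed
qed

lemma upper_piece:
  assumes "w \<in> closed_segment (vtx m) (vtx (Suc m))"
  shows "cen m \<le> Re w" "Re w \<le> cen (Suc m)" "0 \<le> Im w" "Im w \<le> 1 / sqrt (real m + 1)"
    "w \<in> slit_plane" "cmod (w - of_real (cen m)) \<le> rad m / 2"
proof -
  obtain t where t: "0 \<le> t" "t \<le> 1" "w = (1 - t) *\<^sub>R vtx m + t *\<^sub>R vtx (Suc m)"
    using assms by (auto simp: in_segment)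
  have cc: "cen m \<le> cen (Suc m)" by (rule cen_mono) simp
  have "closed_segment (vtx m) (vtx (Suc m)) \<subseteq> {w. Re w \<in> {cen m..cen (Suc m)}} \<inter> {w. Im w \<in> {0..1 / sqrt
    (real m + 1)}}"
  proof (rule closed_segment_subset)
    have "hgt (Suc m) \<le> 1 / sqrt (real m + 1)"
      using hgt_bounds(2)[of "Suc m"] by (rule order_trans) (simp add: frac_le)
    then show "vtx m \<in> {w. Re w \<in> {cen m..cen (Suc m)}} \<inter> {w. Im w \<in> {0..1 / sqrt (real m + 1)}}"
      "vtx (Suc m) \<in> {w. Re w \<in> {cen m..cen (Suc m)}} \<inter> {w. Im w \<in> {0..1 / sqrt (real m + 1)}}"
      using hgt_bounds[of m] hgt_bounds[of "Suc m"] cc by (auto simp: vtx_def)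
    show "convex ({w. Re w \<in> {cen m..cen (Suc m)}} \<inter> {w. Im w \<in> {0..1 / sqrt (real m + 1)}})"
    proof -
      have "{w. Re w \<in> {cen m..cen (Suc m)}} \<inter> {w. Im w \<in> {0..1 / sqrt (real m + 1)}} =
        cbox (Complex (cen m) 0) (Complex (cen (Suc m)) (1 / sqrt (real m + 1)))"
        by (auto simp: in_cbox_complex_iff)
      then show ?thesis by simp
    qed
  qed
  then have b: "Re w \<in> {cen m..cen (Suc m)}" "Im w \<in> {0..1 / sqrt (real m + 1)}" using assms by auto
  then show "cen m \<le> Re w" "Re w \<le> cen (Suc m)" "0 \<le> Im w" "Im w \<le> 1 / sqrt (real m + 1)" by auto
  \<comment> \<open>Only the starting point of piece 0 is real; it equals -1 and lies in the slit
    plane all the same.\<close>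
  have "Im w = (1 - t) * hgt m + t * hgt (Suc m)" by (simp add: t(3) vtx_def)
  then have "Im w > 0" if "\<not> (m = 0 \<and> t = 0)"
    using that t(1,2) hgt_bounds[of m] hgt_bounds(3)[of "Suc m"]
    by (smt (verit) mult_nonneg_nonneg mult_pos_pos not_gr_zero zero_less_Suc mult_cancel_left1)
  moreover have "Re w = -1" if "m = 0 \<and> t = 0" using that by (simp add: t(3) vtx_def cen_def)
  ultimately show "w \<in> slit_plane" by (cases "m = 0 \<and> t = 0") (auto simp: slit_plane_iff)
  have "cmod (w - of_real (cen m)) \<le> \<bar>Re (w - of_real (cen m))\<bar> + \<bar>Im (w - of_real (cen m))\<bar>" by (rule cmod_le)
  also have "\<dots> \<le> (cen (Suc m) - cen m) + 1 / sqrt (real m + 1)" using b by (intro add_mono) auto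
  also have "\<dots> \<le> 2 / sqrt (real m + 1)" using sqrt_step(1)[of m] by (simp add: cen_def add.commute)
  finally show "cmod (w - of_real (cen m)) \<le> rad m / 2" by (simp add: rad_def add.commute)
qed

lemma closed_segment_cnj: "w \<in> closed_segment (cnj a) (cnj b) \<longleftrightarrow> cnj w \<in> closed_segment a b"
proof -
  have "w = (1 - t) *\<^sub>R cnj a + t *\<^sub>R cnj b \<longleftrightarrow> cnj w = (1 - t) *\<^sub>R a + t *\<^sub>R b" for t
    by (auto simp: complex_eq_iff)
  then show ?thesis by (simp add: in_segment)
qed

lemma piece_point:
  assumes "w \<in> eimg (piece m)"
  shows "cen m \<le> Re w" "Re w \<le> cen (Suc m)" "\<bar>Im w\<bar> \<le> 1 / sqrt (real m + 1)"
    "w \<in> slit_plane" "cmod (w - of_real (cen m)) \<le> rad m / 2"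
proof -
  have "w \<in> closed_segment (vtx m) (vtx (Suc m)) \<or> cnj w \<in> closed_segment (vtx m) (vtx (Suc m))"
    using assms unfolding piece_def by (auto simp: closed_segment_cnj closed_segment_commute)
  moreover have "cmod (cnj w - of_real (cen m)) = cmod (w - of_real (cen m))"
    by (metis complex_cnj_complex_of_real complex_cnj_diff complex_mod_cnj)
  ultimately show "cen m \<le> Re w" "Re w \<le> cen (Suc m)" "\<bar>Im w\<bar> \<le> 1 / sqrt (real m + 1)"
    "w \<in> slit_plane" "cmod (w - of_real (cen m)) \<le> rad m / 2"
    using upper_piece[of w m] upper_piece[of "cnj w" m] by (auto simp: slit_plane_iff)
qed

lemma elen_piece: "elen (piece m) \<le> 8"
proof -
  have "cmod (vtx (Suc m) - vtx m) \<le> 4"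
    using upper_piece(6)[of "vtx m" m] upper_piece(6)[of "vtx (Suc m)" m] rad_bounds(2)[of m]
      norm_triangle_ineq4[of "vtx (Suc m) - of_real (cen m)" "vtx m - of_real (cen m)"] by simp
  moreover have "cmod (cnj (vtx m) - cnj (vtx (Suc m))) = cmod (vtx (Suc m) - vtx m)"
    by (metis complex_cnj_diff complex_mod_cnj norm_minus_commute)
  ultimately show ?thesis by (simp add: piece_def)
qed

lemma piece_outer_region: "outer_region \<inter> eimg (piece m) = {}"
proof -
  have False if "w \<in> eimg (piece m)" "w \<in> outer_region" for w
  proof -
    note p = piece_point[OF that(1)]
    have re: "-1 \<le> Re w" using p(1) cen_ge[of m] by linarith
    have "Re w + 2 \<le> 2 * sqrt (real m + 1)"
    proof -
      have "1 \<le> sqrt (real m + 1)" by simp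
      moreover have "cen (Suc m) = sqrt (real m + 1) - 1" by (simp add: cen_def add.commute)
      ultimately show ?thesis using p(2) by linarith
    qed
    then have "1 / sqrt (real m + 1) \<le> 2 / (Re w + 2)" using re by (simp add: field_simps)
    then show False using that(2) re p(3) unfolding outer_region_def by auto
  qed
  then show ?thesis by blast
qed

text \<open>The real point \<open>x\<close> prepares the winding computation: as
  \<open>outer M\<close> meets the real axis only to the left of \<open>x\<close>, the branch
  \<open>Ln (x - w)\<close> is available along it.\<close>

lemma outer_point:
  assumes "1 \<le> M" "0 < cen M" "w \<in> eimg (outer M)" "- cen M < x"
  shows "\<bar>Re w\<bar> = cen M \<or> \<bar>Im w\<bar> = cen M" "Im w \<noteq> 0 \<or> Re w < x" "w \<in> slit_plane"
proof -
  have h: "0 < hgt M" using hgt_bounds(3)[of M] assms(1) by simp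
  have "(\<bar>Re w\<bar> = cen M \<or> \<bar>Im w\<bar> = cen M) \<and> (Im w \<noteq> 0 \<or> Re w = - cen M)"
  proof -
    let ?B = "cen M"
    have e1: "Re w = ?B \<and> Im w > 0" if "w \<in> closed_segment (vtx M) (Complex ?B ?B)" for w
    proof -
      obtain t where t: "0 \<le> t" "t \<le> 1" "w = (1 - t) *\<^sub>R vtx M + t *\<^sub>R Complex ?B ?B"
        using \<open>w \<in> closed_segment (vtx M) (Complex ?B ?B)\<close> by (auto simp: in_segment)
      have "0 < (1 - t) * hgt M + t * ?B"
        using t h assms(2) by (cases "t = 1") (auto intro!: add_pos_nonneg)
      then show ?thesis by (simp add: t(3) vtx_def algebra_simps)
    qed
    have hor: "Im w = y" if "w \<in> closed_segment (Complex a y) (Complex b y)" for w a b y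
      using that by (clarsimp simp: in_segment) (simp add: algebra_simps)
    have ver: "Re w = a" if "w \<in> closed_segment (Complex a y) (Complex a b)" for w a b y
      using that by (clarsimp simp: in_segment) (simp add: algebra_simps)
    have B: "?B \<noteq> 0" using assms by simp
    consider "w \<in> closed_segment (vtx M) (Complex ?B ?B)" | "w \<in> closed_segment (Complex ?B ?B) (Complex
      (-?B) ?B)"
      | "w \<in> closed_segment (Complex (-?B) ?B) (Complex (-?B) (-?B))"
      | "w \<in> closed_segment (Complex (-?B) (-?B)) (Complex ?B (-?B))"
      | "w \<in> closed_segment (Complex ?B (-?B)) (cnj (vtx M))"
      using assms(3) unfolding outer_def Let_def by auto
    then show ?thesis
    proof cases
      case 1
      then show ?thesis using e1[of w] assms(2) by auto
    next
      case 2
      then show ?thesis using hor[of w] B assms(2) by auto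
    next
      case 3
      then show ?thesis using ver[of w] assms(2) by auto
    next
      case 4
      then show ?thesis using hor[of w] B assms(2) by auto
    next
      case 5
      have "Complex ?B (-?B) = cnj (Complex ?B ?B)" by (simp add: complex_eq_iff)
      then have "cnj w \<in> closed_segment (vtx M) (Complex ?B ?B)"
        using 5 by (simp add: closed_segment_cnj closed_segment_commute)
      then show ?thesis using e1[of "cnj w"] assms(2) by auto
    qed
  qed
  then show "\<bar>Re w\<bar> = cen M \<or> \<bar>Im w\<bar> = cen M" "Im w \<noteq> 0 \<or> Re w < x" "w \<in> slit_plane"
    using assms(2,4) by (auto simp: slit_plane_iff)
qed

lemma outer_slit: "1 \<le> M \<Longrightarrow> 0 < cen M \<Longrightarrow> eimg (outer M) \<subseteq> slit_plane"
  using outer_point(3)[of M _ 0] by auto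

lemma piece_slit: "eimg (piece m) \<subseteq> slit_plane"
  using piece_point(4) by blast

text \<open>The pieces telescope to the difference at \<open>vtx M\<close> and its conjugate, which
  \<open>outer M\<close> cancels; nothing remains at the other end because \<open>vtx 0\<close> is
  real.\<close>

lemma outer_pieces_primitive:
  assumes "\<And>w. w \<in> slit_plane \<Longrightarrow> (P has_field_derivative q w) (at w)" "1 \<le> M" "0 < cen M"
  shows "esum (outer M) q + (\<Sum>j<M. esum (piece j) q) = 0"
proof -
  have "esum (outer M) q = P (cnj (vtx M)) - P (vtx M)"
    by (subst esum_primitive[OF assms(1)])
      (use outer_slit[OF assms(2,3)] in blast, simp add: outer_def Let_def)
  moreover have "esum (piece j) q = (P (vtx (Suc j)) - P (cnj (vtx (Suc j)))) - (P (vtx j)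
    - P (cnj (vtx j)))" for j
    by (subst esum_primitive[OF assms(1)]) (use piece_slit in blast, simp add: piece_def)
  then have "(\<Sum>j<M. esum (piece j) q) = (P (vtx M) - P (cnj (vtx M))) - (P (vtx 0) - P (cnj (vtx 0)))"
    using sum_lessThan_telescope[of "\<lambda>j. P (vtx j) - P (cnj (vtx j))" M] by simp
  moreover have "cnj (vtx 0) = vtx 0" by (simp add: vtx_def hgt_def complex_eq_iff)
  ultimately show ?thesis by simp
qed

text \<open>Two branches of the logarithm serve as primitives: \<open>Ln (w - x)\<close> along the
  pieces, which lie to the right of \<open>x\<close>, and \<open>Ln (x - w)\<close> along
  \<open>outer M\<close>. They differ by \<open>\<i> * pi\<close> with opposite signs at the two
  common end points, and these jumps add up to \<open>2 * pi * \<i>\<close>.\<close>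

lemma outer_pieces_winding:
  assumes "1 \<le> M" "0 < cen M" "- cen M < x" "x < -1"
  shows "esum (outer M) (\<lambda>w. 1 / (w - of_real x)) + (\<Sum>j<M. esum (piece j) (\<lambda>w. 1 / (w - of_real x))) = 2 * pi * \<i>"
proof -
  define u where "u j = vtx j - of_real x" for j
  have hM: "Im (u M) > 0" using hgt_bounds(3)[of M] assms(1) by (simp add: u_def vtx_def)
  have dp: "((\<lambda>w. Ln (w - of_real x)) has_field_derivative 1 / (w - of_real x)) (at w)"
    if "w \<in> eimg (piece j)" for w j
  proof -
    have "-1 \<le> Re w" using piece_point(1)[OF that] cen_ge[of j] by linarith
    then have "w - of_real x \<notin> \<real>\<^sub>\<le>\<^sub>0" using assms(4) by (auto simp: complex_nonpos_Reals_iff)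
    then show ?thesis by (auto intro!: derivative_eq_intros simp: inverse_eq_divide)
  qed
  have do: "((\<lambda>w. Ln (of_real x - w)) has_field_derivative 1 / (w - of_real x)) (at w)"
    if "w \<in> eimg (outer M)" for w
  proof -
    have "Im w \<noteq> 0 \<or> Re w < x" using outer_point(2)[OF assms(1,2) that assms(3)] .
    then have "of_real x - w \<notin> \<real>\<^sub>\<le>\<^sub>0" "w \<noteq> of_real x" by (auto simp: complex_nonpos_Reals_iff)
    then show ?thesis by (auto intro!: derivative_eq_intros simp: divide_simps)
  qed
  have "esum (outer M) (\<lambda>w. 1 / (w - of_real x)) = Ln (- cnj (u M)) - Ln (- u M)"
    by (subst esum_primitive[OF do], assumption) (simp add: outer_def Let_def u_def)
  moreover have "esum (piece j) (\<lambda>w. 1 / (w - of_real x)) =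
      (Ln (u (Suc j)) - Ln (cnj (u (Suc j)))) - (Ln (u j) - Ln (cnj (u j)))" for j
    by (subst esum_primitive[OF dp], assumption) (simp add: piece_def u_def)
  then have "(\<Sum>j<M. esum (piece j) (\<lambda>w. 1 / (w - of_real x))) =
      (Ln (u M) - Ln (cnj (u M))) - (Ln (u 0) - Ln (cnj (u 0)))"
    using sum_lessThan_telescope[of "\<lambda>j. Ln (u j) - Ln (cnj (u j))" M] by simp
  moreover have "cnj (u 0) = u 0" by (simp add: u_def vtx_def hgt_def complex_eq_iff)
  moreover have "Ln (- u M) = Ln (u M) - \<i> * pi"
    using hM by (subst Ln_minus) auto
  moreover have "Ln (- cnj (u M)) = Ln (cnj (u M)) + \<i> * pi"
    using hM by (subst Ln_minus) auto
  ultimately show ?thesis by simp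
qed

definition square :: "nat \<Rightarrow> complex set" where
  "square M = {z. \<bar>Re z\<bar> < cen M \<and> \<bar>Im z\<bar> < cen M}"

lemma square_eq: "square M = box (Complex (- cen M) (- cen M)) (Complex (cen M) (cen M))"
  by (auto simp: square_def in_box_complex_iff)

lemma open_square: "open (square M)" and convex_square: "convex (square M)"
  unfolding square_eq by (auto simp: open_box convex_box)

lemma square_outer: "1 \<le> M \<Longrightarrow> 0 < cen M \<Longrightarrow> square M \<inter> eimg (outer M) = {}"
  using outer_point(1)[of M _ 0] by (fastforce simp: square_def)

lemma open_outer_region: "open outer_region"
proof -
  have "open {z. Re z > -2 \<and> 2 < \<bar>Im z\<bar> * (Re z + 2)}"
    by (intro open_Collect_conj open_Collect_less continuous_intros)
  moreover have "{z. Re z > -2 \<and> 2 / (Re z + 2) < \<bar>Im z\<bar>} = {z. Re z > -2 \<and> 2 < \<bar>Im z\<bar> * (Re z + 2)}"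
    by (auto simp: divide_less_eq)
  ultimately show ?thesis unfolding outer_region_def by (auto intro: open_halfspace_Re_lt)
qed

lemma outer_region_slit: "outer_region \<subseteq> slit_plane"
proof
  fix z assume "z \<in> outer_region"
  moreover have "0 < 2 / (Re z + 2)" if "Re z > -2" using that by simp
  ultimately show "z \<in> slit_plane" unfolding outer_region_def slit_plane_iff by fastforce
qed

text \<open>The half-plane part \<open>A\<close> meets both the convex upper and the convex lower
  part. The points with real part -3/2 and imaginary part 5 or -5 lie in the overlaps since
  \<open>2 / (1/2) = 4 < 5\<close>, and they fit into the square because
  \<open>9 \<le> cen M\<close>.\<close>

lemma connected_outer_region_square:
  assumes "9 \<le> cen M"
  shows "connected (outer_region \<inter> square M)"
proof -
  define A where "A = {z. Re z < -1} \<inter> square M"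
  define U where "U s = {z. Re z > -2 \<and> 2 / (Re z + 2) < s * Im z} \<inter> square M" for s :: real
  have eq: "outer_region \<inter> square M = (A \<union> U 1) \<union> (A \<union> U (-1))"
    unfolding outer_region_def A_def U_def by (auto simp: abs_if)
  have A: "convex A" unfolding A_def by (intro convex_Int convex_square convex_halfspace_Re_lt)
  have U: "convex (U s)" for s
  proof -
    have "convex_on {-2<..} (\<lambda>x::real. 2 * inverse (x + 2))"
    proof (rule convex_on_realI[where f' = "\<lambda>x. - 2 * inverse ((x + 2)^2)"])
      show "((\<lambda>x::real. 2 * inverse (x + 2)) has_real_derivative - 2 * inverse ((x + 2)^2)) (at x)"
        if "x \<in> {-2<..}" for x
        using that by (auto intro!: derivative_eq_intros simp: power2_eq_square)
      show "- 2 * inverse ((x + 2)^2) \<le> - 2 * inverse ((y + 2)^2)" if "x \<in> {-2<..}" "y \<in> {-2<..}" "x \<le> y"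
        for x y :: real
        using that by (simp add: le_imp_inverse_le power_mono)
    qed auto
    then have conv: "2 / ((1 - t) * x + t * y + 2) \<le> (1 - t) * (2 / (x + 2)) + t * (2 / (y + 2))"
      if "0 \<le> t" "t \<le> 1" "x > -2" "y > -2" for x y t :: real
      using convex_onD[of "{-2<..}" _ t x y] that by (fastforce simp: divide_inverse)
    have "convex {z. Re z > -2 \<and> 2 / (Re z + 2) < s * Im z}"
      unfolding convex_alt
    proof (intro ballI allI impI)
      fix z w and t :: real
      assume z: "z \<in> {z. Re z > -2 \<and> 2 / (Re z + 2) < s * Im z}" and w: "w \<in> {z. Re z > -2
        \<and> 2 / (Re z + 2) < s * Im z}"
        and t: "0 \<le> t \<and> t \<le> 1"
      have lt: "(1 - t) * a + t * b < (1 - t) * c + t * d" if "a < c" "b < d" for a b c d :: real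
      proof (cases "t = 0")
        case False
        then have "t * b < t * d" using that t by simp
        moreover have "(1 - t) * a \<le> (1 - t) * c" using that t by (intro mult_left_mono) auto
        ultimately show ?thesis by simp
      qed (use that in simp)
      have "- 2 < (1 - t) * Re z + t * Re w" using lt[of "-2" "Re z" "-2" "Re w"] z w by (simp add: algebra_simps)
      moreover have "2 / ((1 - t) * Re z + t * Re w + 2) < s * ((1 - t) * Im z + t * Im w)"
        using conv[of t "Re z" "Re w"] lt[of "2 / (Re z + 2)" "s * Im z" "2 / (Re w + 2)" "s * Im w"] z w t
        by (auto simp: algebra_simps)
      ultimately show "(1 - t) *\<^sub>R z + t *\<^sub>R w \<in> {z. Re z > -2 \<and> 2 / (Re z + 2) < s * Im z}" by simp
    qed
    then show ?thesis unfolding U_def by (intro convex_Int convex_square)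
  qed
  have AU: "connected (A \<union> U s)" if "s = 1 \<or> s = -1" for s
  proof (rule connected_Un)
    have "Complex (- 3 / 2) (s * 5) \<in> A \<inter> U s" using assms that by (auto simp: A_def U_def square_def)
    then show "A \<inter> U s \<noteq> {}" by blast
  qed (use A U in \<open>auto intro: convex_connected\<close>)
  have "(A \<union> U 1) \<inter> (A \<union> U (-1)) \<noteq> {}"
  proof -
    have "Complex (-2) 0 \<in> A" using assms by (auto simp: A_def square_def)
    then show ?thesis by blast
  qed
  then show ?thesis unfolding eq by (intro connected_Un AU) simp_all
qed

text \<open>At a real point \<open>v < -1\<close> inside the square the difference quotient of
  \<open>F\<close> has a primitive, so its integral over the closed contour vanishes and the winding
  number gives Cauchy's formula. Both sides are holomorphic on a connected set, so the formula
  spreads from this real segment by the identity theorem.\<close>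

lemma Cauchy_outer_pieces:
  assumes F: "F holomorphic_on slit_plane" and M: "9 \<le> cen M" "1 \<le> M" and z: "z \<in> outer_region \<inter> square M"
  shows "esum (outer M) (\<lambda>w. F w * (1 / (w - z))) + (\<Sum>j<M. esum (piece j) (\<lambda>w. F w * (1 / (w - z)))) =
    2 * pi * \<i> * F z"
proof -
  have M': "0 < cen M" using M by simp
  have cF: "continuous_on S F" if "S \<subseteq> slit_plane" for S
    using F holomorphic_on_imp_continuous_on continuous_on_subset that by blast
  define L where "L z = esum (outer M) (\<lambda>w. F w * (1 / (w - z))) +
     (\<Sum>j<M. esum (piece j) (\<lambda>w. F w * (1 / (w - z)))) - 2 * pi * \<i> * F z" for z
  have "L z = 0"
  proof (rule analytic_continuation[of L "outer_region \<inter> square M" "{z. z \<in> \<real> \<and> - cen M < Re z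
    \<and> Re z < -1}" "-2"])
    show "L holomorphic_on outer_region \<inter> square M"
      unfolding L_def
    proof (intro holomorphic_intros esum_Cauchy_holomorphic cF)
      show "outer_region \<inter> square M \<inter> eimg (outer M) = {}" using square_outer[OF M(2) M'] by blast
      show "F holomorphic_on outer_region \<inter> square M"
        by (rule holomorphic_on_subset[OF F]) (use outer_region_slit in blast)
      show "outer_region \<inter> square M \<inter> eimg (piece j) = {}" for j using piece_outer_region by blast
    qed (use outer_slit[OF M(2) M'] piece_slit open_outer_region open_square in auto)
    show "(- 2 :: complex) islimpt {z. z \<in> \<real> \<and> - cen M < Re z \<and> Re z < -1}"
      unfolding islimpt_approachable
    proof (intro allI impI)
      fix e :: real assume "e > 0"
      then show "\<exists>x'\<in>{z. z \<in> \<real> \<and> - cen M < Re z \<and> Re z < -1}. x' \<noteq> (-2::complex) \<and> dist x' (-2) < e"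
      proof (intro bexI[of _ "of_real (-2 - min 1 (e/2))"] conjI)
        have "complex_of_real (-2 - min 1 (e/2)) - (-2) = of_real (- min 1 (e/2))" by simp
        then have d: "cmod (complex_of_real (-2 - min 1 (e/2)) - (-2)) = min 1 (e/2)"
          using \<open>e > 0\<close> by (simp add: norm_of_real del: of_real_minus of_real_diff)
        then show "dist (complex_of_real (-2 - min 1 (e/2))) (-2) < e"
          using \<open>e > 0\<close> by (simp add: dist_norm)
        show "complex_of_real (-2 - min 1 (e/2)) \<noteq> -2" using d \<open>e > 0\<close> by auto
        show "complex_of_real (-2 - min 1 (e/2)) \<in> {z. z \<in> \<real> \<and> - cen M < Re z \<and> Re z < -1}"
          using M(1) \<open>e > 0\<close> by (auto simp del: of_real_diff of_real_minus)
      qed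
    qed
    fix v :: complex assume v: "v \<in> {z. z \<in> \<real> \<and> - cen M < Re z \<and> Re z < -1}"
    then obtain x where x: "v = of_real x" "- cen M < x" "x < -1" by (auto elim: Reals_cases)
    define D where "D w = (if w = v then deriv F v else (F w - F v) / (w - v))" for w
    have "D holomorphic_on slit_plane" unfolding D_def by (rule pole_lemma_open[OF F open_slit_plane])
    then obtain P where P: "\<And>w. w \<in> slit_plane \<Longrightarrow> (P has_field_derivative D w) (at w)"
      using slit_plane_primitive by metis
    have cD: "continuous_on S D" if "S \<subseteq> slit_plane" for S
      using \<open>D holomorphic_on slit_plane\<close> holomorphic_on_imp_continuous_on continuous_on_subset that by blast
    have split: "esum es (\<lambda>w. F w * (1 / (w - v))) = esum es D + F v * esum es (\<lambda>w. 1 / (w - v))"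
      if "eimg es \<subseteq> slit_plane" "v \<notin> eimg es" for es
    proof -
      have c: "continuous_on (eimg es) (\<lambda>w. 1 / (w - v))" using that by (intro continuous_intros) auto
      have "esum es (\<lambda>w. F w * (1 / (w - v))) = esum es (\<lambda>w. D w + F v * (1 / (w - v)))"
        using that by (intro esum_cong) (auto simp: D_def diff_divide_distrib)
      also have "\<dots> = esum es D + esum es (\<lambda>w. F v * (1 / (w - v)))"
        by (rule esum_add[OF cD[OF that(1)] continuous_on_mult[OF continuous_on_const c]])
      finally show ?thesis unfolding esum_cmult[OF c] .
    qed
    have vo: "v \<in> outer_region" using x by (simp add: outer_region_def)
    have vb: "v \<in> square M" using x M by (simp add: square_def)
    have "L v = (esum (outer M) D + (\<Sum>j<M. esum (piece j) D)) +
       F v * (esum (outer M) (\<lambda>w. 1 / (w - v)) + (\<Sum>j<M. esum (piece j) (\<lambda>w. 1 / (w - v)))) - 2 * pi * \<i> * F v"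
    proof -
      have "(\<Sum>j<M. esum (piece j) (\<lambda>w. F w * (1 / (w - v)))) =
        (\<Sum>j<M. esum (piece j) D) + F v * (\<Sum>j<M. esum (piece j) (\<lambda>w. 1 / (w - v)))"
        unfolding sum_distrib_left sum.distrib[symmetric]
        by (intro sum.cong refl split piece_slit) (metis IntI empty_iff piece_outer_region vo)
      moreover have "v \<notin> eimg (outer M)" using square_outer[OF M(2) M'] vb by (metis IntI empty_iff)
      then have "esum (outer M) (\<lambda>w. F w * (1 / (w - v)))
        = esum (outer M) D + F v * esum (outer M) (\<lambda>w. 1 / (w - v))"
        by (rule split[OF outer_slit[OF M(2) M']])
      ultimately show ?thesis unfolding L_def by (simp add: algebra_simps)
    qed
    then show "L v = 0"
      using outer_pieces_primitive[OF P M(2) M'] outer_pieces_winding[OF M(2) M' x(2,3)] x(1) by simp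
  qed (use z connected_outer_region_square[OF M(1)] open_outer_region open_square M in \<open>auto simp:
    outer_region_def square_def elim!: Reals_cases\<close>)
  then show ?thesis unfolding L_def by simp
qed

section \<open>Splitting off an entire function\<close>

lemma norm_diff_le_halves:
  fixes x y c :: "'a::real_normed_vector"
  shows "norm (x - c) \<le> e / 2 \<Longrightarrow> norm (y - c) \<le> e / 2 \<Longrightarrow> norm (x - y) \<le> e"
  using norm_triangle_ineq4[of "x - c" "y - c"] by simp

text \<open>\<open>E j\<close> replaces the Cauchy kernel on the \<open>j\<close>-th piece; the
  tolerances \<open>eps j\<close> stay free until the size of the function on the pieces is
  known.\<close>

locale small_kernels =
  fixes E E' :: "nat \<Rightarrow> complex \<Rightarrow> complex \<Rightarrow> complex" and eps :: "nat \<Rightarrow> real"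
  assumes E_derivative: "((\<lambda>z. E j z w) has_field_derivative E' j z w) (at z)"
    and E'_continuous: "continuous_on UNIV (\<lambda>(z, w). E' j z w)"
    and E_continuous: "continuous_on UNIV (\<lambda>(z, w). E j z w)"
    and E_small: "cmod (w - of_real (cen j)) \<le> rad j / 2 \<Longrightarrow> (\<And>m. m \<ge> j \<Longrightarrow> rad m \<le> cmod (z - of_real (cen m))) \<Longrightarrow>
      cmod (1 / (w - z) - E j z w) \<le> eps j"
begin

text \<open>Cauchy's formula in \<open>square M\<close>, except that each piece uses its entire
  kernel. Only \<open>outer M\<close> keeps poles, so the result is holomorphic across the
  half-line.\<close>

definition approx :: "(complex \<Rightarrow> complex) \<Rightarrow> nat \<Rightarrow> complex \<Rightarrow> complex" where
  "approx F M z = (1 / (2 * pi * \<i>)) * (esum (outer M) (\<lambda>w. F w * (1 / (w - z))) +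
     (\<Sum>j<M. esum (piece j) (\<lambda>w. F w * E j z w)))"

definition err :: "(complex \<Rightarrow> complex) \<Rightarrow> nat \<Rightarrow> complex \<Rightarrow> complex" where
  "err F j z = esum (piece j) (\<lambda>w. F w * (1 / (w - z) - E j z w))"

definition entire_part :: "(complex \<Rightarrow> complex) \<Rightarrow> complex \<Rightarrow> complex" where
  "entire_part F z = lim (\<lambda>M. approx F M z)"

text \<open>The right side is moved in by 4, the largest radius, so that all discs with index
  \<open>m \<ge> M\<close> are avoided.\<close>

definition square' :: "nat \<Rightarrow> complex set" where
  "square' M = {z. - cen M < Re z \<and> Re z < cen M - 4 \<and> \<bar>Im z\<bar> < cen M}"

lemma E_continuous1: "continuous_on S (E j z)"
proof -
  have "continuous_on S (\<lambda>w. (\<lambda>(z, w). E j z w) (z, w))"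
    by (rule continuous_on_compose2[OF E_continuous]) (auto intro: continuous_intros)
  then show ?thesis by simp
qed

lemma square'_subset: "square' M \<subseteq> square M"
  by (auto simp: square'_def square_def)

lemma square'_eq: "square' M = box (Complex (- cen M) (- cen M)) (Complex (cen M - 4) (cen M))"
  by (auto simp: square'_def in_box_complex_iff)

lemma square'_mono: "M \<le> N \<Longrightarrow> square' M \<subseteq> square' N"
  using cen_mono[of M N] by (auto simp: square'_def)

lemma square'_exhaust:
  obtains M where "z \<in> square' M" "9 \<le> cen M" "1 \<le> M"
proof -
  \<comment> \<open>15 leaves room for the shift by 1 in \<open>cen\<close>, for the margin 4 of
    \<open>square'\<close> and for \<open>9 \<le> cen M\<close>.\<close>
  obtain M where M: "(cmod z + 15)\<^sup>2 \<le> real M" using real_arch_simple by blast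
  have "cmod z + 15 = sqrt ((cmod z + 15)\<^sup>2)" by simp
  also have "\<dots> \<le> sqrt M" using M by (intro real_sqrt_le_mono)
  finally have "cmod z + 14 \<le> cen M" by (simp add: cen_def)
  moreover have "\<bar>Re z\<bar> \<le> cmod z" "\<bar>Im z\<bar> \<le> cmod z" by (auto simp: abs_Re_le_cmod abs_Im_le_cmod)
  ultimately have "z \<in> square' M" "9 \<le> cen M" using norm_ge_zero[of z] by (auto simp: square'_def)
  moreover have "1 \<le> M" using \<open>9 \<le> cen M\<close> by (cases M) (auto simp: cen_def)
  ultimately show ?thesis using that by blast
qed

lemma square'_far:
  assumes "z \<in> square' M" "m \<ge> M"
  shows "rad m \<le> cmod (z - of_real (cen m))"
proof -
  have "rad m \<le> cen m - Re z"
    using assms cen_mono[OF assms(2)] rad_bounds(2)[of m] by (simp add: square'_def)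
  also have "\<dots> \<le> cmod (z - of_real (cen m))" using abs_Re_le_cmod[of "z - of_real (cen m)"] by simp
  finally show ?thesis .
qed

lemma far_not_piece:
  assumes "rad j \<le> cmod (z - of_real (cen j))"
  shows "z \<notin> eimg (piece j)"
  using assms piece_point(5)[of z j] rad_bounds(1)[of j] by auto

lemma err_split:
  assumes "continuous_on (eimg (piece j)) F" "z \<notin> eimg (piece j)"
  shows "err F j z = esum (piece j) (\<lambda>w. F w * (1 / (w - z))) - esum (piece j) (\<lambda>w. F w * E j z w)"
proof -
  have "continuous_on (eimg (piece j)) (\<lambda>w. F w * (1 / (w - z)))"
    using assms by (intro continuous_intros) auto
  moreover have "continuous_on (eimg (piece j)) (\<lambda>w. F w * E j z w)"
    by (intro continuous_on_mult assms E_continuous1)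
  ultimately show ?thesis
    unfolding err_def by (subst esum_diff[symmetric]) (auto simp: right_diff_distrib)
qed

text \<open>The two segments of a piece have total length at most 8, and on them the kernel error is
  at most \<open>eps j\<close>, weighted by the size of \<open>F\<close>.\<close>

lemma err_bound:
  assumes F: "continuous_on (eimg (piece j)) F" and \<tau>: "\<And>w. w \<in> eimg (piece j) \<Longrightarrow> cmod (F w) * eps j \<le> \<tau>" "0 \<le> \<tau>"
    and far: "\<And>m. m \<ge> j \<Longrightarrow> rad m \<le> cmod (z - of_real (cen m))"
  shows "cmod (err F j z) \<le> 8 * \<tau>"
proof -
  have "z \<notin> eimg (piece j)" by (rule far_not_piece[OF far]) simp
  then have c: "continuous_on (eimg (piece j)) (\<lambda>w. F w * (1 / (w - z) - E j z w))"
    by (intro continuous_intros F E_continuous1) auto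
  have "cmod (err F j z) \<le> \<tau> * elen (piece j)"
    unfolding err_def
  proof (rule esum_bound[OF c \<tau>(2)])
    fix w assume w: "w \<in> eimg (piece j)"
    have "cmod (F w * (1 / (w - z) - E j z w)) \<le> cmod (F w) * eps j"
      unfolding norm_mult by (intro mult_left_mono E_small far piece_point(5)[OF w]) auto
    then show "cmod (F w * (1 / (w - z) - E j z w)) \<le> \<tau>" using \<tau>(1)[OF w] by linarith
  qed
  also have "\<dots> \<le> \<tau> * 8" by (rule mult_left_mono[OF elen_piece \<tau>(2)])
  finally show ?thesis by simp
qed

section \<open>A scalar function with summable errors\<close>

context
  fixes F :: "complex \<Rightarrow> complex" and \<tau> :: "nat \<Rightarrow> real"
  assumes F: "F holomorphic_on slit_plane" and \<tau>0: "\<And>j. 0 \<le> \<tau> j"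
    and summable_\<tau>: "summable \<tau>"
    and \<tau>: "\<And>j w. w \<in> eimg (piece j) \<Longrightarrow> cmod (F w) * eps j \<le> \<tau> j"
begin

lemma F_cont: "S \<subseteq> slit_plane \<Longrightarrow> continuous_on S F"
  using F holomorphic_on_imp_continuous_on continuous_on_subset by blast

lemma E_part_holomorphic: "open \<Omega> \<Longrightarrow> (\<lambda>z. esum (piece j) (\<lambda>w. F w * E j z w)) holomorphic_on \<Omega>"
  by (rule esum_holomorphic[where K' = "E' j", OF F_cont[OF piece_slit]])
    (auto intro: E_derivative E_continuous1 continuous_on_subset[OF E'_continuous])

lemma approx_holomorphic:
  assumes "9 \<le> cen M" "1 \<le> M"
  shows "approx F M holomorphic_on square M"
proof -
  have "0 < cen M" using assms by simp
  then show ?thesis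
    unfolding approx_def
    by (intro holomorphic_intros esum_Cauchy_holomorphic E_part_holomorphic open_square F_cont
        outer_slit square_outer assms)
qed

lemma F_minus_approx:
  assumes "9 \<le> cen M" "1 \<le> M" "z \<in> outer_region \<inter> square M"
  shows "F z - approx F M z = (1 / (2 * pi * \<i>)) * (\<Sum>j<M. err F j z)"
proof -
  let ?O = "esum (outer M) (\<lambda>w. F w * (1 / (w - z)))"
  let ?C = "\<Sum>j<M. esum (piece j) (\<lambda>w. F w * (1 / (w - z)))"
  let ?S = "\<Sum>j<M. esum (piece j) (\<lambda>w. F w * E j z w)"
  have "z \<notin> eimg (piece j)" for j using piece_outer_region assms(3) by blast
  then have "(\<Sum>j<M. err F j z) = ?C - ?S"
    by (simp add: err_split F_cont piece_slit sum_subtractf)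
  moreover have "F z = (1 / (2 * pi * \<i>)) * (?O + ?C)"
    using Cauchy_outer_pieces[OF F assms] by simp
  ultimately show ?thesis unfolding approx_def by (simp only: ) (simp add: algebra_simps)
qed

text \<open>On the outer region both approximants are compared with \<open>F\<close>, and the sums
  of errors differ by the single term of index \<open>M\<close>. The points of
  \<open>square' M\<close> keep away from the piece \<open>M\<close>, so this relation continues
  analytically over the half-line, where no comparison with \<open>F\<close> is possible.\<close>

lemma approx_step:
  assumes M: "9 \<le> cen M" "1 \<le> M" and z: "z \<in> square' M"
  shows "approx F (Suc M) z - approx F M z = - (1 / (2 * pi * \<i>)) * err F M z"
proof (rule analytic_continuation_open[of "outer_region \<inter> square' M" "square' M"
    "\<lambda>z. approx F (Suc M) z - approx F M z" "\<lambda>z. - (1 / (2 * pi * \<i>)) * err F M z" z])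
  have M': "9 \<le> cen (Suc M)" using M(1) cen_mono[of M "Suc M"] by simp
  have sub: "square' M \<subseteq> square (Suc M)" using square'_mono[of M "Suc M"] square'_subset by auto
  show "open (outer_region \<inter> square' M)" "open (square' M)" "connected (square' M)"
    unfolding square'_eq by (auto intro!: open_Int open_outer_region open_box convex_connected convex_box)
  have "Complex (-2) 0 \<in> outer_region \<inter> square' M" using M by (auto simp: outer_region_def square'_def)
  then show "outer_region \<inter> square' M \<noteq> {}" by blast
  have disj: "square' M \<inter> eimg (piece M) = {}" using square'_far far_not_piece by blast
  have "(\<lambda>z. esum (piece M) (\<lambda>w. F w * (1 / (w - z))) - esum (piece M) (\<lambda>w. F w * E M z w)) holomorphic_on
    square' M"
    by (intro holomorphic_intros esum_Cauchy_holomorphic E_part_holomorphic F_cont piece_slit disj)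
      (simp_all add: square'_eq open_box)
  then have "err F M holomorphic_on square' M"
    by (rule holomorphic_transform) (rule err_split[OF F_cont[OF piece_slit], symmetric], use disj in blast)
  then show "(\<lambda>z. - (1 / (2 * pi * \<i>)) * err F M z) holomorphic_on square' M" by (intro holomorphic_intros)
  show "(\<lambda>z. approx F (Suc M) z - approx F M z) holomorphic_on square' M"
    using approx_holomorphic[OF M] approx_holomorphic[OF M'] sub square'_subset
    by (intro holomorphic_intros) (auto intro: holomorphic_on_subset)
  show "approx F (Suc M) z - approx F M z = - (1 / (2 * pi * \<i>)) * err F M z"
    if "z \<in> outer_region \<inter> square' M" for z
    using F_minus_approx[OF M, of z] F_minus_approx[OF M', of z] that sub square'_subset[of M]
    by (auto simp: algebra_simps subset_iff)
qed (use z in auto)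

text \<open>8 is the bound on the length of a piece; the crude \<open>pi \<ge> 2\<close> already
  brings \<open>8 / (2 * pi)\<close> down to 2.\<close>

lemma inverse_2pi: "cmod (1 / (2 * pi * \<i>)) * (8 * t) \<le> 2 * t" if "0 \<le> t"
proof -
  have "8 * t / (2 * pi) \<le> 8 * t / (2 * 2)" using that pi_ge_two by (intro divide_left_mono) auto
  then show ?thesis by (simp add: norm_mult norm_divide)
qed

lemma approx_diff:
  assumes M: "9 \<le> cen M" "1 \<le> M" and z: "z \<in> square' M"
  shows "cmod (approx F (M + n) z - approx F M z) \<le> 2 * (\<Sum>i<n. \<tau> (i + M))"
proof (induction n)
  case (Suc n)
  have M': "9 \<le> cen (M + n)" using M(1) cen_mono[of M "M + n"] by simp
  have z': "z \<in> square' (M + n)" using z square'_mono[of M "M + n"] by auto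
  have "cmod (err F (M + n) z) \<le> 8 * \<tau> (M + n)"
    by (rule err_bound[OF F_cont[OF piece_slit] \<tau> \<tau>0 square'_far[OF z']])
  moreover have "1 \<le> M + n" using M(2) by simp
  ultimately have "cmod (approx F (Suc (M + n)) z - approx F (M + n) z)
    \<le> cmod (1 / (2 * pi * \<i>)) * (8 * \<tau> (M + n))"
    using approx_step[OF M' _ z'] by (simp only: norm_mult norm_minus_cancel mult_minus_left) (intro
      mult_left_mono, auto)
  also have "\<dots> \<le> 2 * \<tau> (M + n)" by (rule inverse_2pi[OF \<tau>0])
  finally have "cmod ((approx F (Suc (M + n)) z - approx F (M + n) z) + (approx F (M + n) z - approx F M z))
     \<le> 2 * \<tau> (M + n) + 2 * (\<Sum>i<n. \<tau> (i + M))"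
    using Suc by (intro norm_triangle_mono)
  then show ?case by (simp add: add.commute distrib_left)
qed simp

lemma approx_Cauchy:
  assumes M: "9 \<le> cen M" "1 \<le> M" "M \<le> N" "N \<le> n" and z: "z \<in> square' M"
  shows "cmod (approx F n z - approx F N z) \<le> 2 * (\<Sum>i. \<tau> (i + N))"
proof -
  have N: "9 \<le> cen N" "1 \<le> N" "z \<in> square' N"
    using M cen_mono[of M N] square'_mono[of M N] z by auto
  have "cmod (approx F n z - approx F N z) \<le> 2 * (\<Sum>i<n - N. \<tau> (i + N))"
    using approx_diff[OF N, of "n - N"] M(4) by simp
  also have "\<dots> \<le> 2 * (\<Sum>i. \<tau> (i + N))"
    using summable_ignore_initial_segment[OF summable_\<tau>, of N] \<tau>0 by (intro mult_left_mono sum_le_suminf) auto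
  finally show ?thesis .
qed

lemma tail_to_0: "(\<lambda>N. 2 * (\<Sum>i. \<tau> (i + N))) \<longlonglongrightarrow> 0"
  using tendsto_mult_right_zero[OF suminf_exist_split2[OF summable_\<tau>]] by simp

lemma approx_converges: "(\<lambda>M. approx F M z) \<longlonglongrightarrow> entire_part F z"
proof -
  obtain M where M: "z \<in> square' M" "9 \<le> cen M" "1 \<le> M" using square'_exhaust by metis
  have "Cauchy (\<lambda>M. approx F M z)"
  proof (rule CauchyI')
    fix e :: real assume "e > 0"
    then obtain N where N: "N \<ge> M" "2 * (\<Sum>i. \<tau> (i + N)) < e"
      using order_tendstoD(2)[OF tail_to_0, of e]
        by (auto simp: eventually_sequentially) (meson max.cobounded1 max.cobounded2)
    have "dist (approx F m z) (approx F n z) < e" if "m \<ge> N" "n > m" for m n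
    proof -
      have "cmod (approx F n z - approx F m z) \<le> 2 * (\<Sum>i. \<tau> (i + m))"
        using approx_Cauchy[OF M(2,3) _ _ M(1), of m n] that N by simp
      also have "(\<Sum>i. \<tau> (i + m)) = (\<Sum>i. \<tau> ((i + (m - N)) + N))" using that by (simp add: add.assoc)
      also have "\<dots> \<le> (\<Sum>i. \<tau> (i + N))"
        using summable_ignore_initial_segment[OF summable_\<tau>, of N] \<tau>0
        by (subst suminf_split_initial_segment[of "\<lambda>i. \<tau> (i + N)" "m - N"]) (auto intro: sum_nonneg)
      finally show ?thesis using N(2) by (simp add: dist_norm norm_minus_commute)
    qed
    then show "\<exists>M. \<forall>m\<ge>M. \<forall>n>m. dist (approx F m z) (approx F n z) < e" by blast
  qed
  then show ?thesis unfolding entire_part_def by (simp add: Cauchy_convergent_iff convergent_LIMSEQ_iff)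
qed

lemma approx_entire_part:
  assumes M: "9 \<le> cen M" "1 \<le> M" "M \<le> N" and z: "z \<in> square' M"
  shows "cmod (entire_part F z - approx F N z) \<le> 2 * (\<Sum>i. \<tau> (i + N))"
proof (rule tendsto_upperbound)
  show "((\<lambda>n. cmod (approx F n z - approx F N z)) \<longlongrightarrow> cmod (entire_part F z - approx F N z)) sequentially"
    by (intro tendsto_intros approx_converges)
  show "\<forall>\<^sub>F n in sequentially. cmod (approx F n z - approx F N z) \<le> 2 * (\<Sum>i. \<tau> (i + N))"
    using approx_Cauchy[OF M _ z] by (rule eventually_sequentiallyI)
qed simp

text \<open>On \<open>square' M\<close> the approximants from index \<open>M\<close> on are
  holomorphic and converge at the rate of the tails of \<open>\<tau>\<close>, and these rectangles
  exhaust the plane.\<close>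

lemma entire_part_holomorphic: "entire_part F holomorphic_on UNIV"
proof -
  have "entire_part F holomorphic_on square' M" if M: "9 \<le> cen M" "1 \<le> M" for M
  proof (rule holomorphic_uniform_sequence[of _ "\<lambda>n. approx F (M + n)"])
    show op: "open (square' M)" by (simp add: square'_eq open_box)
    show "approx F (M + n) holomorphic_on square' M" for n
      by (rule holomorphic_on_subset[OF approx_holomorphic])
        (use M cen_mono[of M "M + n"] square'_mono[of M "M + n"] square'_subset[of "M + n"] in auto)
    have "uniform_limit (square' M) (\<lambda>n. approx F (M + n)) (entire_part F) sequentially"
      unfolding uniform_limit_iff
    proof (intro allI impI)
      fix e :: real assume "e > 0"
      then have "\<forall>\<^sub>F n in sequentially. 2 * (\<Sum>i. \<tau> (i + (n + M))) < e"
        using order_tendstoD(2)[OF LIMSEQ_ignore_initial_segment[OF tail_to_0, of M], of e] by simp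
      then show "\<forall>\<^sub>F n in sequentially. \<forall>z\<in>square' M. dist (approx F (M + n) z) (entire_part F z) < e"
      proof eventually_elim
        case (elim n)
        show ?case
          using approx_entire_part[OF M, of "M + n"] elim
          by (fastforce simp: dist_norm norm_minus_commute add.commute)
      qed
    qed
    then show "\<exists>d>0. cball x d \<subseteq> square' M \<and> uniform_limit (cball x d) (\<lambda>n. approx F (M
      + n)) (entire_part F) sequentially"
      if "x \<in> square' M" for x
      using that op open_contains_cball uniform_limit_on_subset by metis
  qed
  then have "entire_part F field_differentiable at z" for z
    using square'_exhaust[of z] by (metis holomorphic_on_imp_differentiable_at square'_eq open_box)
  then show ?thesis by (simp add: holomorphic_on_def field_differentiable_at_within)
qed

text \<open>Outside all the discs each error obeys its own bound, so the total does not depend on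
  \<open>z\<close>; this is the source of the boundedness on strips.\<close>

lemma F_minus_entire_part:
  assumes z: "z \<in> outer_region" and far: "\<And>m. rad m \<le> cmod (z - of_real (cen m))"
  shows "cmod (F z - entire_part F z) \<le> 2 * (\<Sum>i. \<tau> i)"
proof (rule tendsto_upperbound)
  show "((\<lambda>M. cmod (F z - approx F M z)) \<longlongrightarrow> cmod (F z - entire_part F z)) sequentially"
    by (intro tendsto_intros approx_converges)
  obtain M where M: "z \<in> square' M" "9 \<le> cen M" "1 \<le> M" using square'_exhaust by metis
  show "\<forall>\<^sub>F n in sequentially. cmod (F z - approx F n z) \<le> 2 * (\<Sum>i. \<tau> i)"
  proof (rule eventually_sequentiallyI[of M])
    fix n assume n: "n \<ge> M"
    have n': "9 \<le> cen n" "1 \<le> n" "z \<in> outer_region \<inter> square n"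
      using M n z cen_mono[OF n] square'_mono[OF n] square'_subset[of n] by auto
    have "cmod (\<Sum>j<n. err F j z) \<le> (\<Sum>j<n. 8 * \<tau> j)"
      by (intro sum_norm_le err_bound F_cont piece_slit \<tau> \<tau>0 far)
    then have "cmod (F z - approx F n z) \<le> cmod (1 / (2 * pi * \<i>)) * (8 * (\<Sum>j<n. \<tau> j))"
      unfolding F_minus_approx[OF n'] norm_mult sum_distrib_left[of 8] by (intro mult_left_mono) auto
    also have "\<dots> \<le> 2 * (\<Sum>j<n. \<tau> j)" by (intro inverse_2pi sum_nonneg \<tau>0)
    also have "\<dots> \<le> 2 * (\<Sum>i. \<tau> i)"
      using summable_\<tau> \<tau>0 by (intro mult_left_mono sum_le_suminf) auto
    finally show "cmod (F z - approx F n z) \<le> 2 * (\<Sum>i. \<tau> i)" .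
  qed
qed simp

end

end

lemma strip_far:
  assumes "z \<in> strip_minus {0..\<infinity>} n" "1 \<le> n"
  shows "\<bar>Im z\<bar> < real n" "Re z \<ge> 0 \<Longrightarrow> 1 / real n \<le> \<bar>Im z\<bar>" "z \<in> slit_plane"
    "\<And>x. 0 \<le> x \<Longrightarrow> 1 / real n \<le> dist z (of_real x)"
proof -
  show "\<bar>Im z\<bar> < real n" using assms by (simp add: strip_minus_def)
  have "z \<notin> nbhd (1 / real n) {0..\<infinity>}" using assms closure_subset by (auto simp: strip_minus_def)
  then show *: "1 / real n \<le> dist z (of_real x)" if "0 \<le> x" for x
    using that by (auto simp: nbhd_def not_less)
  show "1 / real n \<le> \<bar>Im z\<bar>" if "Re z \<ge> 0"
    using *[OF that] by (simp add: dist_norm cmod_def)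
  then show "z \<in> slit_plane" using assms by (auto simp: slit_plane_iff)
qed

text \<open>Discs of radius at most \<open>1 / n\<close> centred on the half-line are avoided by
  definition of the strip. The others have \<open>sqrt (m + 1) < 4 * n\<close>, hence lie within
  \<open>4 * n + 10\<close> of 0. At that distance the strip has also entered
  \<open>outer_region\<close>, since \<open>2 / (Re z + 2)\<close> has dropped below
  \<open>1 / n\<close> on the right.\<close>

lemma strip_outer:
  assumes z: "z \<in> strip_minus {0..\<infinity>} n" "1 \<le> n" and far: "4 * real n + 10 < cmod z"
  shows "z \<in> outer_region" "rad m \<le> cmod (z - of_real (cen m))"
proof -
  note s = strip_far[OF z]
  have "cmod z \<le> \<bar>Re z\<bar> + \<bar>Im z\<bar>" by (rule cmod_le)
  then have re: "\<bar>Re z\<bar> > 3 * real n + 10" using s(1) far by linarith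
  show "z \<in> outer_region"
  proof (cases "Re z < 0")
    case True
    then show ?thesis using re by (auto simp: outer_region_def)
  next
    case False
    then have "2 / (Re z + 2) < 1 / real n" using re z(2) by (simp add: field_simps)
    then show ?thesis using False s(2) by (auto simp: outer_region_def)
  qed
  show "rad m \<le> cmod (z - of_real (cen m))"
  proof (cases "rad m \<le> 1 / real n")
    case True
    show ?thesis
    proof (cases "m = 0")
      case True
      have "rad m \<le> 4" by (rule rad_bounds)
      moreover have "cmod z - 1 \<le> cmod (z - of_real (cen m))"
        using norm_triangle_ineq2[of z "of_real (cen m)"] True by (simp add: cen_def)
      ultimately show ?thesis using far by linarith
    next
      case False
      then have "0 \<le> cen m" by (simp add: cen_def)
      then show ?thesis using True s(4)[of "cen m"] by (simp add: dist_norm)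
    qed
  next
    case False
    then have "sqrt (real m + 1) < 4 * real n" using z(2) by (simp add: rad_def field_simps)
    moreover have "sqrt m \<le> sqrt (real m + 1)" by simp
    moreover have "\<bar>cen m\<bar> \<le> sqrt m + 1" using real_sqrt_ge_zero[of "real m"] by (simp add: cen_def abs_if)
    ultimately have "\<bar>cen m\<bar> + rad m \<le> 4 * real n + 10" using rad_bounds(2)[of m] by linarith
    then show ?thesis using far norm_triangle_ineq2[of z "of_real (cen m)"] by (simp add: norm_of_real)
  qed
qed

section \<open>Chain integrals in \<open>E\<close>, closure properties of \<open>holo\<close>, and
  the splitting theorems\<close>

context frechet
begin

definition elineint :: "(complex \<times> complex) list \<Rightarrow> (complex \<Rightarrow> 'e) \<Rightarrow> 'e" where
  "elineint es Q = (\<Sum>(u, v)\<leftarrow>es. lineint u v Q)"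

lemma dual_elineint:
  assumes "econt (eimg es) Q" "dual \<phi>"
  shows "\<phi> (elineint es Q) = esum es (\<lambda>w. \<phi> (Q w))"
  using assms(1)
proof (induction es)
  case Nil
  then show ?case by (simp add: elineint_def dual_linear[OF assms(2)])
next
  case (Cons e es)
  obtain u v where e: "e = (u, v)" by (cases e)
  have "econt (closed_segment u v) Q" "econt (eimg es) Q"
    using Cons.prems by (auto simp: e intro: econt_subset)
  then show ?case using Cons.IH
    by (simp add: e elineint_def dual_linear[OF assms(2)] dual_lineint[OF _ assms(2)])
qed

text \<open>Compactness of small discs turns continuity into the local bounds that
  \<open>holoI_weak\<close> requires.\<close>

lemma holoI_econt:
  assumes "restr \<Omega> f = f" "open \<Omega>" "\<And>\<phi>. dual \<phi> \<Longrightarrow> (\<lambda>z. \<phi> (f z)) holomorphic_on \<Omega>" "econt \<Omega> f"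
  shows "f \<in> holo sc p \<Omega>"
proof (rule holoI_weak[OF assms(1-3)])
  fix a z assume "z \<in> \<Omega>"
  then obtain r where r: "r > 0" "cball z r \<subseteq> \<Omega>" using assms(2) open_contains_cball by blast
  obtain B where B: "\<And>w. w \<in> cball z r \<Longrightarrow> p a (f w) \<le> B"
    using econt_bounded[OF econt_subset[OF assms(4) r(2)] compact_cball, of a] by blast
  show "\<exists>r>0. \<exists>B. \<forall>w\<in>ball z r. w \<in> \<Omega> \<longrightarrow> p a (f w) \<le> B"
    using r(1) B by (intro exI[of _ r] conjI exI[of _ B]) auto
qed

lemma econt_cong: "econt S f \<Longrightarrow> (\<And>w. w \<in> S \<Longrightarrow> f w = g w) \<Longrightarrow> econt S g"
  unfolding econt_def
proof (intro allI ballI)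
  fix a w assume *: "\<forall>a. \<forall>w\<in>S. ((\<lambda>v. p a (f v - f w)) \<longlongrightarrow> 0) (at w within S)"
    "\<And>w. w \<in> S \<Longrightarrow> f w = g w" "w \<in> S"
  have "((\<lambda>v. p a (f v - f w)) \<longlongrightarrow> 0) (at w within S)" using * by blast
  then show "((\<lambda>v. p a (g v - g w)) \<longlongrightarrow> 0) (at w within S)"
    by (rule Lim_transform_eventually) (simp add: eventually_at_filter * )
qed

lemma econt_add: "econt S f \<Longrightarrow> econt S g \<Longrightarrow> econt S (\<lambda>w. f w + g w)"
  unfolding econt_def
proof (intro allI ballI)
  fix a w assume *: "\<forall>a. \<forall>w\<in>S. ((\<lambda>v. p a (f v - f w)) \<longlongrightarrow> 0) (at w within S)"
    "\<forall>a. \<forall>w\<in>S. ((\<lambda>v. p a (g v - g w)) \<longlongrightarrow> 0) (at w within S)" "w \<in> S"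
  have "((\<lambda>v. p a (f v - f w) + p a (g v - g w)) \<longlongrightarrow> 0) (at w within S)"
    using * by (intro tendsto_add_zero) auto
  then show "((\<lambda>v. p a (f v + g v - (f w + g w))) \<longlongrightarrow> 0) (at w within S)"
    by (rule Lim_null_comparison[rotated]) (simp add: add_diff_add p_add)
qed

lemma restr_restr [simp]: "restr \<Omega> (restr \<Omega> f) = restr \<Omega> f"
  by (auto simp: restr_def)

lemma holo_scale:
  assumes K: "K holomorphic_on \<Omega>" and f: "f \<in> holo sc p \<Omega>'" "\<Omega> \<subseteq> \<Omega>'" "open \<Omega>"
  shows "restr \<Omega> (\<lambda>z. sc (K z) (f z)) \<in> holo sc p \<Omega>"
proof (rule holoI_econt)
  show "(\<lambda>z. \<phi> (restr \<Omega> (\<lambda>z. sc (K z) (f z)) z)) holomorphic_on \<Omega>" if "dual \<phi>" for \<phi>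
  proof -
    have "(\<lambda>z. K z * \<phi> (f z)) holomorphic_on \<Omega>"
      using holo_dual_holomorphic[OF f(1) that] f(2) K
        by (intro holomorphic_intros) (auto intro: holomorphic_on_subset)
    then show ?thesis by (rule holomorphic_transform) (simp add: restr_def dual_linear[OF that])
  qed
  have "econt \<Omega> (\<lambda>z. sc (K z) (f z))"
    by (intro econt_scale holomorphic_on_imp_continuous_on[OF K] econt_subset[OF holo_econt[OF f(1)] f(2)])
  then show "econt \<Omega> (restr \<Omega> (\<lambda>z. sc (K z) (f z)))" by (rule econt_cong) (simp add: restr_def)
qed (use f in auto)

lemma holo_add:
  assumes "f \<in> holo sc p \<Omega>" "g \<in> holo sc p \<Omega>" "open \<Omega>"
  shows "f + g \<in> holo sc p \<Omega>"
proof (rule holoI_econt)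
  have r: "restr \<Omega> f = f" "restr \<Omega> g = g" using assms by (auto simp: holo_def)
  show "restr \<Omega> (f + g) = f + g"
    using r by (auto simp: restr_def fun_eq_iff) (metis add_0)
  show "(\<lambda>z. \<phi> ((f + g) z)) holomorphic_on \<Omega>" if "dual \<phi>" for \<phi>
    using holo_dual_holomorphic[OF assms(1) that] holo_dual_holomorphic[OF assms(2) that]
    by (simp add: dual_linear[OF that]) (intro holomorphic_intros)
  show "econt \<Omega> (f + g)" using econt_add[OF holo_econt[OF assms(1)] holo_econt[OF assms(2)]]
    by (simp add: plus_fun_def)
qed fact

lemma holo_restr:
  assumes "f \<in> holo sc p \<Omega>'" "\<Omega> \<subseteq> \<Omega>'" "open \<Omega>"
  shows "restr \<Omega> f \<in> holo sc p \<Omega>"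
  using holo_scale[of "\<lambda>_. 1", OF _ assms] by simp

lemma holo_cmult:
  assumes "f \<in> holo sc p \<Omega>" "open \<Omega>"
  shows "(\<lambda>z. sc c (f z)) \<in> holo sc p \<Omega>"
proof -
  have "restr \<Omega> (\<lambda>z. sc c (f z)) = (\<lambda>z. sc c (f z))"
    using assms(1) by (auto simp: holo_def restr_def fun_eq_iff) (metis scale_zero_right)
  then show ?thesis using holo_scale[of "\<lambda>_. c", OF _ assms(1) order_refl assms(2)] by simp
qed

lemma holo_minus:
  assumes "f \<in> holo sc p \<Omega>" "open \<Omega>"
  shows "- f \<in> holo sc p \<Omega>"
  using holo_cmult[OF assms, of "-1"] by (simp add: fun_Compl_def)

lemma holo_zero: "open \<Omega> \<Longrightarrow> 0 \<in> holo sc p \<Omega>"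
  by (rule holoI_econt) (auto simp: restr_def econt_def dual_linear(3))

text \<open>The kernels are chosen once, before any functional. So the scalar approximants are the
  images of vectors \<open>y M z\<close> under \<open>\<phi>\<close>, and completeness provides the
  limit \<open>h z\<close>. The bound on a strip is the summed error far out and compactness near
  0.\<close>

theorem bounded_splitting:
  assumes f: "f \<in> holo sc p slit_plane"
  obtains h where "h \<in> holo sc p UNIV"
    "\<And>n a. 1 \<le> n \<Longrightarrow> \<exists>B. \<forall>z\<in>strip_minus {0..\<infinity>} n. p a (f z - h z) \<le> B"
proof -
  obtain \<beta> :: "nat \<Rightarrow> 'a" where \<beta>: "\<And>a. \<exists>i. \<exists>C>0. \<forall>x. p a x \<le> C * p (\<beta> i) x"
    using countable_cofinal by metis
  have "\<forall>i j. \<exists>B\<ge>0. \<forall>w\<in>eimg (piece j). p (\<beta> i) (f w) \<le> B"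
    using econt_bounded[OF econt_subset[OF holo_econt[OF f] piece_slit] compact_eimg] by metis
  then obtain Bd where Bd: "\<And>i j. 0 \<le> Bd i j" "\<And>i j w. w \<in> eimg (piece j) \<Longrightarrow> p (\<beta> i) (f w) \<le> Bd i j"
    by metis
  \<comment> \<open>Diagonal choice: the denominator dominates \<open>Bd i j\<close> for all
    \<open>i \<le> j\<close>. For a seminorm bounded by a multiple of \<open>p (\<beta> i)\<close>,
    the products with \<open>eps j\<close> are at most a multiple of \<open>(1/2)^j\<close> from
    \<open>j = i\<close> on; the finitely many earlier terms do not affect summability.\<close>
  define eps where "eps j = (1/2) ^ j / (1 + (\<Sum>i\<le>j. Bd i j))" for j
  have den: "1 + (\<Sum>i\<le>j. Bd i j) > 0" for j using Bd(1) by (intro add_pos_nonneg sum_nonneg) auto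
  have eps0: "eps j > 0" for j unfolding eps_def using den by (intro divide_pos_pos) auto
  have "\<forall>j. \<exists>E E'. (\<forall>z w. ((\<lambda>z. E z w) has_field_derivative E' z w) (at z)) \<and>
    continuous_on UNIV (\<lambda>(z, w). E' z w) \<and> continuous_on UNIV (\<lambda>(z, w). E z w) \<and>
    (\<forall>w z. cmod (w - of_real (cen j)) \<le> rad j / 2 \<longrightarrow> (\<forall>m\<ge>j. rad m \<le> cmod (z - of_real (cen m))) \<longrightarrow>
       cmod (1 / (w - z) - E z w) \<le> eps j)"
  proof
    fix j
    interpret chain: pole_chain "\<lambda>m. of_real (cen m)" rad by (rule pole_chain_cen)
    obtain E E' where "\<And>z w. ((\<lambda>z. E z w) has_field_derivative E' z w) (at z)"
      "continuous_on UNIV (\<lambda>(z, w). E' z w)" "continuous_on UNIV (\<lambda>(z, w). E z w)"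
      "\<And>w z. cmod (w - of_real (cen j)) \<le> rad j / 2 \<Longrightarrow> (\<And>m. m \<ge> j \<Longrightarrow> rad m \<le> cmod (z - of_real (cen m))) \<Longrightarrow>
       cmod (1 / (w - z) - E z w) \<le> eps j"
      by (rule chain.small_Cauchy_kernel[OF eps0[of j], where j = j]) blast
    then show "\<exists>E E'. (\<forall>z w. ((\<lambda>z. E z w) has_field_derivative E' z w) (at z)) \<and>
      continuous_on UNIV (\<lambda>(z, w). E' z w) \<and> continuous_on UNIV (\<lambda>(z, w). E z w) \<and>
      (\<forall>w z. cmod (w - of_real (cen j)) \<le> rad j / 2 \<longrightarrow> (\<forall>m\<ge>j. rad m \<le> cmod (z - of_real (cen m))) \<longrightarrow>
         cmod (1 / (w - z) - E z w) \<le> eps j)"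
      by blast
  qed
  then obtain E E' where EE: "\<And>j z w. ((\<lambda>z. E j z w) has_field_derivative E' j z w) (at z)"
    "\<And>j. continuous_on UNIV (\<lambda>(z, w). E' j z w)" "\<And>j. continuous_on UNIV (\<lambda>(z, w). E j z w)"
    "\<And>j w z. cmod (w - of_real (cen j)) \<le> rad j / 2 \<Longrightarrow> (\<And>m. m \<ge> j \<Longrightarrow> rad m \<le> cmod (z - of_real (cen m))) \<Longrightarrow>
       cmod (1 / (w - z) - E j z w) \<le> eps j"
    by metis
  interpret small_kernels E E' eps
    by standard (use EE in auto)
  have tau: "\<exists>\<tau>. (\<forall>j. 0 \<le> \<tau> j) \<and> summable \<tau> \<and> (\<forall>j. \<forall>w\<in>eimg (piece j). p a (f w) * eps j \<le> \<tau> j)" for a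
  proof -
    obtain i C where C: "C > 0" "\<And>x. p a x \<le> C * p (\<beta> i) x" using \<beta> by blast
    define \<tau> where "\<tau> j = (if j < i then C * Bd i j * eps j else C * (1/2) ^ j)" for j
    have "summable (\<lambda>j. C * (1/2) ^ j)" by (intro summable_mult summable_geometric) simp
    then have "summable \<tau>"
      by (rule summable_cong[THEN iffD1, rotated])
        (auto simp: \<tau>_def eventually_sequentially intro!: exI[of _ i])
    moreover have "0 \<le> \<tau> j" for j using C(1) Bd(1) eps0[of j] by (simp add: \<tau>_def)
    moreover have "p a (f w) * eps j \<le> \<tau> j" if w: "w \<in> eimg (piece j)" for j w
    proof -
      have "p a (f w) * eps j \<le> C * Bd i j * eps j"
        using C(2)[of "f w"] Bd(2)[OF w, of i] C(1) eps0[of j]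
        by (intro mult_right_mono) (auto intro: order_trans mult_left_mono)
      moreover have "Bd i j * eps j \<le> (1/2) ^ j" if "i \<le> j"
      proof -
        have "Bd i j \<le> (\<Sum>i\<le>j. Bd i j)" using that Bd(1) by (intro member_le_sum) auto
        then have "Bd i j \<le> 1 + (\<Sum>i\<le>j. Bd i j)" by simp
        then have "(1/2) ^ j * Bd i j \<le> (1/2) ^ j * (1 + (\<Sum>i\<le>j. Bd i j))" by (intro mult_left_mono) auto
        then show ?thesis using den[of j] by (simp add: eps_def divide_simps mult.commute)
      qed
      then have "C * Bd i j * eps j \<le> C * (1/2) ^ j" if "i \<le> j"
        using C(1) that by (simp only: mult.assoc) (intro mult_left_mono, auto)
      ultimately show ?thesis unfolding \<tau>_def by (cases "j < i") force+
    qed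
    ultimately show ?thesis by blast
  qed
  have scalar: "\<exists>\<tau>. (\<forall>j. 0 \<le> \<tau> j) \<and> summable \<tau> \<and>
      (\<forall>j. \<forall>w\<in>eimg (piece j). cmod (\<phi> (f w)) * eps j \<le> \<tau> j)" if \<phi>: "dual \<phi>" for \<phi>
  proof -
    obtain a C where C: "C > 0" "\<And>x. cmod (\<phi> x) \<le> C * p a x" using dual_bounded[OF \<phi>] by metis
    obtain \<tau> where \<tau>: "\<And>j. 0 \<le> \<tau> j" "summable \<tau>" "\<And>j w. w \<in> eimg (piece j) \<Longrightarrow> p a (f w) * eps j \<le> \<tau> j"
      using tau[of a] by blast
    have "cmod (\<phi> (f w)) * eps j \<le> C * \<tau> j" if "w \<in> eimg (piece j)" for j w
    proof -
      have "cmod (\<phi> (f w)) * eps j \<le> (C * p a (f w)) * eps j" using C(2) eps0[of j]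
        by (intro mult_right_mono) auto
      also have "\<dots> \<le> C * \<tau> j" using \<tau>(3)[OF that] C(1) by (simp add: mult.assoc)
      finally show ?thesis .
    qed
    then show ?thesis using \<tau> C(1) by (intro exI[of _ "\<lambda>j. C * \<tau> j"]) (auto intro: summable_mult)
  qed
  \<comment> \<open>The vector version of \<open>approx\<close>; each functional maps it to the
    approximant of the scalar function.\<close>
  define y where "y M z = sc (1 / (2 * pi * \<i>)) (elineint (outer M) (\<lambda>w. sc (1 / (w - z)) (f w)) +
     (\<Sum>j<M. elineint (piece j) (\<lambda>w. sc (E j z w) (f w))))" for M z
  have y: "\<phi> (y M z) = approx (\<lambda>w. \<phi> (f w)) M z"
    if \<phi>: "dual \<phi>" and M: "9 \<le> cen M" "1 \<le> M" "z \<in> square' M" for \<phi> M z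
  proof -
    have M0: "0 < cen M" using M by simp
    have ec: "econt S f" if "S \<subseteq> slit_plane" for S using econt_subset[OF holo_econt[OF f] that] .
    have "z \<notin> eimg (outer M)" using square_outer[OF M(2) M0] square'_subset M(3) by blast
    then have "econt (eimg (outer M)) (\<lambda>w. sc (1 / (w - z)) (f w))"
      by (intro econt_scale ec outer_slit M M0 continuous_intros) auto
    moreover have "econt (eimg (piece j)) (\<lambda>w. sc (E j z w) (f w))" for j
      by (intro econt_scale ec piece_slit E_continuous1)
    ultimately show ?thesis
      unfolding y_def approx_def by (simp add: dual_linear[OF \<phi>] dual_elineint[OF _ \<phi>] mult.commute)
  qed
  have ex: "\<exists>l. \<forall>\<phi>. dual \<phi> \<longrightarrow> \<phi> l = entire_part (\<lambda>w. \<phi> (f w)) z" for z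
  proof -
    obtain M where M: "z \<in> square' M" "9 \<le> cen M" "1 \<le> M" using square'_exhaust by metis
    have Mn: "z \<in> square' (n + M)" "9 \<le> cen (n + M)" "1 \<le> n + M" for n
      using M square'_mono[of M "n + M"] cen_mono[of M "n + M"] by auto
    obtain l where l: "\<And>\<phi>. dual \<phi> \<Longrightarrow> (\<lambda>n. \<phi> (y (n + M) z)) \<longlonglongrightarrow> \<phi> l"
    proof (rule weak_complete[of "\<lambda>n. y (n + M) z"])
      fix a and e :: real assume "e > 0"
      obtain \<tau> where \<tau>: "\<And>j. 0 \<le> \<tau> j" "summable \<tau>" "\<And>j w. w \<in> eimg (piece j) \<Longrightarrow> p a (f w) * eps j \<le> \<tau> j"
        using tau[of a] by blast
      have "(\<lambda>N. 2 * (\<Sum>i. \<tau> (i + N))) \<longlonglongrightarrow> 0"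
        using tendsto_mult_right_zero[OF suminf_exist_split2[OF \<tau>(2)]] by simp
      then have "\<forall>\<^sub>F n in sequentially. 2 * (\<Sum>i. \<tau> (i + n)) < e / 2"
        by (rule order_tendstoD(2)) (use \<open>e > 0\<close> in simp)
      then obtain N where N: "\<And>n. n \<ge> N \<Longrightarrow> 2 * (\<Sum>i. \<tau> (i + n)) < e / 2"
        unfolding eventually_sequentially by blast
      have "cmod (\<phi> (y (m + M) z) - \<phi> (y (N + M) z)) \<le> e / 2" if "m \<ge> N" "\<phi> \<in> polar a" for m \<phi>
      proof -
        have \<phi>: "dual \<phi>" by (rule polar_dual[OF that(2)])
        have b: "cmod (\<phi> (f w)) * eps j \<le> \<tau> j" if "w \<in> eimg (piece j)" for j w
          using \<tau>(3)[OF that] mult_right_mono[OF polar_le[OF \<open>\<phi> \<in> polar a\<close>, of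
            "f w"] less_imp_le[OF eps0[of j]]] by linarith
        have "cmod (approx (\<lambda>w. \<phi> (f w)) (m + M) z - approx (\<lambda>w. \<phi> (f w)) (N + M) z) \<le> 2 * (\<Sum>i. \<tau> (i + (N + M)))"
          by (rule approx_Cauchy[OF holo_dual_holomorphic[OF f \<phi>] \<tau>(1,2) b M(2,3) _ _ M(1)]) (use that in auto)
        then show ?thesis using N[of "N + M"] Mn by (simp add: y[OF \<phi>])
      qed
      then have "cmod (\<phi> (y (m + M) z) - \<phi> (y (n + M) z)) \<le> e" if "m \<ge> N" "n \<ge> N" "\<phi> \<in> polar a" for m n \<phi>
        using that by (blast intro: norm_diff_le_halves)
      then show "\<exists>N. \<forall>m\<ge>N. \<forall>n\<ge>N. \<forall>\<phi>\<in>polar a. cmod (\<phi> (y (m + M) z) - \<phi> (y (n + M) z)) \<le> e" by blast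
    qed blast
    have "\<phi> l = entire_part (\<lambda>w. \<phi> (f w)) z" if \<phi>: "dual \<phi>" for \<phi>
    proof -
      obtain \<tau> where \<tau>: "\<And>j. 0 \<le> \<tau> j" "summable \<tau>" "\<And>j w. w \<in> eimg (piece j) \<Longrightarrow> cmod (\<phi> (f w)) * eps j \<le> \<tau> j"
        using scalar[OF \<phi>] by blast
      have "(\<lambda>n. approx (\<lambda>w. \<phi> (f w)) (n + M) z) \<longlonglongrightarrow> entire_part (\<lambda>w. \<phi> (f w)) z"
        by (rule LIMSEQ_ignore_initial_segment)
          (rule approx_converges[OF holo_dual_holomorphic[OF f \<phi>] \<tau>])
      moreover have "(\<lambda>n. approx (\<lambda>w. \<phi> (f w)) (n + M) z) \<longlonglongrightarrow> \<phi> l"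
        using l[OF \<phi>] Mn by (simp add: y[OF \<phi>])
      ultimately show ?thesis using LIMSEQ_unique by blast
    qed
    then show ?thesis by blast
  qed
  then obtain h where h: "\<And>z \<phi>. dual \<phi> \<Longrightarrow> \<phi> (h z) = entire_part (\<lambda>w. \<phi> (f w)) z" by metis
  have "h \<in> holo sc p UNIV"
  proof (rule holoI_weak)
    show "(\<lambda>z. \<phi> (h z)) holomorphic_on UNIV" if \<phi>: "dual \<phi>" for \<phi>
      unfolding h[OF \<phi>] using entire_part_holomorphic[OF holo_dual_holomorphic[OF f \<phi>]] scalar[OF \<phi>] by blast
    fix a z
    obtain M where M: "z \<in> square' M" "9 \<le> cen M" "1 \<le> M" using square'_exhaust by metis
    have M0: "0 < cen M" using M by simp
    have "open (square' M)" by (simp add: square'_eq open_box)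
    then obtain r where r: "r > 0" "cball z r \<subseteq> square' M" using M(1) open_contains_cball by blast
    obtain \<tau> where \<tau>: "\<And>j. 0 \<le> \<tau> j" "summable \<tau>" "\<And>j w. w \<in> eimg (piece j) \<Longrightarrow> p a (f w) * eps j \<le> \<tau> j"
      using tau[of a] by blast
    \<comment> \<open>Bounds on the integrals that make up one approximant, uniform in the point and
      over the polar. Together with the tail estimate for \<open>entire_part\<close> they give the
      local boundedness that \<open>holoI_weak\<close> asks for.\<close>
    have kb: "\<exists>B\<ge>0. \<forall>v\<in>cball z r. \<forall>\<phi>\<in>polar a. cmod (esum es (\<lambda>w. \<phi> (f w) * K v w)) \<le> B"
      if es: "eimg es \<subseteq> slit_plane" and K: "continuous_on (cball z r \<times> eimg es) (\<lambda>(v, w). K v w)" for es K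
    proof -
      have "bounded ((\<lambda>(v, w). K v w) ` (cball z r \<times> eimg es))"
        by (intro compact_imp_bounded compact_continuous_image[OF K] compact_Times compact_cball compact_eimg)
      then obtain B1 where B1: "B1 > 0" "\<And>v w. v \<in> cball z r \<Longrightarrow> w \<in> eimg es \<Longrightarrow> cmod (K v w) \<le> B1"
        unfolding bounded_pos by auto
      obtain B2 where B2: "B2 \<ge> 0" "\<And>w. w \<in> eimg es \<Longrightarrow> p a (f w) \<le> B2"
        using econt_bounded[OF econt_subset[OF holo_econt[OF f] es] compact_eimg, of a] by blast
      have "cmod (esum es (\<lambda>w. \<phi> (f w) * K v w)) \<le> (B2 * B1) * elen es"
        if v: "v \<in> cball z r" and \<phi>: "\<phi> \<in> polar a" for v \<phi>
      proof (rule esum_bound)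
        have "continuous_on (eimg es) (\<lambda>w. (\<lambda>(v, w). K v w) (v, w))"
          by (rule continuous_on_compose2[OF K]) (use v in \<open>auto intro: continuous_intros\<close>)
        then show "continuous_on (eimg es) (\<lambda>w. \<phi> (f w) * K v w)"
          by (intro continuous_on_mult econt_dual_continuous[OF econt_subset[OF holo_econt[OF f] es]
            polar_dual[OF \<phi>]]) simp
        show "cmod (\<phi> (f w) * K v w) \<le> B2 * B1" if "w \<in> eimg es" for w
          unfolding norm_mult using polar_le[OF \<phi>, of "f w"] B2 B1 v that
          by (intro mult_mono) (auto intro: order_trans)
      qed (use B1 B2 in auto)
      then show ?thesis using B1 B2 elen_nonneg[of es] by (intro exI[of _ "(B2 * B1) * elen es"]) auto
    qed
    have "\<exists>B\<ge>0. \<forall>v\<in>cball z r. \<forall>\<phi>\<in>polar a. cmod (esum (outer M) (\<lambda>w. \<phi> (f w) * (1 / (w - v)))) \<le> B"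
    proof (rule kb[OF outer_slit[OF M(3) M0]])
      have "w \<noteq> v" if "v \<in> cball z r" "w \<in> eimg (outer M)" for v w
        using that r(2) square'_subset[of M] square_outer[OF M(3) M0] by blast
      then show "continuous_on (cball z r \<times> eimg (outer M)) (\<lambda>(v, w). 1 / (w - v))"
        unfolding split_beta by (intro continuous_intros) auto
    qed
    then obtain B0 where B0: "B0 \<ge> 0" "\<And>v \<phi>. v \<in> cball z r \<Longrightarrow> \<phi> \<in> polar a \<Longrightarrow>
      cmod (esum (outer M) (\<lambda>w. \<phi> (f w) * (1 / (w - v)))) \<le> B0" by blast
    have "\<forall>j. \<exists>B\<ge>0. \<forall>v\<in>cball z r. \<forall>\<phi>\<in>polar a. cmod (esum (piece j) (\<lambda>w. \<phi> (f w) * E j v w)) \<le> B"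
      by (intro allI kb piece_slit continuous_on_subset[OF E_continuous]) auto
    then obtain B1 where B1: "\<And>j. B1 j \<ge> 0" "\<And>j v \<phi>. v \<in> cball z r \<Longrightarrow> \<phi> \<in> polar a \<Longrightarrow>
      cmod (esum (piece j) (\<lambda>w. \<phi> (f w) * E j v w)) \<le> B1 j" by metis
    have "p a (h v) \<le> cmod (1 / (2 * pi * \<i>)) * (B0 + (\<Sum>j<M. B1 j)) + 2 * (\<Sum>i. \<tau> (i + M))"
      if v: "v \<in> ball z r" for v
    proof (rule seminorm_le_polar)
      fix \<phi> assume \<phi>': "\<phi> \<in> polar a"
      have \<phi>: "dual \<phi>" by (rule polar_dual[OF \<phi>'])
      have v': "v \<in> cball z r" using v by auto
      have b: "cmod (\<phi> (f w)) * eps j \<le> \<tau> j" if "w \<in> eimg (piece j)" for j w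
        using \<tau>(3)[OF that] mult_right_mono[OF polar_le[OF \<phi>', of "f w"] less_imp_le[OF eps0[of j]]] by linarith
      have "cmod (entire_part (\<lambda>w. \<phi> (f w)) v - approx (\<lambda>w. \<phi> (f w)) M v) \<le> 2 * (\<Sum>i. \<tau> (i + M))"
        by (rule approx_entire_part[OF holo_dual_holomorphic[OF f \<phi>] \<tau>(1,2) b M(2,3) order_refl])
          (use v' r in auto)
      moreover have "cmod (approx (\<lambda>w. \<phi> (f w)) M v) \<le> cmod (1 / (2 * pi * \<i>)) * (B0 + (\<Sum>j<M. B1 j))"
        unfolding approx_def norm_mult[of "1 / (2 * pi * \<i>)"]
        by (intro mult_left_mono norm_triangle_mono B0 v' \<phi>' sum_norm_le B1) auto
      ultimately show "cmod (\<phi> (h v)) \<le> cmod (1 / (2 * pi * \<i>)) * (B0 + (\<Sum>j<M. B1 j)) + 2 * (\<Sum>i. \<tau> (i + M))"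
        unfolding h[OF \<phi>]
        using norm_triangle_sub[of "entire_part (\<lambda>w. \<phi> (f w)) v" "approx (\<lambda>w. \<phi> (f w)) M v"] by linarith
    qed
    then show "\<exists>r>0. \<exists>B. \<forall>w\<in>ball z r. w \<in> UNIV \<longrightarrow> p a (h w) \<le> B" using r(1) by blast
  qed (auto simp: restr_def)
  moreover have "\<exists>B. \<forall>z\<in>strip_minus {0..\<infinity>} n. p a (f z - h z) \<le> B" if n: "1 \<le> n" for n a
  proof -
    obtain \<tau> where \<tau>: "\<And>j. 0 \<le> \<tau> j" "summable \<tau>" "\<And>j w. w \<in> eimg (piece j) \<Longrightarrow> p a (f w) * eps j \<le> \<tau> j"
      using tau[of a] by blast
    have 1: "p a (f z - h z) \<le> 2 * (\<Sum>i. \<tau> i)"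
      if z: "z \<in> strip_minus {0..\<infinity>} n" "4 * real n + 10 < cmod z" for z
    proof (rule seminorm_le_polar)
      fix \<phi> assume \<phi>': "\<phi> \<in> polar a"
      have \<phi>: "dual \<phi>" by (rule polar_dual[OF \<phi>'])
      have b: "cmod (\<phi> (f w)) * eps j \<le> \<tau> j" if "w \<in> eimg (piece j)" for j w
        using \<tau>(3)[OF that] mult_right_mono[OF polar_le[OF \<phi>', of "f w"] less_imp_le[OF eps0[of j]]] by linarith
      have "cmod (\<phi> (f z) - entire_part (\<lambda>w. \<phi> (f w)) z) \<le> 2 * (\<Sum>i. \<tau> i)"
        by (rule F_minus_entire_part[OF holo_dual_holomorphic[OF f \<phi>] \<tau>(1,2) b strip_outer(1)[OF z(1) n z(2)]
           strip_outer(2)[OF z(1) n z(2)]])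
      then show "cmod (\<phi> (f z - h z)) \<le> 2 * (\<Sum>i. \<tau> i)" by (simp add: dual_linear[OF \<phi>] h[OF \<phi>])
    qed
    \<comment> \<open>The part of the strip that is not covered by the estimate at infinity lies in
      this compact subset of the slit plane.\<close>
    define C :: "complex set" where "C = cball 0 (4 * real n + 10) \<inter> (\<Inter>x\<in>{0..}. {z. 1 / real n
      \<le> dist z (of_real x)})"
    have "compact C"
      unfolding C_def by (intro compact_Int_closed compact_cball closed_INT ballI closed_Collect_le
        continuous_intros)
    have "C \<subseteq> slit_plane"
    proof
      fix z assume z: "z \<in> C"
      show "z \<in> slit_plane"
      proof (rule ccontr)
        assume "z \<notin> slit_plane"
        then have "z = of_real (Re z)" "0 \<le> Re z" by (auto simp: complex_eq_iff)
        then have "1 / real n \<le> dist z z" using z unfolding C_def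
          by (metis (no_types, lifting) IntD2 INT_D atLeast_iff mem_Collect_eq)
        then show False using n by simp
      qed
    qed
    obtain B1 where B1: "\<And>w. w \<in> C \<Longrightarrow> p a (f w) \<le> B1"
      using econt_bounded[OF econt_subset[OF holo_econt[OF f] \<open>C \<subseteq> slit_plane\<close>] \<open>compact C\<close>, of a] by blast
    obtain B2 where B2: "\<And>w. w \<in> C \<Longrightarrow> p a (h w) \<le> B2"
      using econt_bounded[OF econt_subset[OF holo_econt[OF \<open>h \<in> holo sc p UNIV\<close>] subset_UNIV] \<open>compact C\<close>,
        of a] by blast
    have "p a (f z - h z) \<le> max (2 * (\<Sum>i. \<tau> i)) (B1 + B2)" if z: "z \<in> strip_minus {0..\<infinity>} n" for z
    proof (cases "4 * real n + 10 < cmod z")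
      case True
      then show ?thesis using 1[OF z] by simp
    next
      case False
      then have "z \<in> C" unfolding C_def using strip_far(4)[OF z n] by simp
      then have "p a (f z - h z) \<le> B1 + B2" using B1[of z] B2[of z] p_diff[of a "f z" "h z"] by linarith
      then show ?thesis by simp
    qed
    then show ?thesis by blast
  qed
  ultimately show ?thesis using that by blast
qed

text \<open>Multiplying by \<open>exp (z\<^sup>2)\<close> before splitting and by \<open>exp (- z\<^sup>2)\<close> afterwards turns
  boundedness into superexponential decay on strips.\<close>

theorem hyperfunction_splitting:
  assumes f: "f \<in> holo sc p slit_plane"
  obtains g h where "g \<in> H_minus_inf sc p {0..\<infinity>}" "h \<in> holo sc p UNIV" "f = g + restr slit_plane h"
proof -
  define f1 where "f1 = restr slit_plane (\<lambda>z. sc (exp (z\<^sup>2)) (f z))"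
  have "f1 \<in> holo sc p slit_plane"
    unfolding f1_def by (rule holo_scale[OF _ f order_refl open_slit_plane]) (intro holomorphic_intros)
  then obtain h1 where h1: "h1 \<in> holo sc p UNIV"
    "\<And>n a. 1 \<le> n \<Longrightarrow> \<exists>B. \<forall>z\<in>strip_minus {0..\<infinity>} n. p a (f1 z - h1 z) \<le> B"
    using bounded_splitting by metis
  define h where "h = restr UNIV (\<lambda>z. sc (exp (- z\<^sup>2)) (h1 z))"
  have h: "h \<in> holo sc p UNIV"
    unfolding h_def by (rule holo_scale[OF _ h1(1)]) (auto intro!: holomorphic_intros)
  define g where "g = f + - restr slit_plane h"
  have g: "g \<in> holo sc p slit_plane"
    unfolding g_def by (intro holo_add[OF f] holo_minus holo_restr[OF h] open_slit_plane) simp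
  have "g \<in> H_minus_inf sc p {0..\<infinity>}"
    unfolding H_minus_inf_def weighted_holo_def
  proof (intro CollectI conjI allI impI g)
    fix n :: nat and a assume n: "1 \<le> n"
    obtain B where B: "\<And>z. z \<in> strip_minus {0..\<infinity>} n \<Longrightarrow> p a (f1 z - h1 z) \<le> B" using h1(2)[OF n] by blast
    have "p a (g z) * exp (real n * \<bar>Re z\<bar>) \<le> \<bar>B\<bar> * exp (2 * real n ^ 2)" if z: "z \<in> strip_minus {0..\<infinity>} n" for z
    proof -
      have zs: "z \<in> slit_plane" by (rule strip_far(3)[OF z n])
      have "g z = sc (exp (- z\<^sup>2)) (f1 z - h1 z)"
        using zs by (simp add: g_def f1_def h_def restr_def scale_right_diff_distrib exp_minus)
      then have pg: "p a (g z) = exp ((Im z)\<^sup>2 - (Re z)\<^sup>2) * p a (f1 z - h1 z)"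
        by (simp add: p_scale Re_power2)
      \<comment> \<open>The real part of \<open>- z^2\<close> is \<open>(Im z)^2 - (Re z)^2\<close>.
        On the strip the first term is at most \<open>n^2\<close>, and the second absorbs the linear
        weight at the cost of another \<open>n^2\<close>.\<close>
      have ex: "exp ((Im z)\<^sup>2 - (Re z)\<^sup>2) * exp (real n * \<bar>Re z\<bar>) \<le> exp (2 * real n ^ 2)"
      proof -
        have "(Im z)\<^sup>2 \<le> real n ^ 2" using strip_far(1)[OF z n] by (intro power2_le_iff_abs_le[THEN iffD2]) auto
        moreover have "real n * \<bar>Re z\<bar> - (Re z)\<^sup>2 \<le> real n ^ 2"
        proof -
          have "0 \<le> (real n - \<bar>Re z\<bar>)\<^sup>2 + real n * \<bar>Re z\<bar>" by (intro add_nonneg_nonneg) auto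
          then show ?thesis by (simp add: power2_diff)
        qed
        ultimately show ?thesis by (simp flip: exp_add)
      qed
      have "p a (g z) * exp (real n * \<bar>Re z\<bar>) \<le> exp (2 * real n ^ 2) * p a (f1 z - h1 z)"
        using mult_right_mono[OF ex p_nonneg[of a "f1 z - h1 z"]] unfolding pg
          by (simp only: mult.commute mult.left_commute)
      also have "\<dots> \<le> exp (2 * real n ^ 2) * \<bar>B\<bar>" using B[OF z] by (intro mult_left_mono) auto
      finally show ?thesis by (simp add: mult.commute)
    qed
    then show "bdd_above ((\<lambda>z. p a (g z) * exp (real n * \<bar>Re z\<bar>)) ` strip_minus {0..\<infinity>} n)"
      by (intro bdd_aboveI2)
  qed
  moreover have "f = g + restr slit_plane h" by (simp add: g_def)
  ultimately show ?thesis using that h by blast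
qed

end

section \<open>Laplace integrals along the boundary of a tube\<close>

text \<open>The mean value inequality compares \<open>P\<close> along the ray with
  \<open>- (A / \<delta>) * exp (- \<delta> * t)\<close>, a primitive of the bound. The result is
  uniform in the far end \<open>t\<close>, so it controls the tail of an improper integral.\<close>

lemma ray_primitive_bound:
  fixes P q :: "complex \<Rightarrow> complex"
  assumes P: "\<And>t. s \<le> t \<Longrightarrow> (P has_field_derivative q (u + of_real t * d)) (at (u + of_real t * d))"
    and d: "cmod d = 1" and q: "\<And>t. s \<le> t \<Longrightarrow> cmod (q (u + of_real t * d)) \<le> A * exp (- \<delta> * t)"
    and "0 < \<delta>" "s \<le> t"
  shows "cmod (P (u + of_real t * d) - P (u + of_real s * d)) \<le> A / \<delta> * exp (- \<delta> * s)"
proof (cases "s = t")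
  case True
  have "0 \<le> A * exp (- \<delta> * s)" using q[of s] norm_ge_zero order_trans by blast
  then show ?thesis using True \<open>0 < \<delta>\<close> by (simp add: zero_le_mult_iff)
next
  case False
  then have "s < t" using \<open>s \<le> t\<close> by simp
  have der: "((\<lambda>t. P (u + of_real t * d)) has_vector_derivative (d * q (u + of_real x * d))) (at x)"
    if "s \<le> x" for x
  proof -
    have "((\<lambda>t. u + of_real t * d) has_vector_derivative d) (at x)"
      by (auto intro!: derivative_eq_intros simp: has_vector_derivative_def scaleR_conv_of_real)
    then show ?thesis
      using field_vector_diff_chain_at[of "\<lambda>t. u + of_real t * d" d x P] P[OF that] by (simp add: o_def)
  qed
  have "norm (P (u + of_real t * d) - P (u + of_real s * d))
    \<le> (- (A / \<delta>) * exp (- \<delta> * t)) - (- (A / \<delta>) * exp (- \<delta> * s))"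
  proof (rule differentiable_bound_general[OF \<open>s < t\<close>, where \<phi>' = "\<lambda>t. A * exp (- \<delta> * t)"])
    show "continuous_on {s..t} (\<lambda>t. P (u + of_real t * d))"
      using der by (intro continuous_at_imp_continuous_on ballI has_vector_derivative_continuous) auto
    show "((\<lambda>t. P (u + of_real t * d)) has_vector_derivative d * q (u + of_real x * d)) (at x)"
      if "s < x" "x < t" for x using der that by simp
    show "((\<lambda>t. - (A / \<delta>) * exp (- \<delta> * t)) has_vector_derivative A * exp (- \<delta> * x)) (at x)" for x
      unfolding has_real_derivative_iff_has_vector_derivative[symmetric]
      using \<open>0 < \<delta>\<close> by (auto intro!: derivative_eq_intros)
    show "norm (d * q (u + of_real x * d)) \<le> A * exp (- \<delta> * x)" if "s < x" "x < t" for x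
      using q[of x] that d by (simp add: norm_mult)
  qed (intro continuous_intros)
  moreover have "0 \<le> A * exp (- \<delta> * t)" using q[OF \<open>s \<le> t\<close>] norm_ge_zero order_trans by blast
  then have "0 \<le> A / \<delta> * exp (- \<delta> * t)" using \<open>0 < \<delta>\<close> by (simp add: zero_le_mult_iff)
  ultimately show ?thesis by simp
qed

text \<open>The boundary of the tube, truncated at \<open>Re z = R\<close> and straightened to two
  segments through -1. For a function holomorphic on the slit plane only the end points matter, so
  the integral along the curved boundary is the same.\<close>

definition jump :: "real \<Rightarrow> (complex \<Rightarrow> complex) \<Rightarrow> real \<Rightarrow> complex" where
  "jump c q R = esum [(Complex R (-c), -1), (-1, Complex R c)] q"

lemma jump_edges_slit: "c \<noteq> 0 \<Longrightarrow> eimg [(Complex R (-c), -1), (-1, Complex R c)] \<subseteq> slit_plane"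
  using slit_plane_segment[of "-1" "Complex R (-c)"] slit_plane_segment[of "-1" "Complex R c"]
  by (simp add: closed_segment_commute)

lemma jump_primitive:
  assumes "\<And>z. z \<in> slit_plane \<Longrightarrow> (P has_field_derivative q z) (at z)" "c \<noteq> 0"
  shows "jump c q R = P (Complex R c) - P (Complex R (-c))"
  unfolding jump_def
  by (subst esum_primitive[OF assms(1)]) (use jump_edges_slit[OF assms(2)] in blast, simp)

lemma Complex_ray: "Complex R c = Complex 0 c + of_real R * 1"
  by (simp add: complex_eq_iff)

lemma jump_tail:
  assumes hol: "q holomorphic_on slit_plane" and "c \<noteq> 0" "0 < \<delta>" "R \<le> R'"
    and q: "\<And>x. R \<le> x \<Longrightarrow> cmod (q (Complex x c)) \<le> A * exp (- \<delta> * x)"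
     "\<And>x. R \<le> x \<Longrightarrow> cmod (q (Complex x (-c))) \<le> A * exp (- \<delta> * x)"
  shows "cmod (jump c q R' - jump c q R) \<le> 2 * (A / \<delta>) * exp (- \<delta> * R)"
proof -
  obtain P where P: "\<And>z. z \<in> slit_plane \<Longrightarrow> (P has_field_derivative q z) (at z)"
    using slit_plane_primitive[OF hol] by metis
  have 1: "cmod (P (Complex R' y) - P (Complex R y)) \<le> A / \<delta> * exp (- \<delta> * R)" if y: "y = c \<or> y = - c" for y
    unfolding Complex_ray[of R'] Complex_ray[of R]
  proof (rule ray_primitive_bound[OF _ _ _ assms(3,4)])
    show "(P has_field_derivative q (Complex 0 y + of_real t * 1)) (at (Complex 0 y + of_real t * 1))" for t
      by (rule P) (use y \<open>c \<noteq> 0\<close> in auto)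
    show "cmod (q (Complex 0 y + of_real t * 1)) \<le> A * exp (- \<delta> * t)" if "R \<le> t" for t
      unfolding Complex_ray[symmetric] using q that y by auto
  qed simp
  have "jump c q R' - jump c q R = (P (Complex R' c) - P (Complex R c)) - (P (Complex R' (-c))
    - P (Complex R (-c)))"
    using jump_primitive[OF P \<open>c \<noteq> 0\<close>] by simp
  also have "cmod \<dots> \<le> A / \<delta> * exp (- \<delta> * R) + A / \<delta> * exp (- \<delta> * R)"
    using norm_triangle_ineq4 1[of c] 1[of "-c"] add_mono order_trans by blast
  finally show ?thesis by simp
qed

text \<open>At abscissa \<open>R\<close> the contours of heights \<open>c\<close> and
  \<open>c'\<close> are joined by two vertical segments, on which the integrand decays exponentially
  in \<open>R\<close>.\<close>

lemma jump_independent: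
  assumes hol: "q holomorphic_on slit_plane" and c: "0 < c" "c \<le> c'" and "0 < \<delta>"
    and q: "\<And>z. 0 \<le> Re z \<Longrightarrow> c \<le> \<bar>Im z\<bar> \<Longrightarrow> \<bar>Im z\<bar> \<le> c' \<Longrightarrow> cmod (q z) \<le> A * exp (- \<delta> * Re z)"
  shows "(\<lambda>n. jump c' q (real n) - jump c q (real n)) \<longlonglongrightarrow> 0"
proof -
  obtain P where P: "\<And>z. z \<in> slit_plane \<Longrightarrow> (P has_field_derivative q z) (at z)"
    using slit_plane_primitive[OF hol] by metis
  have seg: "cmod (P (Complex R (s * c')) - P (Complex R (s * c))) \<le> (A * exp (- \<delta> * R)) * (c' - c)"
    if R: "0 \<le> R" and s: "s = 1 \<or> s = -1" for R s
  proof -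
    let ?u = "Complex R (s * c)" and ?v = "Complex R (s * c')"
    have on: "Re w = R \<and> c \<le> \<bar>Im w\<bar> \<and> \<bar>Im w\<bar> \<le> c' \<and> w \<in> slit_plane" if w: "w \<in> closed_segment ?u ?v" for w
    proof -
      obtain t where t: "0 \<le> t" "t \<le> 1" "w = (1 - t) *\<^sub>R ?u + t *\<^sub>R ?v" using w by (auto simp: in_segment)
      have im: "Im w = s * ((1 - t) * c + t * c')" by (simp add: t(3) algebra_simps)
      have "0 \<le> t * (c' - c)" "t * (c' - c) \<le> 1 * (c' - c)"
        using t c by (intro mult_nonneg_nonneg mult_right_mono; simp)+
      then have "c \<le> (1 - t) * c + t * c'" "(1 - t) * c + t * c' \<le> c'"
        by (simp_all add: algebra_simps)
      then have "c \<le> \<bar>Im w\<bar>" "\<bar>Im w\<bar> \<le> c'" using s c(1) im by (auto simp: abs_mult)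
      moreover have "Re w = R" by (simp add: t(3) algebra_simps)
      ultimately show ?thesis using c(1) by (auto simp: slit_plane_iff)
    qed
    have "contour_integral (linepath ?u ?v) q = P ?v - P ?u"
      by (rule contour_integral_linepath_primitive) (use on P in blast)
    moreover have "cmod (contour_integral (linepath ?u ?v) q) \<le> (A * exp (- \<delta> * R)) * cmod (?v - ?u)"
    proof (rule contour_integral_bound_linepath)
      have "continuous_on (closed_segment ?u ?v) q"
        by (rule continuous_on_subset[OF holomorphic_on_imp_continuous_on[OF hol]]) (use on in blast)
      then show "q contour_integrable_on linepath ?u ?v" by (rule contour_integrable_continuous_linepath)
      show b: "cmod (q w) \<le> A * exp (- \<delta> * R)" if "w \<in> closed_segment ?u ?v" for w
        using q[of w] on[OF that] R by auto
      show "0 \<le> A * exp (- \<delta> * R)" using order_trans[OF norm_ge_zero b[of ?u]] by simp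
    qed
    moreover have "cmod (?v - ?u) = c' - c"
    proof -
      have "?v - ?u = of_real (s * (c' - c)) * \<i>" by (simp add: complex_eq_iff algebra_simps)
      then have "cmod (?v - ?u) = \<bar>s * (c' - c)\<bar>" by (simp only: norm_mult norm_of_real norm_ii mult_1_right)
      then show ?thesis using s c by (auto simp: abs_mult)
    qed
    ultimately show ?thesis by simp
  qed
  have lim: "(\<lambda>n. 2 * ((A * exp (- \<delta> * real n)) * (c' - c))) \<longlonglongrightarrow> 0"
  proof -
    have "(\<lambda>n. exp (- \<delta>) ^ n) \<longlonglongrightarrow> 0" using \<open>0 < \<delta>\<close> by (intro LIMSEQ_realpow_zero) auto
    then have "(\<lambda>n. exp (- \<delta> * real n)) \<longlonglongrightarrow> 0" by (simp add: exp_of_nat_mult[symmetric] mult.commute)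
    from tendsto_mult_right_zero[OF this, of "2 * A * (c' - c)"] show ?thesis
      by (rule back_subst[of "\<lambda>f. f \<longlonglongrightarrow> 0"]) (auto simp: algebra_simps)
  qed
  show ?thesis
  proof (rule Lim_null_comparison[OF _ lim], rule always_eventually, rule allI)
    fix n
    have "jump c' q (real n) - jump c q (real n) =
      (P (Complex n (1 * c')) - P (Complex n (1 * c))) - (P (Complex n ((-1) * c')) - P (Complex n ((-1) * c)))"
      using jump_primitive[OF P] c by simp
    also have "cmod \<dots> \<le> (A * exp (- \<delta> * real n)) * (c' - c) + (A * exp (- \<delta> * real n)) * (c' - c)"
      by (rule order_trans[OF norm_triangle_ineq4]) (intro add_mono seg, auto)
    finally show "norm (jump c' q (real n) - jump c q (real n)) \<le> 2 * ((A * exp (- \<delta> * real n)) * (c' - c))"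
      unfolding mult_2 .
  qed
qed

section \<open>The parametrised contour and its integral\<close>

lemma gamma_path_eq:
  "gamma_path c t = (if t \<le> -1 then Complex (- 1 - t) (- c)
     else if t \<le> 1 then complex_of_real c * cis (pi - pi / 2 * t) else Complex (t - 1) c)"
  by (auto simp: gamma_path_def complex_eq_iff)

lemma continuous_gamma_path: "continuous_on UNIV (gamma_path c)"
proof -
  have cx: "continuous_on S (\<lambda>t. Complex (f t) (g t))" if "continuous_on S f" "continuous_on S g"
    for S :: "real set" and f g
    using that by (simp add: Complex_eq) (intro continuous_intros)
  have "continuous_on UNIV (\<lambda>t. if t \<le> -1 then Complex (- 1 - t) (- c)
     else if t \<le> 1 then complex_of_real c * cis (pi - pi / 2 * t) else Complex (t - 1) c)"
  proof (rule continuous_on_cases_le)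
    show "continuous_on {t \<in> UNIV. -1 \<le> t} (\<lambda>t. if t \<le> 1 then complex_of_real c * cis (pi
      - pi / 2 * t) else Complex (t - 1) c)"
    proof (rule continuous_on_cases_le)
      show "complex_of_real c * cis (pi - pi / 2 * t) = Complex (t - 1) c" if "t = 1" for t :: real
        using that by (simp add: complex_eq_iff)
    qed (intro continuous_intros cx)+
    show "Complex (- 1 - t) (- c) = (if t \<le> 1 then complex_of_real c * cis (pi - pi / 2 * t) else Complex (t
      - 1) c)"
      if "t = -1" for t :: real
    proof -
      have "cos (pi + pi / 2) = 0" "sin (pi + pi / 2) = -1"
        unfolding cos_add sin_add by simp_all
      then show ?thesis using that by (simp add: complex_eq_iff)
    qed
  qed (intro continuous_intros cx)+
  then show ?thesis by (simp add: gamma_path_eq[abs_def])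
qed

definition gamma_deriv :: "real \<Rightarrow> real \<Rightarrow> complex" where
  "gamma_deriv c t = (if t \<le> -1 then -1 else if t < 1 then complex_of_real c * ((- pi / 2) *\<^sub>R (\<i> * cis (pi
    - pi / 2 * t))) else 1)"

lemma gamma_path_derivative:
  assumes "t \<noteq> -1" "t \<noteq> 1"
  shows "(gamma_path c has_vector_derivative gamma_deriv c t) (at t)"
proof -
  consider "t < -1" | "-1 < t" "t < 1" | "1 < t" using assms by linarith
  then show ?thesis
  proof cases
    case 1
    have "((\<lambda>t. of_real (- 1 - t) + Complex 0 (- c)) has_vector_derivative of_real (-1)) (at t)"
      by (auto intro!: derivative_eq_intros)
    then have "((\<lambda>t. of_real (- 1 - t) + Complex 0 (- c)) has_vector_derivative gamma_deriv c t) (at t)"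
      using 1 by (simp add: gamma_deriv_def)
    then show ?thesis
      by (rule has_vector_derivative_transform_within_open[of _ _ _ "{..< -1}"])
        (use 1 in \<open>auto simp: gamma_path_def complex_eq_iff\<close>)
  next
    case 2
    have "((\<lambda>t. complex_of_real c * cis (pi - pi / 2 * t)) has_vector_derivative gamma_deriv c t) (at t)"
    proof -
      have "((\<lambda>z. of_real c * exp (\<i> * (of_real pi - of_real pi / 2 * z))) has_field_derivative
        of_real c * (exp (\<i> * (of_real pi - of_real pi / 2 * of_real t)) * (\<i> * (- (of_real pi / 2))))) (at
          (of_real t))"
        by (auto intro!: derivative_eq_intros)
      from has_vector_derivative_real_field[OF this] show ?thesis
        using 2 by (simp add: gamma_deriv_def cis_conv_exp scaleR_conv_of_real ac_simps)
    qed
    then show ?thesis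
      by (rule has_vector_derivative_transform_within_open[of _ _ _ "{-1<..<1}"])
        (use 2 in \<open>auto simp: gamma_path_def\<close>)
  next
    case 3
    have "((\<lambda>t. of_real (t - 1) + Complex 0 c) has_vector_derivative of_real 1) (at t)"
      by (auto intro!: derivative_eq_intros)
    then have "((\<lambda>t. of_real (t - 1) + Complex 0 c) has_vector_derivative gamma_deriv c t) (at t)"
      using 3 by (simp add: gamma_deriv_def)
    then show ?thesis
      by (rule has_vector_derivative_transform_within_open[of _ _ _ "{1<..}"])
        (use 3 in \<open>auto simp: gamma_path_def complex_eq_iff\<close>)
  qed
qed

lemma gamma_path_slit:
  assumes "0 < c"
  shows "gamma_path c t \<in> slit_plane"
proof (cases "-1 < t \<and> t < 1")
  case True
  have "cos (pi - pi / 2 * t) < 0"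
  proof -
    have "pi / 2 * (-1) < pi / 2 * t" "pi / 2 * t < pi / 2 * 1"
      using True by (intro mult_strict_left_mono; simp)+
    then have "0 < cos (pi / 2 * t)" by (intro cos_gt_zero_pi) auto
    then show ?thesis unfolding cos_diff by simp
  qed
  then have "c * cos (pi - pi / 2 * t) < 0" using assms by (simp only: mult_pos_neg)
  then have "Re (gamma_path c t) < 0" using True by (simp only: gamma_path_def) simp
  then show ?thesis by (simp add: slit_plane_iff)
next
  case False
  then show ?thesis using assms by (auto simp: slit_plane_iff gamma_path_def)
qed

lemma integrable_exp_abs:
  assumes "0 < (\<delta>::real)"
  shows "integrable lborel (\<lambda>t. exp (- \<delta> * \<bar>t\<bar>))"
proof -
  define G where "G t = indicator {0..} t *\<^sub>R exp (- \<delta> * t)" for t :: real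
  have "((\<lambda>t. exp (- \<delta> * t)) has_integral exp (- \<delta> * 0) / \<delta>) {0..}"
    by (rule has_integral_exp_minus_to_infinity[OF assms])
  then have "(\<lambda>t. exp (- \<delta> * t)) absolutely_integrable_on {0..}"
    by (intro nonnegative_absolutely_integrable_1) auto
  then have "integrable lebesgue G" unfolding set_integrable_def G_def[abs_def] .
  moreover have "G \<in> borel_measurable lborel" unfolding G_def by measurable
  ultimately have G: "integrable lborel G" by (simp add: integrable_completion)
  then have "integrable lborel (\<lambda>t. G (0 + (-1) * t))" by (rule lborel_integrable_real_affine) simp
  then have "integrable lborel (\<lambda>t. G t + G (0 + (-1) * t))" using G
    by (rule Bochner_Integration.integrable_add[rotated])
  then show ?thesis
    by (rule Bochner_Integration.integrable_bound) (auto simp: G_def indicator_def abs_if)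
qed

text \<open>The integrand is dominated by a multiple of
  \<open>exp (- \<delta> * \<bar>t\<bar>)\<close>, so the integral is the limit over the intervals
  from \<open>-(n + 1)\<close> to \<open>n + 1\<close>. There a primitive evaluates it to a
  difference at the end points, which is \<open>jump c q n\<close>.\<close>

lemma has_gamma_integral_scalar:
  assumes hol: "q holomorphic_on slit_plane" and c: "0 < c" and "0 < \<delta>"
    and q: "\<And>x y. 0 \<le> x \<Longrightarrow> \<bar>y\<bar> = c \<Longrightarrow> cmod (q (Complex x y)) \<le> A * exp (- \<delta> * x)"
    and lim: "(\<lambda>n. jump c q (real n)) \<longlonglongrightarrow> l"
  shows "has_bochner_integral lborel (\<lambda>t. q (gamma_path c t) * vector_derivative (gamma_path c) (at t)) l"
proof -
  let ?g = "\<lambda>t. q (gamma_path c t) * vector_derivative (gamma_path c) (at t)"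
  obtain P where P: "\<And>z. z \<in> slit_plane \<Longrightarrow> (P has_field_derivative q z) (at z)"
    using slit_plane_primitive[OF hol] by metis
  have cq: "continuous_on UNIV (\<lambda>t. q (gamma_path c t))"
    by (rule continuous_on_compose2[OF holomorphic_on_imp_continuous_on[OF hol] continuous_gamma_path])
      (use gamma_path_slit[OF c] in auto)
  have vd: "vector_derivative (gamma_path c) (at t) = gamma_deriv c t" if "t \<noteq> -1" "t \<noteq> 1" for t
    by (rule vector_derivative_at[OF gamma_path_derivative[OF that]])
  \<comment> \<open>At the two kinks the derivative is some unspecified number. Splitting off these
    two points exhibits the integrand as measurable.\<close>
  have eq: "?g = (\<lambda>t. if t = -1 then ?g (-1) else if t = 1 then ?g 1 else q (gamma_path c t) * gamma_deriv c t)"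
    using vd by auto
  have meas: "?g \<in> borel_measurable borel"
  proof (subst eq)
    have 1: "(\<lambda>t. q (gamma_path c t)) \<in> borel_measurable borel"
      by (rule borel_measurable_continuous_onI[OF cq])
    have "continuous_on UNIV (\<lambda>t. complex_of_real c * ((- pi / 2) *\<^sub>R (\<i> * cis (pi - pi / 2 * t))))"
      by (intro continuous_intros)
    then have 2: "(\<lambda>t. complex_of_real c * ((- pi / 2) *\<^sub>R (\<i> * cis (pi - pi / 2 * t)))) \<in> borel_measurable borel"
      by (rule borel_measurable_continuous_onI)
    have "gamma_deriv c \<in> borel_measurable borel"
      unfolding gamma_deriv_def[abs_def] by (intro measurable_If 2) auto
    then show "(\<lambda>t. if t = -1 then ?g (-1) else if t = 1 then ?g 1 else q (gamma_path c t) * gamma_deriv c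
      t) \<in> borel_measurable borel"
      using 1 by (intro measurable_If) auto
  qed
  have bound: "\<exists>M. \<forall>t. cmod (?g t) \<le> M * exp (- \<delta> * \<bar>t\<bar>)"
  proof -
    have "bounded ((\<lambda>t. q (gamma_path c t)) ` {-1..1})"
      by (intro compact_imp_bounded compact_continuous_image continuous_on_subset[OF cq]) auto
    then obtain B where B: "B > 0" "\<And>t. t \<in> {-1..1} \<Longrightarrow> cmod (q (gamma_path c t)) \<le> B"
      unfolding bounded_pos by auto
    \<comment> \<open>The two unspecified derivatives at the kinks are included, so that the bound
      holds at every parameter between -1 and 1.\<close>
    define V where "V = cmod (vector_derivative (gamma_path c) (at (-1)))
      + cmod (vector_derivative (gamma_path c) (at 1)) + c * pi"
    have V: "cmod (vector_derivative (gamma_path c) (at t)) \<le> V" if "t \<in> {-1..1}" for t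
    proof (cases "t = -1 \<or> t = 1")
      case True
      then show ?thesis using c by (auto simp: V_def)
    next
      case False
      then have "cmod (vector_derivative (gamma_path c) (at t)) = c * (pi / 2)"
        using that vd[of t] c by (simp add: gamma_deriv_def norm_mult)
      also have "\<dots> \<le> c * pi" using c by (intro mult_left_mono) auto
      finally show ?thesis unfolding V_def by (simp add: add_nonneg_nonneg add_increasing)
    qed
    have A0: "0 \<le> A" using order_trans[OF norm_ge_zero q[of 0 c]] c by simp
    have V0: "0 \<le> B * V" using B(1) order_trans[OF norm_ge_zero V[of 0]] by simp
    have "cmod (?g t) \<le> (A * exp \<delta> + B * V * exp \<delta>) * exp (- \<delta> * \<bar>t\<bar>)" for t
    proof -
      consider "t < -1" | "t \<in> {-1..1}" | "t > 1" by fastforce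
      then show ?thesis
      proof cases
        case 1
        then have "cmod (?g t) \<le> A * exp (- \<delta> * (- 1 - t))"
          using q[of "- 1 - t" "- c"] vd[of t] c by (simp add: norm_mult gamma_deriv_def gamma_path_def)
        also have "\<dots> = A * exp \<delta> * exp (- \<delta> * \<bar>t\<bar>)"
          using 1 by (simp add: mult.assoc abs_if algebra_simps flip: exp_add)
        also have "\<dots> \<le> (A * exp \<delta> + B * V * exp \<delta>) * exp (- \<delta> * \<bar>t\<bar>)"
          using V0 by (intro mult_right_mono) auto
        finally show ?thesis .
      next
        case 2
        have "cmod (?g t) \<le> B * V" unfolding norm_mult using B V 2 by (intro mult_mono) auto
        also have "\<dots> \<le> B * V * (exp \<delta> * exp (- \<delta> * \<bar>t\<bar>))"
        proof -
          have "0 \<le> \<delta> - \<delta> * \<bar>t\<bar>" using 2 \<open>0 < \<delta>\<close> mult_left_mono[of "\<bar>t\<bar>" 1 \<delta>] by auto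
          then have "1 \<le> exp \<delta> * exp (- \<delta> * \<bar>t\<bar>)" by (simp flip: exp_add)
          then show ?thesis using mult_left_mono[OF _ V0, of 1] by simp
        qed
        also have "\<dots> \<le> (A * exp \<delta> + B * V * exp \<delta>) * exp (- \<delta> * \<bar>t\<bar>)"
          using A0 by (simp add: algebra_simps)
        finally show ?thesis .
      next
        case 3
        then have "cmod (?g t) \<le> A * exp (- \<delta> * (t - 1))"
          using q[of "t - 1" c] vd[of t] c by (simp add: norm_mult gamma_deriv_def gamma_path_def)
        also have "\<dots> = A * exp \<delta> * exp (- \<delta> * \<bar>t\<bar>)"
          using 3 by (simp add: mult.assoc abs_if algebra_simps flip: exp_add)
        also have "\<dots> \<le> (A * exp \<delta> + B * V * exp \<delta>) * exp (- \<delta> * \<bar>t\<bar>)"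
          using V0 by (intro mult_right_mono) auto
        finally show ?thesis .
      qed
    qed
    then show ?thesis by blast
  qed
  then obtain M where M: "\<And>t. cmod (?g t) \<le> M * exp (- \<delta> * \<bar>t\<bar>)" by blast
  have dom: "integrable lborel (\<lambda>t. M * exp (- \<delta> * \<bar>t\<bar>))"
    using integrable_exp_abs[OF \<open>0 < \<delta>\<close>] by (rule integrable_mult_right)
  have int: "integrable lborel ?g"
    by (rule Bochner_Integration.integrable_bound[OF dom])
      (use meas M in \<open>auto intro!: AE_I2 intro: order_trans[OF _ abs_ge_self]\<close>)
  \<comment> \<open>The parameter \<open>n + 1\<close> belongs to the abscissa \<open>n\<close>,
    since the straight parts start at the parameters -1 and 1. The kinks form the finite exceptional
    set of the fundamental theorem.\<close>
  have FTC: "(LINT t|lborel. indicator {- (real n + 1)..real n + 1} t *\<^sub>R ?g t) = jump c q (real n)" for n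
  proof -
    let ?a = "- (real n + 1)" and ?b = "real n + 1"
    have "(?g has_integral (P (gamma_path c ?b) - P (gamma_path c ?a))) {?a..?b}"
    proof (rule fundamental_theorem_of_calculus_strong[of "{-1, 1}"])
      have "continuous_on slit_plane P"
        using P by (meson DERIV_isCont continuous_at_imp_continuous_on)
      then show "continuous_on {?a..?b} (\<lambda>t. P (gamma_path c t))"
        by (rule continuous_on_compose2[OF _ continuous_on_subset[OF continuous_gamma_path subset_UNIV]])
          (use gamma_path_slit[OF c] in blast)
      fix t assume "t \<in> {?a..?b} - {-1, 1}"
      then have t: "t \<noteq> -1" "t \<noteq> 1" by auto
      have "((P \<circ> gamma_path c) has_vector_derivative gamma_deriv c t * q (gamma_path c t)) (at t)"
        by (rule field_vector_diff_chain_at[OF gamma_path_derivative[OF t] P[OF gamma_path_slit[OF c]]])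
      then show "((\<lambda>t. P (gamma_path c t)) has_vector_derivative ?g t) (at t)"
        by (simp add: vd[OF t] o_def mult.commute)
    qed auto
    then have "((\<lambda>t. indicator {?a..?b} t *\<^sub>R ?g t) has_integral (P (gamma_path c ?b)
      - P (gamma_path c ?a))) UNIV"
    proof -
      have "(\<lambda>t. indicator {?a..?b} t *\<^sub>R ?g t) = (\<lambda>t. if t \<in> {?a..?b} then ?g t else 0)"
        by (auto simp: indicator_def)
      then show ?thesis
        using \<open>(?g has_integral (P (gamma_path c ?b) - P (gamma_path c ?a))) {?a..?b}\<close>
        by (simp only: has_integral_restrict_UNIV)
    qed
    moreover have "integrable lborel (\<lambda>t. indicator {?a..?b} t *\<^sub>R ?g t)"
      by (rule integrable_mult_indicator[OF _ int]) simp
    then have "((\<lambda>t. indicator {?a..?b} t *\<^sub>R ?g t) has_integral (LINT t|lborel. indicator {?a..?b} t *\<^sub>R ?g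
      t)) UNIV"
      by (rule has_integral_integral_lborel)
    ultimately have "(LINT t|lborel. indicator {?a..?b} t *\<^sub>R ?g t) = P (gamma_path c ?b) - P (gamma_path c ?a)"
      using has_integral_unique by blast
    moreover have "gamma_path c ?b = Complex (real n) c" "gamma_path c ?a = Complex (real n) (- c)"
      by (cases n; simp add: gamma_path_eq complex_eq_iff)+
    ultimately show ?thesis using jump_primitive[OF P, of c "real n"] c by simp
  qed
  have "(\<lambda>n. LINT t|lborel. indicator {- (real n + 1)..real n + 1} t *\<^sub>R ?g t) \<longlonglongrightarrow> (LINT t|lborel. ?g t)"
  proof (rule integral_dominated_convergence[OF _ _ dom])
    show "AE t in lborel. (\<lambda>n. indicator {- (real n + 1)..real n + 1} t *\<^sub>R ?g t) \<longlonglongrightarrow> ?g t"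
    proof (rule AE_I2)
      fix t :: real
      obtain N :: nat where N: "\<bar>t\<bar> \<le> real N" using real_arch_simple by blast
      have "eventually (\<lambda>n. indicator {- (real n + 1)..real n + 1} t *\<^sub>R ?g t = ?g t) sequentially"
        using N by (intro eventually_sequentiallyI[of N]) (auto simp: indicator_def abs_le_iff)
      then show "(\<lambda>n. indicator {- (real n + 1)..real n + 1} t *\<^sub>R ?g t) \<longlonglongrightarrow> ?g t"
        by (rule tendsto_eventually)
    qed
    show "AE t in lborel. norm (indicator {- (real n + 1)..real n + 1} t *\<^sub>R ?g t) \<le> M * exp (- \<delta> * \<bar>t\<bar>)" for n
      using M order_trans[OF norm_ge_zero M] by (intro AE_I2) (auto simp: indicator_def)
  qed (use meas in auto)
  then have "(LINT t|lborel. ?g t) = l" unfolding FTC using lim LIMSEQ_unique by blast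
  then show ?thesis using int by (simp add: has_bochner_integral_iff)
qed

text \<open>The contour is moved to two rays starting at abscissa \<open>N\<close>, joined by a
  vertical segment, within a domain \<open>\<Omega>\<close> on which a primitive exists. With
  \<open>N = - c\<close> and the slit plane this yields the growth of transforms; for an entire
  integrand \<open>N\<close> can be large and positive, which yields decay.\<close>

lemma jump_limit_bound:
  assumes P: "\<And>z. z \<in> \<Omega> \<Longrightarrow> (P has_field_derivative q z) (at z)"
    and lim: "(\<lambda>n. P (Complex (real n) c) - P (Complex (real n) (-c))) \<longlonglongrightarrow> l"
    and "0 < c" "0 < \<delta>"
    and lines: "\<And>x y. N \<le> x \<Longrightarrow> \<bar>y\<bar> = c \<Longrightarrow> Complex x y \<in> \<Omega>" "\<And>y. \<bar>y\<bar> \<le> c \<Longrightarrow> Complex N y \<in> \<Omega>"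
    and A: "\<And>x y. N \<le> x \<Longrightarrow> \<bar>y\<bar> = c \<Longrightarrow> cmod (q (Complex x y)) \<le> A * exp (- \<delta> * x)"
    and B: "\<And>y. \<bar>y\<bar> \<le> c \<Longrightarrow> cmod (q (Complex N y)) \<le> B"
  shows "cmod l \<le> 2 * (A / \<delta>) * exp (- \<delta> * N) + 2 * c * B"
proof (rule tendsto_upperbound)
  show "(\<lambda>n. cmod (P (Complex (real n) c) - P (Complex (real n) (-c)))) \<longlonglongrightarrow> cmod l"
    by (intro tendsto_intros lim)
  obtain n0 :: nat where n0: "N \<le> real n0" using real_arch_simple by blast
  show "\<forall>\<^sub>F n in sequentially. cmod (P (Complex (real n) c) - P (Complex (real n) (-c)))
      \<le> 2 * (A / \<delta>) * exp (- \<delta> * N) + 2 * c * B"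
  proof (rule eventually_sequentiallyI[of n0])
    fix n assume "n \<ge> n0"
    then have n: "N \<le> real n" using n0 by linarith
    have 1: "cmod (P (Complex (real n) y) - P (Complex N y)) \<le> A / \<delta> * exp (- \<delta> * N)" if y: "\<bar>y\<bar> = c" for y
      unfolding Complex_ray[of "real n"] Complex_ray[of N]
    proof (rule ray_primitive_bound[OF _ _ _ \<open>0 < \<delta>\<close> n])
      show "(P has_field_derivative q (Complex 0 y + of_real t * 1)) (at (Complex 0 y + of_real t * 1))"
        if "N \<le> t" for t
        unfolding Complex_ray[symmetric] by (rule P) (rule lines(1)[OF that y])
      show "cmod (q (Complex 0 y + of_real t * 1)) \<le> A * exp (- \<delta> * t)" if "N \<le> t" for t
        unfolding Complex_ray[symmetric] by (rule A[OF that y])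
    qed simp
    have 2: "cmod (P (Complex N c) - P (Complex N (-c))) \<le> 2 * c * B"
    proof -
      let ?u = "Complex N (-c)" and ?v = "Complex N c"
      have on: "\<exists>y. \<bar>y\<bar> \<le> c \<and> w = Complex N y" if w: "w \<in> closed_segment ?u ?v" for w
      proof -
        obtain t where t: "0 \<le> t" "t \<le> 1" "w = (1 - t) *\<^sub>R ?u + t *\<^sub>R ?v" using w by (auto simp: in_segment)
        have "w = Complex N (c * (2 * t - 1))" by (simp add: t(3) complex_eq_iff algebra_simps)
        moreover have "\<bar>c * (2 * t - 1)\<bar> \<le> c"
          using t \<open>0 < c\<close> mult_left_mono[of "\<bar>2 * t - 1\<bar>" 1 c] by (simp add: abs_mult)
        ultimately show ?thesis by blast
      qed
      have der: "(P has_field_derivative q w) (at w within closed_segment ?u ?v)"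
        if "w \<in> closed_segment ?u ?v" for w
      proof -
        obtain y where "\<bar>y\<bar> \<le> c" "w = Complex N y" using on[OF \<open>w \<in> closed_segment ?u ?v\<close>] by blast
        then show ?thesis using has_field_derivative_at_within[OF P[OF lines(2)]] by blast
      qed
      have "(q has_contour_integral (P (pathfinish (linepath ?u ?v))
        - P (pathstart (linepath ?u ?v)))) (linepath ?u ?v)"
        by (rule contour_integral_primitive[OF der]) auto
      then have "(q has_contour_integral (P ?v - P ?u)) (linepath ?u ?v)" by simp
      then have "cmod (P ?v - P ?u) \<le> B * cmod (?v - ?u)"
        by (rule has_contour_integral_bound_linepath)
          (use order_trans[OF norm_ge_zero B[of 0]] \<open>0 < c\<close> in simp, use on B in blast)
      moreover have "cmod (?v - ?u) = 2 * c"
      proof -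
        have "?v - ?u = of_real (2 * c) * \<i>" by (simp add: complex_eq_iff)
        then have "cmod (?v - ?u) = \<bar>2 * c\<bar>" by (simp only: norm_mult norm_of_real norm_ii mult_1_right)
        then show ?thesis using \<open>0 < c\<close> by simp
      qed
      ultimately show ?thesis by (simp add: mult.commute)
    qed
    show "cmod (P (Complex (real n) c) - P (Complex (real n) (-c)))
      \<le> 2 * (A / \<delta>) * exp (- \<delta> * N) + 2 * c * B"
      using 1[of c] 1[of "-c"] 2 \<open>0 < c\<close>
        norm_triangle_ineq[of "P (Complex (real n) c) - P (Complex N c)" "P (Complex N c) - P (Complex N (-c))"]
        norm_triangle_ineq4[of "P (Complex (real n) c) - P (Complex N (-c))"
          "P (Complex (real n) (-c)) - P (Complex N (-c))"]
      by simp
  qed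
qed simp

lemma exp_kernel_derivative: "((\<lambda>\<zeta>. exp (- z * \<zeta>)) has_field_derivative (- z * exp (- z * \<zeta>))) (at \<zeta>)"
  for z \<zeta> :: complex
  by (auto intro!: derivative_eq_intros)

lemma norm_exp_kernel: "cmod (exp (- z * \<zeta>)) = exp (Im z * Im \<zeta> - Re z * Re \<zeta>)"
  by simp

lemma norm_exp_kernel_le:
  assumes "\<bar>Im z\<bar> \<le> c"
  shows "cmod (exp (- z * \<zeta>)) \<le> exp (c * \<bar>Im \<zeta>\<bar>) * exp (- Re \<zeta> * Re z)"
proof -
  have "Im z * Im \<zeta> \<le> \<bar>Im z\<bar> * \<bar>Im \<zeta>\<bar>" by (metis abs_ge_self abs_mult)
  also have "\<dots> \<le> c * \<bar>Im \<zeta>\<bar>" using assms by (intro mult_right_mono) auto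
  finally show ?thesis unfolding norm_exp_kernel by (simp flip: exp_add add: mult.commute)
qed

text \<open>The truncated integrals are holomorphic in \<open>\<zeta>\<close>, and on a disc that
  keeps the distance \<open>d\<close> from the line \<open>Re \<zeta> = b\<close> their tails are
  bounded uniformly by a multiple of \<open>exp (- d * n)\<close>.\<close>

lemma Laplace_limit_holomorphic:
  assumes F: "F holomorphic_on slit_plane" and "0 < c"
    and A: "\<And>x y. 0 \<le> x \<Longrightarrow> \<bar>y\<bar> = c \<Longrightarrow> cmod (F (Complex x y)) \<le> A * exp (b * x)"
    and L: "\<And>\<zeta>. b < Re \<zeta> \<Longrightarrow> (\<lambda>n. jump c (\<lambda>z. F z * exp (- z * \<zeta>)) (real n)) \<longlonglongrightarrow> L \<zeta>"
  shows "L holomorphic_on {\<zeta>. b < Re \<zeta>}"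
proof (rule holomorphic_uniform_sequence[of _ "\<lambda>n \<zeta>. jump c (\<lambda>z. F z * exp (- z * \<zeta>)) (real n)"])
  show op: "open {\<zeta>. b < Re \<zeta>}" by (rule open_halfspace_Re_gt)
  have c0: "c \<noteq> 0" using \<open>0 < c\<close> by simp
  show "(\<lambda>\<zeta>. jump c (\<lambda>z. F z * exp (- z * \<zeta>)) (real n)) holomorphic_on {\<zeta>. b < Re \<zeta>}" for n
    unfolding jump_def
  proof (rule esum_holomorphic[OF _ op exp_kernel_derivative])
    show "continuous_on (eimg [(Complex (real n) (- c), - 1), (- 1, Complex (real n) c)]) F"
      by (rule continuous_on_subset[OF holomorphic_on_imp_continuous_on[OF F] jump_edges_slit[OF c0]])
  qed (unfold split_beta, (intro continuous_intros)+)
  have A0: "0 \<le> A" using order_trans[OF norm_ge_zero A[of 0 c]] \<open>0 < c\<close> by simp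
  show "\<exists>d>0. cball \<zeta>0 d \<subseteq> {\<zeta>. b < Re \<zeta>} \<and>
      uniform_limit (cball \<zeta>0 d) (\<lambda>n \<zeta>. jump c (\<lambda>z. F z * exp (- z * \<zeta>)) (real n)) L sequentially"
    if "\<zeta>0 \<in> {\<zeta>. b < Re \<zeta>}" for \<zeta>0
  proof -
    define d where "d = (Re \<zeta>0 - b) / 2"
    have d: "d > 0" using that by (simp add: d_def)
    have ball: "b + d \<le> Re \<zeta> \<and> \<bar>Im \<zeta>\<bar> \<le> cmod \<zeta>0 + d" if "\<zeta> \<in> cball \<zeta>0 d" for \<zeta>
    proof -
      have "\<bar>Re \<zeta> - Re \<zeta>0\<bar> \<le> d" "\<bar>Im \<zeta> - Im \<zeta>0\<bar> \<le> d"
        using that abs_Re_le_cmod[of "\<zeta> - \<zeta>0"] abs_Im_le_cmod[of "\<zeta> - \<zeta>0"]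
        by (auto simp: dist_norm norm_minus_commute)
      moreover have "Re \<zeta>0 = b + 2 * d" unfolding d_def by (simp add: field_simps)
      ultimately show ?thesis using abs_Im_le_cmod[of \<zeta>0] by linarith
    qed
    define A' where "A' = A * exp (c * (cmod \<zeta>0 + d))"
    have est: "cmod (L \<zeta> - jump c (\<lambda>z. F z * exp (- z * \<zeta>)) (real n)) \<le> 2 * (A' / d) * exp (- d * real n)"
      if \<zeta>: "\<zeta> \<in> cball \<zeta>0 d" for \<zeta> n
    proof (rule tendsto_upperbound)
      have "b < Re \<zeta>" using ball[OF \<zeta>] d by simp
      then show "(\<lambda>m. cmod (jump c (\<lambda>z. F z * exp (- z * \<zeta>)) (real m)
        - jump c (\<lambda>z. F z * exp (- z * \<zeta>)) (real n)))
          \<longlonglongrightarrow> cmod (L \<zeta> - jump c (\<lambda>z. F z * exp (- z * \<zeta>)) (real n))"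
        by (intro tendsto_intros L)
      have qb: "cmod (F (Complex x y) * exp (- Complex x y * \<zeta>)) \<le> A' * exp (- d * x)"
        if "0 \<le> x" "\<bar>y\<bar> = c" for x y
      proof -
        have "cmod (exp (- Complex x y * \<zeta>)) \<le> exp (c * \<bar>Im \<zeta>\<bar>) * exp (- Re \<zeta> * x)"
          using norm_exp_kernel_le[of "Complex x y" c \<zeta>] that by simp
        also have "\<dots> \<le> exp (c * (cmod \<zeta>0 + d)) * exp (- (b + d) * x)"
        proof -
          have "- Re \<zeta> * x \<le> - (b + d) * x" using ball[OF \<zeta>] that by (intro mult_right_mono) auto
          moreover have "c * \<bar>Im \<zeta>\<bar> \<le> c * (cmod \<zeta>0 + d)" using ball[OF \<zeta>] \<open>0 < c\<close> by (intro mult_left_mono) auto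
          ultimately show ?thesis by (intro mult_mono) auto
        qed
        finally have "cmod (F (Complex x y) * exp (- Complex x y * \<zeta>)) \<le>
           (A * exp (b * x)) * (exp (c * (cmod \<zeta>0 + d)) * exp (- (b + d) * x))"
          unfolding norm_mult using A[OF that] A0 by (intro mult_mono) auto
        also have "\<dots> = A' * (exp (b * x) * exp (- (b + d) * x))" by (simp add: A'_def)
        also have "exp (b * x) * exp (- (b + d) * x) = exp (- d * x)" by (simp add: algebra_simps flip: exp_add)
        finally show ?thesis .
      qed
      show "\<forall>\<^sub>F m in sequentially. cmod (jump c (\<lambda>z. F z * exp (- z * \<zeta>)) (real m)
        - jump c (\<lambda>z. F z * exp (- z * \<zeta>)) (real n))
         \<le> 2 * (A' / d) * exp (- d * real n)"
      proof (rule eventually_sequentiallyI[of n])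
        fix m assume "n \<le> m"
        show "cmod (jump c (\<lambda>z. F z * exp (- z * \<zeta>)) (real m) - jump c (\<lambda>z. F z * exp (- z * \<zeta>)) (real n))
         \<le> 2 * (A' / d) * exp (- d * real n)"
          by (rule jump_tail[OF _ c0 d])
            (use F \<open>n \<le> m\<close> qb[of _ c] qb[of _ "-c"] \<open>0 < c\<close> in \<open>auto intro!: holomorphic_intros\<close>)
      qed
    qed simp
    have "uniform_limit (cball \<zeta>0 d) (\<lambda>n \<zeta>. jump c (\<lambda>z. F z * exp (- z * \<zeta>)) (real n)) L sequentially"
      unfolding uniform_limit_iff
    proof (intro allI impI)
      fix e :: real assume "e > 0"
      have "(\<lambda>n. exp (- d) ^ n) \<longlonglongrightarrow> 0" using d by (intro LIMSEQ_realpow_zero) auto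
      then have "(\<lambda>n. exp (- d * real n)) \<longlonglongrightarrow> 0" by (simp add: exp_of_nat_mult[symmetric] mult.commute)
      then have "(\<lambda>n. 2 * (A' / d) * exp (- d * real n)) \<longlonglongrightarrow> 0" by (rule tendsto_mult_right_zero)
      then have "\<forall>\<^sub>F n in sequentially. 2 * (A' / d) * exp (- d * real n) < e"
        by (rule order_tendstoD(2)) fact
      then show "\<forall>\<^sub>F n in sequentially. \<forall>\<zeta>\<in>cball \<zeta>0 d. dist (jump c (\<lambda>z. F z * exp (- z * \<zeta>)) (real n)) (L \<zeta>) < e"
      proof eventually_elim
        case (elim n)
        show ?case
        proof
          fix \<zeta> assume "\<zeta> \<in> cball \<zeta>0 d"
          then show "dist (jump c (\<lambda>z. F z * exp (- z * \<zeta>)) (real n)) (L \<zeta>) < e"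
            using est[of \<zeta> n] elim unfolding dist_norm by (subst norm_minus_commute) linarith
        qed
      qed
    qed
    moreover have "cball \<zeta>0 d \<subseteq> {\<zeta>. b < Re \<zeta>}" using ball d by fastforce
    ultimately show ?thesis using d by blast
  qed
qed

section \<open>The Laplace transform of vector-valued functions\<close>

lemma nbhd_Im: "K = {0..\<infinity>} \<or> K = {\<infinity>} \<Longrightarrow> z \<in> nbhd c K \<Longrightarrow> \<bar>Im z\<bar> < c"
proof (cases "K = {\<infinity>}")
  case False
  assume "K = {0..\<infinity>} \<or> K = {\<infinity>}" "z \<in> nbhd c K"
  then obtain x where "x \<in> finite_part {0..\<infinity>}" "dist z x < c" using False by (auto simp: nbhd_def)
  then show ?thesis using abs_Im_le_cmod[of "z - x"] by (simp add: dist_norm)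
qed (simp add: nbhd_def)

lemma closure_nbhd_Im:
  assumes "K = {0..\<infinity>} \<or> K = {\<infinity>}" "z \<in> closure (nbhd c K)"
  shows "\<bar>Im z\<bar> \<le> c"
proof -
  have "closure (nbhd c K) \<subseteq> {z. \<bar>Im z\<bar> \<le> c}"
    by (rule closure_minimal) (use nbhd_Im[OF assms(1)] in \<open>force intro!: closed_Collect_le continuous_intros\<close>)+
  then show ?thesis using assms by auto
qed

lemma strip_minusI_Im: "K = {0..\<infinity>} \<or> K = {\<infinity>} \<Longrightarrow> 1 / real n < \<bar>Im z\<bar> \<Longrightarrow> \<bar>Im z\<bar> < real n \<Longrightarrow> z \<in> strip_minus K n"
  using closure_nbhd_Im[of K z "1 / real n"] by (auto simp: strip_minus_def)

lemma strip_minus_subset: "strip_minus {0..\<infinity>} n \<subseteq> strip_minus {\<infinity>} n"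
proof (cases "n = 0")
  case False
  have "nbhd (1 / real n) {\<infinity>} \<subseteq> nbhd (1 / real n) {0..\<infinity>}"
  proof
    fix z assume z: "z \<in> nbhd (1 / real n) {\<infinity>}"
    then have "real n < Re z" "\<bar>Im z\<bar> < 1 / real n" by (auto simp: nbhd_def)
    moreover have "dist z (of_real (Re z)) = \<bar>Im z\<bar>" by (simp add: dist_norm cmod_def)
    ultimately have "of_real (Re z) \<in> finite_part {0..\<infinity>} \<and> dist z (of_real (Re z)) < 1 / real n" by simp
    then show "z \<in> nbhd (1 / real n) {0..\<infinity>}" unfolding nbhd_def by auto
  qed
  then show ?thesis using closure_mono by (auto simp: strip_minus_def)
qed (auto simp: strip_minus_def)

lemma jump_add:
  assumes "f holomorphic_on slit_plane" "g holomorphic_on slit_plane" "c \<noteq> 0"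
  shows "jump c (\<lambda>z. f z + g z) R = jump c f R + jump c g R"
  unfolding jump_def
  by (rule esum_add; rule continuous_on_subset[OF holomorphic_on_imp_continuous_on jump_edges_slit[OF assms(3)]])
    (use assms in auto)

section \<open>Growth in horizontal strips and the vector-valued Laplace integral\<close>

context frechet
begin

text \<open>A common hypothesis for both transforms: the Laplace integral converges for
  \<open>Re \<zeta> > b\<close>. Functions in \<open>O_exp\<close> satisfy it for every
  \<open>b > 0\<close>, those in \<open>H_minus_inf\<close> for every real \<open>b\<close>. The
  range starts at -1 to include the horizontal lines extended to \<open>Re z = - c\<close>.\<close>

definition tube_growth :: "real \<Rightarrow> (complex \<Rightarrow> 'e) \<Rightarrow> bool" where
  "tube_growth b G \<longleftrightarrow> (\<forall>a c. 0 < c \<longrightarrow>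
    (\<exists>A. \<forall>z. -1 \<le> Re z \<and> c \<le> \<bar>Im z\<bar> \<and> \<bar>Im z\<bar> \<le> 1 \<longrightarrow> p a (G z) \<le> A * exp (b * Re z)))"

lemma tube_growthD:
  assumes "tube_growth b G" "0 < c"
  obtains A where "0 \<le> A" "\<And>z. -1 \<le> Re z \<Longrightarrow> c \<le> \<bar>Im z\<bar> \<Longrightarrow> \<bar>Im z\<bar> \<le> 1 \<Longrightarrow> p a (G z) \<le> A * exp (b * Re z)"
proof -
  obtain A where A: "\<And>z. -1 \<le> Re z \<Longrightarrow> c \<le> \<bar>Im z\<bar> \<Longrightarrow> \<bar>Im z\<bar> \<le> 1 \<Longrightarrow> p a (G z) \<le> A * exp (b * Re z)"
    using assms unfolding tube_growth_def by blast
  have "p a (G z) \<le> max A 0 * exp (b * Re z)" if "-1 \<le> Re z" "c \<le> \<bar>Im z\<bar>" "\<bar>Im z\<bar> \<le> 1" for z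
    using A[OF that] by (rule order_trans) (intro mult_right_mono, auto)
  then show ?thesis using that[of "max A 0"] by simp
qed

lemma weighted_holoD:
  assumes "f \<in> weighted_holo sc p \<Omega> S w" "1 \<le> n"
  obtains M where "0 \<le> M" "\<And>z. z \<in> S n \<Longrightarrow> p a (f z) \<le> M * exp (- w n z)"
proof -
  have "bdd_above ((\<lambda>z. p a (f z) * exp (w n z)) ` S n)" using assms by (auto simp: weighted_holo_def)
  then obtain M where M: "\<And>z. z \<in> S n \<Longrightarrow> p a (f z) * exp (w n z) \<le> M" unfolding bdd_above_def by auto
  have "p a (f z) \<le> max M 0 * exp (- w n z)" if "z \<in> S n" for z
  proof -
    have "p a (f z) = p a (f z) * exp (w n z) * exp (- w n z)" by (simp add: mult.assoc flip: exp_add)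
    also have "\<dots> \<le> max M 0 * exp (- w n z)" using M[OF that] by (intro mult_right_mono) auto
    finally show ?thesis .
  qed
  then show ?thesis using that[of "max M 0"] by simp
qed

lemma weighted_holoI:
  assumes "f \<in> holo sc p \<Omega>" "\<And>n a. 1 \<le> n \<Longrightarrow> \<exists>M. \<forall>z\<in>S n. p a (f z) \<le> M * exp (- w n z)"
  shows "f \<in> weighted_holo sc p \<Omega> S w"
  unfolding weighted_holo_def
proof (intro CollectI conjI allI impI assms(1))
  fix n :: nat and a assume "1 \<le> n"
  then obtain M where M: "\<And>z. z \<in> S n \<Longrightarrow> p a (f z) \<le> M * exp (- w n z)" using assms(2) by blast
  have "p a (f z) * exp (w n z) \<le> M" if "z \<in> S n" for z
    using mult_right_mono[OF M[OF that], of "exp (w n z)"] by (simp add: mult.assoc flip: exp_add)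
  then show "bdd_above ((\<lambda>z. p a (f z) * exp (w n z)) ` S n)" by (rule bdd_aboveI2)
qed

lemma weighted_holo_holo: "f \<in> weighted_holo sc p \<Omega> S w \<Longrightarrow> f \<in> holo sc p \<Omega>"
  by (simp add: weighted_holo_def)

text \<open>\<open>n\<close> is taken so large that the \<open>n\<close>-th strip contains the
  points with \<open>c \<le> \<bar>Im z\<bar> \<le> 1\<close> and the growth rate
  \<open>1 / n\<close> is at most \<open>b\<close>. The factor \<open>exp (2 * b)\<close> arises
  because \<open>Re z + 2\<close> dominates \<open>\<bar>Re z\<bar>\<close> for
  \<open>Re z \<ge> -1\<close>.\<close>

lemma O_exp_growth:
  assumes G: "G \<in> O_exp sc p {0..\<infinity>}" and "0 < b"
  shows "tube_growth b G"
  unfolding tube_growth_def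
proof (intro allI impI)
  fix a and c :: real assume "0 < c"
  obtain n :: nat where n: "max 2 (max (2 / c) (1 / b)) \<le> real n" using real_arch_simple by blast
  then have n': "1 \<le> n" "1 / real n < c" "1 / real n \<le> b" "1 < real n"
    using \<open>0 < c\<close> \<open>0 < b\<close> by (auto simp: field_simps)
  obtain M where M: "0 \<le> M" "\<And>z. z \<in> strip_minus {0..\<infinity>} n \<Longrightarrow> p a (G z) \<le> M * exp (- (- (1 / real n) * \<bar>Re z\<bar>))"
    using weighted_holoD[OF G[unfolded O_exp_def] n'(1)] by metis
  have "p a (G z) \<le> M * exp (2 * b) * exp (b * Re z)" if z: "-1 \<le> Re z" "c \<le> \<bar>Im z\<bar>" "\<bar>Im z\<bar> \<le> 1" for z
  proof -
    have "1 / real n * \<bar>Re z\<bar> \<le> b * (Re z + 2)" using n' \<open>0 < b\<close> z(1) by (intro mult_mono) auto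
    then have "M * exp (- (- (1 / real n) * \<bar>Re z\<bar>)) \<le> M * exp (b * (Re z + 2))"
      using M(1) by (intro mult_left_mono) auto
    also have "\<dots> = M * exp (2 * b) * exp (b * Re z)" by (simp add: algebra_simps exp_add)
    finally show ?thesis using M(2)[of z] strip_minusI_Im[of "{0..\<infinity>}" n z] z n' by force
  qed
  then show "\<exists>A. \<forall>z. - 1 \<le> Re z \<and> c \<le> \<bar>Im z\<bar> \<and> \<bar>Im z\<bar> \<le> 1 \<longrightarrow> p a (G z) \<le> A * exp (b * Re z)" by blast
qed

lemma H_minus_inf_growth:
  assumes G: "G \<in> H_minus_inf sc p {0..\<infinity>}"
  shows "tube_growth b G"
  unfolding tube_growth_def
proof (intro allI impI)
  fix a and c :: real assume "0 < c"
  obtain n :: nat where n: "max 2 (max (2 / c) \<bar>b\<bar>) \<le> real n" using real_arch_simple by blast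
  then have n': "1 \<le> n" "1 / real n < c" "\<bar>b\<bar> \<le> real n" "1 < real n"
    using \<open>0 < c\<close> by (auto simp: field_simps)
  obtain M where M: "0 \<le> M" "\<And>z. z \<in> strip_minus {0..\<infinity>} n \<Longrightarrow> p a (G z) \<le> M * exp (- (real n * \<bar>Re z\<bar>))"
    using weighted_holoD[OF G[unfolded H_minus_inf_def] n'(1)] by metis
  have "p a (G z) \<le> M * exp (b * Re z)" if z: "-1 \<le> Re z" "c \<le> \<bar>Im z\<bar>" "\<bar>Im z\<bar> \<le> 1" for z
  proof -
    have "\<bar>b\<bar> * \<bar>Re z\<bar> \<le> real n * \<bar>Re z\<bar>" using n' by (intro mult_right_mono) auto
    then have "- (real n * \<bar>Re z\<bar>) \<le> b * Re z" using abs_ge_minus_self[of "b * Re z"] by (simp add: abs_mult)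
    then have "M * exp (- (real n * \<bar>Re z\<bar>)) \<le> M * exp (b * Re z)"
      using M(1) by (intro mult_left_mono) auto
    then show ?thesis using M(2)[of z] strip_minusI_Im[of "{0..\<infinity>}" n z] z n' by force
  qed
  then show "\<exists>A. \<forall>z. - 1 \<le> Re z \<and> c \<le> \<bar>Im z\<bar> \<and> \<bar>Im z\<bar> \<le> 1 \<longrightarrow> p a (G z) \<le> A * exp (b * Re z)" by blast
qed

lemma kernel_bound:
  assumes "p a (G z) \<le> A * exp (b * Re z)" "\<bar>Im z\<bar> \<le> c" "0 \<le> A"
  shows "p a (sc (exp (- z * \<zeta>)) (G z)) \<le> A * exp (c * \<bar>Im \<zeta>\<bar>) * exp (- (Re \<zeta> - b) * Re z)"
proof -
  have "p a (sc (exp (- z * \<zeta>)) (G z)) \<le> (exp (c * \<bar>Im \<zeta>\<bar>) * exp (- Re \<zeta> * Re z)) * (A * exp (b * Re z))"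
    unfolding p_scale by (intro mult_mono norm_exp_kernel_le assms) auto
  also have "\<dots> = A * exp (c * \<bar>Im \<zeta>\<bar>) * (exp (- Re \<zeta> * Re z) * exp (b * Re z))" by simp
  also have "exp (- Re \<zeta> * Re z) * exp (b * Re z) = exp (- (Re \<zeta> - b) * Re z)"
    by (simp add: algebra_simps flip: exp_add)
  finally show ?thesis .
qed

lemma exp_seq_to_0: "0 < \<delta> \<Longrightarrow> (\<lambda>n. C * exp (- \<delta> * real n)) \<longlonglongrightarrow> (0::real)"
proof -
  assume "0 < \<delta>"
  then have "(\<lambda>n. exp (- \<delta>) ^ n) \<longlonglongrightarrow> 0" by (intro LIMSEQ_realpow_zero) auto
  then have "(\<lambda>n. exp (- \<delta> * real n)) \<longlonglongrightarrow> 0" by (simp add: exp_of_nat_mult[symmetric] mult.commute)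
  then show ?thesis by (rule tendsto_mult_right_zero)
qed

text \<open>The jumps at height 1 are Cauchy uniformly over polars, which yields a vector
  \<open>l\<close>; changing the height does not alter the limit, and at each height the Pettis
  integral has the value \<open>l\<close>. This resolves the description in \<open>laplace\<close>,
  and from here on the transform is handled as a limit of jumps.\<close>

lemma laplace_limit:
  assumes G: "G \<in> holo sc p slit_plane" and gr: "tube_growth b G" and \<zeta>: "b < Re \<zeta>" "\<zeta> \<in> \<Omega>"
    and \<phi>: "dual \<phi>" and c: "0 < c" "c \<le> 1"
  shows "(\<lambda>n. jump c (\<lambda>z. \<phi> (G z) * exp (- z * \<zeta>)) (real n)) \<longlonglongrightarrow> \<phi> (laplace sc p \<Omega> G \<zeta>)"
proof -
  define Q where "Q z = sc (exp (- z * \<zeta>)) (G z)" for z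
  define \<delta> where "\<delta> = Re \<zeta> - b"
  have \<delta>: "0 < \<delta>" using \<zeta> by (simp add: \<delta>_def)
  have Qe: "econt slit_plane Q" unfolding Q_def
    by (intro econt_scale holo_econt[OF G] continuous_intros)
  have Q\<phi>: "\<phi> (Q z) = \<phi> (G z) * exp (- z * \<zeta>)" if "dual \<phi>" for \<phi> z
    by (simp add: Q_def dual_linear[OF that] mult.commute)
  have Qh: "(\<lambda>z. \<phi> (Q z)) holomorphic_on slit_plane" if "dual \<phi>" for \<phi>
    unfolding Q\<phi>[OF that] by (intro holomorphic_intros holo_dual_holomorphic[OF G that])
  have Qb: "\<exists>A. \<forall>z. -1 \<le> Re z \<and> c \<le> \<bar>Im z\<bar> \<and> \<bar>Im z\<bar> \<le> 1 \<longrightarrow> p a (Q z) \<le> A * exp (- \<delta> * Re z)"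
    if c0: "0 < c" for a c
  proof -
    obtain A where "0 \<le> A" "\<And>z. -1 \<le> Re z \<Longrightarrow> c \<le> \<bar>Im z\<bar> \<Longrightarrow> \<bar>Im z\<bar> \<le> 1 \<Longrightarrow> p a (G z) \<le> A * exp (b * Re z)"
      using tube_growthD[OF gr c0] by metis
    then show ?thesis unfolding Q_def \<delta>_def
      using kernel_bound[of a G _ A b 1 \<zeta>] by (intro exI[of _ "A * exp (1 * \<bar>Im \<zeta>\<bar>)"]) blast
  qed
  have Qb\<phi>: "\<exists>A. \<forall>z. -1 \<le> Re z \<and> c \<le> \<bar>Im z\<bar> \<and> \<bar>Im z\<bar> \<le> 1 \<longrightarrow> cmod (\<phi> (Q z)) \<le> A * exp (- \<delta> * Re z)"
    if c0: "0 < c" and \<phi>: "dual \<phi>" for \<phi> c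
  proof -
    obtain a C where C: "C > 0" "\<And>x. cmod (\<phi> x) \<le> C * p a x" using dual_bounded[OF \<phi>] by metis
    obtain A where A: "\<And>z. -1 \<le> Re z \<and> c \<le> \<bar>Im z\<bar> \<and> \<bar>Im z\<bar> \<le> 1 \<Longrightarrow> p a (Q z) \<le> A * exp (- \<delta> * Re z)"
      using Qb[OF c0] by metis
    have "cmod (\<phi> (Q z)) \<le> C * A * exp (- \<delta> * Re z)" if "-1 \<le> Re z \<and> c \<le> \<bar>Im z\<bar> \<and> \<bar>Im z\<bar> \<le> 1" for z
    proof -
      have "C * p a (Q z) \<le> C * (A * exp (- \<delta> * Re z))" using A[OF that] C(1) by (intro mult_left_mono) auto
      then show ?thesis using C(2)[of "Q z"] by (simp only: mult.assoc)
    qed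
    then show ?thesis by blast
  qed
  define x where "x n = elineint [(Complex (real n) (-1), -1), (-1, Complex (real n) 1)] Q" for n
  have x: "\<phi> (x n) = jump 1 (\<lambda>z. \<phi> (Q z)) (real n)" if "dual \<phi>" for \<phi> n
    unfolding x_def jump_def
    by (rule dual_elineint[OF econt_subset[OF Qe] that]) (use jump_edges_slit[of 1 "real n"] in simp)
  obtain l where l: "\<And>\<phi>. dual \<phi> \<Longrightarrow> (\<lambda>n. \<phi> (x n)) \<longlonglongrightarrow> \<phi> l"
  proof (rule weak_complete[of x])
    fix a and e :: real assume "0 < e"
    obtain A where A: "\<And>z. -1 \<le> Re z \<and> 1 \<le> \<bar>Im z\<bar> \<and> \<bar>Im z\<bar> \<le> 1 \<Longrightarrow> p a (Q z) \<le> A * exp (- \<delta> * Re z)"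
      using Qb[of 1 a] by auto
    have "\<forall>\<^sub>F n in sequentially. 2 * (A / \<delta>) * exp (- \<delta> * real n) < e / 2"
      by (rule order_tendstoD(2)[OF exp_seq_to_0[OF \<delta>]]) (use \<open>0 < e\<close> in simp)
    then obtain N where N: "2 * (A / \<delta>) * exp (- \<delta> * real N) < e / 2"
      unfolding eventually_sequentially by blast
    have "cmod (\<phi> (x m) - \<phi> (x N)) \<le> e / 2" if "m \<ge> N" "\<phi> \<in> polar a" for m \<phi>
    proof -
      have \<phi>: "dual \<phi>" by (rule polar_dual[OF that(2)])
      have q: "cmod (\<phi> (Q (Complex t y))) \<le> A * exp (- \<delta> * t)" if "real N \<le> t" "y = 1 \<or> y = -1" for t y
        using order_trans[OF polar_le[OF \<open>\<phi> \<in> polar a\<close>] A[of "Complex t y"]] that by auto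
      have "cmod (jump 1 (\<lambda>z. \<phi> (Q z)) (real m) - jump 1 (\<lambda>z. \<phi> (Q z)) (real N))
        \<le> 2 * (A / \<delta>) * exp (- \<delta> * real N)"
        by (rule jump_tail[OF Qh[OF \<phi>] _ \<delta>]) (use that q in auto)
      then show ?thesis using N by (simp add: x[OF \<phi>])
    qed
    then have "cmod (\<phi> (x m) - \<phi> (x n)) \<le> e" if "m \<ge> N" "n \<ge> N" "\<phi> \<in> polar a" for m n \<phi>
      using that by (blast intro: norm_diff_le_halves)
    then show "\<exists>N. \<forall>m\<ge>N. \<forall>n\<ge>N. \<forall>\<phi>\<in>polar a. cmod (\<phi> (x m) - \<phi> (x n)) \<le> e" by blast
  qed blast
  have lim: "(\<lambda>n. jump c (\<lambda>z. \<phi> (Q z)) (real n)) \<longlonglongrightarrow> \<phi> l" if c: "0 < c" "c \<le> 1" and \<phi>: "dual \<phi>" for c \<phi>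
  proof -
    obtain A where A: "\<And>z. -1 \<le> Re z \<and> c \<le> \<bar>Im z\<bar> \<and> \<bar>Im z\<bar> \<le> 1 \<Longrightarrow> cmod (\<phi> (Q z)) \<le> A * exp (- \<delta> * Re z)"
      using Qb\<phi>[OF c(1) \<phi>] by metis
    have "(\<lambda>n. jump 1 (\<lambda>z. \<phi> (Q z)) (real n) - jump c (\<lambda>z. \<phi> (Q z)) (real n)) \<longlonglongrightarrow> 0"
      by (rule jump_independent[where A = A, OF Qh[OF \<phi>] c \<delta>]) (use A in auto)
    from tendsto_diff[OF l[OF \<phi>, unfolded x[OF \<phi>]] this] show ?thesis by simp
  qed
  have gam: "has_gamma_integral sc p c Q l" if c: "0 < c" "c \<le> 1" for c
    unfolding has_gamma_integral_def
  proof (intro allI impI)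
    fix \<phi> assume \<phi>: "dual \<phi>"
    obtain A where A: "\<And>z. -1 \<le> Re z \<and> c \<le> \<bar>Im z\<bar> \<and> \<bar>Im z\<bar> \<le> 1 \<Longrightarrow> cmod (\<phi> (Q z)) \<le> A * exp (- \<delta> * Re z)"
      using Qb\<phi>[OF c(1) \<phi>] by metis
    show "has_bochner_integral lborel (\<lambda>t. \<phi> (Q (gamma_path c t)) * vector_derivative (gamma_path c) (at t))
      (\<phi> l)"
    proof (rule has_gamma_integral_scalar[OF Qh[OF \<phi>] c(1) \<delta> _ lim[OF c \<phi>]])
      show "cmod (\<phi> (Q (Complex x y))) \<le> A * exp (- \<delta> * x)" if "0 \<le> x" "\<bar>y\<bar> = c" for x y
        using A[of "Complex x y"] that c by auto
    qed
  qed
  \<comment> \<open>Two candidates are both integrals at some common height \<open>c\<close>, and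
    there the weak integrals determine the vector because functionals separate points.\<close>
  have "(THE e. \<forall>\<^sub>F c in at_right 0. has_gamma_integral sc p c Q e) = l"
  proof (rule the_equality)
    show ev: "\<forall>\<^sub>F c in at_right 0. has_gamma_integral sc p c Q l"
      unfolding eventually_at_right_field using gam by (intro exI[of _ 1]) auto
    fix e assume "\<forall>\<^sub>F c in at_right 0. has_gamma_integral sc p c Q e"
    then have "\<forall>\<^sub>F c in at_right (0::real). has_gamma_integral sc p c Q e \<and> has_gamma_integral sc p c Q l"
      using ev by eventually_elim simp
    then obtain c where "has_gamma_integral sc p c Q e" "has_gamma_integral sc p c Q l"
      using eventually_happens'[OF trivial_limit_at_right_real] by blast
    then show "e = l"
      unfolding has_gamma_integral_def using has_bochner_integral_eq by (intro dual_eqI) blast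
  qed
  then have "laplace sc p \<Omega> G \<zeta> = l" using \<zeta> by (simp add: laplace_def restr_def Q_def[abs_def])
  then show ?thesis using lim[OF c \<phi>] by (simp add: Q\<phi>[OF \<phi>])
qed

lemma laplace_add:
  assumes G: "G \<in> holo sc p slit_plane" "tube_growth b G" and H: "H \<in> holo sc p slit_plane" "tube_growth b H"
    and \<zeta>: "b < Re \<zeta>" "\<zeta> \<in> \<Omega>"
  shows "laplace sc p \<Omega> (G + H) \<zeta> = laplace sc p \<Omega> G \<zeta> + laplace sc p \<Omega> H \<zeta>"
proof (rule dual_eqI)
  fix \<phi> assume \<phi>: "dual \<phi>"
  have GH: "G + H \<in> holo sc p slit_plane" by (rule holo_add[OF G(1) H(1) open_slit_plane])
  have "tube_growth b (G + H)"
    unfolding tube_growth_def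
  proof (intro allI impI)
    fix a and c :: real assume "0 < c"
    obtain A where A: "\<And>z. -1 \<le> Re z \<Longrightarrow> c \<le> \<bar>Im z\<bar> \<Longrightarrow> \<bar>Im z\<bar> \<le> 1 \<Longrightarrow> p a (G z) \<le> A * exp (b * Re z)"
      using tube_growthD[OF G(2) \<open>0 < c\<close>] by metis
    obtain B where B: "\<And>z. -1 \<le> Re z \<Longrightarrow> c \<le> \<bar>Im z\<bar> \<Longrightarrow> \<bar>Im z\<bar> \<le> 1 \<Longrightarrow> p a (H z) \<le> B * exp (b * Re z)"
      using tube_growthD[OF H(2) \<open>0 < c\<close>] by metis
    have "p a ((G + H) z) \<le> (A + B) * exp (b * Re z)" if "-1 \<le> Re z \<and> c \<le> \<bar>Im z\<bar> \<and> \<bar>Im z\<bar> \<le> 1" for z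
      using A[of z] B[of z] that p_add[of a "G z" "H z"] by (simp add: distrib_right)
    then show "\<exists>A. \<forall>z. - 1 \<le> Re z \<and> c \<le> \<bar>Im z\<bar> \<and> \<bar>Im z\<bar> \<le> 1 \<longrightarrow> p a ((G + H) z) \<le> A * exp (b * Re z)" by blast
  qed
  then have "(\<lambda>n. jump 1 (\<lambda>z. \<phi> ((G + H) z) * exp (- z * \<zeta>)) (real n)) \<longlonglongrightarrow> \<phi> (laplace sc p \<Omega> (G + H) \<zeta>)"
    by (intro laplace_limit[OF GH _ \<zeta> \<phi>]) auto
  moreover have "jump 1 (\<lambda>z. \<phi> ((G + H) z) * exp (- z * \<zeta>)) (real n) =
     jump 1 (\<lambda>z. \<phi> (G z) * exp (- z * \<zeta>)) (real n) + jump 1 (\<lambda>z. \<phi> (H z) * exp (- z * \<zeta>)) (real n)" for n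
  proof -
    have "(\<lambda>z. \<phi> (G z) * exp (- z * \<zeta>)) holomorphic_on slit_plane"
      "(\<lambda>z. \<phi> (H z) * exp (- z * \<zeta>)) holomorphic_on slit_plane"
      by (intro holomorphic_intros holo_dual_holomorphic[OF G(1) \<phi>] holo_dual_holomorphic[OF H(1) \<phi>])+
    from jump_add[OF this one_neq_zero] show ?thesis by (simp add: dual_linear[OF \<phi>] distrib_right)
  qed
  moreover have "(\<lambda>n. jump 1 (\<lambda>z. \<phi> (G z) * exp (- z * \<zeta>)) (real n)
    + jump 1 (\<lambda>z. \<phi> (H z) * exp (- z * \<zeta>)) (real n))
     \<longlonglongrightarrow> \<phi> (laplace sc p \<Omega> G \<zeta>) + \<phi> (laplace sc p \<Omega> H \<zeta>)"
    by (intro tendsto_add laplace_limit[OF G \<zeta> \<phi>] laplace_limit[OF H \<zeta> \<phi>]) auto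
  ultimately show "\<phi> (laplace sc p \<Omega> (G + H) \<zeta>) = \<phi> (laplace sc p \<Omega> G \<zeta> + laplace sc p \<Omega> H \<zeta>)"
    by (simp add: dual_linear[OF \<phi>] LIMSEQ_unique)
qed

text \<open>The contour starting at abscissa \<open>- c\<close> costs at most \<open>exp (c *
  \<bar>Re \<zeta>\<bar> + c * \<bar>Im \<zeta>\<bar>)\<close>, and \<open>c\<close> may be as small
  as desired: this is the infraexponential growth of the transforms. \<open>C\<close> is independent
  of \<open>\<zeta>\<close> and \<open>\<delta>\<close>; the distance from the abscissa
  \<open>b\<close> enters as \<open>1 / \<delta>\<close> through the two rays.\<close>

lemma laplace_bound:
  assumes G: "G \<in> holo sc p slit_plane" and gr: "tube_growth b G" and c: "0 < c" "c \<le> 1"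
  obtains C where "0 \<le> C" "\<And>\<zeta> \<delta>. 0 < \<delta> \<Longrightarrow> b + \<delta> \<le> Re \<zeta> \<Longrightarrow> \<zeta> \<in> \<Omega> \<Longrightarrow>
     p a (laplace sc p \<Omega> G \<zeta>) \<le> C * (1 + 1 / \<delta>) * exp (c * \<bar>Re \<zeta>\<bar> + c * \<bar>Im \<zeta>\<bar>)"
proof -
  obtain A where A: "0 \<le> A" "\<And>z. -1 \<le> Re z \<Longrightarrow> c \<le> \<bar>Im z\<bar> \<Longrightarrow> \<bar>Im z\<bar> \<le> 1 \<Longrightarrow> p a (G z) \<le> A * exp (b * Re z)"
    using tube_growthD[OF gr c(1)] by metis
  have seg: "Complex (-c) y \<in> closed_segment (Complex (-c) (-c)) (Complex (-c) c)" if "\<bar>y\<bar> \<le> c" for y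
  proof -
    have "Complex (-c) y = (1 - (y + c) / (2 * c)) *\<^sub>R Complex (-c) (-c) + ((y + c) / (2 * c)) *\<^sub>R Complex (-c) c"
      using c by (simp add: complex_eq_iff field_simps)
    moreover have "0 \<le> (y + c) / (2 * c)" "(y + c) / (2 * c) \<le> 1" using that c
      by (auto simp: field_simps abs_le_iff)
    ultimately show ?thesis unfolding in_segment by blast
  qed
  have "closed_segment (Complex (-c) (-c)) (Complex (-c) c) \<subseteq> slit_plane"
    by (rule closed_segment_subset[OF _ _ convex_halfspace_Re_lt[of 0], THEN order_trans]) (use c in \<open>auto
      simp: slit_plane_iff\<close>)
  then obtain B where B: "0 \<le> B" "\<And>z. z \<in> closed_segment (Complex (-c) (-c)) (Complex (-c) c) \<Longrightarrow> p a (G z) \<le> B"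
    using econt_bounded[OF econt_subset[OF holo_econt[OF G]] compact_segment, of _ _ a] by metis
  define C where "C = 2 * A * exp (c * \<bar>b\<bar>) + 2 * c * B"
  have "p a (laplace sc p \<Omega> G \<zeta>) \<le> C * (1 + 1 / \<delta>) * exp (c * \<bar>Re \<zeta>\<bar> + c * \<bar>Im \<zeta>\<bar>)"
    if \<delta>: "0 < \<delta>" "b + \<delta> \<le> Re \<zeta>" and \<zeta>: "\<zeta> \<in> \<Omega>" for \<zeta> \<delta>
  proof (rule seminorm_le_polar)
    fix \<phi> assume \<phi>': "\<phi> \<in> polar a"
    have \<phi>: "dual \<phi>" by (rule polar_dual[OF \<phi>'])
    let ?q = "\<lambda>z. \<phi> (G z) * exp (- z * \<zeta>)"
    have b\<zeta>: "b < Re \<zeta>" using \<delta> by simp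
    have hq: "?q holomorphic_on slit_plane" by (intro holomorphic_intros holo_dual_holomorphic[OF G \<phi>])
    obtain P where P: "\<And>z. z \<in> slit_plane \<Longrightarrow> (P has_field_derivative ?q z) (at z)"
      using slit_plane_primitive[OF hq] by metis
    have qle: "cmod (?q z) \<le> p a (sc (exp (- z * \<zeta>)) (G z))" for z
      using polar_le[OF \<phi>', of "sc (exp (- z * \<zeta>)) (G z)"] by (simp add: dual_linear[OF \<phi>] mult.commute)
    have "cmod (\<phi> (laplace sc p \<Omega> G \<zeta>)) \<le> 2 * ((A * exp (c * \<bar>Im \<zeta>\<bar>)) / (Re \<zeta> - b)) * exp (- (Re \<zeta> - b) * (- c))
       + 2 * c * (exp (c * \<bar>Im \<zeta>\<bar>) * exp (c * \<bar>Re \<zeta>\<bar>) * B)"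
    proof (rule jump_limit_bound[where \<Omega> = slit_plane, OF P _ c(1)])
      show "(\<lambda>n. P (Complex (real n) c) - P (Complex (real n) (- c))) \<longlonglongrightarrow> \<phi> (laplace sc p \<Omega> G \<zeta>)"
        using laplace_limit[OF G gr b\<zeta> \<zeta> \<phi> c] jump_primitive[OF P, of c] c by simp
      show "cmod (?q (Complex x y)) \<le> A * exp (c * \<bar>Im \<zeta>\<bar>) * exp (- (Re \<zeta> - b) * x)" if "-c \<le> x" "\<bar>y\<bar> = c" for x y
      proof -
        have "p a (G (Complex x y)) \<le> A * exp (b * x)" using A(2)[of "Complex x y"] that c by simp
        then show ?thesis using order_trans[OF qle kernel_bound[of a G "Complex x y" A b c \<zeta>]] A(1) that by simp
      qed
      show "cmod (?q (Complex (-c) y)) \<le> exp (c * \<bar>Im \<zeta>\<bar>) * exp (c * \<bar>Re \<zeta>\<bar>) * B" if "\<bar>y\<bar> \<le> c" for y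
      proof -
        have "cmod (?q (Complex (-c) y)) \<le> cmod (exp (- Complex (-c) y * \<zeta>)) * B"
        proof -
          have "cmod (exp (- Complex (-c) y * \<zeta>)) * p a (G (Complex (-c) y))
            \<le> cmod (exp (- Complex (-c) y * \<zeta>)) * B"
            by (intro mult_left_mono B(2) seg that) simp
          then show ?thesis using qle[of "Complex (-c) y"] unfolding p_scale by linarith
        qed
        also have "\<dots> \<le> (exp (c * \<bar>Im \<zeta>\<bar>) * exp (- Re \<zeta> * (-c))) * B"
          using norm_exp_kernel_le[of "Complex (-c) y" c \<zeta>] that B(1) by (intro mult_right_mono) auto
        also have "\<dots> \<le> (exp (c * \<bar>Im \<zeta>\<bar>) * exp (c * \<bar>Re \<zeta>\<bar>)) * B"
          using c B(1) mult_left_mono[OF abs_ge_self[of "Re \<zeta>"], of c]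
            by (intro mult_right_mono mult_left_mono) (auto simp: mult.commute)
        finally show ?thesis .
      qed
    qed (use b\<zeta> c in \<open>auto simp: slit_plane_iff\<close>)
    also have "\<dots> \<le> (2 * A * exp (c * \<bar>b\<bar>) * (1 / \<delta>)) * exp (c * \<bar>Re \<zeta>\<bar> + c * \<bar>Im \<zeta>\<bar>)
      + (2 * c * B) * exp (c * \<bar>Re \<zeta>\<bar> + c * \<bar>Im \<zeta>\<bar>)"
    proof (rule add_mono)
      have "1 / (Re \<zeta> - b) \<le> 1 / \<delta>" using \<delta> by (intro divide_left_mono) auto
      moreover have "exp (- (Re \<zeta> - b) * (- c)) \<le> exp (c * \<bar>b\<bar>) * exp (c * \<bar>Re \<zeta>\<bar>)"
        using mult_left_mono[of "Re \<zeta> - b" "\<bar>b\<bar> + \<bar>Re \<zeta>\<bar>" c] c by (simp add: algebra_simps flip: exp_add)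
      ultimately have "(1 / (Re \<zeta> - b)) * exp (- (Re \<zeta> - b) * (- c))
        \<le> (1 / \<delta>) * (exp (c * \<bar>b\<bar>) * exp (c * \<bar>Re \<zeta>\<bar>))"
        using \<delta> b\<zeta> by (intro mult_mono) auto
      then have "(2 * A * exp (c * \<bar>Im \<zeta>\<bar>)) * ((1 / (Re \<zeta> - b)) * exp (- (Re \<zeta> - b) * (- c)))
        \<le> (2 * A * exp (c * \<bar>Im \<zeta>\<bar>)) * ((1 / \<delta>) * (exp (c * \<bar>b\<bar>) * exp (c * \<bar>Re \<zeta>\<bar>)))"
        using A(1) by (intro mult_left_mono) auto
      then show "2 * ((A * exp (c * \<bar>Im \<zeta>\<bar>)) / (Re \<zeta> - b)) * exp (- (Re \<zeta> - b) * (- c))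
        \<le> (2 * A * exp (c * \<bar>b\<bar>) * (1 / \<delta>)) * exp (c * \<bar>Re \<zeta>\<bar> + c * \<bar>Im \<zeta>\<bar>)"
        by (simp add: exp_add mult_ac)
      show "2 * c * (exp (c * \<bar>Im \<zeta>\<bar>) * exp (c * \<bar>Re \<zeta>\<bar>) * B) \<le> (2 * c * B) * exp (c * \<bar>Re \<zeta>\<bar> + c * \<bar>Im \<zeta>\<bar>)"
        by (simp add: exp_add mult_ac)
    qed
    also have "\<dots> \<le> C * (1 + 1 / \<delta>) * exp (c * \<bar>Re \<zeta>\<bar> + c * \<bar>Im \<zeta>\<bar>)"
    proof -
      have "2 * A * exp (c * \<bar>b\<bar>) * (1 / \<delta>) + 2 * c * B \<le> C * (1 + 1 / \<delta>)"
      proof -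
        have "0 \<le> 2 * A * exp (c * \<bar>b\<bar>)" "0 \<le> (2 * c * B) * (1 / \<delta>)" using A(1) B(1) c \<delta>(1) by auto
        moreover have "C * (1 + 1 / \<delta>) = (2 * A * exp (c * \<bar>b\<bar>) * (1 / \<delta>) + 2 * c * B) +
          (2 * A * exp (c * \<bar>b\<bar>) + (2 * c * B) * (1 / \<delta>))"
          unfolding C_def by (simp only: distrib_left distrib_right mult_1_right)
        ultimately show ?thesis by linarith
      qed
      then show ?thesis unfolding distrib_right[symmetric] by (intro mult_right_mono) auto
    qed
    finally show "cmod (\<phi> (laplace sc p \<Omega> G \<zeta>)) \<le> C * (1 + 1 / \<delta>) * exp (c * \<bar>Re \<zeta>\<bar> + c * \<bar>Im \<zeta>\<bar>)" .
  qed
  moreover have "0 \<le> C" using A(1) B(1) c by (simp add: C_def)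
  ultimately show ?thesis using that by blast
qed

text \<open>Near each point one abscissa \<open>b\<close> to its left is fixed. Beyond
  \<open>b\<close> the scalar transforms are locally uniform limits of truncated integrals, and
  \<open>laplace_bound\<close> supplies the local boundedness.\<close>

lemma laplace_holo:
  assumes G: "G \<in> holo sc p slit_plane" and gr: "\<And>\<zeta>. \<zeta> \<in> \<Omega> \<Longrightarrow> \<exists>b < Re \<zeta>. tube_growth b G" and \<Omega>: "open \<Omega>"
  shows "laplace sc p \<Omega> G \<in> holo sc p \<Omega>"
proof (rule holoI_weak[OF _ \<Omega>])
  show "restr \<Omega> (laplace sc p \<Omega> G) = laplace sc p \<Omega> G" by (simp add: laplace_def)
  show "(\<lambda>z. \<phi> (laplace sc p \<Omega> G z)) holomorphic_on \<Omega>" if \<phi>: "dual \<phi>" for \<phi>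
    unfolding holomorphic_on_def
  proof
    fix \<zeta> assume \<zeta>: "\<zeta> \<in> \<Omega>"
    then obtain b where b: "b < Re \<zeta>" "tube_growth b G" using gr by blast
    obtain a C where C: "C > 0" "\<And>x. cmod (\<phi> x) \<le> C * p a x" using dual_bounded[OF \<phi>] by metis
    obtain A where A: "\<And>z. -1 \<le> Re z \<Longrightarrow> 1 \<le> \<bar>Im z\<bar> \<Longrightarrow> \<bar>Im z\<bar> \<le> 1 \<Longrightarrow> p a (G z) \<le> A * exp (b * Re z)"
      using tube_growthD[OF b(2) zero_less_one, of a] by metis
    let ?H = "{\<zeta>. b < Re \<zeta>}"
    have "(\<lambda>z. \<phi> (laplace sc p ?H G z)) holomorphic_on ?H"
    proof (rule Laplace_limit_holomorphic[OF holo_dual_holomorphic[OF G \<phi>] zero_less_one])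
      show "cmod (\<phi> (G (Complex x y))) \<le> (C * A) * exp (b * x)" if "0 \<le> x" "\<bar>y\<bar> = 1" for x y
      proof -
        have "C * p a (G (Complex x y)) \<le> C * (A * exp (b * x))"
          using A[of "Complex x y"] that C(1) by (intro mult_left_mono) auto
        then show ?thesis using C(2)[of "G (Complex x y)"] by simp
      qed
      show "(\<lambda>n. jump 1 (\<lambda>z. \<phi> (G z) * exp (- z * \<zeta>)) (real n)) \<longlonglongrightarrow> \<phi> (laplace sc p ?H G \<zeta>)" if "b < Re \<zeta>" for \<zeta>
        by (rule laplace_limit[OF G b(2) that _ \<phi>]) (use that in auto)
    qed
    then have "(\<lambda>z. \<phi> (laplace sc p ?H G z)) field_differentiable at \<zeta>"
      by (rule holomorphic_on_imp_differentiable_at) (use b in \<open>auto simp: open_halfspace_Re_gt\<close>)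
    moreover have "\<phi> (laplace sc p ?H G z) = \<phi> (laplace sc p \<Omega> G z)" if "z \<in> ?H \<inter> \<Omega>" for z
      using that by (simp add: laplace_def restr_def)
    moreover have "open (?H \<inter> \<Omega>)" "\<zeta> \<in> ?H \<inter> \<Omega>" using b \<zeta> \<Omega> open_halfspace_Re_gt by auto
    ultimately have "(\<lambda>z. \<phi> (laplace sc p \<Omega> G z)) field_differentiable at \<zeta>"
      unfolding field_differentiable_def by (blast intro: has_field_derivative_transform_within_open)
    then show "(\<lambda>z. \<phi> (laplace sc p \<Omega> G z)) field_differentiable at \<zeta> within \<Omega>"
      by (rule field_differentiable_at_within)
  qed
  fix a \<zeta> assume \<zeta>: "\<zeta> \<in> \<Omega>"
  then obtain b where b: "b < Re \<zeta>" "tube_growth b G" using gr by blast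
  obtain C where C: "0 \<le> C" "\<And>\<zeta> \<delta>. 0 < \<delta> \<Longrightarrow> b + \<delta> \<le> Re \<zeta> \<Longrightarrow> \<zeta> \<in> \<Omega> \<Longrightarrow>
     p a (laplace sc p \<Omega> G \<zeta>) \<le> C * (1 + 1 / \<delta>) * exp (1 * \<bar>Re \<zeta>\<bar> + 1 * \<bar>Im \<zeta>\<bar>)"
    using laplace_bound[OF G b(2) zero_less_one order_refl] by metis
  define d where "d = (Re \<zeta> - b) / 2"
  have d: "d > 0" using b by (simp add: d_def)
  have "p a (laplace sc p \<Omega> G w) \<le> C * (1 + 1 / d) * exp (2 * (cmod \<zeta> + d))" if w: "w \<in> ball \<zeta> d" "w \<in> \<Omega>" for w
  proof -
    have "\<bar>Re w - Re \<zeta>\<bar> \<le> d" "cmod w \<le> cmod \<zeta> + d"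
      using w(1) abs_Re_le_cmod[of "w - \<zeta>"] norm_triangle_ineq2[of w \<zeta>]
        by (auto simp: dist_norm norm_minus_commute)
    moreover have "Re \<zeta> = b + 2 * d" unfolding d_def by (simp add: field_simps)
    ultimately have "b + d \<le> Re w" "\<bar>Re w\<bar> \<le> cmod \<zeta> + d" "\<bar>Im w\<bar> \<le> cmod \<zeta> + d"
      using abs_Re_le_cmod[of w] abs_Im_le_cmod[of w] by linarith+
    then have "p a (laplace sc p \<Omega> G w) \<le> C * (1 + 1 / d) * exp (1 * \<bar>Re w\<bar> + 1 * \<bar>Im w\<bar>)"
      using C(2)[OF d] w by blast
    also have "\<dots> \<le> C * (1 + 1 / d) * exp (2 * (cmod \<zeta> + d))"
      using C(1) d \<open>\<bar>Re w\<bar> \<le> cmod \<zeta> + d\<close> \<open>\<bar>Im w\<bar> \<le> cmod \<zeta> + d\<close> by (intro mult_left_mono) auto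
    finally show ?thesis .
  qed
  then show "\<exists>r>0. \<exists>B. \<forall>w\<in>ball \<zeta> r. w \<in> \<Omega> \<longrightarrow> p a (laplace sc p \<Omega> G w) \<le> B" using d by blast
qed

text \<open>For entire \<open>h\<close> the contour is moved to the right of \<open>Re z = k\<close>.\<close>

lemma entire_laplace_decay:
  assumes h: "h \<in> holo sc p UNIV" and gr: "tube_growth b (restr slit_plane h)" and "0 < s" and k: "1 \<le> k"
  obtains C where "0 \<le> C" "\<And>\<zeta> l. b + s \<le> Re \<zeta> \<Longrightarrow>
    (\<And>\<phi>. \<phi> \<in> polar a \<Longrightarrow> (\<lambda>n. jump (1 / k) (\<lambda>z. \<phi> (h z) * exp (- z * \<zeta>)) (real n)) \<longlonglongrightarrow> \<phi> l) \<Longrightarrow>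
    p a l \<le> C * exp (1 / k * \<bar>Im \<zeta>\<bar> - k * Re \<zeta>)"
proof -
  \<comment> \<open>The half-width \<open>1 / k\<close> produces the factor
    \<open>exp (\<bar>Im \<zeta>\<bar> / k)\<close>, the abscissa \<open>k\<close> of the moved
    contour the factor \<open>exp (- k * Re \<zeta>)\<close>; together they match the weights of
    \<open>LO_inf\<close> and \<open>LG_inf\<close>.\<close>
  define c where "c = 1 / k"
  have c: "0 < c" "c \<le> 1" using k by (auto simp: c_def)
  obtain A where A: "0 \<le> A" "\<And>z. -1 \<le> Re z \<Longrightarrow> c \<le> \<bar>Im z\<bar> \<Longrightarrow> \<bar>Im z\<bar> \<le> 1
    \<Longrightarrow> p a (restr slit_plane h z) \<le> A * exp (b * Re z)"
    using tube_growthD[OF gr c(1)] by metis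
  have seg: "Complex k y \<in> closed_segment (Complex k (-c)) (Complex k c)" if "\<bar>y\<bar> \<le> c" for y
  proof -
    have "Complex k y = (1 - (y + c) / (2 * c)) *\<^sub>R Complex k (-c) + ((y + c) / (2 * c)) *\<^sub>R Complex k c"
      using c by (simp add: complex_eq_iff field_simps)
    moreover have "0 \<le> (y + c) / (2 * c)" "(y + c) / (2 * c) \<le> 1" using that c
      by (auto simp: field_simps abs_le_iff)
    ultimately show ?thesis unfolding in_segment by blast
  qed
  obtain B where B: "0 \<le> B" "\<And>z. z \<in> closed_segment (Complex k (-c)) (Complex k c) \<Longrightarrow> p a (h z) \<le> B"
    using econt_bounded[OF econt_subset[OF holo_econt[OF h] subset_UNIV] compact_segment, of _ _ a] by metis
  define C where "C = 2 * A * exp (b * k) * (1 / s) + 2 * c * B"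
  have "p a l \<le> C * exp (c * \<bar>Im \<zeta>\<bar> - k * Re \<zeta>)"
    if \<zeta>: "b + s \<le> Re \<zeta>" and l: "\<And>\<phi>. \<phi> \<in> polar a \<Longrightarrow> (\<lambda>n. jump c (\<lambda>z. \<phi> (h z) * exp (- z * \<zeta>)) (real n))
      \<longlonglongrightarrow> \<phi> l" for \<zeta> l
  proof (rule seminorm_le_polar)
    fix \<phi> assume \<phi>': "\<phi> \<in> polar a"
    have \<phi>: "dual \<phi>" by (rule polar_dual[OF \<phi>'])
    let ?q = "\<lambda>z. \<phi> (h z) * exp (- z * \<zeta>)"
    have b\<zeta>: "b < Re \<zeta>" using \<zeta> \<open>0 < s\<close> by simp
    have "?q holomorphic_on UNIV" by (intro holomorphic_intros holo_dual_holomorphic[OF h \<phi>])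
    then obtain P where P: "\<And>z. (P has_field_derivative ?q z) (at z)"
      using holomorphic_convex_primitive'[of UNIV ?q] by auto
    have qle: "cmod (?q z) \<le> p a (sc (exp (- z * \<zeta>)) (h z))" for z
      using polar_le[OF \<phi>', of "sc (exp (- z * \<zeta>)) (h z)"] by (simp add: dual_linear[OF \<phi>] mult.commute)
    have "cmod (\<phi> l) \<le> 2 * ((A * exp (c * \<bar>Im \<zeta>\<bar>)) / (Re \<zeta> - b)) * exp (- (Re \<zeta> - b) * k)
       + 2 * c * (exp (c * \<bar>Im \<zeta>\<bar>) * exp (- Re \<zeta> * k) * B)"
    proof (rule jump_limit_bound[where \<Omega> = UNIV, OF P _ c(1)])
      show "(\<lambda>n. P (Complex (real n) c) - P (Complex (real n) (- c))) \<longlonglongrightarrow> \<phi> l"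
        using l[OF \<phi>'] jump_primitive[OF P, of c] c by simp
      show "cmod (?q (Complex x y)) \<le> A * exp (c * \<bar>Im \<zeta>\<bar>) * exp (- (Re \<zeta> - b) * x)" if "k \<le> x" "\<bar>y\<bar> = c" for x y
      proof -
        have "y \<noteq> 0" using that c by auto
        then have "p a (h (Complex x y)) \<le> A * exp (b * x)"
          using A(2)[of "Complex x y"] that c k by (simp add: restr_def)
        then show ?thesis using order_trans[OF qle kernel_bound[of a h "Complex x y" A b c \<zeta>]] A(1) that by auto
      qed
      show "cmod (?q (Complex k y)) \<le> exp (c * \<bar>Im \<zeta>\<bar>) * exp (- Re \<zeta> * k) * B" if "\<bar>y\<bar> \<le> c" for y
      proof -
        have "cmod (?q (Complex k y)) \<le> cmod (exp (- Complex k y * \<zeta>)) * B"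
        proof -
          have "cmod (exp (- Complex k y * \<zeta>)) * p a (h (Complex k y)) \<le> cmod (exp (- Complex k y * \<zeta>)) * B"
            by (intro mult_left_mono B(2) seg that) simp
          then show ?thesis using qle[of "Complex k y"] unfolding p_scale by linarith
        qed
        also have "\<dots> \<le> (exp (c * \<bar>Im \<zeta>\<bar>) * exp (- Re \<zeta> * k)) * B"
          using norm_exp_kernel_le[of "Complex k y" c \<zeta>] that B(1) by (intro mult_right_mono) auto
        finally show ?thesis .
      qed
    qed (use b\<zeta> in auto)
    also have "\<dots> \<le> (2 * A * exp (b * k) * (1 / s)) * exp (c * \<bar>Im \<zeta>\<bar> - k * Re \<zeta>)
      + (2 * c * B) * exp (c * \<bar>Im \<zeta>\<bar> - k * Re \<zeta>)"
    proof (rule add_mono)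
      have "1 / (Re \<zeta> - b) \<le> 1 / s" using \<open>0 < s\<close> \<zeta> by (intro divide_left_mono) auto
      then have "(2 * A * exp (b * k) * exp (c * \<bar>Im \<zeta>\<bar> - k * Re \<zeta>)) * (1 / (Re \<zeta> - b))
        \<le> (2 * A * exp (b * k) * exp (c * \<bar>Im \<zeta>\<bar> - k * Re \<zeta>)) * (1 / s)"
        using A(1) by (intro mult_left_mono) auto
      moreover have "exp (c * \<bar>Im \<zeta>\<bar>) * exp (- (Re \<zeta> - b) * k) = exp (b * k) * exp (c * \<bar>Im \<zeta>\<bar> - k * Re \<zeta>)"
        by (simp add: algebra_simps flip: exp_add)
      ultimately show "2 * ((A * exp (c * \<bar>Im \<zeta>\<bar>)) / (Re \<zeta> - b)) * exp (- (Re \<zeta> - b) * k)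
        \<le> (2 * A * exp (b * k) * (1 / s)) * exp (c * \<bar>Im \<zeta>\<bar> - k * Re \<zeta>)"
        by (simp add: mult_ac)
      have "exp (c * \<bar>Im \<zeta>\<bar>) * exp (- Re \<zeta> * k) = exp (c * \<bar>Im \<zeta>\<bar> - k * Re \<zeta>)"
        by (simp add: algebra_simps flip: exp_add)
      then show "2 * c * (exp (c * \<bar>Im \<zeta>\<bar>) * exp (- Re \<zeta> * k) * B) \<le> (2 * c * B) * exp (c * \<bar>Im \<zeta>\<bar> - k * Re \<zeta>)"
        by (simp add: mult_ac)
    qed
    also have "\<dots> = C * exp (c * \<bar>Im \<zeta>\<bar> - k * Re \<zeta>)" by (simp add: C_def distrib_right)
    finally show "cmod (\<phi> l) \<le> C * exp (c * \<bar>Im \<zeta>\<bar> - k * Re \<zeta>)" .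
  qed
  moreover have "0 \<le> C" using A(1) B(1) c \<open>0 < s\<close> by (simp add: C_def)
  ultimately show ?thesis using that unfolding c_def by blast
qed

section \<open>The transforms map into the weighted spaces\<close>

lemma jump_restr: "c \<noteq> 0 \<Longrightarrow> jump c (\<lambda>z. \<phi> (restr slit_plane h z) * K z) R = jump c (\<lambda>z. \<phi> (h z) * K z) R"
  unfolding jump_def
  by (rule esum_cong) (use jump_edges_slit[of c R] in \<open>auto simp: restr_def subset_iff\<close>)

lemma restr_O_exp: "h \<in> O_exp sc p {\<infinity>} \<Longrightarrow> restr slit_plane h \<in> O_exp sc p {0..\<infinity>}"
  and restr_H_minus_inf: "h \<in> H_minus_inf sc p {\<infinity>} \<Longrightarrow> restr slit_plane h \<in> H_minus_inf sc p {0..\<infinity>}"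
proof -
  have *: "restr slit_plane h \<in> weighted_holo sc p slit_plane (strip_minus {0..\<infinity>}) w"
    if h: "h \<in> weighted_holo sc p (- finite_part {\<infinity>}) (strip_minus {\<infinity>}) w" for w
  proof (rule weighted_holoI)
    show "restr slit_plane h \<in> holo sc p slit_plane"
      by (rule holo_restr[OF weighted_holo_holo[OF h]]) (auto simp: open_slit_plane)
    fix n :: nat and a assume "1 \<le> n"
    then obtain M where M: "0 \<le> M" "\<And>z. z \<in> strip_minus {\<infinity>} n \<Longrightarrow> p a (h z) \<le> M * exp (- w n z)"
      using weighted_holoD[OF h] by metis
    have "p a (restr slit_plane h z) \<le> M * exp (- w n z)" if "z \<in> strip_minus {0..\<infinity>} n" for z
      using M that strip_minus_subset[of n] by (auto simp: restr_def)
    then show "\<exists>M. \<forall>z\<in>strip_minus {0..\<infinity>} n. p a (restr slit_plane h z) \<le> M * exp (- w n z)" by blast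
  qed
  show "h \<in> O_exp sc p {\<infinity>} \<Longrightarrow> restr slit_plane h \<in> O_exp sc p {0..\<infinity>}"
    "h \<in> H_minus_inf sc p {\<infinity>} \<Longrightarrow> restr slit_plane h \<in> H_minus_inf sc p {0..\<infinity>}"
    unfolding O_exp_def H_minus_inf_def by (rule *, assumption)+
qed

text \<open>With \<open>c = 1 / (2 * k)\<close> the exponent of \<open>laplace_bound\<close> is at
  most \<open>cmod \<zeta> / k\<close>; \<open>b = -(k + 1)\<close> leaves the distance
  \<open>\<delta> = 1\<close> to the half-plane \<open>Re \<zeta> \<ge> - k\<close>.\<close>

lemma laplace_LG_zero_inf:
  assumes g: "g \<in> H_minus_inf sc p {0..\<infinity>}"
  shows "laplace sc p UNIV g \<in> LG_zero_inf sc p"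
  unfolding LG_zero_inf_def
proof (rule weighted_holoI)
  have g': "g \<in> holo sc p slit_plane" using g weighted_holo_holo by (auto simp: H_minus_inf_def)
  show "laplace sc p UNIV g \<in> holo sc p UNIV"
    by (rule laplace_holo[OF g' _ open_UNIV]) (use H_minus_inf_growth[OF g] lt_ex in blast)
  fix k :: nat and a assume k: "1 \<le> k"
  define c where "c = 1 / (2 * real k)"
  have c: "0 < c" "c \<le> 1" using k by (auto simp: c_def)
  obtain C where C: "0 \<le> C" "\<And>\<zeta> \<delta>. 0 < \<delta> \<Longrightarrow> - (real k + 1) + \<delta> \<le> Re \<zeta> \<Longrightarrow> \<zeta> \<in> UNIV \<Longrightarrow>
     p a (laplace sc p UNIV g \<zeta>) \<le> C * (1 + 1 / \<delta>) * exp (c * \<bar>Re \<zeta>\<bar> + c * \<bar>Im \<zeta>\<bar>)"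
    using laplace_bound[OF g' H_minus_inf_growth[OF g] c] by metis
  have "p a (laplace sc p UNIV g \<zeta>) \<le> (C * 2) * exp (- (- (1 / real k) * cmod \<zeta>))"
    if "\<zeta> \<in> {z. - real k \<le> Re z}" for \<zeta>
  proof -
    have "c * \<bar>Re \<zeta>\<bar> + c * \<bar>Im \<zeta>\<bar> \<le> c * cmod \<zeta> + c * cmod \<zeta>"
      using c by (intro add_mono mult_left_mono abs_Re_le_cmod abs_Im_le_cmod) auto
    also have "\<dots> = - (- (1 / real k) * cmod \<zeta>)" by (simp add: c_def field_simps)
    finally have "C * 2 * exp (c * \<bar>Re \<zeta>\<bar> + c * \<bar>Im \<zeta>\<bar>) \<le> (C * 2) * exp (- (- (1 / real k) * cmod \<zeta>))"
      using C(1) by (intro mult_left_mono) auto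
    then show ?thesis using C(2)[of 1 \<zeta>] that by simp
  qed
  then show "\<exists>M. \<forall>z\<in>{z. - real k \<le> Re z}. p a (laplace sc p UNIV g z)
    \<le> M * exp (- (- (1 / real k) * cmod z))" by blast
qed

text \<open>\<open>O_exp_growth\<close> admits only positive \<open>b\<close>. The abscissa
  \<open>b = 1 / (2 * k)\<close> and the gap \<open>s = 1 / (2 * k)\<close> reach exactly the
  half-plane \<open>Re \<zeta> \<ge> 1 / k\<close>.\<close>

lemma laplace_LO_inf:
  assumes h: "h \<in> O_exp sc p {\<infinity>}"
  shows "laplace sc p right_half_plane (restr slit_plane h) \<in> LO_inf sc p"
  unfolding LO_inf_def
proof (rule weighted_holoI)
  have h': "h \<in> holo sc p UNIV" using h weighted_holo_holo by (fastforce simp: O_exp_def)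
  note r = restr_O_exp[OF h]
  have r': "restr slit_plane h \<in> holo sc p slit_plane" using r weighted_holo_holo by (auto simp: O_exp_def)
  show "laplace sc p right_half_plane (restr slit_plane h) \<in> holo sc p right_half_plane"
    by (rule laplace_holo[OF r' _ open_halfspace_Re_gt]) (use O_exp_growth[OF r] dense in blast)
  fix k :: nat and a assume k: "1 \<le> k"
  let ?b = "1 / (2 * real k)"
  have b: "0 < ?b" using k by simp
  have k1: "1 \<le> real k" using k by simp
  obtain C where C: "0 \<le> C" "\<And>\<zeta> l. ?b + ?b \<le> Re \<zeta> \<Longrightarrow>
    (\<And>\<phi>. \<phi> \<in> polar a \<Longrightarrow> (\<lambda>n. jump (1 / real k) (\<lambda>z. \<phi> (h z) * exp (- z * \<zeta>)) (real n)) \<longlonglongrightarrow> \<phi> l) \<Longrightarrow>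
    p a l \<le> C * exp (1 / real k * \<bar>Im \<zeta>\<bar> - real k * Re \<zeta>)"
    by (rule entire_laplace_decay[OF h' O_exp_growth[OF r b] b k1, of a]) blast
  have "p a (laplace sc p right_half_plane (restr slit_plane h) \<zeta>)
    \<le> C * exp (- (- (1 / real k) * cmod \<zeta> + real k * \<bar>Re \<zeta>\<bar>))"
    if "\<zeta> \<in> {z. 1 / real k \<le> Re z}" for \<zeta>
  proof -
    have k0: "0 < 1 / real k" "1 / real k \<le> 1" using k by auto
    have "?b < 1 / real k" using k by (simp add: field_simps)
    moreover have "1 / real k \<le> Re \<zeta>" using that by simp
    ultimately have \<zeta>: "1 / real k \<le> Re \<zeta>" "0 < Re \<zeta>" "?b < Re \<zeta>" using k0(1) by linarith+
    have "p a (laplace sc p right_half_plane (restr slit_plane h) \<zeta>)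
      \<le> C * exp (1 / real k * \<bar>Im \<zeta>\<bar> - real k * Re \<zeta>)"
    proof (rule C(2))
      show "?b + ?b \<le> Re \<zeta>" using \<zeta>(1) by simp
      fix \<phi> assume "\<phi> \<in> polar a"
      have "\<zeta> \<in> right_half_plane" using \<zeta>(2) by simp
      from laplace_limit[OF r' O_exp_growth[OF r b] \<zeta>(3) this polar_dual[OF \<open>\<phi> \<in> polar a\<close>] k0]
      show "(\<lambda>n. jump (1 / real k) (\<lambda>z. \<phi> (h z) * exp (- z * \<zeta>)) (real n))
        \<longlonglongrightarrow> \<phi> (laplace sc p right_half_plane (restr slit_plane h) \<zeta>)"
        using k0 jump_restr[of "1 / real k" \<phi> h "\<lambda>z. exp (- z * \<zeta>)"] by simp
    qed
    also have "\<dots> \<le> C * exp (- (- (1 / real k) * cmod \<zeta> + real k * \<bar>Re \<zeta>\<bar>))"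
      using C(1) k0 \<zeta>(2) mult_left_mono[OF abs_Im_le_cmod[of \<zeta>], of "1 / real k"] by (intro mult_left_mono) auto
    finally show ?thesis .
  qed
  then show "\<exists>M. \<forall>z\<in>{z. 1 / real k \<le> Re z}. p a (laplace sc p right_half_plane (restr slit_plane h) z) \<le>
     M * exp (- (- (1 / real k) * cmod z + real k * \<bar>Re z\<bar>))" by blast
qed

text \<open>Here \<open>b = -(k + 1)\<close> and \<open>s = 1\<close>. For
  \<open>- k \<le> Re \<zeta> < 0\<close> the weight contains \<open>\<bar>Re \<zeta>\<bar>\<close>
  where the estimate has \<open>Re \<zeta>\<close>, which costs at most the factor
  \<open>exp (2 * k^2)\<close>.\<close>

lemma laplace_LG_inf:
  assumes h: "h \<in> H_minus_inf sc p {\<infinity>}"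
  shows "laplace sc p UNIV (restr slit_plane h) \<in> LG_inf sc p"
  unfolding LG_inf_def
proof (rule weighted_holoI)
  have h': "h \<in> holo sc p UNIV" using h weighted_holo_holo by (fastforce simp: H_minus_inf_def)
  note r = restr_H_minus_inf[OF h]
  have r': "restr slit_plane h \<in> holo sc p slit_plane" using r weighted_holo_holo by (auto simp: H_minus_inf_def)
  show "laplace sc p UNIV (restr slit_plane h) \<in> holo sc p UNIV"
    by (rule laplace_holo[OF r' _ open_UNIV]) (use H_minus_inf_growth[OF r] lt_ex in blast)
  fix k :: nat and a assume k: "1 \<le> k"
  let ?b = "- (real k + 1)"
  have k1: "1 \<le> real k" using k by simp
  obtain C where C: "0 \<le> C" "\<And>\<zeta> l. ?b + 1 \<le> Re \<zeta> \<Longrightarrow>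
    (\<And>\<phi>. \<phi> \<in> polar a \<Longrightarrow> (\<lambda>n. jump (1 / real k) (\<lambda>z. \<phi> (h z) * exp (- z * \<zeta>)) (real n)) \<longlonglongrightarrow> \<phi> l) \<Longrightarrow>
    p a l \<le> C * exp (1 / real k * \<bar>Im \<zeta>\<bar> - real k * Re \<zeta>)"
    by (rule entire_laplace_decay[OF h' H_minus_inf_growth[OF r] zero_less_one k1, of ?b a]) blast
  have "p a (laplace sc p UNIV (restr slit_plane h) \<zeta>) \<le> (C * exp (2 * real k ^ 2)) * exp (- (real k * \<bar>Re
    \<zeta>\<bar> - (1 / real k) * cmod \<zeta>))"
    if "\<zeta> \<in> {z. - real k \<le> Re z}" for \<zeta>
  proof -
    have k0: "0 < 1 / real k" "1 / real k \<le> 1" using k by auto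
    have \<zeta>: "- real k \<le> Re \<zeta>" "?b < Re \<zeta>" using that by auto
    have "p a (laplace sc p UNIV (restr slit_plane h) \<zeta>) \<le> C * exp (1 / real k * \<bar>Im \<zeta>\<bar> - real k * Re \<zeta>)"
    proof (rule C(2))
      show "?b + 1 \<le> Re \<zeta>" using \<zeta>(1) by simp
      fix \<phi> assume "\<phi> \<in> polar a"
      from laplace_limit[OF r' H_minus_inf_growth[OF r] \<zeta>(2) UNIV_I polar_dual[OF this] k0]
      show "(\<lambda>n. jump (1 / real k) (\<lambda>z. \<phi> (h z) * exp (- z * \<zeta>)) (real n))
        \<longlonglongrightarrow> \<phi> (laplace sc p UNIV (restr slit_plane h) \<zeta>)"
        using k0 jump_restr[of "1 / real k" \<phi> h "\<lambda>z. exp (- z * \<zeta>)"] by simp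
    qed
    also have "\<dots> \<le> C * exp (2 * real k ^ 2 - (real k * \<bar>Re \<zeta>\<bar> - (1 / real k) * cmod \<zeta>))"
    proof -
      have "real k * \<bar>Re \<zeta>\<bar> - real k * Re \<zeta> \<le> 2 * real k ^ 2"
      proof (cases "0 \<le> Re \<zeta>")
        case False
        then have "real k * \<bar>Re \<zeta>\<bar> - real k * Re \<zeta> = 2 * (real k * (- Re \<zeta>))" by simp
        also have "\<dots> \<le> 2 * (real k * real k)" using \<zeta>(1) by (intro mult_left_mono) auto
        finally show ?thesis by (simp add: power2_eq_square)
      qed simp
      then show ?thesis
        using C(1) k0 mult_left_mono[OF abs_Im_le_cmod[of \<zeta>], of "1 / real k"] by (intro mult_left_mono) auto
    qed
    also have "\<dots> = (C * exp (2 * real k ^ 2)) * exp (- (real k * \<bar>Re \<zeta>\<bar> - (1 / real k) * cmod \<zeta>))"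
      by (simp add: mult.assoc flip: exp_add)
    finally show ?thesis .
  qed
  then show "\<exists>M. \<forall>z\<in>{z. - real k \<le> Re z}. p a (laplace sc p UNIV (restr slit_plane h) z) \<le>
     M * exp (- (real k * \<bar>Re z\<bar> - (1 / real k) * cmod z))" by blast
qed

end

section \<open>The Borel transform\<close>

definition infra_exp :: "(complex \<Rightarrow> complex) \<Rightarrow> bool" where
  "infra_exp F \<longleftrightarrow> (\<forall>\<epsilon>>0. \<exists>C. \<forall>s. 1 \<le> Re s \<longrightarrow> cmod (F s) \<le> C * exp (\<epsilon> * cmod s))"

text \<open>The Borel integral along the ray from 1 in direction \<open>d\<close>, truncated at
  length \<open>n\<close>. It starts at 1 because infraexponential bounds hold only away from the
  imaginary axis.\<close>

definition ray_int :: "complex \<Rightarrow> (complex \<Rightarrow> complex) \<Rightarrow> nat \<Rightarrow> complex \<Rightarrow> complex" where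
  "ray_int d F n z = esum [(1, 1 + of_nat n * d)] (\<lambda>s. F s * exp (z * s))"

text \<open>The rays stay in \<open>Re s \<ge> 1\<close>, and the half-planes of convergence
  \<open>Re (d * z) < 0\<close> are \<open>Re z < 0\<close>, \<open>Im z > 0\<close> and
  \<open>Im z < 0\<close>, which cover exactly the slit plane.\<close>

definition dirs :: "complex set" where "dirs = {1, \<i>, - \<i>}"

text \<open>By \<open>ray_int_rotate\<close> the limits along different admissible directions agree,
  so one function \<open>L\<close> serves all of them; an estimate may then use the direction that
  suits \<open>z\<close>.\<close>

definition borel_value :: "(complex \<Rightarrow> complex) \<Rightarrow> (complex \<Rightarrow> complex) \<Rightarrow> bool" where
  "borel_value F L \<longleftrightarrow> (\<forall>z. \<forall>d\<in>dirs. Re (d * z) < 0 \<longrightarrow> (\<lambda>n. ray_int d F n z) \<longlonglongrightarrow> L z)"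

lemma dirs_Re: "d \<in> dirs \<Longrightarrow> 0 \<le> Re d \<and> cmod d = 1"
  by (auto simp: dirs_def)

lemma slit_plane_dirs: "z \<in> slit_plane \<longleftrightarrow> (\<exists>d\<in>dirs. Re (d * z) < 0)"
  by (auto simp: dirs_def slit_plane_iff)

lemma ray_segment:
  assumes "d \<in> dirs" "e \<in> dirs" "0 \<le> (t::real)" "s \<in> closed_segment (1 + of_real t * d) (1 + of_real t * e)"
  shows "1 \<le> Re s" "cmod s \<le> 1 + t"
proof -
  have "closed_segment (1 + of_real t * d) (1 + of_real t * e) \<subseteq> {s. 1 \<le> Re s} \<inter> cball 0 (1 + t)"
  proof (rule closed_segment_subset)
    show "convex ({s. 1 \<le> Re s} \<inter> cball 0 (1 + t))" by (intro convex_Int convex_halfspace_Re_ge convex_cball)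
    have "cmod (1 + of_real t * d) \<le> 1 + t" if "d \<in> dirs" for d
      using norm_triangle_ineq[of 1 "of_real t * d"] dirs_Re[OF that] assms(3) by (simp add: norm_mult)
    then show "1 + of_real t * d \<in> {s. 1 \<le> Re s} \<inter> cball 0 (1 + t)" "1 + of_real t * e \<in> {s. 1
      \<le> Re s} \<inter> cball 0 (1 + t)"
      using assms dirs_Re by auto
  qed
  then show "1 \<le> Re s" "cmod s \<le> 1 + t" using assms(4) by (auto simp: dist_norm)
qed

lemma ray_from_1: "d \<in> dirs \<Longrightarrow> s \<in> closed_segment 1 (1 + of_nat n * d) \<Longrightarrow> 1 \<le> Re s"
proof -
  assume d: "d \<in> dirs" and s: "s \<in> closed_segment 1 (1 + of_nat n * d)"
  have "closed_segment 1 (1 + of_nat n * d) \<subseteq> {s. 1 \<le> Re s}"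
    by (rule closed_segment_subset) (use dirs_Re[OF d] in \<open>auto intro: convex_halfspace_Re_ge\<close>)
  then show ?thesis using s by blast
qed

lemma half_plane_primitive:
  assumes "F holomorphic_on right_half_plane"
  obtains P where "\<And>s. 0 < Re s \<Longrightarrow> (P has_field_derivative F s) (at s)"
proof -
  obtain P where P: "\<And>s. s \<in> right_half_plane \<Longrightarrow> (P has_field_derivative F s) (at s within right_half_plane)"
    by (rule holomorphic_convex_primitive'[OF convex_halfspace_Re_gt open_halfspace_Re_gt assms]) blast
  have "(P has_field_derivative F s) (at s)" if "0 < Re s" for s
    using P[of s] that at_within_open[OF _ open_halfspace_Re_gt, of s 0] by simp
  then show ?thesis using that by blast
qed

lemma ray_int_primitive:
  assumes P: "\<And>s. 0 < Re s \<Longrightarrow> (P has_field_derivative F s * exp (z * s)) (at s)" and d: "d \<in> dirs"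
  shows "ray_int d F n z = P (1 + of_real (real n) * d) - P 1"
  unfolding ray_int_def
  by (subst esum_primitive[OF P]) (use ray_from_1[OF d, of _ n] in force, simp)

text \<open>Of the decay rate \<open>2 * \<delta>\<close> along the ray one half is spent on the
  growth \<open>exp (\<delta> * cmod s)\<close> of \<open>F\<close>. The base point 1 contributes
  \<open>exp (\<delta> + Re z)\<close>.\<close>

lemma ray_kernel_bound:
  assumes C: "\<And>s. 1 \<le> Re s \<Longrightarrow> cmod (F s) \<le> C * exp (\<delta> * cmod s)" and d: "d \<in> dirs" and "0 \<le> t"
    and z: "Re (d * z) \<le> - 2 * \<delta>" and "0 < \<delta>"
  shows "cmod (F (1 + of_real t * d) * exp (z * (1 + of_real t * d))) \<le> C * exp (\<delta> + Re z) * exp (- \<delta> * t)"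
proof -
  have s: "1 \<le> Re (1 + of_real t * d)" "cmod (1 + of_real t * d) \<le> 1 + t"
    using ray_segment[OF d d \<open>0 \<le> t\<close>] by auto
  have C0: "0 \<le> C" using order_trans[OF norm_ge_zero C[of 1]] by (simp add: zero_le_mult_iff)
  have "cmod (F (1 + of_real t * d)) \<le> C * exp (\<delta> * (1 + t))"
    using C[OF s(1)] s(2) C0 \<open>0 < \<delta>\<close> by (auto intro!: order_trans[OF C[OF s(1)]] mult_left_mono)
  moreover have "cmod (exp (z * (1 + of_real t * d))) \<le> exp (Re z + t * (- 2 * \<delta>))"
    using mult_left_mono[OF z \<open>0 \<le> t\<close>] by (simp add: algebra_simps)
  ultimately have "cmod (F (1 + of_real t * d) * exp (z * (1 + of_real t * d))) \<le>
      (C * exp (\<delta> * (1 + t))) * exp (Re z + t * (- 2 * \<delta>))"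
    unfolding norm_mult using C0 by (intro mult_mono) auto
  also have "\<dots> = C * exp (\<delta> + Re z) * exp (- \<delta> * t)"
    by (simp add: mult.assoc algebra_simps flip: exp_add)
  finally show ?thesis .
qed

lemma ray_int_tail:
  assumes F: "F holomorphic_on right_half_plane" and C: "\<And>s. 1 \<le> Re s \<Longrightarrow> cmod (F s) \<le> C * exp (\<delta> * cmod s)"
    and d: "d \<in> dirs" and z: "Re (d * z) \<le> - 2 * \<delta>" and "0 < \<delta>" "n \<le> m"
  shows "cmod (ray_int d F m z - ray_int d F n z) \<le> C * exp (\<delta> + Re z) / \<delta> * exp (- \<delta> * real n)"
proof -
  have hq: "(\<lambda>s. F s * exp (z * s)) holomorphic_on right_half_plane" by (intro holomorphic_intros F)
  obtain P where P: "\<And>s. 0 < Re s \<Longrightarrow> (P has_field_derivative F s * exp (z * s)) (at s)"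
    using half_plane_primitive[OF hq] by metis
  have "cmod (P (1 + of_real (real m) * d) - P (1 + of_real (real n) * d))
    \<le> C * exp (\<delta> + Re z) / \<delta> * exp (- \<delta> * real n)"
  proof (rule ray_primitive_bound[where q = "\<lambda>s. F s * exp (z * s)"])
    show "(P has_field_derivative F (1 + of_real t * d) * exp (z * (1 + of_real t * d))) (at (1 + of_real t * d))"
      if "real n \<le> t" for t
      by (rule P) (use ray_segment(1)[OF d d, of t] that in force)
    show "cmod (F (1 + of_real t * d) * exp (z * (1 + of_real t * d))) \<le> C * exp (\<delta> + Re z) * exp (- \<delta> * t)"
      if "real n \<le> t" for t
      using ray_kernel_bound[OF C d _ z \<open>0 < \<delta>\<close>, of t] that by simp
  qed (use dirs_Re[OF d] assms in auto)
  then show ?thesis by (simp add: ray_int_primitive[OF P d])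
qed

lemma ray_int_converges:
  assumes F: "F holomorphic_on right_half_plane" "infra_exp F" and d: "d \<in> dirs" and z: "Re (d * z) < 0"
  shows "convergent (\<lambda>n. ray_int d F n z)"
proof -
  define \<delta> where "\<delta> = - Re (d * z) / 2"
  have \<delta>: "0 < \<delta>" "Re (d * z) \<le> - 2 * \<delta>" using z by (auto simp: \<delta>_def)
  obtain C where C: "\<And>s. 1 \<le> Re s \<Longrightarrow> cmod (F s) \<le> C * exp (\<delta> * cmod s)"
    using F(2) \<delta>(1) unfolding infra_exp_def by blast
  have "Cauchy (\<lambda>n. ray_int d F n z)"
  proof (rule CauchyI')
    fix e :: real assume "e > 0"
    have "(\<lambda>n. exp (- \<delta>) ^ n) \<longlonglongrightarrow> 0" using \<delta> by (intro LIMSEQ_realpow_zero) auto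
    then have "(\<lambda>n. exp (- \<delta> * real n)) \<longlonglongrightarrow> 0" by (simp add: exp_of_nat_mult[symmetric] mult.commute)
    then have "(\<lambda>n. C * exp (\<delta> + Re z) / \<delta> * exp (- \<delta> * real n)) \<longlonglongrightarrow> 0" by (rule tendsto_mult_right_zero)
    then have "\<forall>\<^sub>F n in sequentially. C * exp (\<delta> + Re z) / \<delta> * exp (- \<delta> * real n) < e"
      by (rule order_tendstoD(2)) fact
    then obtain N where N: "\<And>n. n \<ge> N \<Longrightarrow> C * exp (\<delta> + Re z) / \<delta> * exp (- \<delta> * real n) < e"
      unfolding eventually_sequentially by blast
    have "dist (ray_int d F n z) (ray_int d F m z) < e" if "n \<ge> N" "m > n" for n m
      using ray_int_tail[OF F(1) C d \<delta>(2,1), of n m] N[OF that(1)] that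
        by (simp add: dist_norm norm_minus_commute)
    then show "\<exists>M. \<forall>m\<ge>M. \<forall>n>m. dist (ray_int d F m z) (ray_int d F n z) < e" by blast
  qed
  then show ?thesis by (simp add: Cauchy_convergent_iff)
qed

text \<open>The two truncated rays are closed by a segment of length at most \<open>2 * n\<close>.
  On it \<open>Re (z * s)\<close> is a convex combination of the values at its ends, so the
  integrand still decays like \<open>exp (- \<delta> * n)\<close>.\<close>

lemma ray_int_rotate:
  assumes F: "F holomorphic_on right_half_plane" "infra_exp F" and d: "d \<in> dirs" "e \<in> dirs"
    and z: "Re (d * z) < 0" "Re (e * z) < 0"
  shows "(\<lambda>n. ray_int e F n z - ray_int d F n z) \<longlonglongrightarrow> 0"
proof -
  define \<delta> where "\<delta> = min (- Re (d * z)) (- Re (e * z)) / 2"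
  have \<delta>: "0 < \<delta>" "Re (d * z) \<le> - 2 * \<delta>" "Re (e * z) \<le> - 2 * \<delta>" using z by (auto simp: \<delta>_def)
  obtain C where C: "\<And>s. 1 \<le> Re s \<Longrightarrow> cmod (F s) \<le> C * exp (\<delta> * cmod s)"
    using F(2) \<delta>(1) unfolding infra_exp_def by blast
  have C0: "0 \<le> C" using order_trans[OF norm_ge_zero C[of 1]] by (simp add: zero_le_mult_iff)
  have hq: "(\<lambda>s. F s * exp (z * s)) holomorphic_on right_half_plane" by (intro holomorphic_intros F)
  obtain P where P: "\<And>s. 0 < Re s \<Longrightarrow> (P has_field_derivative F s * exp (z * s)) (at s)"
    using half_plane_primitive[OF hq] by metis
  have est: "cmod (ray_int e F n z - ray_int d F n z) \<le> (C * exp (\<delta>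
    + Re z)) * (exp (- \<delta> * real n) * (2 * real n))" for n
  proof -
    let ?u = "1 + of_real (real n) * d" and ?v = "1 + of_real (real n) * e"
    have "contour_integral (linepath ?u ?v) (\<lambda>s. F s * exp (z * s)) = P ?v - P ?u"
      by (rule contour_integral_linepath_primitive, rule P) (use ray_segment(1)[OF d, of "real n"] in force)
    then have "ray_int e F n z - ray_int d F n z = contour_integral (linepath ?u ?v) (\<lambda>s. F s * exp (z * s))"
      using ray_int_primitive[OF P d(1), of n] ray_int_primitive[OF P d(2), of n] by simp
    also have "cmod \<dots> \<le> (C * exp (\<delta> + Re z) * exp (- \<delta> * real n)) * cmod (?v - ?u)"
    proof (rule contour_integral_bound_linepath)
      show "(\<lambda>s. F s * exp (z * s)) contour_integrable_on linepath ?u ?v"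
        by (intro contour_integrable_continuous_linepath continuous_on_subset[OF
          holomorphic_on_imp_continuous_on[OF hq]])
          (use ray_segment(1)[OF d, of "real n"] in force)
      fix s assume s: "s \<in> closed_segment ?u ?v"
      then obtain t where t: "0 \<le> t" "t \<le> 1" "s = (1 - t) *\<^sub>R ?u + t *\<^sub>R ?v" by (auto simp: in_segment)
      have "z * s = z + of_real (real n) * (of_real (1 - t) * (d * z) + of_real t * (e * z))"
        by (simp add: t(3) scaleR_conv_of_real algebra_simps)
      then have "Re (z * s) = Re z + real n * ((1 - t) * Re (d * z) + t * Re (e * z))"
      proof -
        have "Re (z + of_real x * (of_real a * A + of_real b * B)) = Re z + x * (a * Re A + b * Re B)"
          for x a b :: real and A B :: complex by simp
        then show ?thesis using \<open>z * s = _\<close> by (simp only: )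
      qed
      also have "\<dots> \<le> Re z + real n * (- 2 * \<delta>)"
        using convex_bound_le[OF \<delta>(2,3), of "1 - t" t] t by (intro add_left_mono mult_left_mono) auto
      finally have 1: "cmod (exp (z * s)) \<le> exp (Re z + real n * (- 2 * \<delta>))" by simp
      have "\<delta> * cmod s \<le> \<delta> * (1 + real n)"
        using ray_segment(2)[OF d _ s] \<delta>(1) by (intro mult_left_mono) auto
      then have "C * exp (\<delta> * cmod s) \<le> C * exp (\<delta> * (1 + real n))" using C0 by (intro mult_left_mono) auto
      then have 2: "cmod (F s) \<le> C * exp (\<delta> * (1 + real n))"
        using C[OF ray_segment(1)[OF d _ s]] by simp
      have "cmod (F s * exp (z * s)) \<le> (C * exp (\<delta> * (1 + real n))) * exp (Re z + real n * (- 2 * \<delta>))"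
        unfolding norm_mult using 1 2 C0 by (intro mult_mono) auto
      also have "\<dots> = C * exp (\<delta> + Re z) * exp (- \<delta> * real n)"
        by (simp add: mult.assoc algebra_simps flip: exp_add)
      finally show "cmod (F s * exp (z * s)) \<le> C * exp (\<delta> + Re z) * exp (- \<delta> * real n)" .
    qed (use C0 in auto)
    also have "\<dots> \<le> (C * exp (\<delta> + Re z) * exp (- \<delta> * real n)) * (2 * real n)"
    proof (intro mult_left_mono)
      have "?v - ?u = of_real (real n) * (e - d)" by (simp add: algebra_simps)
      then have "cmod (?v - ?u) = real n * cmod (e - d)" by (simp add: norm_mult)
      also have "\<dots> \<le> real n * 2"
        using norm_triangle_ineq4[of e d] dirs_Re[OF d(1)] dirs_Re[OF d(2)] by (intro mult_left_mono) auto
      finally show "cmod (?v - ?u) \<le> 2 * real n" by simp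
    qed (use C0 in auto)
    finally show ?thesis by (simp only: mult.assoc)
  qed
  have "(\<lambda>n. real n * exp (- \<delta>) ^ n) \<longlonglongrightarrow> 0"
    using powser_times_n_limit_0[of "exp (- \<delta>)"] \<delta>(1) by simp
  then have "(\<lambda>n. real n * exp (- \<delta> * real n)) \<longlonglongrightarrow> 0" by (simp add: exp_of_nat_mult[symmetric] mult.commute)
  from tendsto_mult_right_zero[OF this, of "2 * (C * exp (\<delta> + Re z))"]
  have "(\<lambda>n. (C * exp (\<delta> + Re z)) * (exp (- \<delta> * real n) * (2 * real n))) \<longlonglongrightarrow> 0"
    by (rule back_subst[of "\<lambda>f. f \<longlonglongrightarrow> 0"]) auto
  then show ?thesis by (rule Lim_null_comparison[rotated]) (rule always_eventually, rule allI, rule est)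
qed

lemma borel_valueI:
  assumes F: "F holomorphic_on right_half_plane" "infra_exp F"
    and L: "\<And>z. z \<in> slit_plane \<Longrightarrow> \<exists>d\<in>dirs. Re (d * z) < 0 \<and> (\<lambda>n. ray_int d F n z) \<longlonglongrightarrow> L z"
  shows "borel_value F L"
  unfolding borel_value_def
proof (intro allI ballI impI)
  fix z e assume e: "e \<in> dirs" "Re (e * z) < 0"
  then obtain d where d: "d \<in> dirs" "Re (d * z) < 0" "(\<lambda>n. ray_int d F n z) \<longlonglongrightarrow> L z"
    using L slit_plane_dirs by blast
  from tendsto_add[OF d(3) ray_int_rotate[OF F d(1) e(1) d(2) e(2)]]
  show "(\<lambda>n. ray_int e F n z) \<longlonglongrightarrow> L z" by simp
qed

lemma borel_value_exists:
  assumes F: "F holomorphic_on right_half_plane" "infra_exp F"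
  obtains L where "borel_value F L"
proof -
  have "\<forall>z\<in>slit_plane. \<exists>l. \<exists>d\<in>dirs. Re (d * z) < 0 \<and> (\<lambda>n. ray_int d F n z) \<longlonglongrightarrow> l"
    using ray_int_converges[OF F] slit_plane_dirs unfolding convergent_def by metis
  then obtain L where "\<And>z. z \<in> slit_plane \<Longrightarrow> \<exists>d\<in>dirs. Re (d * z) < 0 \<and> (\<lambda>n. ray_int d F n z) \<longlonglongrightarrow> L z"
    by metis
  then show ?thesis using borel_valueI[OF F] that by blast
qed

lemma borel_value_tail:
  assumes L: "borel_value F L" and F: "F holomorphic_on right_half_plane"
    and C: "\<And>s. 1 \<le> Re s \<Longrightarrow> cmod (F s) \<le> C * exp (\<delta> * cmod s)"
    and d: "d \<in> dirs" and z: "Re (d * z) \<le> - 2 * \<delta>" and "0 < \<delta>"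
  shows "cmod (L z - ray_int d F n z) \<le> C * exp (\<delta> + Re z) / \<delta> * exp (- \<delta> * real n)"
proof (rule tendsto_upperbound)
  have "Re (d * z) < 0" using z \<open>0 < \<delta>\<close> by simp
  then show "(\<lambda>m. cmod (ray_int d F m z - ray_int d F n z)) \<longlonglongrightarrow> cmod (L z - ray_int d F n z)"
    using L d unfolding borel_value_def by (intro tendsto_intros) blast
  show "\<forall>\<^sub>F m in sequentially. cmod (ray_int d F m z - ray_int d F n z)
    \<le> C * exp (\<delta> + Re z) / \<delta> * exp (- \<delta> * real n)"
    using ray_int_tail[OF F C d z \<open>0 < \<delta>\<close>] by (rule eventually_sequentiallyI)
qed simp

lemma borel_value_bound:
  assumes "borel_value F L" "F holomorphic_on right_half_plane"
    "\<And>s. 1 \<le> Re s \<Longrightarrow> cmod (F s) \<le> C * exp (\<delta> * cmod s)" "d \<in> dirs" "Re (d * z) \<le> - 2 * \<delta>" "0 < \<delta>"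
  shows "cmod (L z) \<le> C * exp \<delta> / \<delta> * exp (Re z)"
  using borel_value_tail[OF assms, of 0] by (simp add: ray_int_def exp_add)

lemma ray_int_derivative:
  assumes F: "F holomorphic_on right_half_plane" and d: "d \<in> dirs"
  shows "(ray_int d F n has_field_derivative ray_int d (\<lambda>s. s * F s) n z) (at z)"
proof -
  have "((\<lambda>z. esum [(1, 1 + of_nat n * d)] (\<lambda>s. F s * exp (z * s))) has_field_derivative
    esum [(1, 1 + of_nat n * d)] (\<lambda>s. F s * (s * exp (z * s)))) (at z)"
  proof (rule esum_has_field_derivative[of _ _ UNIV])
    show "continuous_on (eimg [(1, 1 + of_nat n * d)]) F"
      by (rule continuous_on_subset[OF holomorphic_on_imp_continuous_on[OF F]]) (use ray_from_1[OF d, of _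
        n] in force)
    show "((\<lambda>z. exp (z * w)) has_field_derivative w * exp (z * w)) (at z)" for z w :: complex
      by (auto intro!: derivative_eq_intros)
  qed (unfold split_beta, auto intro!: continuous_intros)
  then show ?thesis by (simp add: ray_int_def[abs_def] mult.assoc mult.left_commute)
qed

text \<open>Differentiation under the integral multiplies \<open>F\<close> by \<open>s\<close>. The
  derivative is delivered as the limit of these integrals because the differential equation in
  \<open>Borel_inversion\<close> is read off from them.\<close>

lemma borel_value_derivative:
  assumes L: "borel_value F L" and F: "F holomorphic_on right_half_plane" "infra_exp F" and d: "d \<in> dirs"
    "Re (d * z) < 0"
  obtains l where "(L has_field_derivative l) (at z)" "(\<lambda>n. ray_int d (\<lambda>s. s * F s) n z) \<longlonglongrightarrow> l"
proof -
  have op: "open {z. Re (d * z) < 0}" by (intro open_Collect_less continuous_intros)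
  have "\<exists>g'. \<forall>x\<in>{z. Re (d * z) < 0}. (L has_field_derivative g' x) (at x)
    \<and> (\<lambda>n. ray_int d (\<lambda>s. s * F s) n x) \<longlonglongrightarrow> g' x"
  proof (rule has_complex_derivative_uniform_sequence[OF op ray_int_derivative[OF F(1) d(1)]])
    fix x assume x: "x \<in> {z. Re (d * z) < 0}"
    \<comment> \<open>On the disc of radius \<open>\<delta>\<close> about \<open>x\<close> the
      exponent \<open>Re (d * y)\<close> is at most \<open>- 3 * \<delta>\<close>, hence below the
      \<open>- 2 * \<delta>\<close> required by the tail estimate.\<close>
    define \<delta> where "\<delta> = - Re (d * x) / 4"
    have \<delta>: "0 < \<delta>" using x by (simp add: \<delta>_def)
    have ball: "Re (d * y) \<le> - 2 * \<delta>" "Re y \<le> cmod x + \<delta>" if "y \<in> cball x \<delta>" for y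
    proof -
      have "cmod (d * (y - x)) \<le> \<delta>" using that dirs_Re[OF d(1)]
        by (simp add: norm_mult dist_norm norm_minus_commute)
      then have "Re (d * (y - x)) \<le> \<delta>" using complex_Re_le_cmod order_trans by blast
      then have "Re (d * y) \<le> \<delta> + Re (d * x)" by (simp add: algebra_simps)
      moreover have "Re (d * x) = - 4 * \<delta>" by (simp add: \<delta>_def)
      ultimately show "Re (d * y) \<le> - 2 * \<delta>" using \<delta> by linarith
      have "cmod y \<le> cmod x + \<delta>" using that norm_triangle_sub[of y x] by (simp add: dist_norm norm_minus_commute)
      then show "Re y \<le> cmod x + \<delta>" using complex_Re_le_cmod[of y] by linarith
    qed
    obtain C where C: "\<And>s. 1 \<le> Re s \<Longrightarrow> cmod (F s) \<le> C * exp (\<delta> * cmod s)"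
      using F(2) \<delta>(1) unfolding infra_exp_def by blast
    have C0: "0 \<le> C" using order_trans[OF norm_ge_zero C[of 1]] by (simp add: zero_le_mult_iff)
    have "uniform_limit (cball x \<delta>) (ray_int d F) L sequentially"
      unfolding uniform_limit_iff
    proof (intro allI impI)
      fix e :: real assume "e > 0"
      have "(\<lambda>n. exp (- \<delta>) ^ n) \<longlonglongrightarrow> 0" using \<delta> by (intro LIMSEQ_realpow_zero) auto
      then have "(\<lambda>n. exp (- \<delta> * real n)) \<longlonglongrightarrow> 0" by (simp add: exp_of_nat_mult[symmetric] mult.commute)
      then have "(\<lambda>n. C * exp (\<delta> + (cmod x + \<delta>)) / \<delta> * exp (- \<delta> * real n)) \<longlonglongrightarrow> 0" by (rule tendsto_mult_right_zero)
      then have "\<forall>\<^sub>F n in sequentially. C * exp (\<delta> + (cmod x + \<delta>)) / \<delta> * exp (- \<delta> * real n) < e"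
        by (rule order_tendstoD(2)) fact
      then show "\<forall>\<^sub>F n in sequentially. \<forall>y\<in>cball x \<delta>. dist (ray_int d F n y) (L y) < e"
      proof eventually_elim
        case (elim n)
        show ?case
        proof
          fix y assume y: "y \<in> cball x \<delta>"
          have "cmod (L y - ray_int d F n y) \<le> C * exp (\<delta> + Re y) / \<delta> * exp (- \<delta> * real n)"
            by (rule borel_value_tail[OF L F(1) C d(1) ball(1)[OF y] \<delta>])
          also have "\<dots> \<le> C * exp (\<delta> + (cmod x + \<delta>)) / \<delta> * exp (- \<delta> * real n)"
            using ball(2)[OF y] C0 \<delta> by (intro mult_right_mono divide_right_mono mult_left_mono) auto
          finally show "dist (ray_int d F n y) (L y) < e" using elim by (simp add: dist_norm norm_minus_commute)
        qed
      qed
    qed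
    moreover have "cball x \<delta> \<subseteq> {z. Re (d * z) < 0}" using ball(1) \<delta> by fastforce
    ultimately show "\<exists>\<delta>>0. cball x \<delta> \<subseteq> {z. Re (d * z) < 0}
      \<and> uniform_limit (cball x \<delta>) (ray_int d F) L sequentially"
      using \<delta> by blast
  qed
  then show ?thesis using d(2) that by blast
qed

lemma borel_value_holomorphic:
  assumes "borel_value F L" "F holomorphic_on right_half_plane" "infra_exp F"
  shows "L holomorphic_on slit_plane"
  unfolding holomorphic_on_def
proof
  fix z assume "z \<in> slit_plane"
  then obtain d where "d \<in> dirs" "Re (d * z) < 0" using slit_plane_dirs by blast
  then obtain l where "(L has_field_derivative l) (at z)" using borel_value_derivative[OF assms] by metis
  then show "L field_differentiable at z within slit_plane"
    using field_differentiable_at_within field_differentiable_def by blast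
qed

text \<open>Outside the disc of radius \<open>Re \<zeta> - 1\<close> division by
  \<open>s - \<zeta>\<close> is harmless; inside it the removable singularity is bounded by
  compactness. The disc reaches at most to \<open>Re s = 1\<close>, so it lies in the domain of
  \<open>F\<close>.\<close>

lemma infra_exp_quotient:
  assumes F: "F holomorphic_on right_half_plane" "infra_exp F" and \<zeta>: "1 < Re \<zeta>"
  shows "infra_exp (\<lambda>s. if s = \<zeta> then deriv F \<zeta> else (F s - F \<zeta>) / (s - \<zeta>))"
  unfolding infra_exp_def
proof (intro allI impI)
  fix \<epsilon> :: real assume e: "0 < \<epsilon>"
  let ?F = "\<lambda>s. if s = \<zeta> then deriv F \<zeta> else (F s - F \<zeta>) / (s - \<zeta>)"
  obtain C where C: "\<And>s. 1 \<le> Re s \<Longrightarrow> cmod (F s) \<le> C * exp (\<epsilon> * cmod s)"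
    using F(2) e unfolding infra_exp_def by blast
  have C0: "0 \<le> C" using order_trans[OF norm_ge_zero C[of 1]] by (simp add: zero_le_mult_iff)
  define r where "r = Re \<zeta> - 1"
  have r: "r > 0" using \<zeta> by (simp add: r_def)
  have "?F holomorphic_on right_half_plane" by (rule pole_lemma_open[OF F(1) open_halfspace_Re_gt])
  moreover have "cball \<zeta> r \<subseteq> right_half_plane"
  proof
    fix s assume "s \<in> cball \<zeta> r"
    then have "Re \<zeta> - Re s \<le> r" using complex_Re_le_cmod[of "\<zeta> - s"] by (simp add: dist_norm)
    then show "s \<in> right_half_plane" by (simp add: r_def)
  qed
  ultimately have "continuous_on (cball \<zeta> r) ?F" using holomorphic_on_imp_continuous_on continuous_on_subset
    by blast
  then have "bounded (?F ` cball \<zeta> r)" by (intro compact_imp_bounded compact_continuous_image compact_cball)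
  then obtain B where "B > 0" "\<forall>x\<in>?F ` cball \<zeta> r. cmod x \<le> B" unfolding bounded_pos by blast
  then have B: "B > 0" "\<And>s. s \<in> cball \<zeta> r \<Longrightarrow> cmod (?F s) \<le> B" by blast+
  have "cmod (?F s) \<le> (B + (C + cmod (F \<zeta>)) / r) * exp (\<epsilon> * cmod s)" if s: "1 \<le> Re s" for s
  proof (cases "s \<in> cball \<zeta> r")
    case True
    have "cmod (?F s) \<le> B * 1" using B(2)[OF True] by simp
    also have "\<dots> \<le> (B + (C + cmod (F \<zeta>)) / r) * exp (\<epsilon> * cmod s)"
      using B(1) C0 r e by (intro mult_mono) auto
    finally show ?thesis .
  next
    case False
    then have sr: "r < cmod (s - \<zeta>)" by (simp add: dist_norm norm_minus_commute)
    then have ne: "s \<noteq> \<zeta>" using r by auto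
    have "cmod (F s - F \<zeta>) \<le> C * exp (\<epsilon> * cmod s) + cmod (F \<zeta>) * exp (\<epsilon> * cmod s)"
    proof (rule order_trans[OF norm_triangle_ineq4 add_mono[OF C[OF s]]])
      show "cmod (F \<zeta>) \<le> cmod (F \<zeta>) * exp (\<epsilon> * cmod s)"
        using mult_left_mono[of 1 "exp (\<epsilon> * cmod s)" "cmod (F \<zeta>)"] e by simp
    qed
    then have "cmod (F s - F \<zeta>) / cmod (s - \<zeta>) \<le> (C * exp (\<epsilon> * cmod s) + cmod (F \<zeta>) * exp (\<epsilon> * cmod s)) / r"
      using sr r C0 by (intro frac_le) auto
    also have "\<dots> = (C + cmod (F \<zeta>)) / r * exp (\<epsilon> * cmod s)" by (simp add: field_simps)
    also have "\<dots> \<le> (B + (C + cmod (F \<zeta>)) / r) * exp (\<epsilon> * cmod s)" using B(1) by (intro mult_right_mono) auto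
    finally show ?thesis using ne by (simp add: norm_divide)
  qed
  then show "\<exists>C. \<forall>s. 1 \<le> Re s \<longrightarrow> cmod (?F s) \<le> C * exp (\<epsilon> * cmod s)" by blast
qed

text \<open>\<open>exp (z * s) / z\<close> is a primitive, and the powers of
  \<open>exp (d * z)\<close> tend to 0 in a direction of convergence.\<close>

lemma ray_int_one:
  assumes d: "d \<in> dirs" and z: "Re (d * z) < 0"
  shows "(\<lambda>n. ray_int d (\<lambda>_. 1) n z) \<longlonglongrightarrow> - exp z / z"
proof -
  have z0: "z \<noteq> 0" using z by auto
  have "((\<lambda>s. exp (z * s) / z) has_field_derivative 1 * exp (z * s)) (at s)" for s
    using z0 by (auto intro!: derivative_eq_intros)
  then have eq: "ray_int d (\<lambda>_. 1) n z = exp (z * (1 + of_real (real n) * d)) / z - exp (z * 1) / z" for n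
    by (intro ray_int_primitive[OF _ d])
  have "exp (z * (1 + of_real (real n) * d)) = exp z * exp (d * z) ^ n" for n
  proof -
    have "z * (1 + of_real (real n) * d) = z + of_nat n * (d * z)" by (simp add: algebra_simps)
    then show ?thesis by (simp only: exp_add exp_of_nat_mult)
  qed
  moreover have "(\<lambda>n. exp (d * z) ^ n) \<longlonglongrightarrow> 0" using z by (intro LIMSEQ_power_zero) simp
  from tendsto_diff[OF tendsto_divide[OF tendsto_mult[OF tendsto_const this] tendsto_const z0] tendsto_const]
  have "(\<lambda>n. exp z * exp (d * z) ^ n / z - exp z / z) \<longlonglongrightarrow> exp z * 0 / z - exp z / z" .
  ultimately show ?thesis unfolding eq by simp
qed

text \<open>With \<open>F\<^sub>1(s) = (F(s) - F(\<zeta>)) / (s - \<zeta>)\<close> the Borel transform \<open>L\<^sub>1\<close> of \<open>F\<^sub>1\<close> satisfies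
  \<open>(e\<^bsup>-z\<zeta>\<^esup> L\<^sub>1)' = e\<^bsup>-z\<zeta>\<^esup> (L + F(\<zeta>) e\<^bsup>z\<^esup>/z)\<close>, and \<open>e\<^bsup>-z\<zeta>\<^esup> L\<^sub>1\<close> vanishes at infinity;
  only the monodromy of the logarithm contributes to the Laplace integral of \<open>L\<close>.\<close>

lemma Borel_inversion:
  assumes L: "borel_value F L" and F: "F holomorphic_on right_half_plane" "infra_exp F" and \<zeta>: "1 < Re \<zeta>"
  shows "(\<lambda>n. jump 1 (\<lambda>z. L z * exp (- z * \<zeta>)) (real n)) \<longlonglongrightarrow> 2 * pi * \<i> * F \<zeta>"
proof -
  define F1 where "F1 s = (if s = \<zeta> then deriv F \<zeta> else (F s - F \<zeta>) / (s - \<zeta>))" for s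
  have F1: "F1 holomorphic_on right_half_plane" "infra_exp F1"
    using pole_lemma_open[OF F(1) open_halfspace_Re_gt, of \<zeta>] infra_exp_quotient[OF F \<zeta>]
      by (auto simp: F1_def[abs_def])
  obtain L1 where L1: "borel_value F1 L1" using borel_value_exists[OF F1] by blast
  have cont: "continuous_on (eimg [(1, 1 + of_nat n * d)]) G"
    if "G holomorphic_on right_half_plane" "d \<in> dirs" for G d n
    by (rule continuous_on_subset[OF holomorphic_on_imp_continuous_on[OF that(1)]]) (use ray_from_1[OF
      that(2), of _ n] in force)
  \<comment> \<open>Since \<open>s * F1 s = \<zeta> * F1 s + F s - F \<zeta>\<close>, the derivative
    of \<open>L1\<close> is expressed by \<open>L1\<close>, \<open>L\<close> and the Borel transform
    \<open>- exp z / z\<close> of the constant 1.\<close>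
  have dL1: "(L1 has_field_derivative (\<zeta> * L1 z + L z + F \<zeta> * exp z / z)) (at z)" if "z \<in> slit_plane" for z
  proof -
    obtain d where d: "d \<in> dirs" "Re (d * z) < 0" using \<open>z \<in> slit_plane\<close> slit_plane_dirs by blast
    obtain l where l: "(L1 has_field_derivative l) (at z)" "(\<lambda>n. ray_int d (\<lambda>s. s * F1 s) n z) \<longlonglongrightarrow> l"
      using borel_value_derivative[OF L1 F1 d] by metis
    have "ray_int d (\<lambda>s. s * F1 s) n z = \<zeta> * ray_int d F1 n z + ray_int d F n z
      - F \<zeta> * ray_int d (\<lambda>_. 1) n z" for n
    proof -
      let ?es = "[(1, 1 + of_nat n * d)]"
      have "s * F1 s = \<zeta> * F1 s + (F s - F \<zeta>)" for s by (simp add: F1_def field_simps)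
      then have eq: "s * F1 s * exp (z * s) = (\<zeta> * (F1 s * exp (z * s)) + F s * exp (z * s))
        - F \<zeta> * (1 * exp (z * s))" for s
        by (simp only:) (simp add: algebra_simps)
      have "ray_int d (\<lambda>s. s * F1 s) n z = esum ?es (\<lambda>s. (\<zeta> * (F1 s * exp (z * s)) + F s * exp (z * s))
        - F \<zeta> * (1 * exp (z * s)))"
        unfolding ray_int_def eq ..
      also have "\<dots> = esum ?es (\<lambda>s. \<zeta> * (F1 s * exp (z * s)) + F s * exp (z * s))
        - esum ?es (\<lambda>s. F \<zeta> * (1 * exp (z * s)))"
        by (rule esum_diff; intro continuous_intros cont F F1 d)
      also have "esum ?es (\<lambda>s. \<zeta> * (F1 s * exp (z * s)) + F s * exp (z * s)) =
         esum ?es (\<lambda>s. \<zeta> * (F1 s * exp (z * s))) + esum ?es (\<lambda>s. F s * exp (z * s))"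
        by (rule esum_add; intro continuous_intros cont F F1 d)
      also have "esum ?es (\<lambda>s. \<zeta> * (F1 s * exp (z * s))) = \<zeta> * esum ?es (\<lambda>s. F1 s * exp (z * s))"
        by (rule esum_cmult; intro continuous_intros cont F F1 d)
      also have "esum ?es (\<lambda>s. F \<zeta> * (1 * exp (z * s))) = F \<zeta> * esum ?es (\<lambda>s. 1 * exp (z * s))"
        by (rule esum_cmult; intro continuous_intros)
      finally show ?thesis by (simp add: ray_int_def)
    qed
    moreover have "(\<lambda>n. \<zeta> * ray_int d F1 n z + ray_int d F n z - F \<zeta> * ray_int d (\<lambda>_. 1) n z)
       \<longlonglongrightarrow> \<zeta> * L1 z + L z - F \<zeta> * (- exp z / z)"
      using L L1 d unfolding borel_value_def by (intro tendsto_intros ray_int_one) auto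
    ultimately have "l = \<zeta> * L1 z + L z - F \<zeta> * (- exp z / z)" using l(2) LIMSEQ_unique by auto
    then show ?thesis using l(1) by simp
  qed
  \<comment> \<open>Up to the factor \<open>F \<zeta>\<close>, \<open>exp (- z * \<mu>) / z\<close>
    is the inhomogeneity after multiplication by \<open>exp (- z * \<zeta>)\<close>. Its pole is
    split off as \<open>1 / z\<close>, so a primitive is the entire \<open>Ep\<close> plus a branch
    of the logarithm.\<close>
  define \<mu> where "\<mu> = \<zeta> - 1"
  have entire: "(\<lambda>z. if z = 0 then deriv (\<lambda>z. exp (- z * \<mu>)) 0 else (exp (- z * \<mu>) - exp (- 0 * \<mu>)) / (z
    - 0)) holomorphic_on UNIV"
    by (rule pole_lemma_open) (auto intro!: holomorphic_intros)
  obtain Ep where Ep': "\<And>z. z \<in> UNIV \<Longrightarrow> (Ep has_field_derivative (if z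
    = 0 then deriv (\<lambda>z. exp (- z * \<mu>)) 0 else (exp (- z * \<mu>) - exp (- 0 * \<mu>)) / (z - 0))) (at z)"
    by (rule holomorphic_convex_primitive'[OF convex_UNIV open_UNIV entire]) blast
  have Ep: "(Ep has_field_derivative (exp (- z * \<mu>) - 1) / z) (at z)" if "z \<noteq> 0" for z
    using Ep'[OF UNIV_I, of z] that by simp
  define P where "P z = L1 z * exp (- z * \<zeta>) - F \<zeta> * (Ep z + Ln (- z))" for z
  have P: "(P has_field_derivative L z * exp (- z * \<zeta>)) (at z)" if z: "z \<in> slit_plane" for z
  proof -
    have z0: "z \<noteq> 0" using z by auto
    have "- z \<notin> \<real>\<^sub>\<le>\<^sub>0" using z by (auto simp: complex_nonpos_Reals_iff)
    then have Ln: "((\<lambda>z. Ln (- z)) has_field_derivative 1 / z) (at z)"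
      using z0 by (auto intro!: derivative_eq_intros simp: field_simps)
    have ex: "((\<lambda>z. exp (- z * \<zeta>)) has_field_derivative - \<zeta> * exp (- z * \<zeta>)) (at z)"
      by (auto intro!: derivative_eq_intros)
    have "(P has_field_derivative ((\<zeta> * L1 z + L z + F \<zeta> * exp z / z) * exp (- z * \<zeta>)
      + (- \<zeta> * exp (- z * \<zeta>)) * L1 z)
      - F \<zeta> * ((exp (- z * \<mu>) - 1) / z + 1 / z)) (at z)"
      unfolding P_def[abs_def]
      by (rule DERIV_diff[OF DERIV_mult[OF dL1[OF z] ex] DERIV_cmult[OF DERIV_add[OF Ep[OF z0] Ln]]])
    moreover have "exp (- z * \<mu>) = exp z * exp (- z * \<zeta>)"
      unfolding exp_add[symmetric] \<mu>_def by (simp add: algebra_simps)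
    then have "((\<zeta> * L1 z + L z + F \<zeta> * exp z / z) * exp (- z * \<zeta>) + (- \<zeta> * exp (- z * \<zeta>)) * L1 z)
      - F \<zeta> * ((exp (- z * \<mu>) - 1) / z + 1 / z) = L z * exp (- z * \<zeta>)"
      by (simp only: diff_divide_distrib diff_add_cancel) (simp add: algebra_simps del: mult_minus_left)
    ultimately show ?thesis by simp
  qed
  have j: "jump 1 (\<lambda>z. L z * exp (- z * \<zeta>)) (real n) = P (Complex n 1) - P (Complex n (-1))" for n
    by (rule jump_primitive[OF P]) auto
  \<comment> \<open>The same primitive with the branch \<open>Ln z\<close>, which is holomorphic
    across the positive axis. Its difference between \<open>n + \<i>\<close> and
    \<open>n - \<i>\<close> is the integral of a function of order \<open>1 / n\<close> over a
    segment of length 2.\<close>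
  define V where "V z = Ep z + Ln z" for z
  have V: "(V has_field_derivative exp (- z * \<mu>) / z) (at z)" if "0 < Re z" for z
  proof -
    have "z \<noteq> 0" "z \<notin> \<real>\<^sub>\<le>\<^sub>0" using that by (auto simp: complex_nonpos_Reals_iff)
    then have "(V has_field_derivative (exp (- z * \<mu>) - 1) / z + 1 / z) (at z)"
      unfolding V_def[abs_def] by (intro DERIV_add Ep) (auto intro!: derivative_eq_intros simp: inverse_eq_divide)
    then show ?thesis by (simp add: diff_divide_distrib)
  qed
  have Vlim: "(\<lambda>n. V (Complex n 1) - V (Complex n (-1))) \<longlonglongrightarrow> 0"
  proof (rule Lim_null_comparison)
    have "(\<lambda>n. (2 * exp \<bar>Im \<mu>\<bar>) * (1 / real n)) \<longlonglongrightarrow> 0" by (intro tendsto_mult_right_zero lim_1_over_n)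
    then show "(\<lambda>n. exp \<bar>Im \<mu>\<bar> * (1 / real n) * 2) \<longlonglongrightarrow> 0"
      by (rule back_subst[of "\<lambda>f. f \<longlonglongrightarrow> 0"]) auto
    show "\<forall>\<^sub>F n in sequentially. cmod (V (Complex n 1) - V (Complex n (-1))) \<le> exp \<bar>Im \<mu>\<bar> * (1 / real n) * 2"
    proof (rule eventually_sequentiallyI[of 1])
      fix n :: nat assume n: "1 \<le> n"
      let ?u = "Complex n (-1)" and ?v = "Complex n 1"
      have on: "Re w = n \<and> \<bar>Im w\<bar> \<le> 1" if w: "w \<in> closed_segment ?u ?v" for w
      proof -
        obtain t where t: "0 \<le> t" "t \<le> 1" "w = (1 - t) *\<^sub>R ?u + t *\<^sub>R ?v" using w by (auto simp: in_segment)
        have "Re w = n" "Im w = 2 * t - 1" by (simp_all add: t(3) algebra_simps)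
        then show ?thesis using t(1,2) by simp
      qed
      have der: "(V has_field_derivative exp (- w * \<mu>) / w) (at w within closed_segment ?u ?v)"
        if "w \<in> closed_segment ?u ?v" for w
      proof -
        have "0 < Re w" using on[OF that] n by simp
        then show ?thesis by (rule has_field_derivative_at_within[OF V])
      qed
      have "((\<lambda>w. exp (- w * \<mu>) / w) has_contour_integral (V (pathfinish (linepath ?u ?v))
        - V (pathstart (linepath ?u ?v)))) (linepath ?u ?v)"
        by (rule contour_integral_primitive[OF der]) auto
      then have "cmod (V ?v - V ?u) \<le> exp \<bar>Im \<mu>\<bar> * (1 / real n) * cmod (?v - ?u)"
      proof (intro has_contour_integral_bound_linepath)
        fix w assume w: "w \<in> closed_segment ?u ?v"
        have "cmod (exp (- w * \<mu>)) \<le> exp (1 * \<bar>Im \<mu>\<bar>) * exp (- Re \<mu> * Re w)"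
          by (rule norm_exp_kernel_le) (use on[OF w] in simp)
        also have "\<dots> \<le> exp (1 * \<bar>Im \<mu>\<bar>) * 1"
          using \<zeta> on[OF w] by (intro mult_left_mono) (auto simp: \<mu>_def mult_nonpos_nonneg)
        finally have "cmod (exp (- w * \<mu>)) \<le> exp \<bar>Im \<mu>\<bar>" by simp
        moreover have "real n \<le> cmod w" using on[OF w] complex_Re_le_cmod[of w] by simp
        ultimately show "cmod (exp (- w * \<mu>) / w) \<le> exp \<bar>Im \<mu>\<bar> * (1 / real n)"
          unfolding norm_divide using n frac_le[of "exp \<bar>Im \<mu>\<bar>" "cmod (exp (- w * \<mu>))" "real n" "cmod w"] by simp
      qed auto
      moreover have "cmod (?v - ?u) = 2"
      proof -
        have "?v - ?u = 2 * \<i>" by (simp add: complex_eq_iff)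
        then show ?thesis by (simp add: norm_mult)
      qed
      ultimately show "cmod (V (Complex n 1) - V (Complex n (-1))) \<le> exp \<bar>Im \<mu>\<bar> * (1 / real n) * 2" by simp
    qed
  qed
  obtain C where C: "\<And>s. 1 \<le> Re s \<Longrightarrow> cmod (F1 s) \<le> C * exp (1/2 * cmod s)"
    using F1(2) half_gt_zero[OF zero_less_one] unfolding infra_exp_def by (metis)
  have C0: "0 \<le> C" using order_trans[OF norm_ge_zero C[of 1]] by (simp add: zero_le_mult_iff)
  have L1lim: "(\<lambda>n. L1 (Complex n y) * exp (- Complex n y * \<zeta>)) \<longlonglongrightarrow> 0" if y: "y = 1 \<or> y = -1" for y
  proof (rule Lim_null_comparison)
    \<comment> \<open>In this direction \<open>Re (d * z) = -1\<close> on the whole line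
      \<open>Im z = y\<close>, so \<open>\<delta> = 1/2\<close> is admissible uniformly in
      \<open>n\<close>. The resulting growth \<open>exp (Re z)\<close> of \<open>L1\<close> is
      beaten by \<open>exp (- z * \<zeta>)\<close> because \<open>Re \<zeta> > 1\<close>.\<close>
    define d where "d = Complex 0 y"
    have d: "d \<in> dirs" "Re (d * Complex x y) = -1" for x
      using y by (auto simp: d_def dirs_def complex_eq_iff)
    have "cmod (L1 (Complex n y) * exp (- Complex n y * \<zeta>))
      \<le> (C * exp (1/2) / (1/2) * exp \<bar>Im \<zeta>\<bar>) * exp (- (Re \<zeta> - 1) * real n)" for n
    proof -
      have "cmod (L1 (Complex n y)) \<le> C * exp (1/2) / (1/2) * exp (Re (Complex n y))"
        by (rule borel_value_bound[OF L1 F1(1) C d(1)]) (use d(2)[of "real n"] in auto)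
      moreover have "cmod (exp (- Complex n y * \<zeta>)) \<le> exp (1 * \<bar>Im \<zeta>\<bar>) * exp (- Re \<zeta> * Re (Complex n y))"
        by (rule norm_exp_kernel_le) (use y in auto)
      ultimately have "cmod (L1 (Complex n y) * exp (- Complex n y * \<zeta>)) \<le>
        (C * exp (1/2) / (1/2) * exp (real n)) * (exp \<bar>Im \<zeta>\<bar> * exp (- Re \<zeta> * real n))"
        unfolding norm_mult using C0 by (intro mult_mono) auto
      also have "\<dots> = (C * exp (1/2) / (1/2) * exp \<bar>Im \<zeta>\<bar>) * (exp (real n) * exp (- Re \<zeta> * real n))" by simp
      also have "exp (real n) * exp (- Re \<zeta> * real n) = exp (- (Re \<zeta> - 1) * real n)"
        by (simp add: algebra_simps flip: exp_add)
      finally show ?thesis .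
    qed
    then show "\<forall>\<^sub>F n in sequentially. cmod (L1 (Complex n y) * exp (- Complex n y * \<zeta>))
      \<le> (C * exp (1/2) / (1/2) * exp \<bar>Im \<zeta>\<bar>) * exp (- (Re \<zeta> - 1) * real n)"
      by simp
    have "(\<lambda>n. exp (- (Re \<zeta> - 1)) ^ n) \<longlonglongrightarrow> 0" using \<zeta> by (intro LIMSEQ_realpow_zero) auto
    then have "(\<lambda>n. exp (- (Re \<zeta> - 1) * real n)) \<longlonglongrightarrow> 0" by (simp add: exp_of_nat_mult[symmetric] mult.commute)
    then show "(\<lambda>n. (C * exp (1/2) / (1/2) * exp \<bar>Im \<zeta>\<bar>) * exp (- (Re \<zeta> - 1) * real n)) \<longlonglongrightarrow> 0"
      by (rule tendsto_mult_right_zero)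
  qed
  \<comment> \<open>Passing from \<open>Ln (- z)\<close> to \<open>Ln z\<close> contributes
    \<open>- \<i> * pi\<close> above and \<open>+ \<i> * pi\<close> below the axis. Their difference
    is the monodromy term, the only one that survives in the limit.\<close>
  have "P (Complex n 1) - P (Complex n (-1)) = (L1 (Complex n 1) * exp (- Complex n 1 * \<zeta>)
    - L1 (Complex n (-1)) * exp (- Complex n (-1) * \<zeta>))
     - F \<zeta> * (V (Complex n 1) - V (Complex n (-1)) - 2 * pi * \<i>)" for n :: nat
  proof -
    have "Complex n 1 \<noteq> 0" "Complex n (-1) \<noteq> 0" by (auto simp: complex_eq_iff)
    then have "Ln (- Complex n 1) = Ln (Complex n 1) - \<i> * pi" "Ln (- Complex n (-1))
      = Ln (Complex n (-1)) + \<i> * pi"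
      by (auto simp: Ln_minus)
    then show ?thesis unfolding P_def V_def by (simp only:) (simp add: algebra_simps)
  qed
  moreover have "(\<lambda>n. (L1 (Complex n 1) * exp (- Complex n 1 * \<zeta>)
    - L1 (Complex n (-1)) * exp (- Complex n (-1) * \<zeta>))
     - F \<zeta> * (V (Complex n 1) - V (Complex n (-1)) - 2 * pi * \<i>)) \<longlonglongrightarrow> (0 - 0) - F \<zeta> * (0 - 2 * pi * \<i>)"
    by (intro tendsto_intros L1lim Vlim) auto
  ultimately show ?thesis unfolding j by (simp add: mult.commute)
qed

section \<open>Cosets\<close>

lemma coset_eq_iff:
  fixes N :: "'v::ab_group_add set"
  assumes "0 \<in> N" "\<And>x y. x \<in> N \<Longrightarrow> y \<in> N \<Longrightarrow> x + y \<in> N" "\<And>x. x \<in> N \<Longrightarrow> - x \<in> N"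
  shows "F +o N = G +o N \<longleftrightarrow> F - G \<in> N"
proof
  assume "F +o N = G +o N"
  moreover have "F \<in> F +o N" using assms(1) by (auto simp: elt_set_plus_def)
  ultimately have "F \<in> G +o N" by simp
  then show "F - G \<in> N" by (auto simp: elt_set_plus_def)
next
  have sub: "F +o N \<subseteq> G +o N" if d: "F - G \<in> N" for F G
  proof
    fix x assume "x \<in> F +o N"
    then obtain n where n: "n \<in> N" "x = F + n" by (auto simp: elt_set_plus_def)
    have "F - G + n \<in> N" using assms(2) d n(1) by blast
    moreover have "x = G + (F - G + n)" using n(2) by simp
    ultimately show "x \<in> G +o N" unfolding elt_set_plus_def by blast
  qed
  assume d: "F - G \<in> N"
  have "G - F \<in> N" using assms(3)[OF d] by simp
  then show "F +o N = G +o N" using sub[OF d] sub[of G F] by blast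
qed

lemma coset_plus:
  fixes N :: "'v::ab_group_add set"
  assumes "0 \<in> N" "\<And>x y. x \<in> N \<Longrightarrow> y \<in> N \<Longrightarrow> x + y \<in> N"
  shows "(F +o N) + (G +o N) = (F + G) +o N"
proof -
  have "N + N = N"
  proof
    show "N \<subseteq> N + N" using assms(1) set_zero_plus2 by blast
    show "N + N \<subseteq> N" using assms(2) by (auto simp: set_plus_def)
  qed
  then show ?thesis by (simp add: set_plus_rearrange)
qed

text \<open>All representatives in the coset give the same class, so the image is a singleton and
  \<open>the_elem\<close> returns that class.\<close>

lemma quot_map_coset:
  fixes F :: "'v::ab_group_add"
  assumes "\<And>n. n \<in> N \<Longrightarrow> h (F + n) +o M = h F +o M" "0 \<in> N"
  shows "quot_map h M (F +o N) = h F +o M"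
proof -
  have "F \<in> F +o N" using assms(2) unfolding elt_set_plus_def by (auto intro!: bexI[of _ 0])
  moreover have "h G +o M = h F +o M" if "G \<in> F +o N" for G
  proof -
    have "\<exists>n\<in>N. G = F + n" using that by (simp add: elt_set_plus_def)
    then show ?thesis using assms(1) by blast
  qed
  ultimately have "(\<lambda>F. h F +o M) ` (F +o N) = {h F +o M}" by blast
  then show ?thesis by (simp add: quot_map_def)
qed

lemma restr_add: "restr \<Omega> (f + g) = restr \<Omega> f + restr \<Omega> (g :: complex \<Rightarrow> 'e::ab_group_add)"
  by (auto simp: restr_def fun_eq_iff)

section \<open>Subspaces of functions\<close>

context frechet
begin

definition fun_subspace :: "(complex \<Rightarrow> 'e) set \<Rightarrow> bool" where
  "fun_subspace N \<longleftrightarrow> 0 \<in> N \<and> (\<forall>f\<in>N. \<forall>g\<in>N. f + g \<in> N) \<and> (\<forall>c. \<forall>f\<in>N. (\<lambda>z. sc c (f z)) \<in> N)"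

lemma fun_subspaceD:
  assumes "fun_subspace N"
  shows "0 \<in> N" "\<And>f g. f \<in> N \<Longrightarrow> g \<in> N \<Longrightarrow> f + g \<in> N" "\<And>f. f \<in> N \<Longrightarrow> - f \<in> N"
    "\<And>c f. f \<in> N \<Longrightarrow> (\<lambda>z. sc c (f z)) \<in> N" "\<And>f g. f \<in> N \<Longrightarrow> g \<in> N \<Longrightarrow> f - g \<in> N"
proof -
  show a: "0 \<in> N" "\<And>f g. f \<in> N \<Longrightarrow> g \<in> N \<Longrightarrow> f + g \<in> N" "\<And>c f. f \<in> N \<Longrightarrow> (\<lambda>z. sc c (f z)) \<in> N"
    using assms by (auto simp: fun_subspace_def)
  show m: "- f \<in> N" if "f \<in> N" for f using a(3)[OF that, of "-1"] by (simp add: fun_Compl_def)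
  show "f - g \<in> N" if "f \<in> N" "g \<in> N" for f g using a(2)[OF that(1) m[OF that(2)]] by simp
qed

lemma fun_subspace_coset_eq:
  assumes "fun_subspace N"
  shows "F +o N = G +o N \<longleftrightarrow> F - G \<in> N"
  by (rule coset_eq_iff) (use fun_subspaceD(1-3)[OF assms] in blast)+

lemma fun_subspace_coset_plus:
  assumes "fun_subspace N"
  shows "(F +o N) + (G +o N) = (F + G) +o N"
  by (rule coset_plus) (use fun_subspaceD(1,2)[OF assms] in blast)+

lemma fun_subspace_holo: "open \<Omega> \<Longrightarrow> fun_subspace (holo sc p \<Omega>)"
  unfolding fun_subspace_def by (auto intro: holo_zero holo_add holo_cmult)

lemma fun_subspace_weighted_holo:
  assumes "open \<Omega>"
  shows "fun_subspace (weighted_holo sc p \<Omega> S w)"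
  unfolding fun_subspace_def
proof (intro conjI ballI allI)
  note sub = fun_subspaceD[OF fun_subspace_holo[OF assms]]
  show "0 \<in> weighted_holo sc p \<Omega> S w" by (rule weighted_holoI[OF sub(1)]) (auto intro: exI[of _ 0])
  fix f assume f: "f \<in> weighted_holo sc p \<Omega> S w"
  show "(\<lambda>z. sc c (f z)) \<in> weighted_holo sc p \<Omega> S w" for c
  proof (rule weighted_holoI[OF sub(4)[OF weighted_holo_holo[OF f]]])
    fix n :: nat and a assume "1 \<le> n"
    then obtain M where M: "\<And>z. z \<in> S n \<Longrightarrow> p a (f z) \<le> M * exp (- w n z)" using weighted_holoD[OF f] by metis
    have "p a (sc c (f z)) \<le> (cmod c * M) * exp (- w n z)" if "z \<in> S n" for z
      unfolding p_scale mult.assoc by (rule mult_left_mono[OF M[OF that]]) simp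
    then show "\<exists>M. \<forall>z\<in>S n. p a (sc c (f z)) \<le> M * exp (- w n z)" by blast
  qed
  fix g assume g: "g \<in> weighted_holo sc p \<Omega> S w"
  show "f + g \<in> weighted_holo sc p \<Omega> S w"
  proof (rule weighted_holoI[OF sub(2)[OF weighted_holo_holo[OF f] weighted_holo_holo[OF g]]])
    fix n :: nat and a assume n: "1 \<le> n"
    obtain M1 where M1: "\<And>z. z \<in> S n \<Longrightarrow> p a (f z) \<le> M1 * exp (- w n z)" using weighted_holoD[OF f n] by metis
    obtain M2 where M2: "\<And>z. z \<in> S n \<Longrightarrow> p a (g z) \<le> M2 * exp (- w n z)" using weighted_holoD[OF g n] by metis
    have "p a ((f + g) z) \<le> (M1 + M2) * exp (- w n z)" if "z \<in> S n" for z
      using p_add[of a "f z" "g z"] M1[OF that] M2[OF that] by (simp add: distrib_right)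
    then show "\<exists>M. \<forall>z\<in>S n. p a ((f + g) z) \<le> M * exp (- w n z)" by blast
  qed
qed

lemma open_rhp: "open right_half_plane"
  by (rule open_halfspace_Re_gt)

lemma fun_subspaces:
  "fun_subspace (LG_inf sc p)" "fun_subspace (LG_zero_inf sc p)" "fun_subspace (LO_inf sc p)"
    "fun_subspace (LO_zero_inf sc p)"
  "fun_subspace (O_exp sc p {0..\<infinity>})" "fun_subspace (O_exp sc p {\<infinity>})"
  "fun_subspace (H_minus_inf sc p {0..\<infinity>})" "fun_subspace (H_minus_inf sc p {\<infinity>})"
  unfolding LG_inf_def LG_zero_inf_def LO_inf_def LO_zero_inf_def O_exp_def H_minus_inf_def
  by (auto intro!: fun_subspace_weighted_holo open_rhp open_slit_plane)

lemma fun_subspace_restr: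
  assumes "fun_subspace N"
  shows "fun_subspace (restr \<Omega> ` N)"
  unfolding fun_subspace_def
proof (intro conjI ballI allI)
  note sub = fun_subspaceD[OF assms]
  have "restr \<Omega> 0 = 0" by (auto simp: restr_def)
  then show "0 \<in> restr \<Omega> ` N" using sub(1) by force
  show "f + g \<in> restr \<Omega> ` N" if "f \<in> restr \<Omega> ` N" "g \<in> restr \<Omega> ` N" for f g
    using that sub(2) by (auto simp: restr_add[symmetric])
  show "(\<lambda>z. sc c (f z)) \<in> restr \<Omega> ` N" if f: "f \<in> restr \<Omega> ` N" for c f
  proof -
    obtain f' where f': "f' \<in> N" "f = restr \<Omega> f'" using f by blast
    then have "(\<lambda>z. sc c (f z)) = restr \<Omega> (\<lambda>z. sc c (f' z))" by (auto simp: restr_def)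
    then show ?thesis using sub(4)[OF f'(1)] by blast
  qed
qed

section \<open>The canonical map\<close>

lemma weighted_holo_restr:
  assumes f: "f \<in> weighted_holo sc p \<Omega> S w" and "\<Omega>' \<subseteq> \<Omega>" "open \<Omega>'" and S: "\<And>n. 1 \<le> n \<Longrightarrow> S' n \<subseteq> S n \<inter> \<Omega>'"
  shows "restr \<Omega>' f \<in> weighted_holo sc p \<Omega>' S' w"
proof (rule weighted_holoI[OF holo_restr[OF weighted_holo_holo[OF f] assms(2,3)]])
  fix n :: nat and a assume n: "1 \<le> n"
  obtain M where M: "\<And>z. z \<in> S n \<Longrightarrow> p a (f z) \<le> M * exp (- w n z)" using weighted_holoD[OF f n] by metis
  then have "p a (restr \<Omega>' f z) \<le> M * exp (- w n z)" if "z \<in> S' n" for z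
    using that S[OF n] by (auto simp: restr_def)
  then show "\<exists>M. \<forall>z\<in>S' n. p a (restr \<Omega>' f z) \<le> M * exp (- w n z)" by blast
qed

lemma half_plane_sub: "1 \<le> n \<Longrightarrow> {z. 1 / real n \<le> Re z} \<subseteq> {z. - real n \<le> Re z} \<inter> right_half_plane"
proof
  fix z assume n: "1 \<le> n" and z: "z \<in> {z. 1 / real n \<le> Re z}"
  have "0 < 1 / real n" using n by simp
  moreover have "1 / real n \<le> Re z" using z by simp
  ultimately have "0 < Re z" by (rule less_le_trans)
  then show "z \<in> {z. - real n \<le> Re z} \<inter> right_half_plane" by simp
qed

lemma restr_LG_zero_inf: "F \<in> LG_zero_inf sc p \<Longrightarrow> restr right_half_plane F \<in> LO_zero_inf sc p"
  and restr_LG_inf: "F \<in> LG_inf sc p \<Longrightarrow> restr right_half_plane F \<in> LO_inf sc p"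
proof -
  show "restr right_half_plane F \<in> LO_zero_inf sc p" if "F \<in> LG_zero_inf sc p"
    unfolding LO_zero_inf_def
    by (rule weighted_holo_restr[OF that[unfolded LG_zero_inf_def] subset_UNIV open_rhp half_plane_sub])
  have eq: "(\<lambda>k z. real k * \<bar>Re z\<bar> - 1 / real k * cmod z) = (\<lambda>k z. - (1 / real k) * cmod z + real k * \<bar>Re z\<bar>)"
    by auto
  show "restr right_half_plane F \<in> LO_inf sc p" if "F \<in> LG_inf sc p"
    unfolding LO_inf_def
    by (rule weighted_holo_restr[OF that[unfolded LG_inf_def eq] subset_UNIV open_rhp half_plane_sub])
qed

text \<open>Only the strip \<open>- k \<le> Re z < 1 / k\<close> is missing. There
  \<open>\<bar>Re z\<bar> \<le> k\<close>, so the additional weight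
  \<open>exp (k * \<bar>Re z\<bar>)\<close> is bounded and membership in \<open>LG_zero_inf\<close>
  is enough. This gives injectivity of \<open>I_zero\<close>.\<close>

lemma LG_inf_of_restr:
  assumes F: "F \<in> LG_zero_inf sc p" and r: "restr right_half_plane F \<in> LO_inf sc p"
  shows "F \<in> LG_inf sc p"
  unfolding LG_inf_def
proof (rule weighted_holoI)
  show "F \<in> holo sc p UNIV" using F weighted_holo_holo by (auto simp: LG_zero_inf_def)
  fix k :: nat and a assume k: "1 \<le> k"
  have k1: "0 < 1 / real k" "1 \<le> real k" using k by auto
  obtain M1 where M1: "0 \<le> M1" "\<And>z. z \<in> {z. - real k \<le> Re z} \<Longrightarrow> p a (F z) \<le> M1 * exp (- (- (1 / real k) * cmod z))"
    using weighted_holoD[OF F[unfolded LG_zero_inf_def] k] by metis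
  obtain M2 where M2: "0 \<le> M2" "\<And>z. z \<in> {z. 1 / real k \<le> Re z} \<Longrightarrow>
     p a (restr right_half_plane F z) \<le> M2 * exp (- (- (1 / real k) * cmod z + real k * \<bar>Re z\<bar>))"
    using weighted_holoD[OF r[unfolded LO_inf_def] k] by metis
  have "p a (F z) \<le> (M1 * exp (real k * real k) + M2) * exp (- (real k * \<bar>Re z\<bar> - 1 / real k * cmod z))"
    if z: "z \<in> {z. - real k \<le> Re z}" for z
  proof (cases "1 / real k \<le> Re z")
    case True
    then have "0 < Re z" using k1 by linarith
    then have "p a (F z) \<le> M2 * exp (- (real k * \<bar>Re z\<bar> - 1 / real k * cmod z))"
      using M2(2)[of z] True by (simp add: restr_def algebra_simps)
    also have "\<dots> \<le> (M1 * exp (real k * real k) + M2) * exp (- (real k * \<bar>Re z\<bar> - 1 / real k * cmod z))"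
      using M1(1) by (intro mult_right_mono) auto
    finally show ?thesis .
  next
    case False
    have "1 / real k \<le> real k" using k1 by (simp add: field_simps) (metis k1(2) mult_mono' mult_1 zero_le_one)
    then have "\<bar>Re z\<bar> \<le> real k" using False z by auto
    then have "real k * \<bar>Re z\<bar> \<le> real k * real k" by (intro mult_left_mono) auto
    then have "M1 * exp (- (- (1 / real k) * cmod z)) \<le> M1 * exp (real k * real k - (real k * \<bar>Re z\<bar>
      - 1 / real k * cmod z))"
      using M1(1) by (intro mult_left_mono) auto
    also have "\<dots> = (M1 * exp (real k * real k)) * exp (- (real k * \<bar>Re z\<bar> - 1 / real k * cmod z))"
      by (simp add: mult.assoc flip: exp_add)
    also have "\<dots> \<le> (M1 * exp (real k * real k) + M2) * exp (- (real k * \<bar>Re z\<bar> - 1 / real k * cmod z))"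
      using M2(1) by (intro mult_right_mono) auto
    finally show ?thesis using M1(2)[OF z] by linarith
  qed
  then show "\<exists>M. \<forall>z\<in>{z. - real k \<le> Re z}. p a (F z) \<le> M * exp (- (real k * \<bar>Re z\<bar> - 1 / real k * cmod z))"
    by blast
qed

lemma LO_zero_inf_bound:
  assumes F: "F \<in> LO_zero_inf sc p" and "0 < \<epsilon>"
  obtains C where "0 \<le> C" "\<And>s. 1 \<le> Re s \<Longrightarrow> p a (F s) \<le> C * exp (\<epsilon> * cmod s)"
proof -
  obtain k :: nat where k: "max 1 (1 / \<epsilon>) \<le> real k" using real_arch_simple by blast
  then have k1: "1 \<le> k" "1 / real k \<le> \<epsilon>" "1 / real k \<le> 1" using \<open>0 < \<epsilon>\<close> by (auto simp: field_simps)
  obtain C where C: "0 \<le> C" "\<And>z. z \<in> {z. 1 / real k \<le> Re z} \<Longrightarrow> p a (F z) \<le> C * exp (- (- (1 / real k) * cmod z))"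
    using weighted_holoD[OF F[unfolded LO_zero_inf_def] k1(1)] by metis
  have "p a (F s) \<le> C * exp (\<epsilon> * cmod s)" if s: "1 \<le> Re s" for s
  proof -
    have "p a (F s) \<le> C * exp (- (- (1 / real k) * cmod s))" by (rule C(2)) (use s k1(3) in simp)
    also have "\<dots> \<le> C * exp (\<epsilon> * cmod s)"
      using C(1) mult_right_mono[OF k1(2) norm_ge_zero[of s]] by (intro mult_left_mono) auto
    finally show ?thesis .
  qed
  then show ?thesis using that C(1) by blast
qed

text \<open>The scalar Borel integrals converge at rates uniform over polars, so they define vectors
  \<open>f0 z\<close>; \<open>f\<close> carries the factor \<open>1 / (2 * pi * \<i>)\<close> of the
  inversion formula. The growth exponent 1 comes from the base point 1 of the rays.\<close>

lemma Borel_transform: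
  assumes F: "F \<in> LO_zero_inf sc p"
  obtains f where "f \<in> holo sc p slit_plane" "tube_growth 1 f"
    "\<And>\<zeta>. 1 < Re \<zeta> \<Longrightarrow> laplace sc p right_half_plane f \<zeta> = F \<zeta>"
proof -
  have Fh: "F \<in> holo sc p right_half_plane" using F weighted_holo_holo by (auto simp: LO_zero_inf_def)
  have F\<phi>: "(\<lambda>s. \<phi> (F s)) holomorphic_on right_half_plane" if "dual \<phi>" for \<phi>
    by (rule holo_dual_holomorphic[OF Fh that])
  have Fi: "infra_exp (\<lambda>s. \<phi> (F s))" if \<phi>: "dual \<phi>" for \<phi>
    unfolding infra_exp_def
  proof (intro allI impI)
    fix \<epsilon> :: real assume e: "0 < \<epsilon>"
    obtain a D where D: "D > 0" "\<And>x. cmod (\<phi> x) \<le> D * p a x" using dual_bounded[OF \<phi>] by metis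
    obtain C where C: "\<And>s. 1 \<le> Re s \<Longrightarrow> p a (F s) \<le> C * exp (\<epsilon> * cmod s)" using LO_zero_inf_bound[OF F e] by metis
    have "cmod (\<phi> (F s)) \<le> (D * C) * exp (\<epsilon> * cmod s)" if "1 \<le> Re s" for s
    proof -
      have "D * p a (F s) \<le> D * (C * exp (\<epsilon> * cmod s))" using C[OF that] D(1) by (intro mult_left_mono) auto
      then show ?thesis using D(2)[of "F s"] by simp
    qed
    then show "\<exists>C. \<forall>s. 1 \<le> Re s \<longrightarrow> cmod (\<phi> (F s)) \<le> C * exp (\<epsilon> * cmod s)" by blast
  qed
  have polC: "cmod (\<phi> (F s)) \<le> C * exp (\<epsilon> * cmod s)"
    if "\<phi> \<in> polar a" "\<And>s. 1 \<le> Re s \<Longrightarrow> p a (F s) \<le> C * exp (\<epsilon> * cmod s)" "1 \<le> Re s" for a \<phi> C \<epsilon> s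
    using polar_le[OF that(1), of "F s"] that(2)[OF that(3)] by linarith
  have "\<exists>l. \<exists>d\<in>dirs. Re (d * z) < 0 \<and> (\<forall>\<phi>. dual \<phi> \<longrightarrow> (\<lambda>n. ray_int d (\<lambda>s. \<phi> (F s)) n z) \<longlonglongrightarrow> \<phi> l)"
    if z: "z \<in> slit_plane" for z
  proof -
    obtain d where d: "d \<in> dirs" "Re (d * z) < 0" using z slit_plane_dirs by blast
    define \<delta> where "\<delta> = - Re (d * z) / 2"
    have \<delta>: "0 < \<delta>" "Re (d * z) \<le> - 2 * \<delta>" using d by (auto simp: \<delta>_def)
    define x where "x n = elineint [(1, 1 + of_nat n * d)] (\<lambda>s. sc (exp (z * s)) (F s))" for n
    have x: "\<phi> (x n) = ray_int d (\<lambda>s. \<phi> (F s)) n z" if \<phi>: "dual \<phi>" for \<phi> n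
    proof -
      have "econt (eimg [(1, 1 + of_nat n * d)]) (\<lambda>s. sc (exp (z * s)) (F s))"
        by (intro econt_scale econt_subset[OF holo_econt[OF Fh]] continuous_intros)
          (use ray_from_1[OF d(1), of _ n] in force)
      from dual_elineint[OF this \<phi>] show ?thesis by (simp add: x_def ray_int_def dual_linear[OF \<phi>] mult.commute)
    qed
    obtain l where l: "\<And>\<phi>. dual \<phi> \<Longrightarrow> (\<lambda>n. \<phi> (x n)) \<longlonglongrightarrow> \<phi> l"
    proof (rule weak_complete[of x])
      fix a and e :: real assume "0 < e"
      obtain C where C: "\<And>s. 1 \<le> Re s \<Longrightarrow> p a (F s) \<le> C * exp (\<delta> * cmod s)" using LO_zero_inf_bound[OF F \<delta>(1)]
        by metis
      have "\<forall>\<^sub>F n in sequentially. C * exp (\<delta> + Re z) / \<delta> * exp (- \<delta> * real n) < e / 2"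
        by (rule order_tendstoD(2)[OF exp_seq_to_0[OF \<delta>(1)]]) (use \<open>0 < e\<close> in simp)
      then obtain N where N: "C * exp (\<delta> + Re z) / \<delta> * exp (- \<delta> * real N) < e / 2"
        unfolding eventually_sequentially by blast
      have "cmod (\<phi> (x m) - \<phi> (x N)) \<le> e / 2" if "m \<ge> N" "\<phi> \<in> polar a" for m \<phi>
      proof -
        have "cmod (\<phi> (x m) - \<phi> (x N)) \<le> C * exp (\<delta> + Re z) / \<delta> * exp (- \<delta> * real N)"
          using ray_int_tail[OF F\<phi>[OF polar_dual[OF that(2)]] polC[OF that(2) C] d(1) \<delta>(2,1) that(1)]
          by (simp add: x[OF polar_dual[OF that(2)]])
        with N show ?thesis by linarith
      qed
      then have "cmod (\<phi> (x m) - \<phi> (x n)) \<le> e" if "m \<ge> N" "n \<ge> N" "\<phi> \<in> polar a" for m n \<phi>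
        using that by (blast intro: norm_diff_le_halves)
      then show "\<exists>N. \<forall>m\<ge>N. \<forall>n\<ge>N. \<forall>\<phi>\<in>polar a. cmod (\<phi> (x m) - \<phi> (x n)) \<le> e" by blast
    qed blast
    have "(\<lambda>n. ray_int d (\<lambda>s. \<phi> (F s)) n z) \<longlonglongrightarrow> \<phi> l" if "dual \<phi>" for \<phi>
      using l[OF that] unfolding x[OF that] .
    then show ?thesis using d by blast
  qed
  then obtain f0 where f0: "\<And>z. z \<in> slit_plane \<Longrightarrow> \<exists>d\<in>dirs. Re (d * z) < 0 \<and>
     (\<forall>\<phi>. dual \<phi> \<longrightarrow> (\<lambda>n. ray_int d (\<lambda>s. \<phi> (F s)) n z) \<longlonglongrightarrow> \<phi> (f0 z))" by metis
  have bv: "borel_value (\<lambda>s. \<phi> (F s)) (\<lambda>z. \<phi> (f0 z))" if \<phi>: "dual \<phi>" for \<phi>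
    by (rule borel_valueI[OF F\<phi>[OF \<phi>] Fi[OF \<phi>]]) (use f0 \<phi> in blast)
  have bound: "\<exists>C\<ge>0. \<forall>z. Re (d * z) \<le> - 2 * \<delta> \<longrightarrow> p a (f0 z) \<le> C * exp (Re z)" if d: "d \<in> dirs" and \<delta>: "0 < \<delta>"
    for a d \<delta>
  proof -
    obtain C where C: "0 \<le> C" "\<And>s. 1 \<le> Re s \<Longrightarrow> p a (F s) \<le> C * exp (\<delta> * cmod s)"
      using LO_zero_inf_bound[OF F \<delta>] by metis
    have "p a (f0 z) \<le> C * exp \<delta> / \<delta> * exp (Re z)" if z: "Re (d * z) \<le> - 2 * \<delta>" for z
    proof (rule seminorm_le_polar)
      fix \<phi> assume \<phi>: "\<phi> \<in> polar a"
      show "cmod (\<phi> (f0 z)) \<le> C * exp \<delta> / \<delta> * exp (Re z)"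
        by (rule borel_value_bound[OF bv[OF polar_dual[OF \<phi>]] F\<phi>[OF polar_dual[OF \<phi>]] polC[OF \<phi> C(2)] d z \<delta>])
    qed
    then show ?thesis using C(1) \<delta> by (intro exI[of _ "C * exp \<delta> / \<delta>"]) auto
  qed
  define f where "f = restr slit_plane (\<lambda>z. sc (1 / (2 * pi * \<i>)) (f0 z))"
  have f\<phi>: "\<phi> (f z) = 1 / (2 * pi * \<i>) * \<phi> (f0 z)" if "dual \<phi>" "z \<in> slit_plane" for \<phi> z
    using that by (simp add: f_def restr_def dual_linear)
  have fp: "p a (f z) \<le> p a (f0 z)" for a z
  proof -
    have "1 \<le> 2 * pi" using pi_ge_two by simp
    then have "cmod (1 / (2 * pi * \<i>)) \<le> 1" by (simp add: norm_divide norm_mult)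
    then have "cmod (1 / (2 * pi * \<i>)) * p a (f0 z) \<le> 1 * p a (f0 z)" by (rule mult_right_mono) simp
    then show ?thesis by (simp add: f_def restr_def p_scale)
  qed
  have fh: "f \<in> holo sc p slit_plane"
  proof (rule holoI_weak[OF _ open_slit_plane])
    show "restr slit_plane f = f" by (simp add: f_def)
    show "(\<lambda>z. \<phi> (f z)) holomorphic_on slit_plane" if \<phi>: "dual \<phi>" for \<phi>
    proof -
      have "(\<lambda>z. 1 / (2 * pi * \<i>) * \<phi> (f0 z)) holomorphic_on slit_plane"
        by (intro holomorphic_intros borel_value_holomorphic[OF bv[OF \<phi>] F\<phi>[OF \<phi>] Fi[OF \<phi>]])
      then show ?thesis by (rule holomorphic_transform) (simp add: f\<phi>[OF \<phi>])
    qed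
    fix a z assume "z \<in> slit_plane"
    then obtain d where d: "d \<in> dirs" "Re (d * z) < 0" using slit_plane_dirs by blast
    define \<delta> where "\<delta> = - Re (d * z) / 4"
    have \<delta>: "0 < \<delta>" using d by (simp add: \<delta>_def)
    obtain C where C: "0 \<le> C" "\<And>w. Re (d * w) \<le> - 2 * \<delta> \<Longrightarrow> p a (f0 w) \<le> C * exp (Re w)"
      using bound[OF d(1) \<delta>] by metis
    have "p a (f w) \<le> C * exp (cmod z + \<delta>)" if w: "w \<in> ball z \<delta>" for w
    proof -
      have "cmod (d * (w - z)) \<le> \<delta>" using w dirs_Re[OF d(1)] by (simp add: norm_mult dist_norm norm_minus_commute)
      then have "Re (d * (w - z)) \<le> \<delta>" using complex_Re_le_cmod order_trans by blast
      then have "Re (d * w) \<le> \<delta> + Re (d * z)" by (simp add: algebra_simps)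
      moreover have "Re (d * z) = - 4 * \<delta>" by (simp add: \<delta>_def)
      ultimately have "Re (d * w) \<le> - 2 * \<delta>" using \<delta> by linarith
      then have "p a (f0 w) \<le> C * exp (Re w)" by (rule C(2))
      moreover have "cmod w \<le> cmod z + \<delta>" using w norm_triangle_sub[of w z]
        by (simp add: dist_norm norm_minus_commute)
      then have "C * exp (Re w) \<le> C * exp (cmod z + \<delta>)"
        using C(1) complex_Re_le_cmod[of w] by (intro mult_left_mono) auto
      ultimately show ?thesis using fp[of a w] by linarith
    qed
    then show "\<exists>r>0. \<exists>B. \<forall>w\<in>ball z r. w \<in> slit_plane \<longrightarrow> p a (f w) \<le> B" using \<delta> by blast
  qed
  moreover have gr: "tube_growth 1 f"
    unfolding tube_growth_def
  proof (intro allI impI)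
    fix a and c :: real assume c: "0 < c"
    then have c2: "0 < c / 2" by simp
    \<comment> \<open>The direction \<open>\<i>\<close> serves the upper and \<open>- \<i>\<close>
      the lower half-plane; where \<open>\<bar>Im z\<bar> \<ge> c\<close> the decay rate along the
      ray is at least \<open>c = 2 * (c / 2)\<close>.\<close>
    obtain C1 where C1: "0 \<le> C1" "\<And>z. Re (\<i> * z) \<le> - 2 * (c / 2) \<Longrightarrow> p a (f0 z) \<le> C1 * exp (Re z)"
      using bound[of \<i>, OF _ c2] by (auto simp: dirs_def)
    obtain C2 where C2: "0 \<le> C2" "\<And>z. Re (- \<i> * z) \<le> - 2 * (c / 2) \<Longrightarrow> p a (f0 z) \<le> C2 * exp (Re z)"
      using bound[of "- \<i>", OF _ c2] by (auto simp: dirs_def)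
    have "p a (f z) \<le> (C1 + C2) * exp (1 * Re z)" if z: "c \<le> \<bar>Im z\<bar>" for z
    proof (cases "0 \<le> Im z")
      case True
      then have "p a (f0 z) \<le> C1 * exp (Re z)" using z by (intro C1(2)) auto
      also have "\<dots> \<le> (C1 + C2) * exp (1 * Re z)" using C2(1) by (simp add: mult_right_mono)
      finally show ?thesis using fp[of a z] by linarith
    next
      case False
      then have "p a (f0 z) \<le> C2 * exp (Re z)" using z by (intro C2(2)) auto
      also have "\<dots> \<le> (C1 + C2) * exp (1 * Re z)" using C1(1) by (simp add: mult_right_mono)
      finally show ?thesis using fp[of a z] by linarith
    qed
    then show "\<exists>A. \<forall>z. - 1 \<le> Re z \<and> c \<le> \<bar>Im z\<bar> \<and> \<bar>Im z\<bar> \<le> 1 \<longrightarrow> p a (f z) \<le> A * exp (1 * Re z)" by blast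
  qed
  moreover have "laplace sc p right_half_plane f \<zeta> = F \<zeta>" if \<zeta>: "1 < Re \<zeta>" for \<zeta>
  proof (rule dual_eqI)
    fix \<phi> assume \<phi>: "dual \<phi>"
    have r: "\<zeta> \<in> right_half_plane" using \<zeta> by simp
    have "(\<lambda>n. jump 1 (\<lambda>z. \<phi> (f z) * exp (- z * \<zeta>)) (real n)) \<longlonglongrightarrow> \<phi> (laplace sc p right_half_plane f \<zeta>)"
      by (rule laplace_limit[OF fh gr \<zeta> r \<phi>]) auto
    moreover have "jump 1 (\<lambda>z. \<phi> (f z) * exp (- z * \<zeta>)) (real n)
      = 1 / (2 * pi * \<i>) * jump 1 (\<lambda>z. \<phi> (f0 z) * exp (- z * \<zeta>)) (real n)" for n
    proof -
      let ?es = "[(Complex (real n) (-1), -1), (-1, Complex (real n) 1)]"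
      have s: "eimg ?es \<subseteq> slit_plane" by (rule jump_edges_slit) simp
      have "continuous_on (eimg ?es) (\<lambda>z. \<phi> (f0 z) * exp (- z * \<zeta>))"
        by (intro continuous_intros continuous_on_subset[OF holomorphic_on_imp_continuous_on[OF
          borel_value_holomorphic[OF bv[OF \<phi>] F\<phi>[OF \<phi>] Fi[OF \<phi>]]] s])
      from esum_cmult[OF this, of "1 / (2 * pi * \<i>)"]
      have "1 / (2 * pi * \<i>) * jump 1 (\<lambda>z. \<phi> (f0 z) * exp (- z * \<zeta>)) (real n) =
        esum ?es (\<lambda>z. 1 / (2 * pi * \<i>) * (\<phi> (f0 z) * exp (- z * \<zeta>)))" by (simp add: jump_def)
      also have "\<dots> = jump 1 (\<lambda>z. \<phi> (f z) * exp (- z * \<zeta>)) (real n)"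
        unfolding jump_def
      proof (rule esum_cong)
        fix w assume "w \<in> eimg ?es"
        then have "w \<in> slit_plane" using s by blast
        then show "1 / (2 * pi * \<i>) * (\<phi> (f0 w) * exp (- w * \<zeta>)) = \<phi> (f w) * exp (- w * \<zeta>)"
          by (simp only: f\<phi>[OF \<phi>]) (simp add: field_simps)
      qed
      finally show ?thesis by simp
    qed
    moreover have "(\<lambda>n. 1 / (2 * pi * \<i>) * jump 1 (\<lambda>z. \<phi> (f0 z) * exp (- z * \<zeta>)) (real n))
      \<longlonglongrightarrow> 1 / (2 * pi * \<i>) * (2 * pi * \<i> * \<phi> (F \<zeta>))"
      by (intro tendsto_intros Borel_inversion[OF bv[OF \<phi>] F\<phi>[OF \<phi>] Fi[OF \<phi>] \<zeta>])
    ultimately show "\<phi> (laplace sc p right_half_plane f \<zeta>) = \<phi> (F \<zeta>)"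
      using LIMSEQ_unique by fastforce
  qed
  ultimately show ?thesis using that by blast
qed

lemma tube_growth_diff:
  assumes "tube_growth b G" "tube_growth b H"
  shows "tube_growth b (G - H)"
  unfolding tube_growth_def
proof (intro allI impI)
  fix a and c :: real assume c: "0 < c"
  obtain A where A: "\<And>z. -1 \<le> Re z \<Longrightarrow> c \<le> \<bar>Im z\<bar> \<Longrightarrow> \<bar>Im z\<bar> \<le> 1 \<Longrightarrow> p a (G z) \<le> A * exp (b * Re z)"
    using tube_growthD[OF assms(1) c] by metis
  obtain B where B: "\<And>z. -1 \<le> Re z \<Longrightarrow> c \<le> \<bar>Im z\<bar> \<Longrightarrow> \<bar>Im z\<bar> \<le> 1 \<Longrightarrow> p a (H z) \<le> B * exp (b * Re z)"
    using tube_growthD[OF assms(2) c] by metis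
  have "p a ((G - H) z) \<le> (A + B) * exp (b * Re z)" if "-1 \<le> Re z \<and> c \<le> \<bar>Im z\<bar> \<and> \<bar>Im z\<bar> \<le> 1" for z
    using A[of z] B[of z] that p_diff[of a "G z" "H z"] by (simp add: distrib_right)
  then show "\<exists>A. \<forall>z. - 1 \<le> Re z \<and> c \<le> \<bar>Im z\<bar> \<and> \<bar>Im z\<bar> \<le> 1 \<longrightarrow> p a ((G - H) z) \<le> A * exp (b * Re z)" by blast
qed

text \<open>The remainder is known as a transform only for \<open>Re \<zeta> > 1\<close>, but it
  lies in \<open>LO_zero_inf\<close> on the whole right half-plane. So the decay estimate is used
  for \<open>Re \<zeta> \<ge> 2\<close>, while for \<open>1 / k \<le> Re \<zeta> < 2\<close> the
  weight \<open>exp (k * \<bar>Re \<zeta>\<bar>)\<close> is at most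
  \<open>exp (2 * k)\<close>.\<close>

lemma LO_zero_inf_splitting:
  assumes F: "F \<in> LO_zero_inf sc p"
  obtains G where "G \<in> LG_zero_inf sc p" "F - restr right_half_plane G \<in> LO_inf sc p"
proof -
  obtain f where f: "f \<in> holo sc p slit_plane" "tube_growth 1 f"
    "\<And>\<zeta>. 1 < Re \<zeta> \<Longrightarrow> laplace sc p right_half_plane f \<zeta> = F \<zeta>" using Borel_transform[OF F] by metis
  obtain g h where gh: "g \<in> H_minus_inf sc p {0..\<infinity>}" "h \<in> holo sc p UNIV" "f = g + restr slit_plane h"
    using hyperfunction_splitting[OF f(1)] by metis
  have g: "g \<in> holo sc p slit_plane" using gh(1) weighted_holo_holo by (auto simp: H_minus_inf_def)
  have rh: "restr slit_plane h = f - g" using gh(3) by simp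
  have hgr: "tube_growth 1 (restr slit_plane h)"
    unfolding rh by (rule tube_growth_diff[OF f(2) H_minus_inf_growth[OF gh(1)]])
  have rhh: "restr slit_plane h \<in> holo sc p slit_plane"
    by (rule holo_restr[OF gh(2) subset_UNIV open_slit_plane])
  define G where "G = laplace sc p UNIV g"
  have G: "G \<in> LG_zero_inf sc p" unfolding G_def by (rule laplace_LG_zero_inf[OF gh(1)])
  have rG: "restr right_half_plane G \<in> LO_zero_inf sc p" by (rule restr_LG_zero_inf[OF G])
  let ?D = "F - restr right_half_plane G"
  have D: "?D \<in> LO_zero_inf sc p" by (rule fun_subspaceD(5)[OF fun_subspaces(4) F rG])
  have Deq: "?D \<zeta> = laplace sc p right_half_plane (restr slit_plane h) \<zeta>" if \<zeta>: "1 < Re \<zeta>" for \<zeta>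
  proof -
    have r: "\<zeta> \<in> right_half_plane" using \<zeta> by simp
    have "F \<zeta> = laplace sc p right_half_plane g \<zeta> + laplace sc p right_half_plane (restr slit_plane h) \<zeta>"
      using f(3)[OF \<zeta>] laplace_add[OF g H_minus_inf_growth[OF gh(1)] rhh hgr \<zeta> r] gh(3) by simp
    moreover have "laplace sc p right_half_plane g \<zeta> = restr right_half_plane G \<zeta>"
      by (simp add: G_def laplace_def restr_def)
    ultimately show ?thesis by simp
  qed
  have "?D \<in> LO_inf sc p"
    unfolding LO_inf_def
  proof (rule weighted_holoI)
    show "?D \<in> holo sc p right_half_plane" using D weighted_holo_holo by (auto simp: LO_zero_inf_def)
    fix k :: nat and a assume k: "1 \<le> k"
    have k1: "1 \<le> real k" using k by simp
    obtain M where M: "0 \<le> M" "\<And>z. z \<in> {z. 1 / real k \<le> Re z}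
      \<Longrightarrow> p a (?D z) \<le> M * exp (- (- (1 / real k) * cmod z))"
      using weighted_holoD[OF D[unfolded LO_zero_inf_def] k] by metis
    \<comment> \<open>Abscissa \<open>b = 1\<close> and gap \<open>s = 1\<close>, hence the
      threshold \<open>Re \<zeta> \<ge> 2\<close>.\<close>
    obtain C where C: "0 \<le> C" "\<And>\<zeta> l. 1 + 1 \<le> Re \<zeta> \<Longrightarrow>
      (\<And>\<phi>. \<phi> \<in> polar a \<Longrightarrow> (\<lambda>n. jump (1 / real k) (\<lambda>z. \<phi> (h z) * exp (- z * \<zeta>)) (real n)) \<longlonglongrightarrow> \<phi> l) \<Longrightarrow>
      p a l \<le> C * exp (1 / real k * \<bar>Im \<zeta>\<bar> - real k * Re \<zeta>)"
      by (rule entire_laplace_decay[OF gh(2) hgr zero_less_one k1, of a]) blast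
    have "p a (?D \<zeta>) \<le> (M * exp (real k * 2) + C) * exp (- (- (1 / real k) * cmod \<zeta> + real k * \<bar>Re \<zeta>\<bar>))"
      if z: "\<zeta> \<in> {z. 1 / real k \<le> Re z}" for \<zeta>
    proof -
      have "0 < 1 / real k" using k1 by simp
      moreover have "1 / real k \<le> Re \<zeta>" using z by simp
      ultimately have pos: "0 < Re \<zeta>" by (rule less_le_trans)
      show ?thesis
      proof (cases "2 \<le> Re \<zeta>")
        case True
        then have \<zeta>: "1 < Re \<zeta>" "1 + 1 \<le> Re \<zeta>" by auto
        have k0: "0 < 1 / real k" "1 / real k \<le> 1" using k1 by auto
        have r: "\<zeta> \<in> right_half_plane" using pos by simp
        have "p a (?D \<zeta>) \<le> C * exp (1 / real k * \<bar>Im \<zeta>\<bar> - real k * Re \<zeta>)"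
        proof (rule C(2)[OF \<zeta>(2)])
          fix \<phi> assume "\<phi> \<in> polar a"
          from laplace_limit[OF rhh hgr \<zeta>(1) r polar_dual[OF this] k0]
          show "(\<lambda>n. jump (1 / real k) (\<lambda>z. \<phi> (h z) * exp (- z * \<zeta>)) (real n)) \<longlonglongrightarrow> \<phi> (?D \<zeta>)"
            unfolding Deq[OF \<zeta>(1)] using k0 jump_restr[of "1 / real k" \<phi> h "\<lambda>z. exp (- z * \<zeta>)"] by simp
        qed
        also have "\<dots> \<le> C * exp (- (- (1 / real k) * cmod \<zeta> + real k * \<bar>Re \<zeta>\<bar>))"
          using C(1) k0 pos mult_left_mono[OF abs_Im_le_cmod[of \<zeta>], of "1 / real k"]
            by (intro mult_left_mono) auto
        also have "\<dots> \<le> (M * exp (real k * 2) + C) * exp (- (- (1 / real k) * cmod \<zeta> + real k * \<bar>Re \<zeta>\<bar>))"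
          using M(1) by (intro mult_right_mono) auto
        finally show ?thesis .
      next
        case False
        then have "real k * \<bar>Re \<zeta>\<bar> \<le> real k * 2" using pos by (intro mult_left_mono) auto
        then have "M * exp (- (- (1 / real k) * cmod \<zeta>))
          \<le> M * exp (real k * 2 - (- (1 / real k) * cmod \<zeta> + real k * \<bar>Re \<zeta>\<bar>))"
          using M(1) by (intro mult_left_mono) auto
        also have "\<dots> = (M * exp (real k * 2)) * exp (- (- (1 / real k) * cmod \<zeta> + real k * \<bar>Re \<zeta>\<bar>))"
          by (simp add: mult.assoc flip: exp_add)
        also have "\<dots> \<le> (M * exp (real k * 2) + C) * exp (- (- (1 / real k) * cmod \<zeta> + real k * \<bar>Re \<zeta>\<bar>))"
          using C(1) by (intro mult_right_mono) auto
        finally show ?thesis using M(2)[OF z] by linarith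
      qed
    qed
    then show "\<exists>M. \<forall>z\<in>{z. 1 / real k \<le> Re z}. p a (?D z)
      \<le> M * exp (- (- (1 / real k) * cmod z + real k * \<bar>Re z\<bar>))" by blast
  qed
  then show ?thesis using that G by blast
qed

section \<open>The map induced on the quotients\<close>

lemma I_zero_coset: "I_zero sc p (F +o LG_inf sc p) = restr right_half_plane F +o LO_inf sc p"
  unfolding I_zero_def
proof (rule quot_map_coset[OF _ fun_subspaceD(1)[OF fun_subspaces(1)]])
  fix n assume n: "n \<in> LG_inf sc p"
  show "restr right_half_plane (F + n) +o LO_inf sc p = restr right_half_plane F +o LO_inf sc p"
    unfolding fun_subspace_coset_eq[OF fun_subspaces(3)] restr_add using restr_LG_inf[OF n] by simp
qed

text \<open>The sum with \<open>N\<close> in \<open>quot_scale\<close> absorbs the scaled elements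
  of \<open>N\<close>, and for \<open>c = 0\<close> it refills the coset.\<close>

lemma quot_scale_coset:
  assumes "fun_subspace N"
  shows "quot_scale sc N c (F +o N) = (\<lambda>z. sc c (F z)) +o N"
proof -
  note sub = fun_subspaceD[OF assms]
  have "(\<lambda>F z. sc c (F z)) ` (F +o N) + N \<subseteq> (\<lambda>z. sc c (F z)) +o N"
  proof
    fix x assume "x \<in> (\<lambda>F z. sc c (F z)) ` (F +o N) + N"
    then obtain n m where nm: "n \<in> N" "m \<in> N" "x = (\<lambda>z. sc c ((F + n) z)) + m"
      by (auto simp: set_plus_def elt_set_plus_def)
    then have "x = (\<lambda>z. sc c (F z)) + ((\<lambda>z. sc c (n z)) + m)"
      by (auto simp: fun_eq_iff scale_right_distrib)
    then show "x \<in> (\<lambda>z. sc c (F z)) +o N" using sub(2)[OF sub(4)[OF nm(1)] nm(2)] unfolding elt_set_plus_def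
      by blast
  qed
  moreover have "(\<lambda>z. sc c (F z)) +o N \<subseteq> (\<lambda>F z. sc c (F z)) ` (F +o N) + N"
  proof
    fix x assume "x \<in> (\<lambda>z. sc c (F z)) +o N"
    then obtain n where "n \<in> N" "x = (\<lambda>z. sc c (F z)) + n" by (auto simp: elt_set_plus_def)
    moreover have "F \<in> F +o N" using sub(1) by (auto simp: elt_set_plus_def)
    ultimately show "x \<in> (\<lambda>F z. sc c (F z)) ` (F +o N) + N" by (auto intro: set_plus_intro)
  qed
  ultimately show ?thesis by (auto simp: quot_scale_def)
qed

text \<open>Injectivity is \<open>LG_inf_of_restr\<close> applied to a difference, surjectivity is
  \<open>LO_zero_inf_splitting\<close>; linearity is inherited from restriction.\<close>

lemma I_zero_linear_iso:
  "quot_linear_iso sc (LG_zero_inf sc p) (LG_inf sc p) (LO_zero_inf sc p) (LO_inf sc p) (I_zero sc p)"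
  unfolding quot_linear_iso_def
proof (intro conjI ballI allI)
  show "bij_betw (I_zero sc p) (quot (LG_zero_inf sc p) (LG_inf sc p)) (quot (LO_zero_inf sc p) (LO_inf sc p))"
    unfolding bij_betw_def
  proof
    show "inj_on (I_zero sc p) (quot (LG_zero_inf sc p) (LG_inf sc p))"
    proof (rule inj_onI)
      fix X Y assume "X \<in> quot (LG_zero_inf sc p) (LG_inf sc p)" "Y \<in> quot (LG_zero_inf sc p) (LG_inf sc p)"
        and eq: "I_zero sc p X = I_zero sc p Y"
      then obtain F G where FG: "F \<in> LG_zero_inf sc p" "G \<in> LG_zero_inf sc p" "X = F +o LG_inf sc p" "Y
        = G +o LG_inf sc p"
        by (auto simp: quot_def)
      have "restr right_half_plane F - restr right_half_plane G \<in> LO_inf sc p"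
        using eq unfolding FG I_zero_coset fun_subspace_coset_eq[OF fun_subspaces(3)] .
      moreover have "restr right_half_plane F - restr right_half_plane G = restr right_half_plane (F - G)"
        by (auto simp: restr_def fun_eq_iff)
      ultimately have "F - G \<in> LG_inf sc p"
        using LG_inf_of_restr[OF fun_subspaceD(5)[OF fun_subspaces(2) FG(1,2)]] by simp
      then show "X = Y" unfolding FG fun_subspace_coset_eq[OF fun_subspaces(1)] .
    qed
    show "I_zero sc p ` quot (LG_zero_inf sc p) (LG_inf sc p) = quot (LO_zero_inf sc p) (LO_inf sc p)"
    proof
      show "I_zero sc p ` quot (LG_zero_inf sc p) (LG_inf sc p) \<subseteq> quot (LO_zero_inf sc p) (LO_inf sc p)"
        by (auto simp: quot_def I_zero_coset restr_LG_zero_inf)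
      show "quot (LO_zero_inf sc p) (LO_inf sc p) \<subseteq> I_zero sc p ` quot (LG_zero_inf sc p) (LG_inf sc p)"
      proof
        fix X assume "X \<in> quot (LO_zero_inf sc p) (LO_inf sc p)"
        then obtain F where F: "F \<in> LO_zero_inf sc p" "X = F +o LO_inf sc p" by (auto simp: quot_def)
        obtain G where G: "G \<in> LG_zero_inf sc p" "F - restr right_half_plane G \<in> LO_inf sc p"
          using LO_zero_inf_splitting[OF F(1)] by metis
        then have "X = I_zero sc p (G +o LG_inf sc p)"
          unfolding F I_zero_coset fun_subspace_coset_eq[OF fun_subspaces(3)] by simp
        then show "X \<in> I_zero sc p ` quot (LG_zero_inf sc p) (LG_inf sc p)" using G(1) by (auto simp: quot_def)
      qed
    qed
  qed
  fix X assume "X \<in> quot (LG_zero_inf sc p) (LG_inf sc p)"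
  then obtain F where F: "X = F +o LG_inf sc p" by (auto simp: quot_def)
  show "I_zero sc p (quot_scale sc (LG_inf sc p) c X) = quot_scale sc (LO_inf sc p) c (I_zero sc p X)" for c
  proof -
    have "restr right_half_plane (\<lambda>z. sc c (F z)) = (\<lambda>z. sc c (restr right_half_plane F z))"
      by (auto simp: restr_def)
    then show ?thesis
      unfolding F quot_scale_coset[OF fun_subspaces(1)] I_zero_coset quot_scale_coset[OF fun_subspaces(3)] by simp
  qed
  fix Y assume "Y \<in> quot (LG_zero_inf sc p) (LG_inf sc p)"
  then obtain G where G: "Y = G +o LG_inf sc p" by (auto simp: quot_def)
  show "I_zero sc p (X + Y) = I_zero sc p X + I_zero sc p Y"
    unfolding F G fun_subspace_coset_plus[OF fun_subspaces(1)] I_zero_coset restr_add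
      fun_subspace_coset_plus[OF fun_subspaces(3)] ..
qed

section \<open>Compatibility with the Laplace transforms of hyperfunctions\<close>

lemma fun_subspace_entire_on_slit: "fun_subspace (entire_on_slit sc p)"
  unfolding entire_on_slit_def by (intro fun_subspace_restr fun_subspace_holo) simp

text \<open>A point that leaves the strip of index \<open>n + 1\<close> about the half-line has
  \<open>\<bar>Im z\<bar> \<le> 1 / (n + 1)\<close> and \<open>Re z \<ge> -1\<close>. If
  \<open>Re z\<close> exceeded \<open>n\<close>, it would lie in the neighbourhood of infinity; the
  strict inequality \<open>1 / (n + 1) < 1 / n\<close> is the reason for the shifted index.\<close>

lemma strip_minus_infI:
  assumes "z \<in> strip_minus {\<infinity>} n" "z \<notin> strip_minus {0..\<infinity>} (Suc n)" "1 \<le> n"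
  shows "cmod z \<le> 2 * real n + 2"
proof -
  have im: "\<bar>Im z\<bar> < real n" using assms(1) by (simp add: strip_minus_def)
  then have cl: "z \<in> closure (nbhd (1 / real (Suc n)) {0..\<infinity>})" using assms(2) by (auto simp: strip_minus_def)
  have im': "\<bar>Im z\<bar> \<le> 1 / real (Suc n)" by (rule closure_nbhd_Im[OF _ cl]) simp
  have "nbhd (1 / real (Suc n)) {0..\<infinity>} \<subseteq> {z. - 1 \<le> Re z}"
  proof
    fix w assume "w \<in> nbhd (1 / real (Suc n)) {0..\<infinity>}"
    then obtain x where x: "x \<in> finite_part {0..\<infinity>}" "dist w x < 1 / real (Suc n)" by (auto simp: nbhd_def)
    have "Re x - Re w \<le> dist w x" using complex_Re_le_cmod[of "x - w"] by (simp add: dist_norm norm_minus_commute)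
    moreover have "1 / real (Suc n) \<le> 1" by simp
    moreover have "0 \<le> Re x" using x(1) by (auto simp: finite_part_def)
    ultimately have "- 1 \<le> Re w" using x(2) by linarith
    then show "w \<in> {z. - 1 \<le> Re z}" by simp
  qed
  then have "closure (nbhd (1 / real (Suc n)) {0..\<infinity>}) \<subseteq> {z. - 1 \<le> Re z}"
    by (rule closure_minimal) (rule closed_halfspace_Re_ge)
  then have re: "- 1 \<le> Re z" using cl by auto
  have "Re z \<le> real n"
  proof (rule ccontr)
    assume "\<not> Re z \<le> real n"
    moreover have "1 / real (Suc n) < 1 / real n" using assms(3) by (simp add: field_simps)
    ultimately have "z \<in> nbhd (1 / real n) {\<infinity>}" using im' by (simp add: nbhd_def)
    then have "z \<in> closure (nbhd (1 / real n) {\<infinity>})" using closure_subset by blast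
    then show False using assms(1) by (simp add: strip_minus_def)
  qed
  then have "\<bar>Re z\<bar> \<le> real n + 1" using re by linarith
  then show ?thesis using cmod_le[of z] im by linarith
qed

text \<open>By \<open>strip_minus_infI\<close> the strips about infinity and about the half-line
  differ only by a bounded set, on which an entire function is bounded. The growth rate
  \<open>1 / (n + 1)\<close> is within that allowed for \<open>n\<close>. This expresses the
  injectivity of the canonical map on classes modulo \<open>O_exp\<close>.\<close>

lemma O_exp_entire:
  assumes G: "restr slit_plane h \<in> O_exp sc p {0..\<infinity>}" and h: "h \<in> holo sc p UNIV"
  shows "h \<in> O_exp sc p {\<infinity>}"
  unfolding O_exp_def
proof (rule weighted_holoI)
  show "h \<in> holo sc p (- finite_part {\<infinity>})" using h by simp
  fix n :: nat and a assume n: "1 \<le> n"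
  obtain M where M: "0 \<le> M" "\<And>z. z \<in> strip_minus {0..\<infinity>} (Suc n) \<Longrightarrow>
     p a (restr slit_plane h z) \<le> M * exp (- (- (1 / real (Suc n)) * \<bar>Re z\<bar>))"
    using weighted_holoD[OF G[unfolded O_exp_def], of "Suc n"] by auto
  obtain B where B: "0 \<le> B" "\<And>z. z \<in> cball 0 (2 * real n + 2) \<Longrightarrow> p a (h z) \<le> B"
    using econt_bounded[OF econt_subset[OF holo_econt[OF h] subset_UNIV] compact_cball, of _ _ a] by metis
  have "p a (h z) \<le> (M + B) * exp (- (- (1 / real n) * \<bar>Re z\<bar>))" if z: "z \<in> strip_minus {\<infinity>} n" for z
  proof (cases "z \<in> strip_minus {0..\<infinity>} (Suc n)")
    case True
    have "z \<in> slit_plane" by (rule strip_far(3)[OF True]) simp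
    then have "p a (h z) \<le> M * exp (- (- (1 / real (Suc n)) * \<bar>Re z\<bar>))" using M(2)[OF True]
      by (simp add: restr_def)
    also have "\<dots> \<le> (M + B) * exp (- (- (1 / real n) * \<bar>Re z\<bar>))"
    proof -
      have "1 / real (Suc n) * \<bar>Re z\<bar> \<le> 1 / real n * \<bar>Re z\<bar>"
        using n by (intro mult_right_mono) (auto simp: field_simps)
      then show ?thesis using M(1) B(1) by (intro mult_mono) auto
    qed
    finally show ?thesis .
  next
    case False
    have "p a (h z) \<le> B * 1" using B(2)[of z] strip_minus_infI[OF z False n] by simp
    also have "\<dots> \<le> (M + B) * exp (- (- (1 / real n) * \<bar>Re z\<bar>))"
      using M(1) B(1) by (intro mult_mono) auto
    finally show ?thesis .
  qed
  then show "\<exists>M. \<forall>z\<in>strip_minus {\<infinity>} n. p a (h z) \<le> M * exp (- (- (1 / real n) * \<bar>Re z\<bar>))" by blast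
qed

lemma H_minus_inf_subset_O_exp: "H_minus_inf sc p K \<subseteq> O_exp sc p K"
proof
  fix g assume g: "g \<in> H_minus_inf sc p K"
  show "g \<in> O_exp sc p K"
    unfolding O_exp_def
  proof (rule weighted_holoI)
    show "g \<in> holo sc p (- finite_part K)" using g weighted_holo_holo by (auto simp: H_minus_inf_def)
    fix n :: nat and a assume n: "1 \<le> n"
    obtain M where M: "0 \<le> M" "\<And>z. z \<in> strip_minus K n \<Longrightarrow> p a (g z) \<le> M * exp (- (real n * \<bar>Re z\<bar>))"
      using weighted_holoD[OF g[unfolded H_minus_inf_def] n] by metis
    have "p a (g z) \<le> M * exp (- (- (1 / real n) * \<bar>Re z\<bar>))" if "z \<in> strip_minus K n" for z
    proof -
      have "- (real n * \<bar>Re z\<bar>) \<le> 0" "0 \<le> - (- (1 / real n) * \<bar>Re z\<bar>)" by auto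
      then have "M * exp (- (real n * \<bar>Re z\<bar>)) \<le> M * exp (- (- (1 / real n) * \<bar>Re z\<bar>))"
        using M(1) by (intro mult_left_mono iffD2[OF exp_le_cancel_iff]) linarith+
      then show ?thesis using M(2)[OF that] by linarith
    qed
    then show "\<exists>M. \<forall>z\<in>strip_minus K n. p a (g z) \<le> M * exp (- (- (1 / real n) * \<bar>Re z\<bar>))" by blast
  qed
qed

lemma canonical_coset:
  assumes "N \<subseteq> holo sc p UNIV" "fun_subspace N"
  shows "quot_map id (entire_on_slit sc p) (G +o restr slit_plane ` N) = G +o entire_on_slit sc p"
proof -
  have "quot_map id (entire_on_slit sc p) (G +o restr slit_plane ` N) = id G +o entire_on_slit sc p"
  proof (rule quot_map_coset)
    fix n assume "n \<in> restr slit_plane ` N"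
    then have "n \<in> entire_on_slit sc p" using assms(1) by (auto simp: entire_on_slit_def)
    then show "id (G + n) +o entire_on_slit sc p = id G +o entire_on_slit sc p"
      unfolding fun_subspace_coset_eq[OF fun_subspace_entire_on_slit] by simp
  qed (rule fun_subspaceD(1)[OF fun_subspace_restr[OF assms(2)]])
  then show ?thesis by simp
qed

lemma O_exp_inf_entire: "O_exp sc p {\<infinity>} \<subseteq> holo sc p UNIV"
  and H_minus_inf_entire: "H_minus_inf sc p {\<infinity>} \<subseteq> holo sc p UNIV"
  using weighted_holo_holo by (fastforce simp: O_exp_def H_minus_inf_def)+

text \<open>The splitting supplies a preimage of \<open>f\<close> in each quotient, so both inverses
  pick classes that lie over \<open>f\<close>. Their representatives \<open>g\<close> and
  \<open>G\<close> differ by an entire function whose restriction is in \<open>O_exp\<close>, and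
  \<open>O_exp_entire\<close> makes their classes modulo \<open>O_exp\<close> equal. So one
  \<open>g\<close> in \<open>H_minus_inf\<close> represents \<open>f\<close> for both
  transforms.\<close>

lemma inverse_representatives:
  assumes f: "f \<in> hyperfunctions sc p"
  obtains g where "g \<in> H_minus_inf sc p {0..\<infinity>}"
    "R_plus_inverse sc p f = g +o restr slit_plane ` H_minus_inf sc p {\<infinity>}"
    "R_inverse sc p f = g +o restr slit_plane ` O_exp sc p {\<infinity>}"
proof -
  let ?E = "entire_on_slit sc p" and ?NH = "restr slit_plane ` H_minus_inf sc p {\<infinity>}" and ?NO
    = "restr slit_plane ` O_exp sc p {\<infinity>}"
  note cH = canonical_coset[OF H_minus_inf_entire fun_subspaces(8)] and cO
    = canonical_coset[OF O_exp_inf_entire fun_subspaces(6)]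
  obtain F where F: "F \<in> holo sc p slit_plane" "f = F +o ?E" using f by (auto simp: hyperfunctions_def quot_def)
  obtain g0 h where g0: "g0 \<in> H_minus_inf sc p {0..\<infinity>}" "h \<in> holo sc p UNIV" "F = g0 + restr slit_plane h"
    using hyperfunction_splitting[OF F(1)] by metis
  have fg0: "f = g0 +o ?E"
    unfolding F(2) fun_subspace_coset_eq[OF fun_subspace_entire_on_slit] using g0
      by (simp add: entire_on_slit_def)
  have img1: "f \<in> quot_map id ?E ` quot (H_minus_inf sc p {0..\<infinity>}) ?NH"
    using g0(1) cH[of g0] fg0 by (auto simp: quot_def intro!: rev_image_eqI)
  have img2: "f \<in> quot_map id ?E ` quot (O_exp sc p {0..\<infinity>}) ?NO"
    using g0(1) H_minus_inf_subset_O_exp cO[of g0] fg0 by (auto simp: quot_def intro!: rev_image_eqI)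
  obtain g where g: "g \<in> H_minus_inf sc p {0..\<infinity>}" "R_plus_inverse sc p f = g +o ?NH"
    using inv_into_into[OF img1] unfolding R_plus_inverse_def quot_def by blast
  have fg: "g +o ?E = f" using f_inv_into_f[OF img1] g(2) cH[of g] unfolding R_plus_inverse_def by simp
  obtain G where G: "G \<in> O_exp sc p {0..\<infinity>}" "R_inverse sc p f = G +o ?NO"
    using inv_into_into[OF img2] unfolding R_inverse_def quot_def by blast
  have fG: "G +o ?E = f" using f_inv_into_f[OF img2] G(2) cO[of G] unfolding R_inverse_def by simp
  have "G - g \<in> ?E" using fg fG fun_subspace_coset_eq[OF fun_subspace_entire_on_slit, of G g] by simp
  then obtain e where e: "e \<in> holo sc p UNIV" "G - g = restr slit_plane e" by (auto simp: entire_on_slit_def)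
  have "G - g \<in> O_exp sc p {0..\<infinity>}"
    using fun_subspaceD(5)[OF fun_subspaces(5) G(1)] g(1) H_minus_inf_subset_O_exp by blast
  then have "e \<in> O_exp sc p {\<infinity>}" using O_exp_entire[OF _ e(1)] e(2) by simp
  then have "G +o ?NO = g +o ?NO"
    unfolding fun_subspace_coset_eq[OF fun_subspace_restr[OF fun_subspaces(6)]] using e(2) by simp
  then show ?thesis using that g G(2) by simp
qed

text \<open>For the common representative both transforms are the same integral on the right
  half-plane. Independence of the representative, as \<open>quot_map\<close> requires, follows from
  additivity and from \<open>laplace_LG_inf\<close> and \<open>laplace_LO_inf\<close>.\<close>

lemma I_zero_langenbruch:
  assumes f: "f \<in> hyperfunctions sc p"
  shows "I_zero sc p (langenbruch_hyper sc p f) = laplace_hyper sc p f"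
proof -
  obtain g where g: "g \<in> H_minus_inf sc p {0..\<infinity>}"
    "R_plus_inverse sc p f = g +o restr slit_plane ` H_minus_inf sc p {\<infinity>}"
    "R_inverse sc p f = g +o restr slit_plane ` O_exp sc p {\<infinity>}" using inverse_representatives[OF f] by metis
  have gh: "g \<in> holo sc p slit_plane" using g(1) weighted_holo_holo by (auto simp: H_minus_inf_def)
  note ggr = H_minus_inf_growth[OF g(1)]
  have 1: "langenbruch_hyper sc p f = laplace sc p UNIV g +o LG_inf sc p"
    unfolding langenbruch_hyper_def g(2)
  proof (rule quot_map_coset)
    fix n assume "n \<in> restr slit_plane ` H_minus_inf sc p {\<infinity>}"
    then obtain h where h: "h \<in> H_minus_inf sc p {\<infinity>}" "n = restr slit_plane h" by blast
    note r = restr_H_minus_inf[OF h(1)]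
    have rh: "restr slit_plane h \<in> holo sc p slit_plane" using r weighted_holo_holo
      by (auto simp: H_minus_inf_def)
    have "laplace sc p UNIV (g + n) = laplace sc p UNIV g + laplace sc p UNIV n"
    proof
      fix \<zeta>
      show "laplace sc p UNIV (g + n) \<zeta> = (laplace sc p UNIV g + laplace sc p UNIV n) \<zeta>"
        using laplace_add[OF gh ggr rh H_minus_inf_growth[OF r], of "Re \<zeta> - 1" \<zeta> UNIV] h(2) by simp
    qed
    then show "laplace sc p UNIV (g + n) +o LG_inf sc p = laplace sc p UNIV g +o LG_inf sc p"
      unfolding fun_subspace_coset_eq[OF fun_subspaces(1)] using laplace_LG_inf[OF h(1)] h(2) by simp
  qed (rule fun_subspaceD(1)[OF fun_subspace_restr[OF fun_subspaces(8)]])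
  have 2: "laplace_hyper sc p f = laplace sc p right_half_plane g +o LO_inf sc p"
    unfolding laplace_hyper_def g(3)
  proof (rule quot_map_coset)
    fix n assume "n \<in> restr slit_plane ` O_exp sc p {\<infinity>}"
    then obtain h where h: "h \<in> O_exp sc p {\<infinity>}" "n = restr slit_plane h" by blast
    note r = restr_O_exp[OF h(1)]
    have rh: "restr slit_plane h \<in> holo sc p slit_plane" using r weighted_holo_holo by (auto simp: O_exp_def)
    have "laplace sc p right_half_plane (g + n) = laplace sc p right_half_plane g
      + laplace sc p right_half_plane n"
    proof
      fix \<zeta>
      show "laplace sc p right_half_plane (g + n) \<zeta> = (laplace sc p right_half_plane g
        + laplace sc p right_half_plane n) \<zeta>"
      proof (cases "0 < Re \<zeta>")
        \<comment> \<open>\<open>O_exp\<close> functions have the growth property only with positive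
          abscissas, so half of \<open>Re \<zeta>\<close> is taken.\<close>
        case True
        then show ?thesis
          using laplace_add[OF gh ggr rh O_exp_growth[OF r], of "Re \<zeta> / 2" \<zeta> right_half_plane] h(2) by simp
      qed (simp add: laplace_def restr_def)
    qed
    then show "laplace sc p right_half_plane (g + n) +o LO_inf sc p
      = laplace sc p right_half_plane g +o LO_inf sc p"
      unfolding fun_subspace_coset_eq[OF fun_subspaces(3)] using laplace_LO_inf[OF h(1)] h(2) by simp
  qed (rule fun_subspaceD(1)[OF fun_subspace_restr[OF fun_subspaces(6)]])
  have "restr right_half_plane (laplace sc p UNIV g) = laplace sc p right_half_plane g"
    by (auto simp: laplace_def restr_def)
  then show ?thesis unfolding 1 2 I_zero_coset by simp
qed

end

theorem theorem8p4:
  fixes sc :: "complex \<Rightarrow> 'e::ab_group_add \<Rightarrow> 'e" and p :: "'a \<Rightarrow> 'e \<Rightarrow> real"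
  assumes "frechet_space sc p"
  shows "(\<forall>F\<in>LG_zero_inf sc p.
            restr right_half_plane F \<in> LO_zero_inf sc p \<and>
            I_zero sc p (F +o LG_inf sc p) = restr right_half_plane F +o LO_inf sc p) \<and>
         quot_linear_iso sc (LG_zero_inf sc p) (LG_inf sc p) (LO_zero_inf sc p) (LO_inf sc p)
           (I_zero sc p) \<and>
         (\<forall>f\<in>hyperfunctions sc p. I_zero sc p (langenbruch_hyper sc p f) = laplace_hyper sc p f)"
proof -
  interpret frechet sc p by standard (rule assms)
  show ?thesis
    using restr_LG_zero_inf I_zero_coset I_zero_linear_iso I_zero_langenbruch by blast
qed

end
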